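(* Let $f\in C^3(\mathbb{T})$ be a non-constant real-valued function. Let $V\in C^1(A_{f'})\cap C^1(X)\cap C^1(X^2)$ be a compact symmetric operator on $l^2(\mathbb{N})$ such that $\mathrm{ad}_{A_{f'}}V$ is also compact. Let $H=T_f+V$ and let $\Lambda\subset\mathrm{Ran}\,f$ be a non-empty Borel set. Then, for each of the limits $t\to+\infty$ and $t\to-\infty$: - For all $\varphi\in l^2(\mathbb{N})$ such that $E_\Lambda(H)\varphi\in\mathcal{H}_c(H)\cap\mathcal{D}_X$, $$\sqrt{c^{\sharp}_{\Lambda,f,|f'|^2}}\,\|E_\Lambda(H)\varphi\|\le\liminf_{t\to\pm\infty}\frac1{|t|}\|e^{iHt}E_\Lambda(H)\varphi\|_X\le\limsup_{t\to\pm\infty}\frac1{|t|}\|e^{iHt}E_\Lambda(H)\varphi\|_X\le\sqrt{C^{\flat}_{\Lambda,f,|f'|^2}}\,\|E_\Lambda(H)\varphi\|.$$ - For all $\varphi\in\mathcal{H}_c(H)\cap\mathcal{D}_X$ and all real-valued $\Phi\in C_0^\infty(\mathbb{R})$ vanishing outside $\Lambda$, $$\sqrt{c_{\Lambda,f,|f'|^2}}\,\|\Phi(H)\varphi\|\le\liminf_{t\to\pm\infty}\frac1{|t|}\|e^{iHt}\Phi(H)\varphi\|_X\le\limsup_{t\to\pm\infty}\frac1{|t|}\|e^{iHt}\Phi(H)\varphi\|_X\le\sqrt{C_{\Lambda,f,|f'|^2}}\,\|\Phi(H)\varphi\|.$$ If $\overline{\Lambda}\subset\mathrm{Ran}\,f\setminus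 f(\kappa_f)$, then $c_{\Lambda,f,|f'|^2}\ge c^{\sharp}_{\Lambda,f,|f'|^2}>0$.
   Context: $\mathbb{N}=\{1,2,3,\dots\}$, $\mathbb{T}=\mathbb{R}/2\pi\mathbb{Z}$, and $(e_n)_{n\in\mathbb{N}}$ is the canonical orthonormal basis of the complex Hilbert space $l^2(\mathbb{N})$. For $f\in L^\infty(\mathbb{T})$, $\hat f_n=\frac{1}{2\pi}\int_{\mathbb{T}}e^{-in\theta}f(\theta)\,d\theta$, and the Toeplitz operator $T_f$ is the bounded operator on $l^2(\mathbb{N})$ given by $(T_f\varphi)_n=\sum_{k\in\mathbb{N}}\hat f_{n-k}\varphi_k$. $\mathrm{Ran}\,f=f(\mathbb{T})$, and $\kappa_f=\{\theta\in\mathbb{T}: f \text{ is not differentiable at }\theta\text{ or } f'(\theta)=0\}$. $X$ is the self-adjoint position operator $Xe_n=ne_n$ with domain $\mathcal{D}_X=\{\psi\in l^2(\mathbb{N}):\sum_n n^2|\psi_n|^2<\infty\}$, and $\|\psi\|_X=\sqrt{\|\psi\|^2+\|X\psi\|^2}$ for $\psi\in\mathcal{D}_X$. For real-valued $g\in C^2(\mathbb{T})$, one has $T_g\mathcal{D}_X\subset\mathcal{D}_X$, and the symmetric operator $\frac12(T_gX+XT_g)$ with domain $\mathcal{D}_X$ is essentially self-adjoint; $A_g$ denotes its self-adjoint closure. For a self-adjoint operator $A$ with domain $\mathcal{D}(A)$ and a bounded operator $B$ on a Hilbert space, $B\in C^1(A)$ means that the sesquilinear form $(\varphi,\psi)\mapsto\langle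 A\varphi,B\psi\rangle-\langle\varphi,BA\psi\rangle$ on $\mathcal{D}(A)\times\mathcal{D}(A)$ extends to a bounded form on the whole space; the associated bounded operator is denoted $\mathrm{ad}_AB=[A,B]$. $E_\Lambda(H)$ is the spectral projection of the self-adjoint operator $H$ on $\Lambda$, and $\mathcal{H}_c(H)$ is its continuous subspace (orthogonal complement of the closed span of the eigenvectors). One has $H\in C^1(X)$, so $e^{iHt}\mathcal{D}_X\subset\mathcal{D}_X$. For real-valued continuous $f,g$ on $\mathbb{T}$ and a Borel set $\Lambda\subset\mathbb{R}$ with $\Lambda\cap\mathrm{Ran}\,f\ne\emptyset$: $c_{\Lambda,f,g}=\min_{\theta\in\overline{f^{-1}(\Lambda)}}g(\theta)$, $C_{\Lambda,f,g}=\max_{\theta\in\overline{f^{-1}(\Lambda)}}g(\theta)$, and $c^{\sharp}_{\Lambda,f,g}=\sup_{\Lambda'}c_{\Lambda',f,g}$, $C^{\flat}_{\Lambda,f,g}=\inf_{\Lambda'}C_{\Lambda',f,g}$, where $\Lambda'$ ranges over all open sets $\Lambda'\subset\mathbb{R}$ with $\overline{\Lambda}\subset\Lambda'$. *)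

theory Defs
  imports "HOL-Analysis.Analysis"
begin

section \<open>The complex Hilbert space of square summable sequences\<close>

text \<open>The index set is \<open>{1, 2, 3, \<dots>}\<close>. Sequences are functions on \<^typ>\<open>nat\<close> whose spurious
  entry at \<open>0\<close> vanishes, so that coordinates keep their usual numbers and sums over all
  of \<^typ>\<open>nat\<close> are sums over the positive integers.\<close>

typedef ell2 = "{\<psi> :: nat \<Rightarrow> complex. \<psi> 0 = 0 \<and> summable (\<lambda>n. (cmod (\<psi> n))\<^sup>2)}"
  morphisms coord Abs_ell2
  by (rule exI[of _ "\<lambda>_. 0"]) simp

setup_lifting type_definition_ell2

lemma coord_summable: "summable (\<lambda>n. (cmod (coord \<psi> n))\<^sup>2)"
  using coord[of \<psi>] by simp

lemma summable_norm_add_sq: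
  fixes a b :: "nat \<Rightarrow> complex"
  assumes "summable (\<lambda>n. (cmod (a n))\<^sup>2)" "summable (\<lambda>n. (cmod (b n))\<^sup>2)"
  shows "summable (\<lambda>n. (cmod (a n + b n))\<^sup>2)"
proof (rule summable_comparison_test')
  show "summable (\<lambda>n. 2 * (cmod (a n))\<^sup>2 + 2 * (cmod (b n))\<^sup>2)"
    using assms by (intro summable_add summable_mult)
  fix n
  have "(cmod (a n + b n))\<^sup>2 \<le> (cmod (a n) + cmod (b n))\<^sup>2"
    by (intro power_mono norm_triangle_ineq) simp
  also have "\<dots> \<le> 2 * (cmod (a n))\<^sup>2 + 2 * (cmod (b n))\<^sup>2"
    using sum_squares_bound[of "cmod (a n)" "cmod (b n)"] by (simp add: power2_sum)
  finally show "norm ((cmod (a n + b n))\<^sup>2) \<le> 2 * (cmod (a n))\<^sup>2 + 2 * (cmod (b n))\<^sup>2"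
    by simp
qed

lemma summable_cnj_mult:
  fixes a b :: "nat \<Rightarrow> complex"
  assumes "summable (\<lambda>n. (cmod (a n))\<^sup>2)" "summable (\<lambda>n. (cmod (b n))\<^sup>2)"
  shows "summable (\<lambda>n. cnj (a n) * b n)"
proof (rule summable_comparison_test')
  show "summable (\<lambda>n. (cmod (a n))\<^sup>2 + (cmod (b n))\<^sup>2)"
    using assms by (rule summable_add)
  fix n
  have "2 * cmod (a n) * cmod (b n) \<le> (cmod (a n))\<^sup>2 + (cmod (b n))\<^sup>2"
    by (rule sum_squares_bound)
  moreover have "0 \<le> cmod (a n) * cmod (b n)" by simp
  ultimately show "norm (cnj (a n) * b n) \<le> (cmod (a n))\<^sup>2 + (cmod (b n))\<^sup>2"
    unfolding norm_mult complex_mod_cnj by linarith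
qed

definition cinner :: "ell2 \<Rightarrow> ell2 \<Rightarrow> complex" where
  "cinner \<phi> \<psi> = (\<Sum>n. cnj (coord \<phi> n) * coord \<psi> n)"

lift_definition scaleC :: "complex \<Rightarrow> ell2 \<Rightarrow> ell2" (infixr \<open>*\<^sub>C\<close> 75)
  is "\<lambda>c \<psi> n. c * \<psi> n"
  by (auto simp: norm_mult power_mult_distrib intro: summable_mult)

instantiation ell2 :: real_inner
begin

lift_definition zero_ell2 :: ell2 is "\<lambda>_. 0" by simp

lift_definition plus_ell2 :: "ell2 \<Rightarrow> ell2 \<Rightarrow> ell2" is "\<lambda>\<phi> \<psi> n. \<phi> n + \<psi> n"
  by (auto intro: summable_norm_add_sq)

lift_definition uminus_ell2 :: "ell2 \<Rightarrow> ell2" is "\<lambda>\<psi> n. - \<psi> n"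
  by simp

definition minus_ell2 :: "ell2 \<Rightarrow> ell2 \<Rightarrow> ell2" where
  "\<phi> - \<psi> = \<phi> + (- \<psi> :: ell2)"

definition scaleR_ell2 :: "real \<Rightarrow> ell2 \<Rightarrow> ell2" where
  "r *\<^sub>R \<psi> = complex_of_real r *\<^sub>C \<psi>"

definition inner_ell2 :: "ell2 \<Rightarrow> ell2 \<Rightarrow> real" where
  "inner (\<phi> :: ell2) \<psi> = Re (cinner \<phi> \<psi>)"

definition norm_ell2 :: "ell2 \<Rightarrow> real" where
  "norm \<psi> = sqrt (\<Sum>n. (cmod (coord \<psi> n))\<^sup>2)"

definition sgn_ell2 :: "ell2 \<Rightarrow> ell2" where
  "sgn (\<psi> :: ell2) = inverse (norm \<psi>) *\<^sub>R \<psi>"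

definition dist_ell2 :: "ell2 \<Rightarrow> ell2 \<Rightarrow> real" where
  "dist (\<phi> :: ell2) \<psi> = norm (\<phi> - \<psi>)"

definition uniformity_ell2 :: "(ell2 \<times> ell2) filter" where
  "uniformity_ell2 = (INF e\<in>{0<..}. principal {(x, y). dist x y < e})"

definition open_ell2 :: "ell2 set \<Rightarrow> bool" where
  "open_ell2 U \<longleftrightarrow> (\<forall>x\<in>U. eventually (\<lambda>(x', y). x' = x \<longrightarrow> y \<in> U) uniformity)"

lemma inner_self_ell2: "inner \<psi> \<psi> = (\<Sum>n. (cmod (coord \<psi> n))\<^sup>2)" for \<psi> :: ell2
proof -
  have "summable (\<lambda>n. cnj (coord \<psi> n) * coord \<psi> n)"
    by (intro summable_cnj_mult coord_summable)
  then have "Re (\<Sum>n. cnj (coord \<psi> n) * coord \<psi> n) = (\<Sum>n. Re (cnj (coord \<psi> n) * coord \<psi> n))"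
    by (rule bounded_linear.suminf[OF bounded_linear_Re])
  moreover have "Re (cnj z * z) = (cmod z)\<^sup>2" for z
    unfolding cmod_power2 by (simp add: power2_eq_square)
  ultimately show ?thesis
    by (simp only: inner_ell2_def cinner_def)
qed

instance
proof
  fix a b c :: ell2 and r s :: real
  show "a + b + c = a + (b + c)" by transfer (simp add: add.assoc)
  show "a + b = b + a" by transfer (simp add: add.commute)
  show "0 + a = a" by transfer simp
  show "- a + a = 0" by transfer simp
  show "a - b = a + - b" by (rule minus_ell2_def)
  show "r *\<^sub>R (a + b) = r *\<^sub>R a + r *\<^sub>R b"
    unfolding scaleR_ell2_def by transfer (simp add: algebra_simps)
  show "(r + s) *\<^sub>R a = r *\<^sub>R a + s *\<^sub>R a"
    unfolding scaleR_ell2_def by transfer (simp add: algebra_simps)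
  show "r *\<^sub>R s *\<^sub>R a = (r * s) *\<^sub>R a"
    unfolding scaleR_ell2_def by transfer (simp add: algebra_simps)
  show "1 *\<^sub>R a = a"
    unfolding scaleR_ell2_def by transfer simp
  show "dist a b = norm (a - b)" by (rule dist_ell2_def)
  show "sgn a = inverse (norm a) *\<^sub>R a" by (rule sgn_ell2_def)
  show "uniformity = (INF e\<in>{0<..}. principal {(x, y). dist x (y :: ell2) < e})"
    by (rule uniformity_ell2_def)
  show "open U \<longleftrightarrow> (\<forall>x\<in>U. eventually (\<lambda>(x', y). x' = x \<longrightarrow> y \<in> U) uniformity)"
    for U :: "ell2 set" by (rule open_ell2_def)
  have sm: "summable (\<lambda>n. cnj (coord x n) * coord y n)" for x y
    by (intro summable_cnj_mult coord_summable)
  have inner_sum: "inner x y = (\<Sum>n. Re (cnj (coord x n) * coord y n))" for x y :: ell2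
    unfolding inner_ell2_def cinner_def
    by (rule bounded_linear.suminf[OF bounded_linear_Re sm])
  have smR: "summable (\<lambda>n. Re (cnj (coord x n) * coord y n))" for x y
    by (rule bounded_linear.summable[OF bounded_linear_Re sm])
  show "inner a b = inner b a"
    unfolding inner_sum by (simp add: mult.commute)
  show "inner (a + b) c = inner a c + inner b c"
    unfolding inner_sum suminf_add[OF smR smR]
    by (simp add: plus_ell2.rep_eq algebra_simps)
  show "inner (r *\<^sub>R a) b = r * inner a b"
    unfolding inner_sum suminf_mult[OF smR, symmetric] scaleR_ell2_def
    by (simp add: scaleC.rep_eq algebra_simps)
  show "0 \<le> inner a a"
    unfolding inner_self_ell2 by (intro suminf_nonneg coord_summable) simp
  show "inner a a = 0 \<longleftrightarrow> a = 0"
    unfolding inner_self_ell2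
    by (subst suminf_eq_zero_iff[OF coord_summable])
      (auto simp: coord_inject[symmetric] zero_ell2.rep_eq fun_eq_iff)
  show "norm a = sqrt (inner a a)"
    unfolding inner_self_ell2 by (rule norm_ell2_def)
qed

end


section \<open>Operators\<close>

definition bounded_op :: "(ell2 \<Rightarrow> ell2) \<Rightarrow> bool" where
  "bounded_op B \<longleftrightarrow> bounded_linear B \<and> (\<forall>c \<psi>. B (c *\<^sub>C \<psi>) = c *\<^sub>C B \<psi>)"

definition symmetric_op :: "(ell2 \<Rightarrow> ell2) \<Rightarrow> bool" where
  "symmetric_op B \<longleftrightarrow> (\<forall>\<phi> \<psi>. cinner (B \<phi>) \<psi> = cinner \<phi> (B \<psi>))"

definition compact_op :: "(ell2 \<Rightarrow> ell2) \<Rightarrow> bool" where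
  "compact_op B \<longleftrightarrow> bounded_op B \<and> (\<forall>S. bounded S \<longrightarrow> compact (closure (B ` S)))"

definition bounded_sesquilinear :: "(ell2 \<Rightarrow> ell2 \<Rightarrow> complex) \<Rightarrow> bool" where
  "bounded_sesquilinear q \<longleftrightarrow> bounded_bilinear q \<and>
     (\<forall>c \<phi> \<psi>. q (c *\<^sub>C \<phi>) \<psi> = cnj c * q \<phi> \<psi> \<and> q \<phi> (c *\<^sub>C \<psi>) = c * q \<phi> \<psi>)"

text \<open>A possibly unbounded operator is given by its graph, a subset of
  \<^typ>\<open>ell2 \<times> ell2\<close>: its domain is the \<^const>\<open>Domain\<close> of the graph, its closure
  is the \<^const>\<open>closure\<close> of the graph, and the composition of \<open>A\<close> with itself is \<open>A O A\<close>.\<close>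

type_synonym graph_op = "(ell2 \<times> ell2) set"

definition C1 :: "graph_op \<Rightarrow> (ell2 \<Rightarrow> ell2) \<Rightarrow> bool" where
  "C1 A B \<longleftrightarrow> (\<exists>q. bounded_sesquilinear q \<and>
     (\<forall>(\<phi>, A\<phi>) \<in> A. \<forall>(\<psi>, A\<psi>) \<in> A. cinner A\<phi> (B \<psi>) - cinner \<phi> (B A\<psi>) = q \<phi> \<psi>))"

definition ad :: "graph_op \<Rightarrow> (ell2 \<Rightarrow> ell2) \<Rightarrow> ell2 \<Rightarrow> ell2" where
  "ad A B = (THE C. bounded_op C \<and>
     (\<forall>(\<phi>, A\<phi>) \<in> A. \<forall>(\<psi>, A\<psi>) \<in> A.
        cinner A\<phi> (B \<psi>) - cinner \<phi> (B A\<psi>) = cinner \<phi> (C \<psi>)))"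


subsection \<open>Toeplitz operators, the position operator and the conjugate operator\<close>

text \<open>Functions on the torus are \<open>2\<pi>\<close>-periodic functions on \<^typ>\<open>real\<close>.\<close>

definition fourier_coeff :: "(real \<Rightarrow> complex) \<Rightarrow> int \<Rightarrow> complex" where
  "fourier_coeff f n =
     (LINT \<theta>:{0..2*pi}|lborel. exp (- \<i> * of_int n * of_real \<theta>) * f \<theta>) / (2 * of_real pi)"

text \<open>For essentially bounded \<open>f\<close> the sequence below is square summable, so that
  \<^const>\<open>Abs_ell2\<close> is applied inside its intended range.\<close>

definition toeplitz :: "(real \<Rightarrow> complex) \<Rightarrow> ell2 \<Rightarrow> ell2" where
  "toeplitz f \<phi> = Abs_ell2 (\<lambda>n. if n = 0 then 0
     else (\<Sum>k. fourier_coeff f (int n - int k) * coord \<phi> k))"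

definition dom_X :: "ell2 set" where
  "dom_X = {\<psi>. summable (\<lambda>n. (real n)\<^sup>2 * (cmod (coord \<psi> n))\<^sup>2)}"

definition X_op :: "ell2 \<Rightarrow> ell2" where
  "X_op \<psi> = Abs_ell2 (\<lambda>n. of_nat n * coord \<psi> n)"

definition X_graph :: graph_op where
  "X_graph = {(\<psi>, X_op \<psi>) | \<psi>. \<psi> \<in> dom_X}"

definition norm_X :: "ell2 \<Rightarrow> real" where
  "norm_X \<psi> = sqrt ((norm \<psi>)\<^sup>2 + (norm (X_op \<psi>))\<^sup>2)"

definition A_graph :: "(real \<Rightarrow> real) \<Rightarrow> graph_op" where
  "A_graph g = closure {(\<psi>, (1/2) *\<^sub>R (toeplitz (\<lambda>\<theta>. of_real (g \<theta>)) (X_op \<psi>)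
                                   + X_op (toeplitz (\<lambda>\<theta>. of_real (g \<theta>)) \<psi>))) | \<psi>. \<psi> \<in> dom_X}"


subsection \<open>Spectral calculus of bounded self-adjoint operators\<close>

definition projection_valued_measure :: "(real set \<Rightarrow> ell2 \<Rightarrow> ell2) \<Rightarrow> bool" where
  "projection_valued_measure E \<longleftrightarrow>
     (\<forall>\<Lambda>\<in>sets borel. bounded_op (E \<Lambda>) \<and> symmetric_op (E \<Lambda>) \<and> E \<Lambda> \<circ> E \<Lambda> = E \<Lambda>) \<and>
     E UNIV = id \<and>
     (\<forall>D :: nat \<Rightarrow> real set. range D \<subseteq> sets borel \<longrightarrow> disjoint_family D \<longrightarrow>
        (\<forall>\<psi>. (\<lambda>n. E (D n) \<psi>) sums E (\<Union>n. D n) \<psi>))"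

definition scalar_measure :: "(real set \<Rightarrow> ell2 \<Rightarrow> ell2) \<Rightarrow> ell2 \<Rightarrow> real measure" where
  "scalar_measure E \<psi> =
     measure_of UNIV (sets borel) (\<lambda>\<Lambda>. ennreal (Re (cinner \<psi> (E \<Lambda> \<psi>))))"

text \<open>\<open>H = \<integral> \<lambda> dE(\<lambda>)\<close> in the weak sense; by polarization the diagonal of the
  form determines the operator.\<close>

definition spectral_measure :: "(ell2 \<Rightarrow> ell2) \<Rightarrow> (real set \<Rightarrow> ell2 \<Rightarrow> ell2) \<Rightarrow> bool" where
  "spectral_measure H E \<longleftrightarrow> projection_valued_measure E \<and>
     (\<forall>\<psi>. integrable (scalar_measure E \<psi>) (\<lambda>x. x) \<and>
          cinner \<psi> (H \<psi>) = of_real (LINT x|scalar_measure E \<psi>. x))"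

text \<open>The spectral measure is unique on Borel sets only, hence the description of the single
  projection instead of the family \<open>E\<close>.\<close>

definition spectral_proj :: "(ell2 \<Rightarrow> ell2) \<Rightarrow> real set \<Rightarrow> ell2 \<Rightarrow> ell2" where
  "spectral_proj H \<Lambda> = (THE P. \<exists>E. spectral_measure H E \<and> P = E \<Lambda>)"

text \<open>\<open>\<Phi>(H) = \<integral> \<Phi>(\<lambda>) dE(\<lambda>)\<close> for bounded Borel \<open>\<Phi>\<close>.\<close>

definition fun_calc :: "(real \<Rightarrow> complex) \<Rightarrow> (ell2 \<Rightarrow> ell2) \<Rightarrow> ell2 \<Rightarrow> ell2" where
  "fun_calc \<Phi> H = (THE B. bounded_op B \<and>
     (\<forall>\<psi>. cinner \<psi> (B \<psi>) = (LINT x|scalar_measure (spectral_proj H) \<psi>. \<Phi> x)))"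

definition evolution :: "(ell2 \<Rightarrow> ell2) \<Rightarrow> real \<Rightarrow> ell2 \<Rightarrow> ell2" where
  "evolution H t = fun_calc (\<lambda>x. exp (\<i> * of_real (t * x))) H"

definition eigenvectors :: "(ell2 \<Rightarrow> ell2) \<Rightarrow> ell2 set" where
  "eigenvectors H = {\<psi>. \<psi> \<noteq> 0 \<and> (\<exists>\<mu>. H \<psi> = \<mu> *\<^sub>C \<psi>)}"

text \<open>\<^const>\<open>span\<close> is the real span, but it is also the complex one here, since the set of
  eigenvectors is stable under multiplication by nonzero complex numbers.\<close>

definition continuous_subspace :: "(ell2 \<Rightarrow> ell2) \<Rightarrow> ell2 set" where
  "continuous_subspace H = {\<psi>. \<forall>\<phi>\<in>closure (span (eigenvectors H)). cinner \<phi> \<psi> = 0}"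


section \<open>Functions on the torus and on the line\<close>

definition C_k :: "nat \<Rightarrow> (real \<Rightarrow> real) \<Rightarrow> bool" where
  "C_k k f \<longleftrightarrow> (\<forall>j<k. \<forall>x. (deriv ^^ j) f differentiable (at x)) \<and>
     continuous_on UNIV ((deriv ^^ k) f)"

definition C_k_torus :: "nat \<Rightarrow> (real \<Rightarrow> real) \<Rightarrow> bool" where
  "C_k_torus k f \<longleftrightarrow> C_k k f \<and> (\<forall>\<theta>. f (\<theta> + 2 * pi) = f \<theta>)"

definition C_infinity_compact :: "(real \<Rightarrow> real) \<Rightarrow> bool" where
  "C_infinity_compact \<Phi> \<longleftrightarrow> (\<forall>k. C_k k \<Phi>) \<and> compact (closure {x. \<Phi> x \<noteq> 0})"

definition critical_set :: "(real \<Rightarrow> real) \<Rightarrow> real set" where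
  "critical_set f = {\<theta>. \<not> f differentiable (at \<theta>) \<or> deriv f \<theta> = 0}"

text \<open>For continuous periodic \<open>f\<close>, \<open>g\<close> and \<open>\<Lambda>\<close> meeting the range of \<open>f\<close>, the infimum and the
  supremum in the first two definitions are a minimum and a maximum: the closure is the
  periodic lift of a nonempty compact subset of the torus.\<close>

definition c_min :: "real set \<Rightarrow> (real \<Rightarrow> real) \<Rightarrow> (real \<Rightarrow> real) \<Rightarrow> real" where
  "c_min \<Lambda> f g = (INF \<theta>\<in>closure (f -` \<Lambda>). g \<theta>)"

definition C_max :: "real set \<Rightarrow> (real \<Rightarrow> real) \<Rightarrow> (real \<Rightarrow> real) \<Rightarrow> real" where
  "C_max \<Lambda> f g = (SUP \<theta>\<in>closure (f -` \<Lambda>). g \<theta>)"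

definition c_sharp :: "real set \<Rightarrow> (real \<Rightarrow> real) \<Rightarrow> (real \<Rightarrow> real) \<Rightarrow> real" where
  "c_sharp \<Lambda> f g = (SUP \<Lambda>'\<in>{\<Lambda>'. open \<Lambda>' \<and> closure \<Lambda> \<subseteq> \<Lambda>'}. c_min \<Lambda>' f g)"

definition C_flat :: "real set \<Rightarrow> (real \<Rightarrow> real) \<Rightarrow> (real \<Rightarrow> real) \<Rightarrow> real" where
  "C_flat \<Lambda> f g = (INF \<Lambda>'\<in>{\<Lambda>'. open \<Lambda>' \<and> closure \<Lambda> \<subseteq> \<Lambda>'}. C_max \<Lambda>' f g)"

end

theory Submission
  imports Defs "HOL-Probability.Probability"
begin

text \<open>Let \<open>\<psi>(t) = e\<^bsup>iHt\<^esup> \<psi>\<close>. The theorem says that the position grows at the rate \<open>|f'|\<close>, the modulus of the group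
  velocity, on the part of the torus that carries the energy of \<open>\<psi>\<close>, and the proof differentiates
  \<open>\<parallel>X \<psi>(t)\<parallel>\<^sup>2\<close> twice.

  Since \<open>[X, T\<^sub>f] = -i T\<^bsub>f'\<^esub>\<close>, the first derivative is twice the expectation of
  \<open>A = (T\<^bsub>f'\<^esub> X + X T\<^bsub>f'\<^esub>) / 2\<close>, plus the expectation of \<open>i [X\<^sup>2, V]\<close>, which stays bounded because
  \<open>V \<in> C\<^sup>1(X\<^sup>2)\<close>. The expectation of \<open>A\<close> has the derivative \<open>\<parallel>T\<^bsub>f'\<^esub> \<psi>(t)\<parallel>\<^sup>2\<close> plus a compact form: \<open>[A, V]\<close> is
  compact by assumption, and the rest is \<open>X\<close> times the commutator of two Toeplitz operators, compact
  since the Fourier coefficients of \<open>f\<close> decay like \<open>n\<^bsup>-3\<^esup>\<close> (lemma \<open>position_commutator\<close>). Up to another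
  compact form \<open>\<parallel>T\<^bsub>f'\<^esub> \<psi>\<parallel>\<^sup>2\<close> is the form of \<open>T\<^bsub>g\<^esub>\<close> with \<open>g = |f'|\<^sup>2\<close>.

  Modulo compact operators \<open>\<Phi>(H)\<close> is the Toeplitz operator with symbol \<open>\<Phi> \<circ> f\<close>. If \<open>g \<ge> c\<close> wherever \<open>\<Phi> \<circ> f\<close> does
  not vanish, then \<open>\<Phi>(H) T\<^bsub>g - c\<^esub> \<Phi>(H)\<close> is therefore nonnegative modulo compact operators (lemma
  \<open>energy_localization\<close>), and the same argument applies to upper bounds. Compactness enters in the
  form of an estimate by finitely many matrix elements \<open>\<langle>y, \<psi>(t)\<rangle>\<close>; for \<open>\<psi>\<close> in the continuous subspace
  their time averages vanish by Wiener's theorem (lemma \<open>weak_size_average\<close>). So for \<open>\<psi>\<close> in the range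
  of \<open>\<Phi>(H)\<close> the second derivative of \<open>\<parallel>X \<psi>(t)\<parallel>\<^sup>2\<close> is on average at least \<open>2 c \<parallel>\<psi>\<parallel>\<^sup>2\<close>, and two integrations
  (lemma \<open>second_order_growth\<close>) give the growth \<open>c \<parallel>\<psi>\<parallel>\<^sup>2 t\<^sup>2\<close>.

  These computations are legitimate because the evolution preserves the domain of \<open>X\<close>. So does \<open>\<Phi>(H)\<close>
  for smooth \<open>\<Phi>\<close>, being a superposition of evolutions with rapidly decreasing weights; here the
  optimal constants for \<open>\<Lambda>\<close> itself come out. The vector \<open>E\<^sub>\<Lambda>(H) \<phi>\<close> is fixed by \<open>\<Phi>(H)\<close> only for cutoffs \<open>\<Phi>\<close> that are
  \<open>1\<close> on \<open>\<Lambda>\<close>, hence nonzero on a neighbourhood, and this is why \<open>c\<^sup>\<sharp>\<close> and \<open>C\<^sup>\<flat>\<close> appear there.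

  The spectral theorem is derived along the way: Hausdorff's moment problem yields the scalar
  spectral measures, polarization and bounded limits the Borel functional calculus, and the
  comparison of the projections of half lines the uniqueness of the spectral measure.\<close>

section \<open>Square summable sequences\<close>

lemma coord_0 [simp]: "coord \<psi> 0 = 0"
  using coord[of \<psi>] by simp

lemma coord_simps [simp]:
  "coord 0 n = 0" "coord (\<phi> + \<psi>) n = coord \<phi> n + coord \<psi> n" "coord (- \<psi>) n = - coord \<psi> n"
  "coord (\<phi> - \<psi>) n = coord \<phi> n - coord \<psi> n" "coord (c *\<^sub>C \<psi>) n = c * coord \<psi> n"
  "coord (r *\<^sub>R \<psi>) n = complex_of_real r * coord \<psi> n"
  unfolding minus_ell2_def
  by (simp_all add: zero_ell2.rep_eq plus_ell2.rep_eq uminus_ell2.rep_eq scaleC.rep_eq scaleR_ell2_def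
      del: add_uminus_conv_diff)

lemma coord_sum [simp]: "coord (\<Sum>i\<in>I. \<psi> i) n = (\<Sum>i\<in>I. coord (\<psi> i) n)"
  by (induction I rule: infinite_finite_induct) auto

lemma coord_Abs_ell2:
  assumes "a 0 = 0" "summable (\<lambda>n. (cmod (a n))\<^sup>2)"
  shows "coord (Abs_ell2 a) = a"
  using assms by (subst Abs_ell2_inverse) auto

lemma ell2_eqI: "(\<And>n. coord \<phi> n = coord \<psi> n) \<Longrightarrow> \<phi> = \<psi>"
  by (simp add: coord_inject[symmetric] fun_eq_iff)

lemma summable_cinner: "summable (\<lambda>n. cnj (coord \<phi> n) * coord \<psi> n)"
  by (intro summable_cnj_mult coord_summable)

lemma norm_ell2_sq: "(norm \<psi>)\<^sup>2 = (\<Sum>n. (cmod (coord \<psi> n))\<^sup>2)" for \<psi> :: ell2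
  unfolding norm_ell2_def by (simp add: suminf_nonneg coord_summable)

lemma Re_cinner: "Re (cinner \<phi> \<psi>) = inner \<phi> \<psi>"
  by (simp add: inner_ell2_def)

lemma scaleC_simps [simp]:
  "1 *\<^sub>C \<psi> = \<psi>" "0 *\<^sub>C \<psi> = 0" "c *\<^sub>C (0 :: ell2) = 0" "(- c) *\<^sub>C \<psi> = - (c *\<^sub>C \<psi>)"
  "c *\<^sub>C (- \<psi>) = - (c *\<^sub>C \<psi>)" "c *\<^sub>C d *\<^sub>C \<psi> = (c * d) *\<^sub>C \<psi>"
  by (rule ell2_eqI; simp)+

lemma scaleC_distribs:
  "c *\<^sub>C (\<phi> + \<psi>) = c *\<^sub>C \<phi> + c *\<^sub>C \<psi>" "c *\<^sub>C (\<phi> - \<psi>) = c *\<^sub>C \<phi> - c *\<^sub>C \<psi>"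
  "(c + d) *\<^sub>C \<psi> = c *\<^sub>C \<psi> + d *\<^sub>C \<psi>" "(c - d) *\<^sub>C \<psi> = c *\<^sub>C \<psi> - d *\<^sub>C \<psi>"
  by (rule ell2_eqI; simp add: algebra_simps)+

lemma scaleR_conv_scaleC: "r *\<^sub>R \<psi> = complex_of_real r *\<^sub>C \<psi>" for \<psi> :: ell2
  by (rule ell2_eqI) simp

lemma scaleC_of_real [simp]: "complex_of_real r *\<^sub>C \<psi> = r *\<^sub>R \<psi>"
  by (rule ell2_eqI) simp

lemma scaleC_sum: "c *\<^sub>C (\<Sum>i\<in>I. \<psi> i) = (\<Sum>i\<in>I. c *\<^sub>C \<psi> i)"
  by (rule ell2_eqI) (simp add: sum_distrib_left)

lemma cinner_add_left: "cinner (\<phi> + \<phi>') \<psi> = cinner \<phi> \<psi> + cinner \<phi>' \<psi>"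
  unfolding cinner_def by (subst suminf_add[OF summable_cinner summable_cinner]) (simp add: algebra_simps)

lemma cinner_add_right: "cinner \<phi> (\<psi> + \<psi>') = cinner \<phi> \<psi> + cinner \<phi> \<psi>'"
  unfolding cinner_def by (subst suminf_add[OF summable_cinner summable_cinner]) (simp add: algebra_simps)

lemma cinner_scaleC_left [simp]: "cinner (c *\<^sub>C \<phi>) \<psi> = cnj c * cinner \<phi> \<psi>"
  unfolding cinner_def by (subst suminf_mult[OF summable_cinner, symmetric]) (simp add: algebra_simps)

lemma cinner_scaleC_right [simp]: "cinner \<phi> (c *\<^sub>C \<psi>) = c * cinner \<phi> \<psi>"
  unfolding cinner_def by (subst suminf_mult[OF summable_cinner, symmetric]) (simp add: algebra_simps)

lemma cinner_commute: "cinner \<psi> \<phi> = cnj (cinner \<phi> \<psi>)"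
proof -
  have "cnj (\<Sum>n. cnj (coord \<phi> n) * coord \<psi> n) = (\<Sum>n. cnj (cnj (coord \<phi> n) * coord \<psi> n))"
    by (rule bounded_linear.suminf[OF bounded_linear_cnj summable_cinner])
  then show ?thesis unfolding cinner_def by (simp add: mult.commute)
qed

lemma cinner_zero [simp]: "cinner 0 \<psi> = 0" "cinner \<phi> 0 = 0"
  by (simp_all add: cinner_def)

lemma cinner_minus [simp]: "cinner (- \<phi>) \<psi> = - cinner \<phi> \<psi>" "cinner \<phi> (- \<psi>) = - cinner \<phi> \<psi>"
  using cinner_scaleC_left[of "- 1" \<phi> \<psi>] cinner_scaleC_right[of \<phi> "- 1" \<psi>] by simp_all

lemma cinner_diff_left: "cinner (\<phi> - \<phi>') \<psi> = cinner \<phi> \<psi> - cinner \<phi>' \<psi>"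
  using cinner_add_left[of \<phi> "- \<phi>'" \<psi>] by simp

lemma cinner_diff_right: "cinner \<phi> (\<psi> - \<psi>') = cinner \<phi> \<psi> - cinner \<phi> \<psi>'"
  using cinner_add_right[of \<phi> \<psi> "- \<psi>'"] by simp

lemma cinner_scaleR [simp]:
  "cinner (r *\<^sub>R \<phi>) \<psi> = of_real r * cinner \<phi> \<psi>" "cinner \<phi> (r *\<^sub>R \<psi>) = of_real r * cinner \<phi> \<psi>"
  by (simp_all add: scaleR_conv_scaleC del: scaleC_of_real)

lemma cinner_self: "cinner \<psi> \<psi> = complex_of_real ((norm \<psi>)\<^sup>2)"
proof (rule complex_eqI)
  show "Re (cinner \<psi> \<psi>) = Re (of_real ((norm \<psi>)\<^sup>2))"
    by (simp add: Re_cinner power2_norm_eq_inner)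
  have "Im (cinner \<psi> \<psi>) = Im (cnj (cinner \<psi> \<psi>))"
    using cinner_commute[of \<psi> \<psi>] by (rule arg_cong)
  then show "Im (cinner \<psi> \<psi>) = Im (complex_of_real ((norm \<psi>)\<^sup>2))" by simp
qed

lemma norm_scaleC [simp]: "norm (c *\<^sub>C \<psi>) = cmod c * norm \<psi>"
proof (rule power2_eq_imp_eq)
  have "complex_of_real ((norm (c *\<^sub>C \<psi>))\<^sup>2) = complex_of_real ((cmod c * norm \<psi>)\<^sup>2)"
    unfolding cinner_self[symmetric] cinner_scaleC_left cinner_scaleC_right
    by (simp add: cinner_self power_mult_distrib complex_norm_square[unfolded of_real_power] mult.commute mult.left_commute)
  then show "(norm (c *\<^sub>C \<psi>))\<^sup>2 = (cmod c * norm \<psi>)\<^sup>2" by (simp only: of_real_eq_iff)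
qed auto

lemma Cauchy_Schwarz_cinner: "cmod (cinner \<phi> \<psi>) \<le> norm \<phi> * norm \<psi>"
proof (cases "cinner \<phi> \<psi> = 0")
  case False
  define z where "z = cinner \<phi> \<psi>"
  define c where "c = z / of_real (cmod z)"
  have z: "z \<noteq> 0" using False z_def by simp
  have "cnj c * z = z * cnj z / of_real (cmod z)" by (simp add: c_def)
  also have "\<dots> = of_real ((cmod z)\<^sup>2) / of_real (cmod z)"
    by (simp add: complex_norm_square[unfolded of_real_power])
  also have "\<dots> = of_real (cmod z)" using z by (simp add: power2_eq_square)
  finally have "cnj c * z = of_real (cmod z)" .
  then have "cmod z = Re (cinner (c *\<^sub>C \<phi>) \<psi>)"
    by (simp add: z_def[symmetric])
  also have "\<dots> \<le> norm (c *\<^sub>C \<phi>) * norm \<psi>"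
    unfolding Re_cinner by (rule norm_cauchy_schwarz)
  also have "norm (c *\<^sub>C \<phi>) = norm \<phi>"
    using z by (simp add: c_def norm_divide)
  finally show ?thesis by (simp add: z_def)
qed simp

lemma bounded_bilinear_cinner: "bounded_bilinear cinner"
  by (rule bounded_bilinear.intro)
    (auto simp: cinner_add_left cinner_add_right scaleR_conv_of_real
      intro!: exI[of _ 1] Cauchy_Schwarz_cinner)

interpretation cinner: bounded_bilinear cinner
  by (rule bounded_bilinear_cinner)

lemma coord_le_norm: "cmod (coord \<psi> n) \<le> norm \<psi>"
proof -
  have "(cmod (coord \<psi> n))\<^sup>2 \<le> (\<Sum>n. (cmod (coord \<psi> n))\<^sup>2)"
    using sum_le_suminf[OF coord_summable, of "{n}" \<psi>] by simp
  then show ?thesis by (simp add: norm_ell2_sq[symmetric] power2_le_iff_abs_le)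
qed

lemma norm_ell2_le:
  assumes "\<And>J. (\<Sum>n<J. (cmod (coord \<psi> n))\<^sup>2) \<le> r\<^sup>2" "0 \<le> r"
  shows "norm \<psi> \<le> r"
proof -
  have "(norm \<psi>)\<^sup>2 \<le> r\<^sup>2"
    unfolding norm_ell2_sq by (rule suminf_le_const[OF coord_summable assms(1)])
  then show ?thesis using assms(2) by (rule power2_le_imp_le)
qed

text \<open>The limit is taken coordinatewise; partial sums of the squared norm pass to the limit.\<close>

instance ell2 :: complete_space
proof
  fix X :: "nat \<Rightarrow> ell2"
  assume X: "Cauchy X"
  have "Cauchy (\<lambda>n. coord (X n) k)" for k
    unfolding Cauchy_def
  proof (intro allI impI)
    fix e :: real assume "e > 0"
    then obtain M where "\<forall>m\<ge>M. \<forall>n\<ge>M. dist (X m) (X n) < e"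
      using X unfolding Cauchy_def by blast
    then show "\<exists>M. \<forall>m\<ge>M. \<forall>n\<ge>M. dist (coord (X m) k) (coord (X n) k) < e"
      unfolding dist_norm coord_simps(4)[symmetric]
      by (meson coord_le_norm le_less_trans)
  qed
  then have "\<exists>l. (\<lambda>n. coord (X n) k) \<longlonglongrightarrow> l" for k
    using Cauchy_convergent_iff convergent_def by blast
  then obtain a where a: "\<And>k. (\<lambda>n. coord (X n) k) \<longlonglongrightarrow> a k" by metis
  have key: "\<exists>M. \<forall>n\<ge>M. \<forall>J. (\<Sum>k<J. (cmod (a k - coord (X n) k))\<^sup>2) \<le> e\<^sup>2" if e: "e > 0" for e :: real
  proof -
    obtain M where M: "\<forall>m\<ge>M. \<forall>n\<ge>M. dist (X m) (X n) < e"
      using X e unfolding Cauchy_def by blast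
    show ?thesis
    proof (intro exI[of _ M] allI impI)
      fix n J assume n: "n \<ge> M"
      have "(\<lambda>m. \<Sum>k<J. (cmod (coord (X m) k - coord (X n) k))\<^sup>2)
              \<longlonglongrightarrow> (\<Sum>k<J. (cmod (a k - coord (X n) k))\<^sup>2)"
        by (intro tendsto_intros a)
      moreover have "(\<Sum>k<J. (cmod (coord (X m) k - coord (X n) k))\<^sup>2) \<le> e\<^sup>2" if "m \<ge> M" for m
      proof -
        have "(\<Sum>k<J. (cmod (coord (X m - X n) k))\<^sup>2) \<le> (norm (X m - X n))\<^sup>2"
          unfolding norm_ell2_sq by (rule sum_le_suminf[OF coord_summable]) auto
        also have "\<dots> \<le> e\<^sup>2"
          using M that n by (intro power_mono) (auto simp: dist_norm less_imp_le)
        finally show ?thesis by simp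
      qed
      ultimately show "(\<Sum>k<J. (cmod (a k - coord (X n) k))\<^sup>2) \<le> e\<^sup>2"
        by (intro LIMSEQ_le_const2) auto
    qed
  qed
  obtain M where M: "\<And>J. (\<Sum>k<J. (cmod (a k - coord (X M) k))\<^sup>2) \<le> 1\<^sup>2"
    using key[of 1] by auto
  have "summable (\<lambda>k. (cmod (a k - coord (X M) k))\<^sup>2)"
    by (rule summableI_nonneg_bounded[OF _ M]) simp
  from summable_norm_add_sq[OF this coord_summable[of "X M"]]
  have sa: "summable (\<lambda>k. (cmod (a k))\<^sup>2)" by simp
  have "(\<lambda>n. coord (X n) 0) \<longlonglongrightarrow> 0" by simp
  with a[of 0] have a0: "a 0 = 0" by (rule LIMSEQ_unique)
  define L where "L = Abs_ell2 a"
  have L: "coord L = a" unfolding L_def using a0 sa by (rule coord_Abs_ell2)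
  have "X \<longlonglongrightarrow> L"
  proof (rule metric_LIMSEQ_I)
    fix r :: real assume r: "r > 0"
    obtain M where M: "\<And>n J. n \<ge> M \<Longrightarrow> (\<Sum>k<J. (cmod (a k - coord (X n) k))\<^sup>2) \<le> (r/2)\<^sup>2"
      using key[of "r/2"] r by auto
    show "\<exists>no. \<forall>n\<ge>no. dist (X n) L < r"
    proof (intro exI[of _ M] allI impI)
      fix n assume "n \<ge> M"
      then have "norm (L - X n) \<le> r / 2"
        using M r by (intro norm_ell2_le) (auto simp: L)
      then show "dist (X n) L < r" using r by (simp add: dist_norm norm_minus_commute)
    qed
  qed
  then show "convergent X" by (rule convergentI)
qed

instance ell2 :: banach ..

subsection \<open>Basis vectors and truncation\<close>

text \<open>The index \<open>0\<close> is spurious, so \<open>basis 0 = 0\<close>; sums over all indices then need no exception.\<close>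

lift_definition basis :: "nat \<Rightarrow> ell2" is "\<lambda>n m. if m = n \<and> 0 < n then 1 else 0"
proof
  fix n :: nat
  show "(if 0 = n \<and> 0 < n then 1 else 0) = (0::complex)" by (cases n) simp_all
  show "summable (\<lambda>m. (cmod (if m = n \<and> 0 < n then 1 else 0))\<^sup>2)"
    by (rule summable_finite[of "{n}"]) auto
qed

lemma coord_basis: "coord (basis n) m = (if m = n \<and> 0 < n then 1 else 0)"
  by (simp add: basis.rep_eq)

lemma basis_0 [simp]: "basis 0 = 0"
  by (rule ell2_eqI) (simp add: coord_basis)

lemma cinner_basis [simp]: "cinner (basis n) \<psi> = coord \<psi> n"
proof (cases "n = 0")
  case False
  then show ?thesis
    unfolding cinner_def by (subst suminf_finite[of "{n}"]) (auto simp: coord_basis)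
qed simp

lemma bounded_linear_coord: "bounded_linear (\<lambda>\<psi>. coord \<psi> n)"
  unfolding cinner_basis[symmetric] by (rule cinner.bounded_linear_right)

definition trunc :: "nat \<Rightarrow> ell2 \<Rightarrow> ell2" where
  "trunc N \<psi> = (\<Sum>n\<le>N. coord \<psi> n *\<^sub>C basis n)"

lemma coord_trunc [simp]: "coord (trunc N \<psi>) n = (if n \<le> N then coord \<psi> n else 0)"
proof -
  have "coord (trunc N \<psi>) n = (\<Sum>m\<le>N. if m = n then coord \<psi> n else 0)"
    unfolding trunc_def coord_sum by (rule sum.cong) (auto simp: coord_basis)
  then show ?thesis by simp
qed

lemma norm_diff_trunc_sq: "(norm (\<psi> - trunc N \<psi>))\<^sup>2 = (\<Sum>n. (cmod (coord \<psi> (n + Suc N)))\<^sup>2)"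
proof -
  have "(norm (\<psi> - trunc N \<psi>))\<^sup>2 = (\<Sum>n. (cmod (coord (\<psi> - trunc N \<psi>) (n + Suc N)))\<^sup>2)
      + (\<Sum>n<Suc N. (cmod (coord (\<psi> - trunc N \<psi>) n))\<^sup>2)"
    unfolding norm_ell2_sq by (rule suminf_split_initial_segment[OF coord_summable])
  then show ?thesis by simp
qed

lemma trunc_tendsto: "(\<lambda>N. trunc N \<psi>) \<longlonglongrightarrow> \<psi>"
proof -
  have "(\<lambda>N. \<Sum>n. (cmod (coord \<psi> (n + N)))\<^sup>2) \<longlonglongrightarrow> 0"
    by (rule suminf_exist_split2[OF coord_summable])
  from LIMSEQ_Suc[OF this] have "(\<lambda>N. (norm (\<psi> - trunc N \<psi>))\<^sup>2) \<longlonglongrightarrow> 0"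
    unfolding norm_diff_trunc_sq .
  from tendsto_real_sqrt[OF this] have "(\<lambda>N. norm (\<psi> - trunc N \<psi>)) \<longlonglongrightarrow> 0" by simp
  then have "(\<lambda>N. \<psi> - trunc N \<psi>) \<longlonglongrightarrow> 0" by (rule tendsto_norm_zero_cancel)
  from tendsto_diff[OF tendsto_const this, of \<psi>] show ?thesis by simp
qed

section \<open>Bounded operators and forms\<close>

lemma bounded_opI:
  assumes "\<And>\<phi> \<psi>. B (\<phi> + \<psi>) = B \<phi> + B \<psi>" "\<And>c \<psi>. B (c *\<^sub>C \<psi>) = c *\<^sub>C B \<psi>"
    "\<And>\<psi>. norm (B \<psi>) \<le> norm \<psi> * K"
  shows "bounded_op B"
  unfolding bounded_op_def
  by (intro conjI allI bounded_linear_intro[of _ K] assms)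
    (metis assms(2) scaleR_conv_scaleC)

lemma bounded_op_linear: "bounded_op B \<Longrightarrow> bounded_linear B"
  by (simp add: bounded_op_def)

lemma bounded_op_simps:
  assumes "bounded_op B"
  shows "B (\<phi> + \<psi>) = B \<phi> + B \<psi>" "B (\<phi> - \<psi>) = B \<phi> - B \<psi>" "B (- \<phi>) = - B \<phi>" "B 0 = 0"
    "B (c *\<^sub>C \<phi>) = c *\<^sub>C B \<phi>" "B (r *\<^sub>R \<phi>) = r *\<^sub>R B \<phi>"
    "B (\<Sum>i\<in>I. f i) = (\<Sum>i\<in>I. B (f i))"
proof -
  interpret bounded_linear B using assms by (rule bounded_op_linear)
  show "B (\<phi> + \<psi>) = B \<phi> + B \<psi>" "B (\<phi> - \<psi>) = B \<phi> - B \<psi>" "B (- \<phi>) = - B \<phi>" "B 0 = 0"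
    "B (r *\<^sub>R \<phi>) = r *\<^sub>R B \<phi>" "B (\<Sum>i\<in>I. f i) = (\<Sum>i\<in>I. B (f i))"
    by (rule add diff neg zero scaleR sum)+
  show "B (c *\<^sub>C \<phi>) = c *\<^sub>C B \<phi>" using assms by (simp add: bounded_op_def)
qed

lemma bounded_op_bound:
  assumes "bounded_op B"
  obtains K where "K > 0" "\<And>\<psi>. norm (B \<psi>) \<le> norm \<psi> * K"
  using bounded_linear.pos_bounded[OF bounded_op_linear[OF assms]] by auto

lemma bounded_op_tendsto:
  assumes "bounded_op B" "(f \<longlongrightarrow> l) F"
  shows "((\<lambda>x. B (f x)) \<longlongrightarrow> B l) F"
  using bounded_linear.tendsto[OF bounded_op_linear[OF assms(1)] assms(2)] .

lemma bounded_op_id: "bounded_op (\<lambda>\<psi>. \<psi>)"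
  by (rule bounded_opI[of _ 1]) auto

lemma bounded_op_compose:
  assumes "bounded_op A" "bounded_op B"
  shows "bounded_op (\<lambda>\<psi>. A (B \<psi>))"
  using bounded_linear_compose[OF assms[THEN bounded_op_linear]] assms
  by (simp add: bounded_op_def)

lemma bounded_op_add:
  assumes "bounded_op A" "bounded_op B"
  shows "bounded_op (\<lambda>\<psi>. A \<psi> + B \<psi>)"
  using bounded_linear_add[OF assms[THEN bounded_op_linear]] assms
  by (simp add: bounded_op_def scaleC_distribs)

lemma bounded_op_scaleC:
  assumes "bounded_op A"
  shows "bounded_op (\<lambda>\<psi>. c *\<^sub>C A \<psi>)"
proof -
  obtain K where K: "K > 0" "\<And>\<psi>. norm (A \<psi>) \<le> norm \<psi> * K" using bounded_op_bound[OF assms] by blast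
  show ?thesis
  proof (rule bounded_opI[of _ "cmod c * K"])
    show "norm (c *\<^sub>C A \<psi>) \<le> norm \<psi> * (cmod c * K)" for \<psi>
      using mult_left_mono[OF K(2)[of \<psi>], of "cmod c"] by (simp add: mult_ac)
  qed (simp_all add: bounded_op_simps[OF assms] scaleC_distribs mult.commute)
qed

lemma bounded_op_diff:
  assumes "bounded_op A" "bounded_op B"
  shows "bounded_op (\<lambda>\<psi>. A \<psi> - B \<psi>)"
  using bounded_op_add[OF assms(1) bounded_op_scaleC[OF assms(2), of "- 1"]] by simp

lemma bounded_op_funpow: "bounded_op A \<Longrightarrow> bounded_op (A ^^ n)"
  by (induction n) (auto simp: id_def comp_def intro: bounded_op_id bounded_op_compose)

text \<open>The numbers \<open>q e\<^sub>n \<psi>\<close> have to be the coordinates of \<open>C \<psi>\<close>. They are square summable since \<open>q\<close> is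
  bounded on the partial sums \<open>\<Sum>\<^sub>n q e\<^sub>n \<psi> e\<^sub>n\<close>.\<close>

lemma riesz_form:
  fixes q :: "ell2 \<Rightarrow> ell2 \<Rightarrow> complex"
  assumes add_right: "\<And>\<phi> a b. q \<phi> (a + b) = q \<phi> a + q \<phi> b"
    and scale_right: "\<And>c \<phi> a. q \<phi> (c *\<^sub>C a) = c * q \<phi> a"
    and add_left: "\<And>\<psi> a b. q (a + b) \<psi> = q a \<psi> + q b \<psi>"
    and scale_left: "\<And>c \<psi> a. q (c *\<^sub>C a) \<psi> = cnj c * q a \<psi>"
    and bound: "\<And>\<phi> \<psi>. cmod (q \<phi> \<psi>) \<le> norm \<phi> * norm \<psi> * K"
  obtains C where "bounded_op C" "\<And>\<phi> \<psi>. q \<phi> \<psi> = cinner \<phi> (C \<psi>)"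
proof -
  define L where "L = \<bar>K\<bar>"
  have L: "cmod (q \<phi> \<psi>) \<le> norm \<phi> * norm \<psi> * L" "L \<ge> 0" for \<phi> \<psi>
  proof -
    have "norm \<phi> * norm \<psi> * K \<le> norm \<phi> * norm \<psi> * L"
      by (rule mult_left_mono) (auto simp: L_def)
    then show "cmod (q \<phi> \<psi>) \<le> norm \<phi> * norm \<psi> * L" using bound[of \<phi> \<psi>] by linarith
  qed (simp add: L_def)
  have q0: "q 0 \<psi> = 0" for \<psi> using scale_left[of 0 0 \<psi>] by simp
  have q_sum: "q (\<Sum>i\<in>I. f i) \<psi> = (\<Sum>i\<in>I. q (f i) \<psi>)" for f :: "nat \<Rightarrow> ell2" and I \<psi>
    by (induction I rule: infinite_finite_induct) (auto simp: q0 add_left)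
  define a where "a \<psi> n = q (basis n) \<psi>" for \<psi> n
  have a0: "a \<psi> 0 = 0" for \<psi> by (simp add: a_def q0)
  have sum_le: "(\<Sum>n<J. (cmod (a \<psi> n))\<^sup>2) \<le> (norm \<psi> * L)\<^sup>2" for \<psi> J
  proof -
    define s where "s = (\<Sum>n<J. (cmod (a \<psi> n))\<^sup>2)"
    have s: "s \<ge> 0" by (auto simp: s_def intro: sum_nonneg)
    define v where "v = (\<Sum>n<J. a \<psi> n *\<^sub>C basis n)"
    have cv: "coord v n = (if n < J then a \<psi> n else 0)" for n
    proof -
      have "coord v n = (\<Sum>m<J. if m = n then a \<psi> n else 0)"
        unfolding v_def coord_sum by (rule sum.cong) (auto simp: coord_basis a0)
      then show ?thesis by simp
    qed
    have nv: "(norm v)\<^sup>2 = s"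
      unfolding norm_ell2_sq s_def by (subst suminf_finite[of "{..<J}"]) (auto simp: cv)
    have "q v \<psi> = (\<Sum>n<J. cnj (a \<psi> n) * a \<psi> n)"
      unfolding v_def q_sum scale_left by (simp add: a_def)
    also have "\<dots> = (\<Sum>n<J. of_real ((cmod (a \<psi> n))\<^sup>2))"
      by (rule sum.cong) (simp_all only: complex_norm_square mult.commute)
    also have "\<dots> = complex_of_real s" by (simp add: s_def)
    finally have "s = cmod (q v \<psi>)" using s by simp
    also have "\<dots> \<le> norm v * norm \<psi> * L" by (rule L(1))
    also have "norm v = sqrt s" unfolding nv[symmetric] by simp
    finally have *: "s \<le> sqrt s * (norm \<psi> * L)" by simp
    show ?thesis
    proof (cases "s = 0")
      case False
      then have "sqrt s > 0" using s by simp
      have "sqrt s * sqrt s \<le> sqrt s * (norm \<psi> * L)" using * s by simp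
      then have "sqrt s \<le> norm \<psi> * L" using \<open>sqrt s > 0\<close> by (rule mult_left_le_imp_le)
      then have "(sqrt s)\<^sup>2 \<le> (norm \<psi> * L)\<^sup>2" using s by (intro power_mono) auto
      then show ?thesis using s by (simp add: s_def)
    qed (simp flip: s_def)
  qed
  define C where "C \<psi> = Abs_ell2 (a \<psi>)" for \<psi>
  have cC: "coord (C \<psi>) n = a \<psi> n" for \<psi> n
  proof -
    have "summable (\<lambda>n. (cmod (a \<psi> n))\<^sup>2)" by (rule summableI_nonneg_bounded[OF _ sum_le]) simp
    then show ?thesis unfolding C_def using a0 by (simp add: coord_Abs_ell2)
  qed
  have bC: "bounded_op C"
  proof (rule bounded_opI)
    show "norm (C \<psi>) \<le> norm \<psi> * L" for \<psi>
      using sum_le L(2) by (intro norm_ell2_le) (auto simp: cC)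
  qed (rule ell2_eqI; simp add: cC a_def add_right scale_right)+
  have "q \<phi> \<psi> = cinner \<phi> (C \<psi>)" for \<phi> \<psi>
  proof (rule LIMSEQ_unique)
    have eq: "q (trunc N \<phi>) \<psi> = cinner (trunc N \<phi>) (C \<psi>)" for N
      unfolding trunc_def q_sum cinner.sum_left scale_left cinner_scaleC_left cinner_basis cC a_def ..
    show "(\<lambda>N. q (trunc N \<phi>) \<psi>) \<longlonglongrightarrow> cinner \<phi> (C \<psi>)"
      unfolding eq by (intro cinner.tendsto trunc_tendsto tendsto_const)
    have "(\<lambda>N. norm (trunc N \<phi> - \<phi>) * (norm \<psi> * L)) \<longlonglongrightarrow> 0 * (norm \<psi> * L)"
      by (intro tendsto_mult tendsto_const tendsto_norm_zero LIM_zero trunc_tendsto)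
    then have lim0: "(\<lambda>N. norm (trunc N \<phi> - \<phi>) * (norm \<psi> * L)) \<longlonglongrightarrow> 0" by simp
    have "(\<lambda>N. q (trunc N \<phi>) \<psi> - q \<phi> \<psi>) \<longlonglongrightarrow> 0"
    proof (rule Lim_null_comparison[OF always_eventually lim0], rule allI)
      fix N
      have "q (trunc N \<phi>) \<psi> = q (trunc N \<phi> - \<phi>) \<psi> + q \<phi> \<psi>"
        unfolding add_left[symmetric] by simp
      then show "norm (q (trunc N \<phi>) \<psi> - q \<phi> \<psi>) \<le> norm (trunc N \<phi> - \<phi>) * (norm \<psi> * L)"
        using L(1)[of "trunc N \<phi> - \<phi>" \<psi>] by (simp add: mult.assoc)
    qed
    then show "(\<lambda>N. q (trunc N \<phi>) \<psi>) \<longlonglongrightarrow> q \<phi> \<psi>" by (rule LIM_zero_cancel)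
  qed
  with bC show ?thesis by (rule that)
qed

lemma bounded_op_adjoint:
  assumes "bounded_op B"
  obtains C where "bounded_op C" "\<And>\<phi> \<psi>. cinner (B \<phi>) \<psi> = cinner \<phi> (C \<psi>)"
proof -
  obtain K where K: "K > 0" "\<And>\<psi>. norm (B \<psi>) \<le> norm \<psi> * K" using bounded_op_bound[OF assms] by blast
  show ?thesis
  proof (rule riesz_form[of "\<lambda>\<phi> \<psi>. cinner (B \<phi>) \<psi>" K])
    fix \<phi> \<psi>
    have "cmod (cinner (B \<phi>) \<psi>) \<le> norm (B \<phi>) * norm \<psi>" by (rule Cauchy_Schwarz_cinner)
    also have "\<dots> \<le> (norm \<phi> * K) * norm \<psi>" by (intro mult_right_mono K) simp
    finally show "cmod (cinner (B \<phi>) \<psi>) \<le> norm \<phi> * norm \<psi> * K" by (simp add: mult_ac)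
  qed (use that in \<open>auto simp: bounded_op_simps[OF assms] cinner_add_left cinner_add_right\<close>)
qed

lemma polarization:
  assumes "bounded_op B"
  shows "cinner \<phi> (B \<psi>) = (cinner (\<phi> + \<psi>) (B (\<phi> + \<psi>)) - cinner (\<phi> - \<psi>) (B (\<phi> - \<psi>))
     - \<i> * cinner (\<phi> + \<i> *\<^sub>C \<psi>) (B (\<phi> + \<i> *\<^sub>C \<psi>))
     + \<i> * cinner (\<phi> - \<i> *\<^sub>C \<psi>) (B (\<phi> - \<i> *\<^sub>C \<psi>))) / 4"
  by (simp add: bounded_op_simps[OF assms] cinner_add_left cinner_add_right cinner_diff_left
      cinner_diff_right algebra_simps)

lemma bounded_op_eqI:
  assumes "bounded_op A" "bounded_op B" "\<And>\<psi>. cinner \<psi> (A \<psi>) = cinner \<psi> (B \<psi>)"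
  shows "A = B"
proof
  fix \<psi>
  have "cinner \<phi> (A \<psi>) = cinner \<phi> (B \<psi>)" for \<phi>
    unfolding polarization[OF assms(1), of \<phi> \<psi>] polarization[OF assms(2), of \<phi> \<psi>] assms(3) ..
  from this[of "basis _"] show "A \<psi> = B \<psi>" by (intro ell2_eqI) simp
qed

lemma cinner_eqI: "(\<And>\<phi>. cinner \<phi> a = cinner \<phi> b) \<Longrightarrow> a = b"
  by (rule ell2_eqI) (metis cinner_basis)

lemma symmetric_opD: "symmetric_op B \<Longrightarrow> cinner (B \<phi>) \<psi> = cinner \<phi> (B \<psi>)"
  by (simp add: symmetric_op_def)

text \<open>Polarization turns the limits of the quadratic forms into a bounded limit form, which is represented
  by an operator.\<close>

lemma weak_operator_limit:
  fixes B :: "nat \<Rightarrow> ell2 \<Rightarrow> ell2"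
  assumes B: "\<And>n. bounded_op (B n)"
    and bd: "\<And>n \<psi>. cmod (cinner \<psi> (B n \<psi>)) \<le> K * (norm \<psi>)\<^sup>2"
    and lim: "\<And>\<psi>. (\<lambda>n. cinner \<psi> (B n \<psi>)) \<longlonglongrightarrow> d \<psi>"
  obtains C where "bounded_op C" "\<And>\<phi> \<psi>. (\<lambda>n. cinner \<phi> (B n \<psi>)) \<longlonglongrightarrow> cinner \<phi> (C \<psi>)"
proof -
  define q where "q \<phi> \<psi> = (d (\<phi> + \<psi>) - d (\<phi> - \<psi>) - \<i> * d (\<phi> + \<i> *\<^sub>C \<psi>) + \<i> * d (\<phi> - \<i> *\<^sub>C \<psi>)) / 4"
    for \<phi> \<psi>
  have q: "(\<lambda>n. cinner \<phi> (B n \<psi>)) \<longlonglongrightarrow> q \<phi> \<psi>" for \<phi> \<psi>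
    unfolding polarization[OF B, of \<phi> _ \<psi>] q_def by (intro tendsto_intros lim) simp
  have unit: "cmod (cinner \<phi> (B n \<psi>)) \<le> 2 * K" if "norm \<phi> = 1" "norm \<psi> = 1" for \<phi> \<psi> n
  proof -
    have par: "(norm (\<phi> + \<eta>))\<^sup>2 + (norm (\<phi> - \<eta>))\<^sup>2 = 2 * (norm \<phi>)\<^sup>2 + 2 * (norm \<eta>)\<^sup>2" for \<eta>
      by (simp add: power2_norm_eq_inner inner_add inner_diff inner_commute algebra_simps)
    let ?D = "\<lambda>\<psi>. cinner \<psi> (B n \<psi>)"
    have "cmod (cinner \<phi> (B n \<psi>)) \<le> (cmod (?D (\<phi> + \<psi>)) + cmod (?D (\<phi> - \<psi>))
        + cmod (\<i> * ?D (\<phi> + \<i> *\<^sub>C \<psi>)) + cmod (\<i> * ?D (\<phi> - \<i> *\<^sub>C \<psi>))) / 4"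
      unfolding polarization[OF B, of \<phi> n \<psi>] norm_divide
      by (auto intro!: divide_right_mono norm_triangle_le norm_triangle_le_diff)
    also have "\<dots> \<le> (K * (norm (\<phi> + \<psi>))\<^sup>2 + K * (norm (\<phi> - \<psi>))\<^sup>2
        + K * (norm (\<phi> + \<i> *\<^sub>C \<psi>))\<^sup>2 + K * (norm (\<phi> - \<i> *\<^sub>C \<psi>))\<^sup>2) / 4"
      by (intro divide_right_mono add_mono) (auto simp: norm_mult bd)
    also have "\<dots> = K * (((norm (\<phi> + \<psi>))\<^sup>2 + (norm (\<phi> - \<psi>))\<^sup>2)
        + ((norm (\<phi> + \<i> *\<^sub>C \<psi>))\<^sup>2 + (norm (\<phi> - \<i> *\<^sub>C \<psi>))\<^sup>2)) / 4"
      by (simp add: algebra_simps)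
    also have "\<dots> = 2 * K" unfolding par using that by simp
    finally show ?thesis .
  qed
  have Bbd: "cmod (cinner \<phi> (B n \<psi>)) \<le> norm \<phi> * norm \<psi> * (2 * K)" for \<phi> \<psi> n
  proof (cases "\<phi> = 0 \<or> \<psi> = 0")
    case True then show ?thesis by (auto simp: bounded_op_simps[OF B])
  next
    case False
    have "cmod (cinner ((1 / norm \<phi>) *\<^sub>R \<phi>) (B n ((1 / norm \<psi>) *\<^sub>R \<psi>))) \<le> 2 * K"
      using False by (intro unit) simp_all
    then show ?thesis using False by (simp add: bounded_op_simps[OF B] norm_mult norm_divide pos_divide_le_eq mult_ac)
  qed
  have qbd: "cmod (q \<phi> \<psi>) \<le> norm \<phi> * norm \<psi> * (2 * K)" for \<phi> \<psi>
    by (rule LIMSEQ_le_const2[OF tendsto_norm[OF q]]) (use Bbd in auto)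
  show ?thesis
  proof (rule riesz_form[of q "2 * K"])
    fix \<phi> \<psi> a b c
    show "q \<phi> (a + b) = q \<phi> a + q \<phi> b"
      by (rule LIMSEQ_unique[OF q[of \<phi> "a + b"]])
        (auto simp: bounded_op_simps[OF B] cinner_add_right intro!: tendsto_add q)
    show "q \<phi> (c *\<^sub>C a) = c * q \<phi> a"
      by (rule LIMSEQ_unique[OF q[of \<phi> "c *\<^sub>C a"]])
        (auto simp: bounded_op_simps[OF B] intro!: tendsto_mult_left q)
    show "q (a + b) \<psi> = q a \<psi> + q b \<psi>"
      by (rule LIMSEQ_unique[OF q[of "a + b" \<psi>]]) (auto simp: cinner_add_left intro!: tendsto_add q)
    show "q (c *\<^sub>C a) \<psi> = cnj c * q a \<psi>"
      by (rule LIMSEQ_unique[OF q[of "c *\<^sub>C a" \<psi>]]) (auto intro!: tendsto_mult_left q)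
  qed (use qbd q that in auto)
qed

section \<open>Scalar spectral measures\<close>

subsection \<open>Polynomials of an operator\<close>

definition poly_op :: "complex poly \<Rightarrow> (ell2 \<Rightarrow> ell2) \<Rightarrow> ell2 \<Rightarrow> ell2" where
  "poly_op p A \<psi> = (\<Sum>i\<le>degree p. coeff p i *\<^sub>C (A ^^ i) \<psi>)"

lemma poly_op_altdef:
  assumes "degree p \<le> n"
  shows "poly_op p A \<psi> = (\<Sum>i\<le>n. coeff p i *\<^sub>C (A ^^ i) \<psi>)"
  unfolding poly_op_def using assms
  by (intro sum.mono_neutral_left) (auto simp: coeff_eq_0)

lemma poly_op_add: "poly_op (p + q) A \<psi> = poly_op p A \<psi> + poly_op q A \<psi>"
  by (simp add: poly_op_altdef[of _ "max (degree p) (degree q)"] degree_add_le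
      scaleC_distribs sum.distrib)

lemma poly_op_0 [simp]: "poly_op 0 A \<psi> = 0"
  by (simp add: poly_op_def)

lemma poly_op_smult: "poly_op (smult c p) A \<psi> = c *\<^sub>C poly_op p A \<psi>"
  by (simp add: poly_op_altdef[of _ "degree p"] degree_smult_le scaleC_sum)

lemma poly_op_sum: "poly_op (\<Sum>i\<in>I. p i) A \<psi> = (\<Sum>i\<in>I. poly_op (p i) A \<psi>)"
  by (induction I rule: infinite_finite_induct) (auto simp: poly_op_add)

lemma poly_op_pCons:
  assumes "bounded_op A"
  shows "poly_op (pCons a p) A \<psi> = a *\<^sub>C \<psi> + A (poly_op p A \<psi>)"
proof -
  have "poly_op (pCons a p) A \<psi> = (\<Sum>i\<le>Suc (degree p). coeff (pCons a p) i *\<^sub>C (A ^^ i) \<psi>)"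
    by (rule poly_op_altdef) (rule degree_pCons_le)
  also have "\<dots> = a *\<^sub>C \<psi> + (\<Sum>i\<le>degree p. coeff p i *\<^sub>C A ((A ^^ i) \<psi>))"
    by (subst sum.atMost_Suc_shift) simp
  finally show ?thesis
    by (simp add: poly_op_def bounded_op_simps[OF assms])
qed

lemma poly_op_mult:
  assumes "bounded_op A"
  shows "poly_op (p * q) A \<psi> = poly_op p A (poly_op q A \<psi>)"
proof (induction p)
  case (pCons a p)
  then show ?case
    by (simp add: mult_pCons_left poly_op_add poly_op_smult poly_op_pCons[OF assms])
qed simp

lemma poly_op_1 [simp]: "poly_op 1 A \<psi> = \<psi>"
  by (simp add: poly_op_def)

lemma poly_op_power:
  assumes "bounded_op A"
  shows "poly_op (p ^ n) A \<psi> = (poly_op p A ^^ n) \<psi>"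
  by (induction n) (auto simp: poly_op_mult[OF assms])

definition sym_poly :: "(ell2 \<Rightarrow> ell2) \<Rightarrow> complex poly \<Rightarrow> bool" where
  "sym_poly A p \<longleftrightarrow> symmetric_op (poly_op p A)"

definition pos_poly :: "(ell2 \<Rightarrow> ell2) \<Rightarrow> complex poly \<Rightarrow> bool" where
  "pos_poly A p \<longleftrightarrow> (\<forall>\<psi>. \<exists>r\<ge>0. cinner \<psi> (poly_op p A \<psi>) = complex_of_real r)"

lemma sym_poly_mult:
  assumes "bounded_op A" "sym_poly A p" "sym_poly A q"
  shows "sym_poly A (p * q)"
proof -
  have "poly_op (p * q) A \<psi> = poly_op q A (poly_op p A \<psi>)" for \<psi>
    using poly_op_mult[OF assms(1), of q p \<psi>] by (simp add: mult.commute)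
  moreover have "poly_op (p * q) A \<psi> = poly_op p A (poly_op q A \<psi>)" for \<psi>
    by (rule poly_op_mult[OF assms(1)])
  ultimately show ?thesis
    using assms(2,3) unfolding sym_poly_def symmetric_op_def by metis
qed

lemma sym_poly_power: "bounded_op A \<Longrightarrow> sym_poly A p \<Longrightarrow> sym_poly A (p ^ n)"
  by (induction n) (simp add: sym_poly_def symmetric_op_def, simp add: sym_poly_mult)

lemma pos_poly_sandwich:
  assumes "bounded_op A" "sym_poly A q" "pos_poly A p"
  shows "pos_poly A (q * p * q)"
  unfolding pos_poly_def
proof
  fix \<psi>
  have "cinner \<psi> (poly_op (q * p * q) A \<psi>) = cinner (poly_op q A \<psi>) (poly_op p A (poly_op q A \<psi>))"
    using assms(2) by (simp add: poly_op_mult[OF assms(1)] sym_poly_def symmetric_op_def)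
  then show "\<exists>r\<ge>0. cinner \<psi> (poly_op (q * p * q) A \<psi>) = complex_of_real r"
    using assms(3) by (simp add: pos_poly_def)
qed

lemma pos_poly_add: "pos_poly A p \<Longrightarrow> pos_poly A q \<Longrightarrow> pos_poly A (p + q)"
  unfolding pos_poly_def poly_op_add cinner_add_right
  by (metis add_nonneg_nonneg of_real_add)

text \<open>Even powers are squares of a symmetric operator; an odd power leaves one factor \<open>S\<close> or
  \<open>1 - S\<close> in the middle, and \<open>S (1 - S) = S (1 - S) S + (1 - S) S (1 - S)\<close>.\<close>

lemma pos_poly_Bernstein:
  assumes S: "bounded_op S" "symmetric_op S"
    and pos: "\<And>\<psi>. 0 \<le> Re (cinner \<psi> (S \<psi>))" "\<And>\<psi>. Re (cinner \<psi> (S \<psi>)) \<le> (norm \<psi>)\<^sup>2"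
  shows "pos_poly S ([:0, 1:] ^ k * [:1, -1:] ^ l)"
proof -
  let ?x = "[:0, 1:] :: complex poly" and ?y = "[:1, -1:] :: complex poly"
  have x: "poly_op ?x S \<psi> = S \<psi>" and y: "poly_op ?y S \<psi> = \<psi> - S \<psi>" for \<psi>
    by (simp_all add: poly_op_pCons[OF S(1)] bounded_op_simps[OF S(1)])
  have real: "cinner \<psi> (S \<psi>) = complex_of_real (Re (cinner \<psi> (S \<psi>)))" for \<psi>
    using cinner_commute[of \<psi> "S \<psi>"] symmetric_opD[OF S(2), of \<psi> \<psi>]
    by (metis Reals_cnj_iff of_real_Re)
  have sx: "sym_poly S ?x" and sy: "sym_poly S ?y"
    using S(2) by (simp_all add: sym_poly_def symmetric_op_def x y cinner_diff_left cinner_diff_right)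
  have p1: "pos_poly S 1"
    unfolding pos_poly_def poly_op_1 cinner_self by (metis zero_le_power2)
  have px: "pos_poly S ?x"
    unfolding pos_poly_def x using real pos(1) by metis
  have py: "pos_poly S ?y"
    unfolding pos_poly_def y cinner_diff_right cinner_self
    by (metis diff_ge_0_iff_ge of_real_diff pos(2) real)
  have xy: "?x * ?y = ?x * ?y * ?x + ?y * ?x * ?y"
    by (simp add: one_pCons)
  have pxy: "pos_poly S (?x * ?y)"
    by (subst xy) (intro pos_poly_add pos_poly_sandwich[OF S(1)] sx sy px py)
  have base: "pos_poly S (?x ^ (k mod 2) * ?y ^ (l mod 2))"
    using p1 px py pxy by (cases "even k"; cases "even l") (simp_all add: odd_iff_mod_2_eq_one even_iff_mod_2_eq_zero)
  define q where "q = ?x ^ (k div 2) * ?y ^ (l div 2)"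
  have "pos_poly S (q * (?x ^ (k mod 2) * ?y ^ (l mod 2)) * q)"
    using S(1) unfolding q_def by (intro pos_poly_sandwich base sym_poly_mult sym_poly_power sx sy)
  also have "q * (?x ^ (k mod 2) * ?y ^ (l mod 2)) * q
      = ?x ^ (k div 2 + k div 2 + k mod 2) * ?y ^ (l div 2 + l div 2 + l mod 2)"
    unfolding q_def power_add by (simp only: mult_ac)
  also have "k div 2 + k div 2 + k mod 2 = k" by presburger
  also have "l div 2 + l div 2 + l mod 2 = l" by presburger
  finally show ?thesis .
qed

subsection \<open>The moment problem\<close>

text \<open>The factorial moments of the binomial weights are exact in any commutative ring, in particular for
  polynomials of an operator.\<close>

lemma Bernstein_factorial_moment:
  fixes x y :: "'a :: comm_ring_1"
  assumes "x + y = 1" "m \<le> n"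
  shows "(\<Sum>k\<le>n. of_nat ((n choose k) * (k choose m)) * (x ^ k * y ^ (n - k)))
           = of_nat (n choose m) * x ^ m"
proof -
  have "(\<Sum>k\<le>n. of_nat ((n choose k) * (k choose m)) * (x ^ k * y ^ (n - k)))
      = (\<Sum>k\<in>{m..n}. of_nat ((n choose k) * (k choose m)) * (x ^ k * y ^ (n - k)))"
    by (rule sum.mono_neutral_right) (auto simp: not_le binomial_eq_0)
  also have "\<dots> = (\<Sum>j\<le>n - m. of_nat ((n choose (m + j)) * ((m + j) choose m))
      * (x ^ (m + j) * y ^ (n - (m + j))))"
    by (rule sum.reindex_bij_witness[of _ "\<lambda>j. m + j" "\<lambda>k. k - m"]) (use assms in auto)
  also have "\<dots> = (\<Sum>j\<le>n - m. of_nat (n choose m) * x ^ m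
      * (of_nat ((n - m) choose j) * x ^ j * y ^ (n - m - j)))"
  proof (rule sum.cong)
    fix j assume "j \<in> {..n - m}"
    then have "(n choose (m + j)) * ((m + j) choose m) = (n choose m) * ((n - m) choose j)"
      using assms choose_mult[of m "m + j" n] by simp
    then show "of_nat ((n choose (m + j)) * ((m + j) choose m)) * (x ^ (m + j) * y ^ (n - (m + j)))
        = of_nat (n choose m) * x ^ m * (of_nat ((n - m) choose j) * x ^ j * y ^ (n - m - j))"
      by (simp add: power_add mult_ac)
  qed simp
  also have "\<dots> = of_nat (n choose m) * x ^ m * (x + y) ^ (n - m)"
    unfolding sum_distrib_left[symmetric] binomial_ring ..
  finally show ?thesis using assms by simp
qed

text \<open>This passes from the factorial moments, which are exact, to the moments of the points \<open>k / n\<close>.\<close>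

lemma binomial_ratio_approx:
  assumes "k \<le> n" "2 * m \<le> n" "0 < n"
  shows "\<bar>(real k / real n) ^ m - real (k choose m) / real (n choose m)\<bar> \<le> 2 * real m * real m / real n"
proof -
  have "real (k choose m) / real (n choose m) = (\<Prod>i<m. (real k - real i) / (real n - real i))"
    by (simp add: binomial_gbinomial gbinomial_prod_rev prod_dividef lessThan_atLeast0)
  then have "\<bar>(real k / real n) ^ m - real (k choose m) / real (n choose m)\<bar>
      = norm ((\<Prod>i<m. real k / real n) - (\<Prod>i<m. (real k - real i) / (real n - real i)))"
    by simp
  also have "\<dots> \<le> (\<Sum>i<m. norm (real k / real n - (real k - real i) / (real n - real i)))"
  proof (rule norm_prod_diff)
    fix i assume i: "i \<in> {..<m}"
    show "norm (real k / real n) \<le> 1" using assms by simp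
    have "\<bar>real k - real i\<bar> \<le> real n - real i" "0 < real n - real i" using assms i by auto
    then show "norm ((real k - real i) / (real n - real i)) \<le> 1" by simp
  qed
  also have "\<dots> \<le> (\<Sum>i<m. 2 * real m / real n)"
  proof (rule sum_mono)
    fix i assume i: "i \<in> {..<m}"
    have pos: "0 < real n - real i" "0 < real n" using assms i by auto
    have "real k / real n - (real k - real i) / (real n - real i)
        = real i * (real n - real k) / (real n * (real n - real i))"
      using pos by (simp add: field_simps)
    also have "norm \<dots> \<le> real m * real n / (real n * (real n / 2))"
      unfolding real_norm_def abs_divide
      using assms i pos by (intro frac_le) (auto simp: abs_mult intro!: mult_mono mult_left_mono)
    also have "\<dots> = 2 * real m / real n" using pos by simp
    finally show "norm (real k / real n - (real k - real i) / (real n - real i)) \<le> 2 * real m / real n" .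
  qed
  also have "\<dots> = 2 * real m * real m / real n" by simp
  finally show ?thesis .
qed

text \<open>Hausdorff's moment problem for the sequence \<open>\<langle>\<psi>, S\<^sup>m \<psi>\<rangle>\<close>: the Bernstein weights
  \<open>C(n,k) \<langle>\<psi>, S\<^sup>k (1 - S)\<^bsup>n-k\<^esup> \<psi>\<rangle>\<close> at the points \<open>k / n\<close> are probability measures whose moments
  tend to the given ones, and Helly's theorem provides a limit.\<close>

lemma moment_measure_unit:
  assumes S: "bounded_op S" "symmetric_op S"
    and pos: "\<And>\<psi>. 0 \<le> Re (cinner \<psi> (S \<psi>))" "\<And>\<psi>. Re (cinner \<psi> (S \<psi>)) \<le> (norm \<psi>)\<^sup>2"
    and unit: "norm \<psi> = 1"
  obtains M where "real_distribution M" "AE x in M. 0 \<le> x \<and> x \<le> 1"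
    "\<And>m. (LINT x|M. x ^ m) = Re (cinner \<psi> ((S ^^ m) \<psi>))"
proof -
  let ?x = "[:0, 1:] :: complex poly" and ?y = "[:1, -1:] :: complex poly"
  define w where "w n k = Re (cinner \<psi> (poly_op (of_nat (n choose k) * (?x ^ k * ?y ^ (n - k))) S \<psi>))" for n k
  have of_nat_op: "poly_op (of_nat c * p) S \<eta> = of_nat c *\<^sub>C poly_op p S \<eta>" for c p \<eta>
    by (simp add: of_nat_poly poly_op_smult)
  have w_nonneg: "0 \<le> w n k" for n k
  proof -
    obtain r where "r \<ge> 0" "cinner \<psi> (poly_op (?x ^ k * ?y ^ (n - k)) S \<psi>) = complex_of_real r"
      using pos_poly_Bernstein[OF S pos, of k "n - k"] unfolding pos_poly_def by blast
    then show ?thesis by (simp add: w_def of_nat_op)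
  qed
  have xS: "(poly_op ?x S ^^ m) \<psi> = (S ^^ m) \<psi>" for m
    by (induction m) (simp_all add: poly_op_pCons[OF S(1)] bounded_op_simps[OF S(1)])
  have moment: "(\<Sum>k\<le>n. w n k * real (k choose m)) = real (n choose m) * Re (cinner \<psi> ((S ^^ m) \<psi>))"
    if "m \<le> n" for n m
  proof -
    have "(\<Sum>k\<le>n. w n k * real (k choose m))
        = (\<Sum>k\<le>n. Re (cinner \<psi> (poly_op (of_nat ((n choose k) * (k choose m)) * (?x ^ k * ?y ^ (n - k))) S \<psi>)))"
      unfolding w_def of_nat_op by (simp add: mult_ac)
    also have "\<dots> = Re (cinner \<psi> (poly_op (\<Sum>k\<le>n. of_nat ((n choose k) * (k choose m)) * (?x ^ k * ?y ^ (n - k))) S \<psi>))"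
      unfolding poly_op_sum cinner.sum_right by simp
    also have "(\<Sum>k\<le>n. of_nat ((n choose k) * (k choose m)) * (?x ^ k * ?y ^ (n - k)))
        = of_nat (n choose m) * ?x ^ m"
      by (rule Bernstein_factorial_moment) (use that in \<open>simp_all add: one_pCons\<close>)
    finally show ?thesis unfolding of_nat_op poly_op_power[OF S(1)] xS by simp
  qed
  have w_sum: "(\<Sum>k\<le>n. w n k) = 1" for n
    using moment[of 0 n] unit by (simp add: cinner_self)
  define P where "P n = point_measure {..n} (\<lambda>k. ennreal (w n k))" for n
  define M where "M n = distr (P n) borel (\<lambda>k. real k / real n)" for n
  have sP: "space (P n) = {..n}" and [simp]: "sets (P n) = Pow {..n}" for n
    by (simp_all add: P_def space_point_measure sets_point_measure)
  have measP [measurable]: "(\<lambda>k. real k / real n) \<in> borel_measurable (P n)" for n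
    unfolding P_def by simp
  have prob_P: "prob_space (P n)" for n
  proof
    have "emeasure (P n) {..n} = ennreal (\<Sum>k\<le>n. w n k)"
      unfolding P_def by (subst emeasure_point_measure_finite) (auto simp: w_nonneg)
    then show "emeasure (P n) (space (P n)) = 1" by (simp add: sP w_sum)
  qed
  have distM: "real_distribution (M n)" for n
  proof -
    interpret prob_space "P n" by (rule prob_P)
    have "prob_space (M n)" unfolding M_def by (rule prob_space_distr) (rule measP)
    then show ?thesis
      unfolding real_distribution_def real_distribution_axioms_def by (simp add: M_def)
  qed
  have intM: "(LINT x|M n. g x) = (\<Sum>k\<le>n. w n k * g (real k / real n))"
    if "g \<in> borel_measurable borel" for g :: "real \<Rightarrow> real" and n
    unfolding M_def using that
    by (subst integral_distr) (simp_all add: P_def lebesgue_integral_point_measure_finite w_nonneg)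
  have "tight M"
    unfolding tight_def
  proof (intro conjI allI impI)
    show "real_distribution (M n)" for n by (rule distM)
    fix e :: real assume e: "e > 0"
    have "measure (M n) {-1<..1} = 1" for n
    proof -
      interpret prob_space "P n" by (rule prob_P)
      have "(\<lambda>k. real k / real n) -` {-1<..1} \<inter> space (P n) = space (P n)"
        by (auto simp: sP divide_simps)
      then show ?thesis
        unfolding M_def by (subst measure_distr) (simp_all add: prob_space)
    qed
    then show "\<exists>a b. a < b \<and> (\<forall>n. 1 - e < measure (M n) {a<..b})"
      using e by (intro exI[of _ "-1"] exI[of _ 1]) simp
  qed
  from tight_imp_convergent_subsubsequence[OF this strict_mono_id]
  obtain r N where r: "strict_mono r" and N: "real_distribution N" and wc: "weak_conv_m (M \<circ> id \<circ> r) N"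
    by (auto simp: id_def)
  have conv: "(\<lambda>j. LINT x|M (r j). g x) \<longlonglongrightarrow> (LINT x|N. g x)"
    if "\<And>x. isCont g x" "\<And>x. norm (g x) \<le> 1" for g :: "real \<Rightarrow> real"
    using weak_conv_imp_integral_bdd_continuous_conv[of "\<lambda>j. M (r j)" N g 1]
      N distM wc that by (simp add: comp_def)
  define c where "c x = max 0 (min 1 (x::real))" for x
  have cont_c: "isCont c x" for x unfolding c_def by (intro continuous_intros)
  have c01: "0 \<le> c x" "c x \<le> 1" for x by (auto simp: c_def)
  have c_meas: "c \<in> borel_measurable borel" unfolding c_def by simp
  have c_node: "c (real k / real n) = real k / real n" if "k \<le> n" for k n
    using that by (auto simp: c_def divide_simps)
  interpret N: real_distribution N by (rule N)
  have "AE x in N. x = c x"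
  proof -
    define g where "g x = min 1 \<bar>x - c x\<bar>" for x
    have cont_g: "isCont g x" for x unfolding g_def by (intro continuous_intros cont_c)
    have g_meas: "g \<in> borel_measurable borel"
      using cont_g by (intro borel_measurable_continuous_onI continuous_at_imp_continuous_on) auto
    have "(\<lambda>j. LINT x|M (r j). g x) \<longlonglongrightarrow> (LINT x|N. g x)"
      by (rule conv[OF cont_g]) (simp add: g_def)
    moreover have "(LINT x|M n. g x) = 0" for n
      by (subst intM[OF g_meas]) (simp add: g_def c_node)
    ultimately have "(LINT x|N. g x) = 0" by (simp add: LIMSEQ_const_iff)
    moreover have "integrable N g"
      by (rule N.integrable_const_bound[of _ 1]) (use g_meas in \<open>auto simp: g_def\<close>)
    ultimately have "AE x in N. g x = 0"
      by (subst (asm) integral_nonneg_eq_0_iff_AE) (auto simp: g_def)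
    then show ?thesis by eventually_elim (auto simp: g_def min_def split: if_splits)
  qed
  then have supp: "AE x in N. 0 \<le> x \<and> x \<le> 1"
    by eventually_elim (metis c01)
  have "(LINT x|N. x ^ m) = Re (cinner \<psi> ((S ^^ m) \<psi>))" for m
  proof -
    have "(LINT x|N. x ^ m) = (LINT x|N. c x ^ m)"
    proof (rule integral_cong_AE)
      show "AE x in N. x ^ m = c x ^ m" using \<open>AE x in N. x = c x\<close> by eventually_elim simp
    qed (simp_all add: c_def)
    moreover have "(\<lambda>n. LINT x|M n. c x ^ m) \<longlonglongrightarrow> Re (cinner \<psi> ((S ^^ m) \<psi>))"
    proof (rule LIM_zero_cancel, rule Lim_null_comparison)
      show "(\<lambda>n. 2 * real m * real m / real n) \<longlonglongrightarrow> 0" by (rule lim_const_over_n)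
      show "\<forall>\<^sub>F n in sequentially. norm ((LINT x|M n. c x ^ m) - Re (cinner \<psi> ((S ^^ m) \<psi>)))
          \<le> 2 * real m * real m / real n"
        using eventually_ge_at_top[of "Suc (2 * m)"]
      proof eventually_elim
        fix n assume n: "Suc (2 * m) \<le> n"
        have "(LINT x|M n. c x ^ m) = (\<Sum>k\<le>n. w n k * (real k / real n) ^ m)"
          using c_meas by (subst intM) (auto intro!: sum.cong simp: c_node)
        moreover have "Re (cinner \<psi> ((S ^^ m) \<psi>)) = (\<Sum>k\<le>n. w n k * (real (k choose m) / real (n choose m)))"
          using moment[of m n] n by (simp add: sum_divide_distrib[symmetric] zero_less_binomial)
        ultimately have "norm ((LINT x|M n. c x ^ m) - Re (cinner \<psi> ((S ^^ m) \<psi>)))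
            = \<bar>\<Sum>k\<le>n. w n k * ((real k / real n) ^ m - real (k choose m) / real (n choose m))\<bar>"
          by (simp add: sum_subtractf[symmetric] algebra_simps)
        also have "\<dots> \<le> (\<Sum>k\<le>n. w n k * (2 * real m * real m / real n))"
          by (rule order_trans[OF sum_abs], rule sum_mono)
            (use n in \<open>auto simp: abs_mult w_nonneg simp del: times_divide_eq_right
              intro!: mult_left_mono binomial_ratio_approx\<close>)
        also have "\<dots> = 2 * real m * real m / real n"
          unfolding sum_distrib_right[symmetric] w_sum by simp
        finally show "norm ((LINT x|M n. c x ^ m) - Re (cinner \<psi> ((S ^^ m) \<psi>))) \<le> 2 * real m * real m / real n" .
      qed
    qed
    then have "(\<lambda>j. LINT x|M (r j). c x ^ m) \<longlonglongrightarrow> Re (cinner \<psi> ((S ^^ m) \<psi>))"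
      by (rule LIMSEQ_subseq_LIMSEQ[OF _ r, unfolded comp_def])
    moreover have "(\<lambda>j. LINT x|M (r j). c x ^ m) \<longlonglongrightarrow> (LINT x|N. c x ^ m)"
      by (rule conv) (auto intro!: continuous_intros cont_c simp: c01 power_le_one)
    ultimately show ?thesis using LIMSEQ_unique by metis
  qed
  with N supp show ?thesis by (rule that)
qed

text \<open>The affine map \<open>S = (H + K) / (2K)\<close> brings the form of \<open>H\<close> into \<open>[0, 1]\<close>.\<close>

lemma moment_measure:
  assumes H: "bounded_op H" "symmetric_op H"
    and K: "0 < K" "\<And>\<psi>. norm (H \<psi>) \<le> norm \<psi> * K"
  shows "\<exists>M. finite_measure M \<and> sets M = sets borel \<and> (AE x in M. \<bar>x\<bar> \<le> K) \<and>
    (\<forall>m. (LINT x|M. x ^ m) = Re (cinner \<psi> ((H ^^ m) \<psi>)))"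
proof -
  define S where "S \<psi> = (1 / (2 * K)) *\<^sub>R (H \<psi> + K *\<^sub>R \<psi>)" for \<psi>
  have S: "bounded_op S"
    unfolding S_def scaleR_conv_scaleC
    by (intro bounded_op_scaleC bounded_op_add bounded_op_id H)
  have symS: "symmetric_op S"
    using H(2) by (simp add: S_def symmetric_op_def cinner_add_left cinner_add_right)
  have "\<bar>Re (cinner \<eta> (H \<eta>))\<bar> \<le> K * (norm \<eta>)\<^sup>2" for \<eta>
  proof -
    have "\<bar>Re (cinner \<eta> (H \<eta>))\<bar> \<le> norm \<eta> * norm (H \<eta>)"
      using abs_Re_le_cmod Cauchy_Schwarz_cinner by (rule order_trans)
    also have "\<dots> \<le> norm \<eta> * (norm \<eta> * K)" by (intro mult_left_mono K) simp
    finally show ?thesis by (simp add: power2_eq_square mult_ac)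
  qed
  then have H_bd: "- (K * (norm \<eta>)\<^sup>2) \<le> Re (cinner \<eta> (H \<eta>))" "Re (cinner \<eta> (H \<eta>)) \<le> K * (norm \<eta>)\<^sup>2" for \<eta>
    by (simp_all add: abs_le_iff minus_le_iff)
  have ReS: "Re (cinner \<eta> (S \<eta>)) = (Re (cinner \<eta> (H \<eta>)) + K * (norm \<eta>)\<^sup>2) / (2 * K)" for \<eta>
    by (simp add: S_def cinner_add_right cinner_self)
  have pos: "0 \<le> Re (cinner \<eta> (S \<eta>))" "Re (cinner \<eta> (S \<eta>)) \<le> (norm \<eta>)\<^sup>2" for \<eta>
    unfolding ReS using H_bd[of \<eta>] K(1) by (simp_all add: divide_simps)
  \<comment> \<open>For \<open>\<psi> = 0\<close> any unit vector will do: the measure of \<open>u\<close> is multiplied by \<open>\<parallel>\<psi>\<parallel>\<^sup>2\<close>.\<close>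
  define u where "u = (if \<psi> = 0 then basis 1 else (1 / norm \<psi>) *\<^sub>R \<psi>)"
  have "complex_of_real ((norm (basis 1))\<^sup>2) = complex_of_real 1"
    unfolding cinner_self[symmetric] by (simp add: coord_basis)
  then have "(norm (basis 1))\<^sup>2 = 1" by (simp only: of_real_eq_iff)
  then have "norm (basis 1) = 1" using norm_ge_zero by (metis power2_eq_1_iff le_minus_one_simps(3))
  then have u: "norm u = 1" "\<psi> = norm \<psi> *\<^sub>R u"
    by (auto simp: u_def)
  obtain N where N: "real_distribution N" "AE x in N. 0 \<le> x \<and> x \<le> 1"
    and mom: "\<And>m. (LINT x|N. x ^ m) = Re (cinner u ((S ^^ m) u))"
    using moment_measure_unit[OF S symS pos u(1)] by blast
  interpret N: real_distribution N by (rule N)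
  have int_pow: "integrable N (\<lambda>x. x ^ m)" for m
  proof (rule N.integrable_const_bound[of _ 1])
    show "AE x in N. norm (x ^ m) \<le> 1" using N(2) by eventually_elim (auto simp: power_le_one)
  qed simp
  have real_pow: "cinner u ((S ^^ m) u) = complex_of_real (LINT x|N. x ^ m)" for m
  proof -
    have "cinner ((S ^^ m) u) v = cinner u ((S ^^ m) v)" for u v
      using symmetric_opD[OF symS] by (induction m arbitrary: u v) (simp_all add: funpow_swap1)
    then have "cinner u ((S ^^ m) u) = cnj (cinner u ((S ^^ m) u))" using cinner_commute by metis
    then show ?thesis unfolding mom by (metis Reals_cnj_iff of_real_Re)
  qed
  have poly: "(CLINT x|N. poly p (of_real x)) = cinner u (poly_op p S u)" for p
    unfolding poly_altdef poly_op_def cinner.sum_right cinner_scaleC_right real_pow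
    by (subst Bochner_Integration.integral_sum)
      (auto simp del: of_real_power simp: of_real_power[symmetric] int_pow intro!: integrable_of_real)
  let ?p = "[:- complex_of_real K, 2 * complex_of_real K:]"
  have Hp: "poly_op ?p S \<eta> = H \<eta>" for \<eta>
  proof -
    have "poly_op ?p S \<eta> = (2 * K) *\<^sub>R S \<eta> - K *\<^sub>R \<eta>"
      by (intro ell2_eqI) (simp add: poly_op_pCons[OF S] bounded_op_simps[OF S])
    then show ?thesis using K(1) by (simp add: S_def)
  qed
  have "poly_op ?p S = H" using Hp by blast
  then have momH: "(CLINT x|N. (of_real (2 * K * x - K)) ^ m) = cinner u ((H ^^ m) u)" for m
    using poly[of "?p ^ m"] unfolding poly_op_power[OF S] by (simp add: poly_power algebra_simps)
  define M where "M = density (distr N borel (\<lambda>x. 2 * K * x - K)) (\<lambda>_. ennreal ((norm \<psi>)\<^sup>2))"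
  have prob: "prob_space (distr N borel (\<lambda>x. 2 * K * x - K))"
    by (rule N.prob_space_distr) simp
  have "finite_measure M"
  proof
    have "emeasure M (space M) = ennreal ((norm \<psi>)\<^sup>2)"
      using prob_space.emeasure_space_1[OF prob]
      by (simp add: M_def emeasure_density nn_integral_cmult_indicator)
    then show "emeasure M (space M) \<noteq> \<infinity>" by simp
  qed
  moreover have "AE x in M. \<bar>x\<bar> \<le> K"
  proof -
    have "AE x in distr N borel (\<lambda>x. 2 * K * x - K). \<bar>x\<bar> \<le> K"
    proof (subst AE_distr_iff)
      show "AE x in N. \<bar>2 * K * x - K\<bar> \<le> K" using N(2)
      proof eventually_elim
        fix x :: real assume "0 \<le> x \<and> x \<le> 1"
        then have "0 \<le> K * x" "K * x \<le> K * 1" using K(1) by (auto simp del: mult_1_right intro!: mult_left_mono)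
        then show "\<bar>2 * K * x - K\<bar> \<le> K" by (simp add: abs_le_iff)
      qed
    qed simp_all
    then show ?thesis unfolding M_def by (subst AE_density) (auto elim: eventually_mono)
  qed
  moreover have "(LINT x|M. x ^ m) = Re (cinner \<psi> ((H ^^ m) \<psi>))" for m
  proof -
    have "(LINT x|M. x ^ m) = (norm \<psi>)\<^sup>2 * (LINT x|N. (2 * K * x - K) ^ m)"
      unfolding M_def by (subst integral_density) (simp_all add: integral_distr)
    also have "(LINT x|N. (2 * K * x - K) ^ m) = Re (cinner u ((H ^^ m) u))"
      unfolding momH[symmetric] of_real_power[symmetric] integral_complex_of_real by simp
    also have "(norm \<psi>)\<^sup>2 * \<dots> = Re (cinner (norm \<psi> *\<^sub>R u) ((H ^^ m) (norm \<psi> *\<^sub>R u)))"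
      by (simp add: bounded_op_simps[OF bounded_op_funpow[OF H(1)]] power2_eq_square)
    finally show ?thesis using u(2) by simp
  qed
  moreover have "sets M = sets borel" by (simp add: M_def)
  ultimately show ?thesis by blast
qed

section \<open>Borel functional calculus of a bounded symmetric operator\<close>

definition bounded_borel :: "(real \<Rightarrow> complex) \<Rightarrow> bool" where
  "bounded_borel g \<longleftrightarrow> g \<in> borel_measurable borel \<and> (\<exists>C. \<forall>x. cmod (g x) \<le> C)"

lemma bounded_borelI: "g \<in> borel_measurable borel \<Longrightarrow> (\<And>x. cmod (g x) \<le> C) \<Longrightarrow> bounded_borel g"
  by (auto simp: bounded_borel_def)

lemma bounded_borel_const: "bounded_borel (\<lambda>_. c)"
  by (rule bounded_borelI) auto

lemma bounded_borel_add:
  assumes "bounded_borel g" "bounded_borel h"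
  shows "bounded_borel (\<lambda>x. g x + h x)"
proof -
  obtain C D where "\<forall>x. cmod (g x) \<le> C" "\<forall>x. cmod (h x) \<le> D"
    using assms unfolding bounded_borel_def by blast
  then have "cmod (g x + h x) \<le> C + D" for x
    by (meson add_mono norm_triangle_le)
  then show ?thesis
    using assms unfolding bounded_borel_def by (auto intro: borel_measurable_add)
qed

lemma bounded_borel_mult:
  assumes "bounded_borel g" "bounded_borel h"
  shows "bounded_borel (\<lambda>x. g x * h x)"
proof -
  obtain C D where CD: "\<forall>x. cmod (g x) \<le> C" "\<forall>x. cmod (h x) \<le> D"
    using assms unfolding bounded_borel_def by blast
  have "cmod (g x * h x) \<le> C * D" for x
    unfolding norm_mult using CD norm_ge_zero by (meson mult_mono order_trans)
  then show ?thesis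
    using assms unfolding bounded_borel_def by (auto intro: borel_measurable_times)
qed

lemma bounded_borel_cmult: "bounded_borel g \<Longrightarrow> bounded_borel (\<lambda>x. c * g x)"
  by (intro bounded_borel_mult bounded_borel_const)

lemma bounded_borel_diff:
  assumes "bounded_borel g" "bounded_borel h"
  shows "bounded_borel (\<lambda>x. g x - h x)"
  using bounded_borel_add[OF assms(1) bounded_borel_cmult[OF assms(2), of "- 1"]] by simp

lemma bounded_borel_cnj: "bounded_borel g \<Longrightarrow> bounded_borel (\<lambda>x. cnj (g x))"
  unfolding bounded_borel_def
  by (auto intro: measurable_compose[OF _ borel_measurable_continuous_onI[of cnj]] continuous_intros)

lemma bounded_borel_indicator: "A \<in> sets borel \<Longrightarrow> bounded_borel (\<lambda>x. of_real (indicator A x))"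
  by (rule bounded_borelI[of _ 1]) (auto simp: indicator_def)

lemma bounded_borel_lim:
  assumes "\<And>n. bounded_borel (g n)" "\<And>n x. cmod (g n x) \<le> C" "\<And>x. (\<lambda>n. g n x) \<longlonglongrightarrow> h x"
  shows "bounded_borel h"
proof (rule bounded_borelI[of _ C])
  show "h \<in> borel_measurable borel"
    by (rule borel_measurable_LIMSEQ_metric[of g]) (use assms in \<open>auto simp: bounded_borel_def\<close>)
  show "cmod (h x) \<le> C" for x
    by (rule LIMSEQ_le_const2[OF tendsto_norm[OF assms(3)]]) (use assms(2) in auto)
qed

text \<open>Only arguments in \<open>[-K, K]\<close> matter for an operator of norm at most \<open>K\<close>; cutting off the others makes
  the powers of the identity bounded functions.\<close>

definition clamp_K :: "real \<Rightarrow> real \<Rightarrow> real" where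
  "clamp_K K x = max (- K) (min K x)"

lemma clamp_K_bounds: "0 \<le> K \<Longrightarrow> - K \<le> clamp_K K x" "0 \<le> K \<Longrightarrow> clamp_K K x \<le> K"
  by (auto simp: clamp_K_def)

lemma clamp_K_id: "\<bar>x\<bar> \<le> K \<Longrightarrow> clamp_K K x = x"
  by (auto simp: clamp_K_def)

lemma clamp_K_measurable [measurable]: "clamp_K K \<in> borel_measurable borel"
  unfolding clamp_K_def[abs_def] by measurable

text \<open>The Weierstrass theorem gives continuous functions, bounded limits of these give indicators of half
  lines, a Dynkin system argument gives all Borel sets, and monotone limits give nonnegative functions,
  of which the others are linear combinations.\<close>

lemma bounded_borel_induct:
  fixes P :: "(real \<Rightarrow> complex) \<Rightarrow> bool"
  assumes K: "0 \<le> K"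
    and pow: "\<And>m. P (\<lambda>x. of_real (clamp_K K x) ^ m)"
    and add: "\<And>g h. P g \<Longrightarrow> P h \<Longrightarrow> P (\<lambda>x. g x + h x)"
    and scale: "\<And>c g. P g \<Longrightarrow> P (\<lambda>x. c * g x)"
    and lim: "\<And>g h C. (\<And>n::nat. P (g n)) \<Longrightarrow> (\<And>n x. cmod (g n x) \<le> C) \<Longrightarrow>
      (\<And>x. (\<lambda>n. g n x) \<longlonglongrightarrow> h x) \<Longrightarrow> P h"
    and g: "bounded_borel g"
  shows "P (\<lambda>x. g (clamp_K K x))"
proof -
  let ?c = "clamp_K K"
  have one: "P (\<lambda>x. 1)" using pow[of 0] by simp
  have zero: "P (\<lambda>x. 0)" using scale[OF one, of 0] by simp
  have sum: "P (\<lambda>x. \<Sum>i\<in>I. f i x)" if "\<And>i. i \<in> I \<Longrightarrow> P (f i)" for f :: "nat \<Rightarrow> real \<Rightarrow> complex" and I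
    using that by (induction I rule: infinite_finite_induct) (auto intro: zero add)
  have poly: "P (\<lambda>x. of_real (p (?c x)))" if rp: "real_polynomial_function p" for p
  proof -
    obtain a n where p: "p = (\<lambda>x. \<Sum>i\<le>n. a i * x ^ i)"
      using rp unfolding real_polynomial_function_iff_sum by blast
    have "P (\<lambda>x. \<Sum>i\<le>n. of_real (a i) * of_real (?c x) ^ i)"
      by (intro sum scale pow)
    then show ?thesis by (simp add: p)
  qed
  have cont: "P (\<lambda>x. of_real (h (?c x)))" if h: "continuous_on {-K..K} h" for h
  proof -
    have "\<forall>n. \<exists>p. real_polynomial_function p \<and> (\<forall>x\<in>{-K..K}. \<bar>h x - p x\<bar> < 1 / Suc n)"
    proof
      fix n
      obtain p where "real_polynomial_function p" "\<And>x. x \<in> {-K..K} \<Longrightarrow> \<bar>h x - p x\<bar> < 1 / Suc n"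
        by (rule Stone_Weierstrass_real_polynomial_function[OF compact_Icc h, of "1 / Suc n"]) auto
      then show "\<exists>p. real_polynomial_function p \<and> (\<forall>x\<in>{-K..K}. \<bar>h x - p x\<bar> < 1 / Suc n)" by blast
    qed
    from choice[OF this] obtain p where p: "\<And>n. real_polynomial_function (p n)"
      "\<And>n x. x \<in> {-K..K} \<Longrightarrow> \<bar>h x - p n x\<bar> < 1 / Suc n" by blast
    have "bounded (h ` {-K..K})"
      using h compact_Icc by (intro compact_imp_bounded compact_continuous_image)
    then obtain C where "\<forall>y\<in>h ` {-K..K}. norm y \<le> C"
      unfolding bounded_iff by blast
    then have C: "\<And>x. x \<in> {-K..K} \<Longrightarrow> \<bar>h x\<bar> \<le> C" by simp
    have mem: "?c x \<in> {-K..K}" for x using clamp_K_bounds[OF K] by auto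
    show ?thesis
    proof (rule lim[of "\<lambda>n x. complex_of_real (p n (?c x))" "C + 1"])
      show "P (\<lambda>x. of_real (p n (?c x)))" for n by (rule poly[OF p(1)])
      fix x
      have "1 / real (Suc n) \<le> 1" for n by simp
      then have near: "\<bar>h (?c x) - p n (?c x)\<bar> \<le> 1" for n
        using p(2)[OF mem[of x], of n] by (meson less_imp_le order_trans)
      show "cmod (of_real (p n (?c x))) \<le> C + 1" for n
        using C[OF mem[of x]] near[of n] unfolding norm_of_real by linarith
      have "(\<lambda>n. p n (?c x) - h (?c x)) \<longlonglongrightarrow> 0"
        by (rule Lim_null_comparison[OF _ LIMSEQ_Suc[OF lim_1_over_n]])
          (use p(2)[OF mem[of x]] in \<open>auto simp: abs_minus_commute intro!: always_eventually less_imp_le\<close>)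
      then show "(\<lambda>n. complex_of_real (p n (?c x))) \<longlonglongrightarrow> complex_of_real (h (?c x))"
        by (intro tendsto_of_real) (rule LIM_zero_cancel)
    qed
  qed
  have half: "P (\<lambda>x. of_real (indicator {..a} (?c x)))" for a
  proof (rule lim[of "\<lambda>n x. complex_of_real (max 0 (1 - real n * max 0 (?c x - a)))" 1])
    show "P (\<lambda>x. of_real (max 0 (1 - real n * max 0 (?c x - a))))" for n
      by (rule cont[of "\<lambda>y. max 0 (1 - real n * max 0 (y - a))"]) (intro continuous_intros)
    show "cmod (of_real (max 0 (1 - real n * max 0 (?c x - a)))) \<le> 1" for n x
      by (simp add: max_def)
    fix x
    show "(\<lambda>n. complex_of_real (max 0 (1 - real n * max 0 (?c x - a))))
        \<longlonglongrightarrow> complex_of_real (indicator {..a} (?c x))"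
    proof (cases "?c x \<le> a")
      case False
      then obtain N where N: "real N * (?c x - a) > 1" by (metis ex_less_of_nat_mult diff_gt_0_iff_gt not_le)
      have "real n * (?c x - a) > 1" if "n \<ge> N" for n
        using N False that by (smt (verit) mult_right_mono of_nat_mono)
      then have "\<forall>\<^sub>F n in sequentially. of_real (max 0 (1 - real n * max 0 (?c x - a))) = 0"
        using False by (intro eventually_sequentiallyI[of N]) (force simp: max_def)
      with False show ?thesis by (auto intro: tendsto_eventually)
    qed simp
  qed
  have sets: "P (\<lambda>x. of_real (indicator A (?c x)))" if "A \<in> sets borel" for A
  proof -
    have "Int_stable (range (\<lambda>a::real. {..a}))"
      by (auto simp: Int_stable_def)
    moreover have "range (\<lambda>a::real. {..a}) \<subseteq> Pow UNIV" by simp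
    moreover have "A \<in> sigma_sets UNIV (range (\<lambda>a. {..a}))"
      using that by (simp add: borel_eq_atMost)
    ultimately show ?thesis
    proof (induction rule: sigma_sets_induct_disjoint[consumes 3])
      case (basic A) then show ?case using half by auto
    next
      case empty show ?case using zero by simp
    next
      case (compl A)
      have "P (\<lambda>x. 1 + (- 1) * of_real (indicator A (?c x)))"
        by (intro add scale one compl)
      moreover have "1 + (- 1) * complex_of_real (indicator A y) = complex_of_real (indicator (UNIV - A) y)" for y
        by (auto simp: indicator_def)
      ultimately show ?case by simp
    next
      case (union A)
      show ?case
      proof (rule lim[of "\<lambda>n x. complex_of_real (indicator (\<Union>i<n. A i) (?c x))" 1])
        fix n
        have "P (\<lambda>x. \<Sum>i<n. of_real (indicator (A i) (?c x)))"
          by (intro sum union)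
        moreover have "indicator (\<Union>i<n. A i) y = (\<Sum>i<n. indicator (A i) y :: real)" for y
          using union(1) by (intro indicator_UN_disjoint) (auto simp: disjoint_family_on_def)
        ultimately show "P (\<lambda>x. of_real (indicator (\<Union>i<n. A i) (?c x)))" by simp
      next
        show "cmod (of_real (indicator (\<Union>i<n. A i) (?c x))) \<le> 1" for n x
          by (simp add: indicator_def)
        show "(\<lambda>n. complex_of_real (indicator (\<Union>i<n. A i) (?c x)))
            \<longlonglongrightarrow> complex_of_real (indicator (\<Union>i. A i) (?c x))" for x
          by (intro tendsto_of_real LIMSEQ_indicator_UN)
      qed
    qed
  qed
  have nonneg: "(\<exists>C. \<forall>x. u x \<le> C) \<longrightarrow> P (\<lambda>x. of_real (u (?c x)))"
    if "u \<in> borel_measurable borel" "\<And>x. 0 \<le> u x" for u :: "real \<Rightarrow> real"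
    using that
  proof (induction rule: borel_measurable_induct_real)
    case (set A) then show ?case using sets by simp
  next
    case (mult u c)
    show ?case
    proof (cases "c = 0")
      case False
      then have "c > 0" using mult by simp
      show ?thesis
      proof
        assume "\<exists>C. \<forall>x. c * u x \<le> C"
        then obtain C where "\<forall>x. c * u x \<le> C" by blast
        then have "\<forall>x. u x \<le> C / c" using \<open>c > 0\<close> by (simp add: field_simps)
        then have "P (\<lambda>x. of_real c * of_real (u (?c x)))" using mult.IH by (intro scale) blast
        then show "P (\<lambda>x. of_real (c * u (?c x)))" by simp
      qed
    qed (simp add: zero)
  next
    case (add u v)
    show ?case
    proof
      assume "\<exists>C. \<forall>x. v x + u x \<le> C"
      then obtain C where C: "\<forall>x. v x + u x \<le> C" by blast
      have "u x \<le> C" "v x \<le> C" for x using C add.hyps by (smt (verit) space_borel UNIV_I)+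
      then have "P (\<lambda>x. of_real (v (?c x)) + of_real (u (?c x)))"
        using add.IH by (intro assms(3)) blast+
      then show "P (\<lambda>x. of_real (v (?c x) + u (?c x)))" by simp
    qed
  next
    case (seq U)
    show ?case
    proof
      assume "\<exists>C. \<forall>x. u x \<le> C"
      then obtain C where C: "\<forall>x. u x \<le> C" by blast
      have nn: "0 \<le> U n x" for n x by (rule seq.hyps(2))
      have le: "U n x \<le> u x" for n x
        using seq by (intro incseq_le[of "\<lambda>n. U n x"]) (auto simp: incseq_def le_fun_def)
      show "P (\<lambda>x. of_real (u (?c x)))"
      proof (rule lim[of "\<lambda>n x. complex_of_real (U n (?c x))" C])
        show "P (\<lambda>x. of_real (U n (?c x)))" for n
          using seq.IH[of n] le C by (meson order_trans)
        show "cmod (of_real (U n (?c x))) \<le> C" for n x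
          using nn[of n "?c x"] le[of n "?c x"] C by (simp) (meson order_trans)
        show "(\<lambda>n. complex_of_real (U n (?c x))) \<longlonglongrightarrow> complex_of_real (u (?c x))" for x
          using seq by (intro tendsto_of_real) simp
      qed
    qed
  qed
  obtain C where C: "\<And>x. cmod (g x) \<le> C" and gm [measurable]: "g \<in> borel_measurable borel"
    using g by (auto simp: bounded_borel_def)
  have ReIm: "\<bar>Re (g x)\<bar> \<le> C" "\<bar>Im (g x)\<bar> \<le> C" for x
    using C abs_Re_le_cmod abs_Im_le_cmod order_trans by blast+
  have part: "P (\<lambda>x. of_real (u (?c x)))"
    if u: "u \<in> borel_measurable borel" "\<And>x. \<bar>u x\<bar> \<le> C" for u :: "real \<Rightarrow> real"
  proof -
    have "C \<ge> 0" using u(2) abs_ge_zero order_trans by blast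
    have 1: "P (\<lambda>x. of_real (max 0 (u (?c x))))"
      using u \<open>C \<ge> 0\<close> by (intro nonneg[of "\<lambda>x. max 0 (u x)", rule_format]) (auto simp: abs_le_iff)
    have 2: "P (\<lambda>x. of_real (max 0 (- u (?c x))))"
      using u \<open>C \<ge> 0\<close> by (intro nonneg[of "\<lambda>x. max 0 (- u x)", rule_format]) (auto simp: abs_le_iff)
    have "P (\<lambda>x. of_real (max 0 (u (?c x))) + (- 1) * of_real (max 0 (- u (?c x))))"
      by (intro add scale 1 2)
    moreover have "complex_of_real (max 0 y) + (- 1) * complex_of_real (max 0 (- y)) = complex_of_real y" for y
      by (auto simp: max_def)
    ultimately show ?thesis by simp
  qed
  have "P (\<lambda>x. of_real (Re (g (?c x))) + \<i> * of_real (Im (g (?c x))))"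
    by (intro add scale part[of "\<lambda>x. Re (g x)"] part[of "\<lambda>x. Im (g x)"] ReIm) auto
  then show ?thesis by (simp add: complex_eq[symmetric])
qed

locale bounded_symmetric =
  fixes H :: "ell2 \<Rightarrow> ell2" and K :: real
  assumes bounded_H: "bounded_op H" and symmetric_H: "symmetric_op H"
    and K_pos: "0 < K" and norm_H: "\<And>\<psi>. norm (H \<psi>) \<le> norm \<psi> * K"
begin

text \<open>The scalar spectral measure of \<open>\<psi>\<close>; so far only its moments are known.\<close>

definition mu :: "ell2 \<Rightarrow> real measure" where
  "mu \<psi> = (SOME M. finite_measure M \<and> sets M = sets borel \<and> (AE x in M. \<bar>x\<bar> \<le> K) \<and>
    (\<forall>m. (LINT x|M. x ^ m) = Re (cinner \<psi> ((H ^^ m) \<psi>))))"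

lemma mu_props:
  "finite_measure (mu \<psi>)" "sets (mu \<psi>) = sets borel" "AE x in mu \<psi>. \<bar>x\<bar> \<le> K"
  "(LINT x|mu \<psi>. x ^ m) = Re (cinner \<psi> ((H ^^ m) \<psi>))"
  using someI_ex[OF moment_measure[OF bounded_H symmetric_H K_pos norm_H, of \<psi>]]
  unfolding mu_def[symmetric] by blast+

lemmas sets_mu [simp, measurable_cong] = mu_props(2)

lemma space_mu [simp]: "space (mu \<psi>) = UNIV"
  using sets_eq_imp_space_eq[OF sets_mu] by simp

lemma borel_measurable_mu [simp]: "g \<in> borel_measurable (mu \<psi>) \<longleftrightarrow> g \<in> borel_measurable borel"
  by (simp add: measurable_cong_sets[OF sets_mu refl])

lemma funpow_symmetric: "cinner ((H ^^ m) \<phi>) \<psi> = cinner \<phi> ((H ^^ m) \<psi>)"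
  using symmetric_opD[OF symmetric_H] by (induction m arbitrary: \<phi> \<psi>) (simp_all add: funpow_swap1)

lemma integrable_mu:
  assumes "bounded_borel g"
  shows "integrable (mu \<psi>) g"
proof -
  interpret finite_measure "mu \<psi>" by (rule mu_props)
  obtain C where "\<And>x. cmod (g x) \<le> C" using assms by (auto simp: bounded_borel_def)
  then show ?thesis
    using assms by (intro integrable_const_bound[of _ C]) (auto simp: bounded_borel_def)
qed

lemma measure_mu_UNIV: "measure (mu \<psi>) UNIV = (norm \<psi>)\<^sup>2"
proof -
  have "measure (mu \<psi>) UNIV = (LINT x|mu \<psi>. x ^ 0)" by simp
  also have "\<dots> = (norm \<psi>)\<^sup>2" unfolding mu_props(4) by (simp add: cinner_self)
  finally show ?thesis .
qed

lemma norm_integral_mu_le: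
  assumes "bounded_borel g" "\<And>x. cmod (g x) \<le> C"
  shows "cmod (CLINT x|mu \<psi>. g x) \<le> C * (norm \<psi>)\<^sup>2"
proof -
  interpret finite_measure "mu \<psi>" by (rule mu_props)
  have "cmod (CLINT x|mu \<psi>. g x) \<le> (LINT x|mu \<psi>. cmod (g x))" by (rule integral_norm_bound)
  also have "\<dots> \<le> (LINT x|mu \<psi>. C)"
    using assms integrable_mu[OF assms(1)] by (intro integral_mono) auto
  finally show ?thesis by (simp add: measure_mu_UNIV mult.commute)
qed

text \<open>The operator \<open>g(H)\<close>, described by its quadratic form.\<close>

definition is_calc :: "(real \<Rightarrow> complex) \<Rightarrow> (ell2 \<Rightarrow> ell2) \<Rightarrow> bool" where
  "is_calc g B \<longleftrightarrow> bounded_op B \<and> (\<forall>\<psi>. cinner \<psi> (B \<psi>) = (CLINT x|mu \<psi>. g x))"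

lemma is_calc_unique: "is_calc g A \<Longrightarrow> is_calc g B \<Longrightarrow> A = B"
  by (rule bounded_op_eqI) (auto simp: is_calc_def)

lemma integral_mu_cong:
  assumes "bounded_borel g" "bounded_borel h" "\<And>x. \<bar>x\<bar> \<le> K \<Longrightarrow> g x = h x"
  shows "(CLINT x|mu \<psi>. g x) = (CLINT x|mu \<psi>. h x)"
proof (rule integral_cong_AE)
  show "AE x in mu \<psi>. g x = h x"
    using mu_props(3) by eventually_elim (rule assms(3))
qed (use assms in \<open>simp_all add: bounded_borel_def\<close>)

lemma bounded_borel_clamp_power: "bounded_borel (\<lambda>x. of_real (clamp_K K x) ^ m)"
proof (rule bounded_borelI[of _ "K ^ m"])
  show "cmod (of_real (clamp_K K x) ^ m) \<le> K ^ m" for x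
    using clamp_K_bounds[of K x] K_pos by (auto simp: norm_power abs_le_iff intro!: power_mono)
qed simp

lemma is_calc_power: "is_calc (\<lambda>x. of_real (clamp_K K x) ^ m) (H ^^ m)"
  unfolding is_calc_def
proof (intro conjI allI)
  fix \<psi>
  have "(CLINT x|mu \<psi>. complex_of_real (clamp_K K x) ^ m) = complex_of_real (LINT x|mu \<psi>. clamp_K K x ^ m)"
    by (simp flip: of_real_power)
  also have "(LINT x|mu \<psi>. clamp_K K x ^ m) = (LINT x|mu \<psi>. x ^ m)"
  proof (rule integral_cong_AE)
    show "AE x in mu \<psi>. clamp_K K x ^ m = x ^ m"
      using mu_props(3) by eventually_elim (simp add: clamp_K_id)
  qed simp_all
  also have "\<dots> = Re (cinner \<psi> ((H ^^ m) \<psi>))" by (rule mu_props)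
  also have "complex_of_real \<dots> = cinner \<psi> ((H ^^ m) \<psi>)"
    using cinner_commute[of \<psi> "(H ^^ m) \<psi>"] unfolding funpow_symmetric
    by (metis Reals_cnj_iff of_real_Re)
  finally show "cinner \<psi> ((H ^^ m) \<psi>) = (CLINT x|mu \<psi>. of_real (clamp_K K x) ^ m)" ..
qed (rule bounded_op_funpow[OF bounded_H])

lemma is_calc_add:
  assumes "bounded_borel g" "bounded_borel h" "is_calc g A" "is_calc h B"
  shows "is_calc (\<lambda>x. g x + h x) (\<lambda>\<psi>. A \<psi> + B \<psi>)"
  using assms unfolding is_calc_def
  by (simp add: integrable_mu cinner_add_right bounded_op_add)

lemma is_calc_cmult:
  assumes "is_calc g A"
  shows "is_calc (\<lambda>x. c * g x) (\<lambda>\<psi>. c *\<^sub>C A \<psi>)"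
  using assms unfolding is_calc_def by (simp add: bounded_op_scaleC)

lemma integral_mu_tendsto:
  assumes "\<And>n. bounded_borel (g n)" "\<And>n x. cmod (g n x) \<le> C" "\<And>x. (\<lambda>n. g n x) \<longlonglongrightarrow> h x"
  shows "(\<lambda>n. CLINT x|mu \<psi>. g n x) \<longlonglongrightarrow> (CLINT x|mu \<psi>. h x)"
proof -
  interpret finite_measure "mu \<psi>" by (rule mu_props)
  show ?thesis
    using assms bounded_borel_lim[OF assms]
    by (intro integral_dominated_convergence[where w = "\<lambda>_. C"]) (auto simp: bounded_borel_def)
qed

lemma is_calc_lim:
  assumes calc: "\<And>n. is_calc (g n) (B n)" and g: "\<And>n. bounded_borel (g n)" "\<And>n x. cmod (g n x) \<le> C"
    "\<And>x. (\<lambda>n. g n x) \<longlonglongrightarrow> h x"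
  obtains A where "is_calc h A" "\<And>\<phi> \<psi>. (\<lambda>n. cinner \<phi> (B n \<psi>)) \<longlonglongrightarrow> cinner \<phi> (A \<psi>)"
proof (rule weak_operator_limit[of B C "\<lambda>\<psi>. CLINT x|mu \<psi>. h x"])
  have eq: "cinner \<psi> (B n \<psi>) = (CLINT x|mu \<psi>. g n x)" for n \<psi> using calc by (simp add: is_calc_def)
  show "bounded_op (B n)" for n using calc by (simp add: is_calc_def)
  show "cmod (cinner \<psi> (B n \<psi>)) \<le> C * (norm \<psi>)\<^sup>2" for n \<psi>
    unfolding eq using g by (intro norm_integral_mu_le)
  show lim: "(\<lambda>n. cinner \<psi> (B n \<psi>)) \<longlonglongrightarrow> (CLINT x|mu \<psi>. h x)" for \<psi>
    unfolding eq by (rule integral_mu_tendsto[OF g])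
  fix A assume A: "bounded_op A" "\<And>\<phi> \<psi>. (\<lambda>n. cinner \<phi> (B n \<psi>)) \<longlonglongrightarrow> cinner \<phi> (A \<psi>)"
  have "cinner \<psi> (A \<psi>) = (CLINT x|mu \<psi>. h x)" for \<psi>
    by (rule LIMSEQ_unique[OF A(2) lim])
  with A show thesis by (intro that[of A]) (auto simp: is_calc_def)
qed

text \<open>Induction over the functions; the limit step is the weak limit of operators.\<close>

lemma is_calc_exists:
  assumes "bounded_borel g"
  shows "\<exists>B. is_calc g B"
proof -
  have "bounded_borel (\<lambda>x. g (clamp_K K x)) \<and> (\<exists>B. is_calc (\<lambda>x. g (clamp_K K x)) B)"
  proof (rule bounded_borel_induct[OF less_imp_le[OF K_pos] _ _ _ _ assms,
        where P = "\<lambda>g. bounded_borel g \<and> (\<exists>B. is_calc g B)"])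
    show "bounded_borel (\<lambda>x. of_real (clamp_K K x) ^ m) \<and>
        (\<exists>B. is_calc (\<lambda>x. of_real (clamp_K K x) ^ m) B)" for m
      using bounded_borel_clamp_power is_calc_power by blast
    show "bounded_borel (\<lambda>x. g x + h x) \<and> (\<exists>B. is_calc (\<lambda>x. g x + h x) B)"
      if "bounded_borel g \<and> (\<exists>B. is_calc g B)" "bounded_borel h \<and> (\<exists>B. is_calc h B)" for g h
      using that bounded_borel_add is_calc_add by blast
    show "bounded_borel (\<lambda>x. c * g x) \<and> (\<exists>B. is_calc (\<lambda>x. c * g x) B)"
      if "bounded_borel g \<and> (\<exists>B. is_calc g B)" for c g
      using that bounded_borel_cmult is_calc_cmult by blast
    fix g :: "nat \<Rightarrow> real \<Rightarrow> complex" and h C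
    assume g: "\<And>n. bounded_borel (g n) \<and> (\<exists>B. is_calc (g n) B)"
      and lim: "\<And>n x. cmod (g n x) \<le> C" "\<And>x. (\<lambda>n. g n x) \<longlonglongrightarrow> h x"
    have "\<forall>n. \<exists>B. is_calc (g n) B" using g by blast
    from choice[OF this] obtain B where B: "\<And>n. is_calc (g n) (B n)" by blast
    have g': "\<And>n. bounded_borel (g n)" using g by blast
    obtain A where "is_calc h A" by (rule is_calc_lim[OF B g' lim])
    then show "bounded_borel h \<and> (\<exists>B. is_calc h B)"
      using bounded_borel_lim[OF g' lim] by blast
  qed
  then obtain B where B: "bounded_borel (\<lambda>x. g (clamp_K K x))" "is_calc (\<lambda>x. g (clamp_K K x)) B" by blast
  have "(CLINT x|mu \<psi>. g (clamp_K K x)) = (CLINT x|mu \<psi>. g x)" for \<psi>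
    by (rule integral_mu_cong[OF B(1) assms]) (simp add: clamp_K_id)
  then have "is_calc g B" using B(2) by (simp add: is_calc_def)
  then show ?thesis by blast
qed

definition fc :: "(real \<Rightarrow> complex) \<Rightarrow> ell2 \<Rightarrow> ell2" where
  "fc g = (THE B. is_calc g B)"

lemma fc_eqI: "is_calc g B \<Longrightarrow> fc g = B"
  unfolding fc_def using is_calc_unique by blast

lemma is_calc_fc: "bounded_borel g \<Longrightarrow> is_calc g (fc g)"
  using is_calc_exists[of g] fc_eqI[of g] by auto

lemma bounded_op_fc: "bounded_borel g \<Longrightarrow> bounded_op (fc g)"
  using is_calc_fc by (simp add: is_calc_def)

lemma cinner_fc: "bounded_borel g \<Longrightarrow> cinner \<psi> (fc g \<psi>) = (CLINT x|mu \<psi>. g x)"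
  using is_calc_fc by (simp add: is_calc_def)

lemma fc_cong:
  assumes "bounded_borel g" "bounded_borel h" "\<And>x. \<bar>x\<bar> \<le> K \<Longrightarrow> g x = h x"
  shows "fc g = fc h"
proof (rule fc_eqI)
  show "is_calc g (fc h)"
    using is_calc_fc[OF assms(2)] integral_mu_cong[OF assms] by (simp add: is_calc_def)
qed

lemma fc_add:
  assumes "bounded_borel g" "bounded_borel h"
  shows "fc (\<lambda>x. g x + h x) \<psi> = fc g \<psi> + fc h \<psi>"
  using fc_eqI[OF is_calc_add[OF assms assms[THEN is_calc_fc]]] by simp

lemma fc_cmult:
  assumes "bounded_borel g"
  shows "fc (\<lambda>x. c * g x) \<psi> = c *\<^sub>C fc g \<psi>"
  using fc_eqI[OF is_calc_cmult[OF is_calc_fc[OF assms]]] by simp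

lemma fc_diff:
  assumes "bounded_borel g" "bounded_borel h"
  shows "fc (\<lambda>x. g x - h x) \<psi> = fc g \<psi> - fc h \<psi>"
  using fc_add[OF assms(1) bounded_borel_cmult[OF assms(2), of "- 1"]] fc_cmult[OF assms(2), of "- 1"]
  by simp

lemma fc_power: "fc (\<lambda>x. of_real (clamp_K K x) ^ m) = H ^^ m"
  by (rule fc_eqI[OF is_calc_power])

lemma fc_clamp: "fc (\<lambda>x. of_real (clamp_K K x)) = H"
  using fc_power[of 1] by simp

lemma fc_const: "fc (\<lambda>x. c) \<psi> = c *\<^sub>C \<psi>"
  using fc_cmult[OF bounded_borel_clamp_power[of 0], of c] fc_power[of 0] by simp

lemma fc_weak_lim:
  assumes "\<And>n. bounded_borel (g n)" "\<And>n x. cmod (g n x) \<le> C" "\<And>x. (\<lambda>n. g n x) \<longlonglongrightarrow> h x"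
  shows "(\<lambda>n. cinner \<phi> (fc (g n) \<psi>)) \<longlonglongrightarrow> cinner \<phi> (fc h \<psi>)"
proof -
  obtain A where A: "is_calc h A" "\<And>\<phi> \<psi>. (\<lambda>n. cinner \<phi> (fc (g n) \<psi>)) \<longlonglongrightarrow> cinner \<phi> (A \<psi>)"
    using is_calc_lim[OF is_calc_fc[OF assms(1)] assms] by blast
  show ?thesis unfolding fc_eqI[OF A(1)] by (rule A(2))
qed

lemma fc_adjoint:
  assumes "bounded_borel g"
  shows "cinner (fc g \<phi>) \<psi> = cinner \<phi> (fc (\<lambda>x. cnj (g x)) \<psi>)"
proof -
  obtain C where C: "bounded_op C" "\<And>\<phi> \<psi>. cinner (fc g \<phi>) \<psi> = cinner \<phi> (C \<psi>)"
    using bounded_op_adjoint[OF bounded_op_fc[OF assms]] by blast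
  have "cinner \<psi> (C \<psi>) = cinner \<psi> (fc (\<lambda>x. cnj (g x)) \<psi>)" for \<psi>
  proof -
    have "cinner \<psi> (C \<psi>) = cnj (cinner \<psi> (fc g \<psi>))"
      unfolding C(2)[symmetric] by (rule cinner_commute)
    also have "\<dots> = cinner \<psi> (fc (\<lambda>x. cnj (g x)) \<psi>)"
      unfolding cinner_fc[OF assms] cinner_fc[OF bounded_borel_cnj[OF assms]] by simp
    finally show ?thesis .
  qed
  then have "C = fc (\<lambda>x. cnj (g x))"
    using C(1) bounded_op_fc[OF bounded_borel_cnj[OF assms]] by (intro bounded_op_eqI)
  then show ?thesis using C(2) by simp
qed

lemma fc_real_symmetric:
  assumes "bounded_borel (\<lambda>x. of_real (g x))"
  shows "symmetric_op (fc (\<lambda>x. of_real (g x)))"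
  unfolding symmetric_op_def using fc_adjoint[OF assms] by simp

text \<open>Multiplicativity and commutation are identities between matrix elements that depend linearly
  and, under bounded pointwise convergence, continuously on the function; it is enough to verify
  them for powers.\<close>

definition weak_calc :: "((real \<Rightarrow> complex) \<Rightarrow> complex) \<Rightarrow> bool" where
  "weak_calc F \<longleftrightarrow> (\<forall>g h. bounded_borel g \<longrightarrow> bounded_borel h \<longrightarrow> F (\<lambda>x. g x + h x) = F g + F h) \<and>
    (\<forall>c g. bounded_borel g \<longrightarrow> F (\<lambda>x. c * g x) = c * F g) \<and>
    (\<forall>g h C. (\<forall>n. bounded_borel (g n)) \<longrightarrow> (\<forall>n x. cmod (g n x) \<le> C) \<longrightarrow> (\<forall>x. (\<lambda>n. g n x) \<longlonglongrightarrow> h x)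
      \<longrightarrow> (\<lambda>n::nat. F (g n)) \<longlonglongrightarrow> F h)"

lemma weak_calc_fc:
  assumes h: "bounded_borel h"
  shows "weak_calc (\<lambda>g. cinner \<phi> (fc (\<lambda>x. h x * g x) \<psi>))"
  unfolding weak_calc_def
proof (intro conjI allI impI)
  fix c g assume g: "bounded_borel g"
  show "cinner \<phi> (fc (\<lambda>x. h x * (c * g x)) \<psi>) = c * cinner \<phi> (fc (\<lambda>x. h x * g x) \<psi>)"
    using fc_cmult[OF bounded_borel_mult[OF h g], of c \<psi>] by (simp add: mult.left_commute)
  show "cinner \<phi> (fc (\<lambda>x. h x * (g x + g' x)) \<psi>) = cinner \<phi> (fc (\<lambda>x. h x * g x) \<psi>) + cinner \<phi> (fc (\<lambda>x. h x * g' x) \<psi>)"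
    if g': "bounded_borel g'" for g'
    using fc_add[OF bounded_borel_mult[OF h g] bounded_borel_mult[OF h g'], of \<psi>]
    by (simp add: distrib_left cinner_add_right)
next
  fix g :: "nat \<Rightarrow> real \<Rightarrow> complex" and k C
  assume g: "\<forall>n. bounded_borel (g n)" "\<forall>n x. cmod (g n x) \<le> C" "\<forall>x. (\<lambda>n. g n x) \<longlonglongrightarrow> k x"
  obtain D where D: "\<And>x. cmod (h x) \<le> D" using h by (auto simp: bounded_borel_def)
  show "(\<lambda>n. cinner \<phi> (fc (\<lambda>x. h x * g n x) \<psi>)) \<longlonglongrightarrow> cinner \<phi> (fc (\<lambda>x. h x * k x) \<psi>)"
  proof (rule fc_weak_lim)
    show "bounded_borel (\<lambda>x. h x * g n x)" for n using g(1) h by (blast intro: bounded_borel_mult)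
    show "cmod (h x * g n x) \<le> D * C" for n x
      unfolding norm_mult using D g(2) order_trans[OF norm_ge_zero D] by (intro mult_mono) auto
    show "(\<lambda>n. h x * g n x) \<longlonglongrightarrow> h x * k x" for x using g(3) by (intro tendsto_intros) blast
  qed
qed

lemma weak_calc_ext:
  assumes F: "weak_calc F" and G: "weak_calc G" and g: "bounded_borel g"
    and pow: "\<And>m. F (\<lambda>x. of_real (clamp_K K x) ^ m) = G (\<lambda>x. of_real (clamp_K K x) ^ m)"
  shows "F (\<lambda>x. g (clamp_K K x)) = G (\<lambda>x. g (clamp_K K x))"
proof -
  have "bounded_borel (\<lambda>x. g (clamp_K K x)) \<and> F (\<lambda>x. g (clamp_K K x)) = G (\<lambda>x. g (clamp_K K x))"
  proof (rule bounded_borel_induct[OF less_imp_le[OF K_pos] _ _ _ _ g, where P = "\<lambda>g. bounded_borel g \<and> F g = G g"])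
    fix g :: "nat \<Rightarrow> real \<Rightarrow> complex" and h C
    assume g: "\<And>n. bounded_borel (g n) \<and> F (g n) = G (g n)"
      and lim: "\<And>n x. cmod (g n x) \<le> C" "\<And>x. (\<lambda>n. g n x) \<longlonglongrightarrow> h x"
    have "(\<lambda>n. F (g n)) \<longlonglongrightarrow> F h" "(\<lambda>n. G (g n)) \<longlonglongrightarrow> G h"
      using F G g lim unfolding weak_calc_def by blast+
    then have "F h = G h" using g LIMSEQ_unique by simp
    moreover have "bounded_borel h" using g by (intro bounded_borel_lim[OF _ lim]) blast
    ultimately show "bounded_borel h \<and> F h = G h" by blast
  qed (use F G in \<open>auto simp: weak_calc_def pow intro: bounded_borel_clamp_power bounded_borel_add bounded_borel_cmult\<close>)
  then show ?thesis by blast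
qed

lemma weak_calc_matrix_element: "weak_calc (\<lambda>g. cinner \<phi> (fc g \<psi>))"
  using weak_calc_fc[OF bounded_borel_const[of 1]] by simp

lemma fc_mult:
  assumes g: "bounded_borel g" and h: "bounded_borel h"
  shows "fc (\<lambda>x. g x * h x) \<psi> = fc g (fc h \<psi>)"
proof (rule cinner_eqI)
  fix \<phi>
  let ?c = "\<lambda>x. complex_of_real (clamp_K K x)" and ?g = "\<lambda>x. g (clamp_K K x)" and ?h = "\<lambda>x. h (clamp_K K x)"
  have b: "bounded_borel ?g" "bounded_borel ?h"
    using g h clamp_K_measurable unfolding bounded_borel_def by (auto intro: measurable_compose)
  have left: "cinner \<phi> (fc (\<lambda>x. ?c x ^ m * ?g x) \<psi>) = cinner \<phi> (fc ?g ((H ^^ m) \<psi>))" for m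
  proof (rule weak_calc_ext[OF weak_calc_fc[OF bounded_borel_clamp_power] weak_calc_matrix_element g])
    fix k
    have "(H ^^ (m + k)) \<psi> = (H ^^ k) ((H ^^ m) \<psi>)" by (simp only: add.commute[of m] funpow_add comp_apply)
    then show "cinner \<phi> (fc (\<lambda>x. ?c x ^ m * ?c x ^ k) \<psi>) = cinner \<phi> (fc (\<lambda>x. ?c x ^ k) ((H ^^ m) \<psi>))"
      by (simp only: power_add[symmetric] fc_power)
  qed
  have adj: "cinner (fc (\<lambda>x. cnj (?g x)) \<phi>) \<eta> = cinner \<phi> (fc ?g \<eta>)" for \<eta>
    using fc_adjoint[OF bounded_borel_cnj[OF b(1)]] by simp
  have "cinner \<phi> (fc (\<lambda>x. ?g x * ?h x) \<psi>) = cinner (fc (\<lambda>x. cnj (?g x)) \<phi>) (fc ?h \<psi>)"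
    by (rule weak_calc_ext[OF weak_calc_fc[OF b(1)] weak_calc_matrix_element h])
      (simp add: left[unfolded mult.commute[of "?c _ ^ _"]] adj fc_power)
  moreover have "fc (\<lambda>x. ?g x * ?h x) = fc (\<lambda>x. g x * h x)" "fc ?g = fc g" "fc ?h = fc h"
    using g h b by (auto intro!: fc_cong bounded_borel_mult simp: clamp_K_id)
  ultimately show "cinner \<phi> (fc (\<lambda>x. g x * h x) \<psi>) = cinner \<phi> (fc g (fc h \<psi>))" by (simp add: adj)
qed

lemma cnj_mult_self: "cnj z * z = complex_of_real ((cmod z)\<^sup>2)"
  unfolding complex_norm_square by (rule mult.commute)

lemma norm_fc_sq:
  assumes g: "bounded_borel g"
  shows "(norm (fc g \<psi>))\<^sup>2 = (LINT x|mu \<psi>. (cmod (g x))\<^sup>2)"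
proof -
  have "complex_of_real ((norm (fc g \<psi>))\<^sup>2) = cinner \<psi> (fc (\<lambda>x. cnj (g x) * g x) \<psi>)"
    unfolding cinner_self[symmetric] fc_adjoint[OF g] fc_mult[OF bounded_borel_cnj[OF g] g] ..
  also have "\<dots> = (CLINT x|mu \<psi>. cnj (g x) * g x)"
    by (rule cinner_fc) (intro bounded_borel_mult bounded_borel_cnj g)
  also have "\<dots> = complex_of_real (LINT x|mu \<psi>. (cmod (g x))\<^sup>2)"
    unfolding cnj_mult_self by (rule integral_complex_of_real)
  finally show ?thesis by (simp only: of_real_eq_iff)
qed

lemma norm_fc_le:
  assumes g: "bounded_borel g" and C: "\<And>x. \<bar>x\<bar> \<le> K \<Longrightarrow> cmod (g x) \<le> C" "0 \<le> C"
  shows "norm (fc g \<psi>) \<le> C * norm \<psi>"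
proof -
  interpret finite_measure "mu \<psi>" by (rule mu_props)
  have "(norm (fc g \<psi>))\<^sup>2 \<le> (LINT x|mu \<psi>. C\<^sup>2)"
    unfolding norm_fc_sq[OF g]
  proof (rule integral_mono_AE)
    have "bounded_borel (\<lambda>x. cnj (g x) * g x)" by (intro bounded_borel_mult bounded_borel_cnj g)
    from integrable_Re[OF integrable_mu[OF this, of \<psi>]]
    show "integrable (mu \<psi>) (\<lambda>x. (cmod (g x))\<^sup>2)"
      unfolding cnj_mult_self Re_complex_of_real .
    show "AE x in mu \<psi>. (cmod (g x))\<^sup>2 \<le> C\<^sup>2"
      using mu_props(3) by eventually_elim (intro power_mono C norm_ge_zero)
  qed simp
  also have "\<dots> = (C * norm \<psi>)\<^sup>2" by (simp add: measure_mu_UNIV power_mult_distrib mult.commute)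
  finally show ?thesis by (rule power2_le_imp_le) (simp add: C)
qed

text \<open>Powers of \<open>H\<close> commute with \<open>B\<close>, and matrix elements extend this to all functions.\<close>

lemma fc_commute:
  assumes g: "bounded_borel g" and B: "bounded_op B" "\<And>\<psi>. B (H \<psi>) = H (B \<psi>)"
  shows "fc g (B \<psi>) = B (fc g \<psi>)"
proof (rule cinner_eqI)
  fix \<phi>
  obtain B' where "bounded_op B'" and B': "\<And>\<phi> \<psi>. cinner (B \<phi>) \<psi> = cinner \<phi> (B' \<psi>)"
    using bounded_op_adjoint[OF B(1)] by blast
  have move: "cinner \<phi> (B \<psi>) = cinner (B' \<phi>) \<psi>" for \<psi>
    unfolding cinner_commute[of \<phi> "B \<psi>"] B' by (rule cinner_commute[symmetric])
  have "(H ^^ m) (B \<psi>) = B ((H ^^ m) \<psi>)" for m by (induction m) (auto simp: B)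
  then have "cinner \<phi> (fc (\<lambda>x. g (clamp_K K x)) (B \<psi>)) = cinner (B' \<phi>) (fc (\<lambda>x. g (clamp_K K x)) \<psi>)"
    by (intro weak_calc_ext[OF weak_calc_matrix_element weak_calc_matrix_element g]) (simp add: fc_power move)
  moreover have "fc (\<lambda>x. g (clamp_K K x)) = fc g"
    using g clamp_K_measurable unfolding bounded_borel_def
    by (intro fc_cong) (auto simp: clamp_K_id bounded_borel_def intro: measurable_compose)
  ultimately show "cinner \<phi> (fc g (B \<psi>)) = cinner \<phi> (B (fc g \<psi>))" by (simp add: move)
qed

end

section \<open>Spectral measures: existence and uniqueness\<close>

subsection \<open>Projection valued measures\<close>

lemma pvmD:
  assumes "projection_valued_measure F"
  shows "A \<in> sets borel \<Longrightarrow> bounded_op (F A)" "A \<in> sets borel \<Longrightarrow> symmetric_op (F A)"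
    "A \<in> sets borel \<Longrightarrow> F A (F A \<psi>) = F A \<psi>" "F UNIV = id"
    "range D \<subseteq> sets borel \<Longrightarrow> disjoint_family D \<Longrightarrow> (\<lambda>n. F (D n) \<psi>) sums F (\<Union>n. D n) \<psi>"
  using assms unfolding projection_valued_measure_def by (auto simp: fun_eq_iff)

lemma pvm_empty:
  assumes "projection_valued_measure F"
  shows "F {} \<psi> = 0"
proof -
  have "(\<lambda>n::nat. F {} \<psi>) sums F (\<Union>n::nat. {}) \<psi>"
    by (rule pvmD(5)[OF assms]) (auto simp: disjoint_family_on_def)
  then have "(\<lambda>n::nat. F {} \<psi>) \<longlonglongrightarrow> 0" by (intro summable_LIMSEQ_zero sums_summable)
  then show ?thesis by (simp add: LIMSEQ_const_iff)
qed

lemma pvm_Un: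
  assumes F: "projection_valued_measure F" and "A \<in> sets borel" "B \<in> sets borel" "A \<inter> B = {}"
  shows "F (A \<union> B) \<psi> = F A \<psi> + F B \<psi>"
proof -
  have "(\<lambda>n. F (binaryset A B n) \<psi>) sums F (\<Union>n. binaryset A B n) \<psi>"
    using assms by (intro pvmD(5)[OF F])
      (auto simp: range_binaryset_eq disjoint_family_on_def binaryset_def)
  moreover have "(\<lambda>n. F (binaryset A B n) \<psi>) sums (F A \<psi> + F B \<psi>)"
    by (rule binaryset_sums) (rule pvm_empty[OF F])
  ultimately show ?thesis unfolding UN_binaryset_eq by (rule sums_unique2)
qed

lemma pvm_disjoint:
  assumes F: "projection_valued_measure F" and A: "A \<in> sets borel" and B: "B \<in> sets borel"
    and "A \<inter> B = {}"
  shows "F A (F B \<psi>) = 0"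
proof -
  let ?P = "F A" and ?Q = "F B"
  note linP = bounded_op_simps[OF pvmD(1)[OF F A]] and linQ = bounded_op_simps[OF pvmD(1)[OF F B]]
  note idem = pvmD(3)[OF F A] pvmD(3)[OF F B]
  have un: "F (A \<union> B) \<eta> = ?P \<eta> + ?Q \<eta>" for \<eta> by (rule pvm_Un[OF F A B assms(4)])
  have anti: "?P (?Q \<eta>) + ?Q (?P \<eta>) = 0" for \<eta>
  proof -
    have "F (A \<union> B) (F (A \<union> B) \<eta>) = F (A \<union> B) \<eta>" using A B by (intro pvmD(3)[OF F]) auto
    then show ?thesis unfolding un by (simp add: linP linQ idem algebra_simps)
  qed
  have 1: "?P (?Q \<psi>) + ?P (?Q (?P \<psi>)) = 0"
    using arg_cong[OF anti[of \<psi>], of ?P] by (simp add: linP idem)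
  have 2: "?P (?Q (?P \<psi>)) + ?Q (?P \<psi>) = 0"
    using anti[of "?P \<psi>"] by (simp add: idem)
  from 1 2 have "?P (?Q \<psi>) = ?Q (?P \<psi>)" by (metis add.commute add_left_cancel)
  with anti[of \<psi>] have "2 *\<^sub>R ?P (?Q \<psi>) = 0" by (simp add: scaleR_2)
  then show ?thesis by simp
qed

lemma pvm_Int:
  assumes F: "projection_valued_measure F" and A: "A \<in> sets borel" and B: "B \<in> sets borel"
  shows "F A (F B \<psi>) = F (A \<inter> B) \<psi>"
proof -
  have sets: "A \<inter> B \<union> (B - A) = B" "A \<inter> B \<union> (A - B) = A" "(A \<inter> B) \<inter> (B - A) = {}" "(A \<inter> B) \<inter> (A - B) = {}"
    by auto
  have B_split: "F B \<psi> = F (A \<inter> B) \<psi> + F (B - A) \<psi>"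
    using pvm_Un[OF F, of "A \<inter> B" "B - A" \<psi>] A B unfolding sets by auto
  have A_split: "F A \<eta> = F (A \<inter> B) \<eta> + F (A - B) \<eta>" for \<eta>
    using pvm_Un[OF F, of "A \<inter> B" "A - B" \<eta>] A B unfolding sets by auto
  have "F A (F B \<psi>) = F A (F (A \<inter> B) \<psi>) + F A (F (B - A) \<psi>)"
    unfolding B_split using A by (simp add: bounded_op_simps[OF pvmD(1)[OF F A]])
  also have "F A (F (B - A) \<psi>) = 0" using A B by (intro pvm_disjoint[OF F]) auto
  also have "F A (F (A \<inter> B) \<psi>) = F (A \<inter> B) (F (A \<inter> B) \<psi>) + F (A - B) (F (A \<inter> B) \<psi>)"
    by (rule A_split)
  also have "F (A - B) (F (A \<inter> B) \<psi>) = 0" using A B by (intro pvm_disjoint[OF F]) auto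
  finally show ?thesis using A B by (simp add: pvmD(3)[OF F])
qed

lemma pvm_cinner:
  assumes F: "projection_valued_measure F" and A: "A \<in> sets borel"
  shows "cinner \<psi> (F A \<psi>) = complex_of_real ((norm (F A \<psi>))\<^sup>2)"
  unfolding cinner_self[symmetric]
  using symmetric_opD[OF pvmD(2)[OF F A]] by (simp add: pvmD(3)[OF F A])

lemma scalar_measure_sets: "sets (scalar_measure F \<psi>) = sets borel"
  unfolding scalar_measure_def using sets.sigma_sets_eq[of "borel :: real measure"] by simp

lemma scalar_measure_space: "space (scalar_measure F \<psi>) = UNIV"
  unfolding scalar_measure_def by simp

lemma emeasure_scalar_measure:
  assumes F: "projection_valued_measure F" and A: "A \<in> sets borel"
  shows "emeasure (scalar_measure F \<psi>) A = ennreal ((norm (F A \<psi>))\<^sup>2)"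
proof -
  let ?m = "\<lambda>\<Lambda>. ennreal (Re (cinner \<psi> (F \<Lambda> \<psi>)))"
  have "emeasure (scalar_measure F \<psi>) A = ?m A"
  proof (rule emeasure_measure_of[OF scalar_measure_def])
    show "sets borel \<subseteq> Pow UNIV" by simp
    show "A \<in> sets (scalar_measure F \<psi>)" using A by (simp add: scalar_measure_sets)
    show "positive (sets (scalar_measure F \<psi>)) ?m"
      by (simp add: positive_def pvm_empty[OF F])
    show "countably_additive (sets (scalar_measure F \<psi>)) ?m"
      unfolding countably_additive_def scalar_measure_sets
    proof (intro allI impI)
      fix D :: "nat \<Rightarrow> real set"
      assume D: "range D \<subseteq> sets borel" "disjoint_family D"
      have "(\<lambda>n. Re (cinner \<psi> (F (D n) \<psi>))) sums Re (cinner \<psi> (F (\<Union>n. D n) \<psi>))"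
        by (intro sums_Re bounded_linear.sums[OF cinner.bounded_linear_right] pvmD(5)[OF F] D)
      then show "(\<Sum>n. ?m (D n)) = ?m (\<Union>n. D n)"
        using D(1) by (intro suminf_ennreal_eq) (auto simp: pvm_cinner[OF F] range_subsetD)
    qed
  qed
  then show ?thesis by (simp add: pvm_cinner[OF F A])
qed

lemma finite_scalar_measure:
  assumes "projection_valued_measure F"
  shows "finite_measure (scalar_measure F \<psi>)"
  by standard (simp add: emeasure_scalar_measure[OF assms] scalar_measure_space)

lemma measure_scalar_measure:
  assumes "projection_valued_measure F" "A \<in> sets borel"
  shows "measure (scalar_measure F \<psi>) A = (norm (F A \<psi>))\<^sup>2"
  by (simp add: measure_def emeasure_scalar_measure[OF assms])

text \<open>Through this restriction a bound for the energies in \<open>A\<close> becomes a bound for the form of \<open>H\<close> on the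
  range of \<open>F A\<close>.\<close>

lemma scalar_measure_restrict:
  assumes F: "projection_valued_measure F" and A: "A \<in> sets borel"
  shows "scalar_measure F (F A \<psi>) = density (scalar_measure F \<psi>) (indicator A)"
proof (rule measure_eqI)
  show "sets (scalar_measure F (F A \<psi>)) = sets (density (scalar_measure F \<psi>) (indicator A))"
    by (simp add: scalar_measure_sets)
  fix B assume "B \<in> sets (scalar_measure F (F A \<psi>))"
  then have B: "B \<in> sets borel" by (simp add: scalar_measure_sets)
  have "emeasure (density (scalar_measure F \<psi>) (indicator A)) B = emeasure (scalar_measure F \<psi>) (A \<inter> B)"
    using A B by (subst emeasure_density)
      (simp_all add: scalar_measure_sets nn_integral_indicator measurable_cong_sets[OF scalar_measure_sets refl]
        indicator_inter_arith[symmetric])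
  then show "emeasure (scalar_measure F (F A \<psi>)) B = emeasure (density (scalar_measure F \<psi>) (indicator A)) B"
    using A B by (simp add: emeasure_scalar_measure[OF F] pvm_Int[OF F] Int_commute)
qed

subsection \<open>Two spectral measures of one operator\<close>

lemma spectral_measureD:
  assumes "spectral_measure H F"
  shows "projection_valued_measure F" "integrable (scalar_measure F \<psi>) (\<lambda>x. x)"
    "cinner \<psi> (H \<psi>) = complex_of_real (LINT x|scalar_measure F \<psi>. x)"
  using assms by (auto simp: spectral_measure_def)

lemma spectral_restrict:
  assumes F: "spectral_measure H F" and A: "A \<in> sets borel"
  shows "cinner (F A \<psi>) (H (F A \<psi>)) = complex_of_real (LINT x|scalar_measure F \<psi>. indicator A x * x)"
proof -
  have "(LINT x|scalar_measure F (F A \<psi>). x) = (LINT x|scalar_measure F \<psi>. indicator A x *\<^sub>R x)"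
    unfolding scalar_measure_restrict[OF spectral_measureD(1)[OF F] A] ennreal_indicator[symmetric]
    using A by (subst integral_density) (auto simp: measurable_cong_sets[OF scalar_measure_sets refl])
  then show ?thesis unfolding spectral_measureD(3)[OF F] by simp
qed

text \<open>With \<open>P = F A\<close> and \<open>Q = 1 - P\<close>, the forms of \<open>H\<close> and of \<open>P H P + Q H Q\<close> agree; so \<open>H\<close> is block diagonal.\<close>

lemma spectral_commute:
  assumes H: "bounded_op H" and F: "spectral_measure H F" and A: "A \<in> sets borel"
  shows "F A (H \<psi>) = H (F A \<psi>)"
proof -
  note pvm = spectral_measureD(1)[OF F]
  let ?B = "UNIV - A"
  have B: "?B \<in> sets borel" using A by auto
  let ?P = "F A" and ?Q = "F ?B"
  have bP: "bounded_op ?P" "bounded_op ?Q" using pvmD(1)[OF pvm] A B by auto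
  have disj: "?P (?Q \<eta>) = 0" "?Q (?P \<eta>) = 0" for \<eta>
    using A B by (auto intro!: pvm_disjoint[OF pvm])
  have split: "H = (\<lambda>\<psi>. ?P (H (?P \<psi>)) + ?Q (H (?Q \<psi>)))"
  proof (rule bounded_op_eqI[OF H])
    show "bounded_op (\<lambda>\<psi>. ?P (H (?P \<psi>)) + ?Q (H (?Q \<psi>)))"
      by (rule bounded_op_add[OF bounded_op_compose[OF bP(1) bounded_op_compose[OF H bP(1)]]
          bounded_op_compose[OF bP(2) bounded_op_compose[OF H bP(2)]]])
    fix \<psi>
    let ?M = "scalar_measure F \<psi>"
    have int: "integrable ?M (\<lambda>x. indicator S x * x)" if "S \<in> sets borel" for S
    proof -
      have "integrable ?M (\<lambda>x. indicator S x *\<^sub>R x)"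
        using that by (intro integrable_mult_indicator spectral_measureD(2)[OF F]) (simp add: scalar_measure_sets)
      then show ?thesis by simp
    qed
    have "(LINT x|?M. x) = (LINT x|?M. indicator A x * x + indicator ?B x * x)"
      by (rule Bochner_Integration.integral_cong) (auto simp: indicator_def)
    also have "\<dots> = (LINT x|?M. indicator A x * x) + (LINT x|?M. indicator ?B x * x)"
      by (rule Bochner_Integration.integral_add) (intro int A B)+
    finally have "cinner \<psi> (H \<psi>) = cinner (?P \<psi>) (H (?P \<psi>)) + cinner (?Q \<psi>) (H (?Q \<psi>))"
      unfolding spectral_restrict[OF F A] spectral_restrict[OF F B] spectral_measureD(3)[OF F, of \<psi>] by simp
    then show "cinner \<psi> (H \<psi>) = cinner \<psi> (?P (H (?P \<psi>)) + ?Q (H (?Q \<psi>)))"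
      using symmetric_opD[OF pvmD(2)[OF pvm A]] symmetric_opD[OF pvmD(2)[OF pvm B]]
      by (simp add: cinner_add_right)
  qed
  have "?P (H \<psi>) = ?P (?P (H (?P \<psi>)) + ?Q (H (?Q \<psi>)))"
    using arg_cong[OF fun_cong[OF split, of \<psi>], of ?P] .
  also have "\<dots> = ?P (H (?P \<psi>))"
    by (simp add: bounded_op_simps[OF bP(1)] disj pvmD(3)[OF pvm A])
  also have "\<dots> = ?P (H (?P (?P \<psi>))) + ?Q (H (?Q (?P \<psi>)))"
    by (simp add: disj pvmD(3)[OF pvm A] bounded_op_simps[OF H] bounded_op_simps[OF bP(2)])
  also have "\<dots> = H (?P \<psi>)" using fun_cong[OF split, of "?P \<psi>"] by (rule sym)
  finally show ?thesis .
qed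

lemma spectral_upper:
  assumes F: "spectral_measure H F" and \<psi>: "F {..a} \<psi> = \<psi>"
  shows "Re (cinner \<psi> (H \<psi>)) \<le> a * (norm \<psi>)\<^sup>2"
proof -
  note pvm = spectral_measureD(1)[OF F]
  interpret finite_measure "scalar_measure F \<psi>" by (rule finite_scalar_measure[OF pvm])
  have "Re (cinner \<psi> (H \<psi>)) = (LINT x|scalar_measure F \<psi>. indicator {..a} x * x)"
    using spectral_restrict[OF F, of "{..a}" \<psi>] \<psi> by simp
  also have "\<dots> \<le> (LINT x|scalar_measure F \<psi>. indicator {..a} x * a)"
  proof (rule integral_mono)
    have "integrable (scalar_measure F \<psi>) (\<lambda>x. indicator {..a} x *\<^sub>R x)"
      by (intro integrable_mult_indicator spectral_measureD(2)[OF F]) (simp add: scalar_measure_sets)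
    then show "integrable (scalar_measure F \<psi>) (\<lambda>x. indicator {..a} x * x)" by simp
    have "integrable (scalar_measure F \<psi>) (\<lambda>x. indicator {..a} x *\<^sub>R a)"
      by (intro integrable_mult_indicator) (auto simp: scalar_measure_sets)
    then show "integrable (scalar_measure F \<psi>) (\<lambda>x. indicator {..a} x * a)" by simp
  qed (auto simp: indicator_def)
  also have "\<dots> = a * (norm \<psi>)\<^sup>2"
    using \<psi> by (simp add: scalar_measure_sets scalar_measure_space measure_scalar_measure[OF pvm])
  finally show ?thesis .
qed

lemma spectral_lower:
  assumes F: "spectral_measure H F" and \<psi>: "F {b<..} \<psi> = \<psi>"
  shows "b * (norm \<psi>)\<^sup>2 \<le> Re (cinner \<psi> (H \<psi>))"
proof -
  note pvm = spectral_measureD(1)[OF F]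
  interpret finite_measure "scalar_measure F \<psi>" by (rule finite_scalar_measure[OF pvm])
  have "b * (norm \<psi>)\<^sup>2 = (LINT x|scalar_measure F \<psi>. indicator {b<..} x * b)"
    using \<psi> by (simp add: scalar_measure_sets scalar_measure_space measure_scalar_measure[OF pvm])
  also have "\<dots> \<le> (LINT x|scalar_measure F \<psi>. indicator {b<..} x * x)"
  proof (rule integral_mono)
    have "integrable (scalar_measure F \<psi>) (\<lambda>x. indicator {b<..} x *\<^sub>R x)"
      by (intro integrable_mult_indicator spectral_measureD(2)[OF F]) (simp add: scalar_measure_sets)
    then show "integrable (scalar_measure F \<psi>) (\<lambda>x. indicator {b<..} x * x)" by simp
    have "integrable (scalar_measure F \<psi>) (\<lambda>x. indicator {b<..} x *\<^sub>R b)"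
      by (intro integrable_mult_indicator) (auto simp: scalar_measure_sets)
    then show "integrable (scalar_measure F \<psi>) (\<lambda>x. indicator {b<..} x * b)" by simp
  qed (auto simp: indicator_def)
  also have "\<dots> = Re (cinner \<psi> (H \<psi>))"
    using spectral_restrict[OF F, of "{b<..}" \<psi>] \<psi> by simp
  finally show ?thesis .
qed

text \<open>If \<open>a < b\<close>, a vector in the ranges of both \<open>F {..a}\<close> and \<open>G {b<..}\<close> would have energy at
  most \<open>a\<close> and at least \<open>b\<close>; hence \<open>F {..a}\<close> is dominated by \<open>G {..b}\<close>.\<close>

lemma spectral_compare:
  assumes F: "spectral_measure H F" and G: "spectral_measure H G"
    and comm: "\<And>A B \<psi>. A \<in> sets borel \<Longrightarrow> B \<in> sets borel \<Longrightarrow> F A (G B \<psi>) = G B (F A \<psi>)"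
  shows "measure (scalar_measure F \<psi>) {..a} \<le> measure (scalar_measure G \<psi>) {..a}"
proof -
  note pF = spectral_measureD(1)[OF F] and pG = spectral_measureD(1)[OF G]
  interpret G: finite_measure "scalar_measure G \<psi>" by (rule finite_scalar_measure[OF pG])
  have step: "measure (scalar_measure F \<psi>) {..a} \<le> measure (scalar_measure G \<psi>) {..b}" if "a < b" for b
  proof -
    define \<eta> where "\<eta> = F {..a} (G {b<..} \<psi>)"
    have "F {..a} \<eta> = \<eta>" unfolding \<eta>_def by (simp add: pvmD(3)[OF pF])
    then have "Re (cinner \<eta> (H \<eta>)) \<le> a * (norm \<eta>)\<^sup>2" by (rule spectral_upper[OF F])
    moreover have "G {b<..} \<eta> = \<eta>" unfolding \<eta>_def by (simp add: comm[symmetric] pvmD(3)[OF pG])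
    then have "b * (norm \<eta>)\<^sup>2 \<le> Re (cinner \<eta> (H \<eta>))" by (rule spectral_lower[OF G])
    ultimately have "b * (norm \<eta>)\<^sup>2 \<le> a * (norm \<eta>)\<^sup>2" by linarith
    with that have "norm \<eta> = 0" by (simp add: mult_le_cancel_right)
    then have zero: "F {..a} (G {b<..} \<psi>) = 0" by (simp add: \<eta>_def)
    have un: "{..b} \<union> {b<..} = UNIV" by auto
    have "\<psi> = G {..b} \<psi> + G {b<..} \<psi>"
      using pvm_Un[OF pG, of "{..b}" "{b<..}" \<psi>] pvmD(4)[OF pG] by (simp add: un disjoint_iff)
    then have "F {..a} \<psi> = F {..a} (G {..b} \<psi>) + F {..a} (G {b<..} \<psi>)"
      using bounded_op_simps(1)[OF pvmD(1)[OF pF], of "{..a}" "G {..b} \<psi>" "G {b<..} \<psi>"] by simp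
    then have eq: "F {..a} \<psi> = F {..a} (G {..b} \<psi>)" by (simp add: zero)
    have contr: "norm (F {..a} \<eta>) \<le> norm \<eta>" for \<eta>
    proof (cases "F {..a} \<eta> = 0")
      case False
      have "(norm (F {..a} \<eta>))\<^sup>2 = cmod (cinner \<eta> (F {..a} \<eta>))"
        by (subst pvm_cinner[OF pF]) (simp_all del: of_real_power)
      also have "\<dots> \<le> norm \<eta> * norm (F {..a} \<eta>)" by (rule Cauchy_Schwarz_cinner)
      finally show ?thesis using False by (simp add: power2_eq_square)
    qed simp
    show ?thesis
      unfolding measure_scalar_measure[OF pF borel_closed[OF closed_atMost]]
        measure_scalar_measure[OF pG borel_closed[OF closed_atMost]]
      using contr[of "G {..b} \<psi>"] by (intro power_mono) (simp_all add: eq)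
  qed
  have "(\<lambda>n. measure (scalar_measure G \<psi>) {..a + 1 / Suc n}) \<longlonglongrightarrow> measure (scalar_measure G \<psi>) (\<Inter>n. {..a + 1 / Suc n})"
    by (rule G.finite_Lim_measure_decseq)
      (auto simp: scalar_measure_sets decseq_def field_simps intro: order_trans)
  moreover have "(\<Inter>n. {..a + 1 / Suc n}) = {..a}"
  proof (intro equalityI subsetI)
    fix x assume "x \<in> (\<Inter>n. {..a + 1 / Suc n})"
    then have "x \<le> a + 1 / Suc n" for n by auto
    moreover have "(\<lambda>n. a + 1 / Suc n) \<longlonglongrightarrow> a + 0" by (intro tendsto_intros LIMSEQ_Suc[OF lim_1_over_n])
    ultimately show "x \<in> {..a}" using LIMSEQ_le_const[of "\<lambda>n. a + 1 / Suc n" "a + 0" x] by auto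
  qed (auto intro: add_increasing2)
  ultimately show ?thesis
    by (intro LIMSEQ_le_const[of "\<lambda>n. measure (scalar_measure G \<psi>) {..a + 1 / Suc n}"]) (auto intro!: step)
qed

text \<open>The scalar measures agree on half lines, which generate the Borel sets.\<close>

lemma spectral_unique:
  assumes F: "spectral_measure H F" and G: "spectral_measure H G"
    and comm: "\<And>A B \<psi>. A \<in> sets borel \<Longrightarrow> B \<in> sets borel \<Longrightarrow> F A (G B \<psi>) = G B (F A \<psi>)"
    and A: "A \<in> sets borel"
  shows "F A = G A"
proof (rule bounded_op_eqI)
  note pF = spectral_measureD(1)[OF F] and pG = spectral_measureD(1)[OF G]
  show "bounded_op (F A)" "bounded_op (G A)" using pvmD(1) pF pG A by auto
  fix \<psi>
  interpret F: finite_measure "scalar_measure F \<psi>" by (rule finite_scalar_measure[OF pF])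
  interpret G: finite_measure "scalar_measure G \<psi>" by (rule finite_scalar_measure[OF pG])
  have "scalar_measure F \<psi> = scalar_measure G \<psi>"
  proof (rule measure_eqI_generator_eq[where A = "\<lambda>i. {..real i}" and E = "range (\<lambda>a. {..a})" and \<Omega> = UNIV])
    show "Int_stable (range (\<lambda>a::real. {..a}))" by (auto simp: Int_stable_def)
    show "sets (scalar_measure F \<psi>) = sigma_sets UNIV (range (\<lambda>a. {..a}))"
      "sets (scalar_measure G \<psi>) = sigma_sets UNIV (range (\<lambda>a. {..a}))"
      by (simp_all add: scalar_measure_sets borel_eq_atMost)
    show "(\<Union>i. {..real i}) = UNIV" using real_arch_simple by auto
    show "emeasure (scalar_measure F \<psi>) X = emeasure (scalar_measure G \<psi>) X" if X': "X \<in> range (\<lambda>a. {..a})" for X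
    proof -
      obtain a where X: "X = {..a}" using X' by auto
      have "measure (scalar_measure F \<psi>) X = measure (scalar_measure G \<psi>) X"
        unfolding X
      proof (rule antisym)
        show "measure (scalar_measure F \<psi>) {..a} \<le> measure (scalar_measure G \<psi>) {..a}"
          by (rule spectral_compare[OF F G]) (rule comm)
        show "measure (scalar_measure G \<psi>) {..a} \<le> measure (scalar_measure F \<psi>) {..a}"
          by (rule spectral_compare[OF G F]) (rule comm[symmetric])
      qed
      then show ?thesis by (simp add: F.emeasure_eq_measure G.emeasure_eq_measure)
    qed
  qed (auto simp: F.emeasure_eq_measure)
  then have "(norm (F A \<psi>))\<^sup>2 = (norm (G A \<psi>))\<^sup>2"
    unfolding measure_scalar_measure[OF pF A, symmetric] measure_scalar_measure[OF pG A, symmetric] by simp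
  then show "cinner \<psi> (F A \<psi>) = cinner \<psi> (G A \<psi>)"
    unfolding pvm_cinner[OF pF A] pvm_cinner[OF pG A] by simp
qed

subsection \<open>The spectral theorem\<close>

context bounded_symmetric
begin

text \<open>The square of the norm of the difference is the integral of \<open>\<bar>g\<^sub>n - h\<bar>\<^sup>2\<close>, to which dominated convergence
  applies.\<close>

lemma fc_strong_lim:
  assumes g: "\<And>n. bounded_borel (g n)" "\<And>n x. cmod (g n x) \<le> C" "\<And>x. (\<lambda>n. g n x) \<longlonglongrightarrow> h x"
  shows "(\<lambda>n. fc (g n) \<psi>) \<longlonglongrightarrow> fc h \<psi>"
proof -
  have h: "bounded_borel h" by (rule bounded_borel_lim[OF g])
  have hC: "cmod (h x) \<le> C" for x
    by (rule LIMSEQ_le_const2[OF tendsto_norm[OF g(3)]]) (use g(2) in auto)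
  have C0: "0 \<le> C" using norm_ge_zero hC[of 0] by (rule order_trans)
  define d where "d n x = cnj (g n x - h x) * (g n x - h x)" for n x
  have "(\<lambda>n. CLINT x|mu \<psi>. d n x) \<longlonglongrightarrow> (CLINT x|mu \<psi>. 0)"
  proof (rule integral_mu_tendsto)
    show "bounded_borel (d n)" for n
      unfolding d_def by (intro bounded_borel_mult bounded_borel_cnj bounded_borel_diff g h)
    have "cmod (g n x - h x) \<le> 2 * C" for n x
      using norm_triangle_ineq4[of "g n x" "h x"] g(2)[of n x] hC[of x] by linarith
    then show "cmod (d n x) \<le> (2 * C) * (2 * C)" for n x
      unfolding d_def norm_mult complex_mod_cnj using C0 by (intro mult_mono) auto
    show "(\<lambda>n. d n x) \<longlonglongrightarrow> 0" for x
    proof -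
      have "(\<lambda>n. d n x) \<longlonglongrightarrow> cnj (h x - h x) * (h x - h x)"
        unfolding d_def by (intro tendsto_intros g)
      then show ?thesis by simp
    qed
  qed
  moreover have "(CLINT x|mu \<psi>. d n x) = complex_of_real ((norm (fc (g n) \<psi> - fc h \<psi>))\<^sup>2)" for n
    unfolding fc_diff[OF g(1) h, symmetric] norm_fc_sq[OF bounded_borel_diff[OF g(1) h]] d_def cnj_mult_self
    by (rule integral_complex_of_real)
  ultimately have "(\<lambda>n. complex_of_real ((norm (fc (g n) \<psi> - fc h \<psi>))\<^sup>2)) \<longlonglongrightarrow> complex_of_real 0" by simp
  then have "(\<lambda>n. (norm (fc (g n) \<psi> - fc h \<psi>))\<^sup>2) \<longlonglongrightarrow> 0" by (simp only: tendsto_of_real_iff)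
  from tendsto_real_sqrt[OF this] have "(\<lambda>n. norm (fc (g n) \<psi> - fc h \<psi>)) \<longlonglongrightarrow> 0" by simp
  then show ?thesis by (rule LIM_zero_cancel[OF tendsto_norm_zero_cancel])
qed

definition E :: "real set \<Rightarrow> ell2 \<Rightarrow> ell2" where
  "E A = fc (\<lambda>x. of_real (indicator A x))"

lemma cinner_E:
  assumes "A \<in> sets borel"
  shows "cinner \<psi> (E A \<psi>) = complex_of_real (measure (mu \<psi>) A)"
  unfolding E_def cinner_fc[OF bounded_borel_indicator[OF assms]] integral_complex_of_real
  using assms by simp

lemma pvm_E: "projection_valued_measure E"
  unfolding projection_valued_measure_def
proof (intro conjI ballI allI impI)
  fix A :: "real set" assume A: "A \<in> sets borel"
  note bb = bounded_borel_indicator[OF A]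
  show "bounded_op (E A)" unfolding E_def by (rule bounded_op_fc[OF bb])
  show "symmetric_op (E A)" unfolding E_def by (rule fc_real_symmetric[OF bb])
  show "E A \<circ> E A = E A"
  proof
    fix \<psi>
    have "(\<lambda>x. complex_of_real (indicator A x) * complex_of_real (indicator A x)) = (\<lambda>x. complex_of_real (indicator A x))"
      by (auto simp: indicator_def)
    then show "(E A \<circ> E A) \<psi> = E A \<psi>" using fc_mult[OF bb bb, of \<psi>] by (simp add: E_def)
  qed
next
  show "E UNIV = id" unfolding E_def using fc_const[of 1] by (auto simp: fun_eq_iff)
next
  fix D :: "nat \<Rightarrow> real set" and \<psi>
  assume D: "range D \<subseteq> sets borel" "disjoint_family D"
  have Dn: "D n \<in> sets borel" for n using D(1) by auto
  have partial: "(\<Sum>i<n. E (D i) \<psi>) = fc (\<lambda>x. of_real (indicator (\<Union>i<n. D i) x)) \<psi>" for n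
  proof (induction n)
    case 0 show ?case using fc_const[of 0] by simp
  next
    case (Suc n)
    have "(\<lambda>x. complex_of_real (indicator (\<Union>i<Suc n. D i) x))
        = (\<lambda>x. complex_of_real (indicator (\<Union>i<n. D i) x) + complex_of_real (indicator (D n) x))"
    proof
      fix x
      have "D i \<inter> D n = {}" if "i < n" for i
        using D(2) that by (simp add: disjoint_family_on_def)
      then have "x \<in> D n \<Longrightarrow> x \<notin> (\<Union>i<n. D i)" by blast
      then show "complex_of_real (indicator (\<Union>i<Suc n. D i) x)
        = complex_of_real (indicator (\<Union>i<n. D i) x) + complex_of_real (indicator (D n) x)"
        by (auto simp: indicator_def lessThan_Suc)
    qed
    moreover have "bounded_borel (\<lambda>x. of_real (indicator (\<Union>i<n. D i) x))"
      using Dn by (intro bounded_borel_indicator) auto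
    ultimately show ?case
      using Suc by (simp add: fc_add bounded_borel_indicator Dn E_def)
  qed
  show "(\<lambda>n. E (D n) \<psi>) sums E (\<Union>n. D n) \<psi>"
    unfolding sums_def partial unfolding E_def
  proof (rule fc_strong_lim[where C = 1])
    show "bounded_borel (\<lambda>x. of_real (indicator (\<Union>i<n. D i) x))" for n
      using Dn by (intro bounded_borel_indicator) auto
    show "cmod (of_real (indicator (\<Union>i<n. D i) x)) \<le> 1" for n x
      by (simp add: indicator_def)
    show "(\<lambda>n. complex_of_real (indicator (\<Union>i<n. D i) x)) \<longlonglongrightarrow> complex_of_real (indicator (\<Union>n. D n) x)" for x
      by (intro tendsto_of_real LIMSEQ_indicator_UN)
  qed
qed

lemma scalar_measure_eq_mu:
  assumes "\<And>A. A \<in> sets borel \<Longrightarrow> F A = E A"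
  shows "scalar_measure F \<psi> = mu \<psi>"
proof -
  have "scalar_measure F \<psi> = measure_of UNIV (sets borel) (emeasure (mu \<psi>))"
    unfolding scalar_measure_def
  proof (rule measure_of_eq)
    fix A assume "A \<in> sigma_sets UNIV (sets (borel :: real measure))"
    then have A: "A \<in> sets borel" using sets.sigma_sets_eq[of "borel :: real measure"] by simp
    interpret finite_measure "mu \<psi>" by (rule mu_props)
    show "ennreal (Re (cinner \<psi> (F A \<psi>))) = emeasure (mu \<psi>) A"
      using cinner_E[OF A] assms[OF A] by (simp add: emeasure_eq_measure)
  qed simp
  also have "\<dots> = mu \<psi>" using measure_of_of_measure[of "mu \<psi>"] by simp
  finally show ?thesis .
qed

lemma spectral_measure_E: "spectral_measure H E"
  unfolding spectral_measure_def scalar_measure_eq_mu[of E, OF refl]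
proof (intro conjI allI pvm_E)
  fix \<psi>
  interpret finite_measure "mu \<psi>" by (rule mu_props)
  show "integrable (mu \<psi>) (\<lambda>x. x)"
    by (rule integrable_const_bound[of _ K]) (use mu_props(3) in auto)
  have "cinner \<psi> (H \<psi>) = complex_of_real (Re (cinner \<psi> (H \<psi>)))"
    using cinner_commute[of \<psi> "H \<psi>"] symmetric_opD[OF symmetric_H, of \<psi> \<psi>]
    by (metis Reals_cnj_iff of_real_Re)
  then show "cinner \<psi> (H \<psi>) = complex_of_real (LINT x|mu \<psi>. x)"
    using mu_props(4)[of \<psi> 1] by simp
qed

lemma spectral_measure_eq_E:
  assumes "spectral_measure H F" "A \<in> sets borel"
  shows "F A = E A"
proof (rule spectral_unique[OF assms(1) spectral_measure_E _ assms(2)])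
  fix A B :: "real set" and \<psi> assume A: "A \<in> sets borel" and B: "B \<in> sets borel"
  have "bounded_op (F A)" using pvmD(1)[OF spectral_measureD(1)[OF assms(1)] A] .
  then show "F A (E B \<psi>) = E B (F A \<psi>)"
    unfolding E_def
    using fc_commute[of "\<lambda>x. complex_of_real (indicator B x)" "F A" \<psi>]
      bounded_borel_indicator[OF B] spectral_commute[OF bounded_H assms(1) A] by simp
qed

lemma spectral_proj_eq:
  assumes "A \<in> sets borel"
  shows "spectral_proj H A = E A"
  unfolding spectral_proj_def
proof (rule the_equality)
  show "\<exists>F. spectral_measure H F \<and> E A = F A" using spectral_measure_E by blast
  fix P assume "\<exists>F. spectral_measure H F \<and> P = F A"
  then show "P = E A" using spectral_measure_eq_E[OF _ assms] by blast
qed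

lemma fun_calc_eq: "fun_calc g H = fc g"
  unfolding fun_calc_def fc_def is_calc_def
  by (simp only: scalar_measure_eq_mu[of "spectral_proj H", OF spectral_proj_eq])

end

section \<open>The unitary group\<close>

context bounded_symmetric
begin

definition U :: "real \<Rightarrow> ell2 \<Rightarrow> ell2" where
  "U t = fc (\<lambda>x. exp (\<i> * of_real (t * x)))"

lemma evolution_eq: "evolution H t = U t"
  by (simp add: evolution_def fun_calc_eq U_def)

lemma bounded_borel_exp: "bounded_borel (\<lambda>x. exp (\<i> * of_real (t * x)))"
  by (rule bounded_borelI[of _ 1]) simp_all

lemma U_0 [simp]: "U 0 \<psi> = \<psi>"
  using fc_const[of 1 \<psi>] by (simp add: U_def)

lemma U_add: "U (s + t) \<psi> = U s (U t \<psi>)"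
  unfolding U_def fc_mult[OF bounded_borel_exp bounded_borel_exp, symmetric]
  by (simp add: exp_add[symmetric] algebra_simps)

lemma U_adjoint: "cinner (U t \<phi>) \<psi> = cinner \<phi> (U (- t) \<psi>)"
  unfolding U_def fc_adjoint[OF bounded_borel_exp] by (simp add: exp_cnj)

lemma norm_U [simp]: "norm (U t \<psi>) = norm \<psi>"
proof -
  have "cinner (U t \<psi>) (U t \<psi>) = cinner \<psi> \<psi>"
    unfolding U_adjoint U_add[symmetric] by simp
  then have "complex_of_real ((norm (U t \<psi>))\<^sup>2) = complex_of_real ((norm \<psi>)\<^sup>2)"
    unfolding cinner_self .
  then have "(norm (U t \<psi>))\<^sup>2 = (norm \<psi>)\<^sup>2" by (simp only: of_real_eq_iff)
  then show ?thesis by simp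
qed

lemma U_fc: "bounded_borel g \<Longrightarrow> U t (fc g \<psi>) = fc g (U t \<psi>)"
  unfolding U_def fc_mult[OF bounded_borel_exp, symmetric] fc_mult[OF _ bounded_borel_exp, symmetric]
  by (simp add: mult.commute)

lemma bounded_borel_sum:
  "(\<And>i. i \<in> I \<Longrightarrow> bounded_borel (g i)) \<Longrightarrow> bounded_borel (\<lambda>x. \<Sum>i\<in>I. g i x)"
  by (induction I rule: infinite_finite_induct) (auto intro: bounded_borel_const bounded_borel_add)

lemma fc_sum:
  "(\<And>i. i \<in> I \<Longrightarrow> bounded_borel (g i)) \<Longrightarrow> fc (\<lambda>x. \<Sum>i\<in>I. g i x) \<psi> = (\<Sum>i\<in>I. fc (g i) \<psi>)"
  using fc_const[of 0]
  by (induction I rule: infinite_finite_induct) (auto simp: fc_add bounded_borel_sum)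

text \<open>The remainder of the exponential series is estimated on the spectrum, pointwise.\<close>

lemma U_Taylor:
  "norm (U t \<psi> - (\<Sum>k\<le>n. ((\<i> * of_real t) ^ k / fact k) *\<^sub>C (H ^^ k) \<psi>))
     \<le> (\<bar>t\<bar> * K) ^ Suc n / fact (Suc n) * norm \<psi>"
proof -
  let ?p = "\<lambda>x. \<Sum>k\<le>n. ((\<i> * of_real t) ^ k / fact k) * complex_of_real (clamp_K K x) ^ k"
  let ?e = "\<lambda>x. exp (\<i> * complex_of_real (t * x))"
  have bp: "bounded_borel ?p"
    by (intro bounded_borel_sum bounded_borel_cmult bounded_borel_clamp_power)
  have "fc ?p \<psi> = (\<Sum>k\<le>n. ((\<i> * of_real t) ^ k / fact k) *\<^sub>C (H ^^ k) \<psi>)"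
    by (subst fc_sum)
      (simp_all add: fc_cmult[OF bounded_borel_clamp_power] fc_power bounded_borel_cmult
        bounded_borel_clamp_power del: times_divide_eq_left)
  then have "U t \<psi> - (\<Sum>k\<le>n. ((\<i> * of_real t) ^ k / fact k) *\<^sub>C (H ^^ k) \<psi>) = fc (\<lambda>x. ?e x - ?p x) \<psi>"
    unfolding fc_diff[OF bounded_borel_exp bp] U_def by simp
  also have "norm \<dots> \<le> (\<bar>t\<bar> * K) ^ Suc n / fact (Suc n) * norm \<psi>"
  proof (rule norm_fc_le)
    show "bounded_borel (\<lambda>x. ?e x - ?p x)" by (rule bounded_borel_diff[OF bounded_borel_exp bp])
    fix x assume x: "\<bar>x\<bar> \<le> K"
    have "?p x = (\<Sum>k\<le>n. (\<i> * of_real (t * x)) ^ k / fact k)"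
      unfolding clamp_K_id[OF x] by (rule sum.cong) (simp_all add: power_mult_distrib)
    then have "cmod (?e x - ?p x) \<le> \<bar>t * x\<bar> ^ Suc n / fact (Suc n)"
      using iexp_approx1[of "t * x" n] by simp
    also have "\<dots> \<le> (\<bar>t\<bar> * K) ^ Suc n / fact (Suc n)"
      using x by (intro divide_right_mono power_mono) (auto simp: abs_mult intro!: mult_left_mono)
    finally show "cmod (?e x - ?p x) \<le> (\<bar>t\<bar> * K) ^ Suc n / fact (Suc n)" .
  qed (use K_pos in simp)
  finally show ?thesis .
qed

lemma U_has_derivative: "((\<lambda>t. U t \<psi>) has_vector_derivative \<i> *\<^sub>C H (U t \<psi>)) (at t)"
  unfolding has_vector_derivative_def has_derivative_at
proof (intro conjI)
  show "bounded_linear (\<lambda>h. h *\<^sub>R (\<i> *\<^sub>C H (U t \<psi>)))" by (rule bounded_linear_scaleR_left)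
  have bound: "norm (U (t + h) \<psi> - U t \<psi> - h *\<^sub>R (\<i> *\<^sub>C H (U t \<psi>))) / norm h \<le> \<bar>h\<bar> * (K\<^sup>2 * norm \<psi>)" for h
  proof (cases "h = 0")
    case False
    have "U (t + h) \<psi> - U t \<psi> - h *\<^sub>R (\<i> *\<^sub>C H (U t \<psi>))
        = U h (U t \<psi>) - (\<Sum>k\<le>1. ((\<i> * of_real h) ^ k / fact k) *\<^sub>C (H ^^ k) (U t \<psi>))"
      unfolding U_add[symmetric] by (intro ell2_eqI) (simp add: add.commute algebra_simps)
    also have "norm \<dots> \<le> (\<bar>h\<bar> * K) ^ Suc 1 / fact (Suc 1) * norm (U t \<psi>)" by (rule U_Taylor)
    also have "\<dots> = (\<bar>h\<bar> * (\<bar>h\<bar> * (K\<^sup>2 * norm \<psi>))) / 2"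
      by (simp add: power2_eq_square)
    also have "\<dots> \<le> \<bar>h\<bar> * (\<bar>h\<bar> * (K\<^sup>2 * norm \<psi>))"
      using mult_nonneg_nonneg[OF abs_ge_zero mult_nonneg_nonneg[OF abs_ge_zero mult_nonneg_nonneg[OF zero_le_power2 norm_ge_zero]], of h h K \<psi>]
      by linarith
    finally show ?thesis using False by (simp add: divide_le_eq mult.commute)
  qed simp
  have "((\<lambda>h. \<bar>h\<bar> * (K\<^sup>2 * norm \<psi>)) \<longlongrightarrow> \<bar>0\<bar> * (K\<^sup>2 * norm \<psi>)) (at 0)"
    by (intro tendsto_intros)
  then have lim: "((\<lambda>h. \<bar>h\<bar> * (K\<^sup>2 * norm \<psi>)) \<longlongrightarrow> 0) (at 0)" by simp
  show "(\<lambda>h. norm (U (t + h) \<psi> - U t \<psi> - h *\<^sub>R (\<i> *\<^sub>C H (U t \<psi>))) / norm h) \<midarrow>0\<rightarrow> 0"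
    by (rule Lim_null_comparison[OF always_eventually lim]) (use bound in simp)
qed

lemma continuous_U: "continuous_on S (\<lambda>t. U t \<psi>)"
  using has_vector_derivative_continuous[OF U_has_derivative]
  by (intro continuous_at_imp_continuous_on) auto

end

section \<open>Time averages on the continuous subspace\<close>

subsection \<open>Wiener's theorem\<close>

lemma integral_exp_symmetric_bound:
  assumes "0 \<le> T"
  shows "cmod (CLINT t:{-T..T}|lborel. exp (\<i> * of_real (t * u))) \<le> 2 * T"
    "u \<noteq> 0 \<Longrightarrow> cmod (CLINT t:{-T..T}|lborel. exp (\<i> * of_real (t * u))) \<le> 2 / \<bar>u\<bar>"
proof -
  let ?f = "\<lambda>t. exp (\<i> * complex_of_real (t * u))"
  have cont: "continuous_on {-T..T} ?f" by (intro continuous_intros)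
  have eq: "(CLINT t:{-T..T}|lborel. ?f t) = integral {-T..T} ?f"
    by (rule set_borel_integral_eq_integral[OF borel_integrable_atLeastAtMost'[OF cont]])
  have "norm (integral {-T..T} ?f) \<le> 1 * (T - (- T))"
    by (rule integral_bound) (use assms cont in auto)
  then show "cmod (CLINT t:{-T..T}|lborel. ?f t) \<le> 2 * T" unfolding eq by simp
  assume u: "u \<noteq> 0"
  let ?F = "\<lambda>t. ?f t / (\<i> * complex_of_real u)"
  have "(?f has_integral ?F T - ?F (- T)) {-T..T}"
  proof (rule fundamental_theorem_of_calculus)
    show "- T \<le> T" using assms by simp
    fix t
    have "((\<lambda>z. exp (\<i> * (z * of_real u)) / (\<i> * of_real u)) has_field_derivative ?f t)
        (at (of_real t))"
      using u by (auto intro!: derivative_eq_intros simp: field_simps)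
    from has_vector_derivative_real_field[OF this]
    show "(?F has_vector_derivative ?f t) (at t within {-T..T})" by simp
  qed
  then have "integral {-T..T} ?f = (?f T - ?f (- T)) / (\<i> * of_real u)"
    by (simp add: integral_unique diff_divide_distrib)
  also have "cmod \<dots> = cmod (?f T - ?f (- T)) / \<bar>u\<bar>" by (simp add: norm_divide norm_mult)
  also have "\<dots> \<le> 2 / \<bar>u\<bar>"
  proof (rule divide_right_mono)
    have "cmod (?f T) = 1" "cmod (?f (- T)) = 1" by (rule norm_exp_i_times)+
    then show "cmod (?f T - ?f (- T)) \<le> 2" using norm_triangle_ineq4[of "?f T" "?f (- T)"] by simp
  qed simp
  finally show "cmod (CLINT t:{-T..T}|lborel. ?f t) \<le> 2 / \<bar>u\<bar>" unfolding eq .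
qed

lemma integrable_lborel_pair:
  fixes M :: "real measure" and f :: "real \<times> real \<Rightarrow> complex"
  assumes M: "finite_measure M" "sets M = sets borel"
    and f: "f \<in> borel_measurable (lborel \<Otimes>\<^sub>M M)" "\<And>t x. t \<notin> {-T..T} \<Longrightarrow> f (t, x) = 0"
    and B: "\<And>t x. cmod (f (t, x)) \<le> B"
  shows "integrable (lborel \<Otimes>\<^sub>M M) f"
proof (rule integrableI_bounded_set[where A = "{-T..T} \<times> UNIV" and B = B])
  interpret finite_measure M by (rule M)
  have sp: "space M = UNIV" using sets_eq_imp_space_eq[OF M(2)] by simp
  have U: "UNIV \<in> sets M" using sets.top[of M] by (simp add: sp)
  show "{-T..T} \<times> UNIV \<in> sets (lborel \<Otimes>\<^sub>M M)" using U by (intro pair_measureI) auto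
  have "emeasure (lborel \<Otimes>\<^sub>M M) ({-T..T} \<times> UNIV) = emeasure lborel {-T..T} * emeasure M UNIV"
    using U by (intro emeasure_pair_measure_Times) auto
  also have "\<dots> < \<infinity>" using emeasure_finite[of UNIV]
    by (auto simp: ennreal_mult_eq_top_iff less_top[symmetric] emeasure_lborel_Icc_eq)
  finally show "emeasure (lborel \<Otimes>\<^sub>M M) ({-T..T} \<times> UNIV) < \<infinity>" .
  show "AE x in lborel \<Otimes>\<^sub>M M. x \<in> {-T..T} \<times> UNIV \<longrightarrow> norm (f x) \<le> B" using B by auto
  show "AE x in lborel \<Otimes>\<^sub>M M. x \<notin> {-T..T} \<times> UNIV \<longrightarrow> f x = 0"
  proof (rule AE_I2, rule impI)
    fix x :: "real \<times> real" assume "x \<notin> {-T..T} \<times> UNIV"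
    then have "fst x \<notin> {-T..T}" by (cases x) simp
    then show "f x = 0" using f(2)[of "fst x" "snd x"] by simp
  qed
qed (rule f)

lemma measurable_cnj [measurable]: "cnj \<in> borel_measurable borel"
  by (intro borel_measurable_continuous_onI continuous_intros)

text \<open>By Fubini the mean of \<open>\<bar>m\<bar>\<^sup>2\<close> is the double integral of the kernel
  \<open>1/T \<integral>\<^bsub>-T\<^esub>\<^bsup>T\<^esup> e\<^bsup>i t (x - y)\<^esup> dt\<close>, which is bounded and tends to \<open>0\<close> off the diagonal.\<close>

lemma Wiener:
  fixes M :: "real measure"
  assumes M: "finite_measure M" "sets M = sets borel" and atomless: "\<And>x. measure M {x} = 0"
  defines "m \<equiv> \<lambda>t. CLINT x|M. exp (\<i> * of_real (t * x))"
  shows "((\<lambda>T. (LINT t:{-T..T}|lborel. (cmod (m t))\<^sup>2) / T) \<longlongrightarrow> 0) at_top"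
proof -
  interpret finite_measure M by (rule M)
  interpret P: pair_sigma_finite lborel M ..
  note [measurable_cong] = M(2)
  have sp: "space M = UNIV" using sets_eq_imp_space_eq[OF M(2)] by simp
  let ?e = "\<lambda>t x. exp (\<i> * complex_of_real (t * x))"
  define c where "c = measure M UNIV"
  have int_e: "integrable M (?e t)" for t
    by (rule integrable_const_bound[of _ 1]) simp_all
  have m_le: "cmod (m t) \<le> c" for t
  proof -
    have "cmod (m t) \<le> (LINT x|M. cmod (?e t x))" unfolding m_def by (rule integral_norm_bound)
    then show ?thesis by (simp add: c_def sp)
  qed
  have m_meas [measurable]: "m \<in> borel_measurable borel"
    unfolding m_def by measurable
  define D where "D T u = (CLINT t:{-T..T}|lborel. ?e t u)" for T u
  have D_meas [measurable]: "D T \<in> borel_measurable borel" for T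
    unfolding D_def set_lebesgue_integral_def by measurable
  have key: "complex_of_real (LINT t:{-T..T}|lborel. (cmod (m t))\<^sup>2) = (CLINT x|M. CLINT y|M. D T (x - y))" for T
  proof -
    have sq: "complex_of_real ((cmod (m t))\<^sup>2) = (CLINT x|M. ?e t x * cnj (m t))" for t
      unfolding complex_norm_square by (simp add: m_def)
    have cnj_m: "cnj (m t) = (CLINT y|M. ?e (- t) y)" for t
    proof -
      have "(\<lambda>y. ?e (- t) y) = (\<lambda>y. cnj (?e t y))" by (simp add: exp_cnj)
      then show ?thesis unfolding m_def by simp
    qed
    have "complex_of_real (LINT t:{-T..T}|lborel. (cmod (m t))\<^sup>2)
        = (CLINT t|lborel. CLINT x|M. indicator {-T..T} t *\<^sub>R (?e t x * cnj (m t)))"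
      unfolding set_lebesgue_integral_def integral_complex_of_real[symmetric]
      by (simp add: sq scaleR_conv_of_real del: of_real_power)
    also have "\<dots> = (CLINT x|M. CLINT t|lborel. indicator {-T..T} t *\<^sub>R (?e t x * cnj (m t)))"
    proof (rule P.Fubini_integral[symmetric])
      show "integrable (lborel \<Otimes>\<^sub>M M) (\<lambda>(t, x). indicator {-T..T} t *\<^sub>R (?e t x * cnj (m t)))"
      proof (rule integrable_lborel_pair[OF M, where T = T and B = c])
        show "cmod (case (t, x) of (t, x) \<Rightarrow> indicator {-T..T} t *\<^sub>R (?e t x * cnj (m t))) \<le> c" for t x
          using m_le[of t] order_trans[OF norm_ge_zero m_le[of t]] by (simp add: norm_mult indicator_def)
        show "(\<lambda>(t, x). indicator {-T..T} t *\<^sub>R (?e t x * cnj (m t))) \<in> borel_measurable (lborel \<Otimes>\<^sub>M M)"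
          by measurable
      qed simp
    qed
    also have "\<dots> = (CLINT x|M. CLINT y|M. D T (x - y))"
    proof (rule Bochner_Integration.integral_cong[OF refl])
      fix x
      have "(CLINT t|lborel. indicator {-T..T} t *\<^sub>R (?e t x * cnj (m t)))
          = (CLINT t|lborel. CLINT y|M. indicator {-T..T} t *\<^sub>R ?e t (x - y))"
        unfolding cnj_m
        by (simp add: exp_add[symmetric] algebra_simps flip: integral_mult_right_zero)
      also have "\<dots> = (CLINT y|M. CLINT t|lborel. indicator {-T..T} t *\<^sub>R ?e t (x - y))"
      proof (rule P.Fubini_integral[symmetric])
        show "integrable (lborel \<Otimes>\<^sub>M M) (\<lambda>(t, y). indicator {-T..T} t *\<^sub>R ?e t (x - y))"
          by (rule integrable_lborel_pair[OF M, where T = T and B = 1]) (auto simp: indicator_def)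
      qed
      finally show "(CLINT t|lborel. indicator {-T..T} t *\<^sub>R (?e t x * cnj (m t))) = (CLINT y|M. D T (x - y))"
        by (simp add: D_def set_lebesgue_integral_def)
    qed
    finally show ?thesis .
  qed
  have D_bd: "cmod (D T u / of_real T) \<le> 2" if "T > 0" for T u
    using integral_exp_symmetric_bound(1)[of T u] that by (simp add: D_def norm_divide divide_le_eq)
  have D_lim: "((\<lambda>T. D T u / of_real T) \<longlongrightarrow> 0) at_top" if "u \<noteq> 0" for u
  proof (rule Lim_null_comparison)
    show "\<forall>\<^sub>F T in at_top. norm (D T u / of_real T) \<le> (2 / \<bar>u\<bar>) / T"
      using eventually_gt_at_top[of 0]
    proof eventually_elim
      fix T :: real assume "T > 0"
      then show "norm (D T u / of_real T) \<le> (2 / \<bar>u\<bar>) / T"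
        using integral_exp_symmetric_bound(2)[of T u] that
        by (simp only: D_def norm_divide norm_of_real) (intro divide_mono, auto)
    qed
    show "((\<lambda>T. (2 / \<bar>u\<bar>) / T) \<longlongrightarrow> 0) at_top"
      by (rule tendsto_divide_0[OF tendsto_const]) (rule filterlim_at_top_imp_at_infinity[OF filterlim_ident])
  qed
  define G where "G T x = (CLINT y|M. D T (x - y) / of_real T)" for T x
  have G_lim: "((\<lambda>T. G T x) \<longlongrightarrow> 0) at_top" for x
  proof -
    have "((\<lambda>T. CLINT y|M. D T (x - y) / of_real T) \<longlongrightarrow> (CLINT y|M. 0)) at_top"
    proof (rule integral_dominated_convergence_at_top[where w = "\<lambda>_. 2"])
      have "AE y in M. y \<noteq> x"
      proof (rule AE_I[of _ _ "{x}"])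
        show "emeasure M {x} = 0" using atomless by (simp add: emeasure_eq_measure)
      qed (auto simp: M(2))
      then show "AE y in M. ((\<lambda>T. D T (x - y) / of_real T) \<longlongrightarrow> 0) at_top"
        by eventually_elim (intro D_lim, simp)
      show "\<forall>\<^sub>F T in at_top. AE y in M. norm (D T (x - y) / of_real T) \<le> 2"
        using eventually_gt_at_top[of 0] by eventually_elim (simp only: D_bd AE_I2)
    qed auto
    then show ?thesis by (simp add: G_def)
  qed
  have "((\<lambda>T. CLINT x|M. G T x) \<longlongrightarrow> (CLINT x|M. 0)) at_top"
  proof (rule integral_dominated_convergence_at_top[where w = "\<lambda>_. 2 * c"])
    show "G T \<in> borel_measurable M" for T unfolding G_def by measurable
    show "\<forall>\<^sub>F T in at_top. AE x in M. norm (G T x) \<le> 2 * c"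
      using eventually_gt_at_top[of 0]
    proof eventually_elim
      fix T :: real assume T: "T > 0"
      have "norm (G T x) \<le> 2 * c" for x
      proof -
        have "norm (G T x) \<le> (LINT y|M. cmod (D T (x - y) / of_real T))"
          unfolding G_def by (rule integral_norm_bound)
        also have "\<dots> \<le> (LINT y|M. 2)"
          by (rule integral_mono) (use D_bd[OF T] in \<open>auto intro!: integrable_const_bound[of _ 2]\<close>)
        finally show ?thesis by (simp add: c_def sp)
      qed
      then show "AE x in M. norm (G T x) \<le> 2 * c" by simp
    qed
  qed (use G_lim in auto)
  then have "((\<lambda>T. CLINT x|M. G T x) \<longlongrightarrow> 0) at_top" by simp
  moreover have "(CLINT x|M. G T x) = complex_of_real ((LINT t:{-T..T}|lborel. (cmod (m t))\<^sup>2) / T)" for T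
    unfolding of_real_divide key G_def by simp
  ultimately have "((\<lambda>T. complex_of_real ((LINT t:{-T..T}|lborel. (cmod (m t))\<^sup>2) / T)) \<longlongrightarrow> complex_of_real 0) at_top"
    by simp
  then show ?thesis by (simp only: tendsto_of_real_iff)
qed

subsection \<open>Averages of matrix elements\<close>

text \<open>Cauchy--Schwarz in the form \<open>h \<le> \<delta> + h\<^sup>2 / \<delta>\<close>.\<close>

lemma ergodic_average_integral:
  fixes h :: "real \<Rightarrow> real"
  assumes h: "continuous_on UNIV h" "\<And>t. 0 \<le> h t"
    and lim: "((\<lambda>T. integral {-T..T} (\<lambda>t. (h t)\<^sup>2) / T) \<longlongrightarrow> 0) at_top"
  shows "((\<lambda>T. integral {-T..T} h / T) \<longlongrightarrow> 0) at_top"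
proof (rule tendstoI)
  fix e :: real assume e: "e > 0"
  have int: "h integrable_on {-T..T}" "(\<lambda>t. (h t)\<^sup>2) integrable_on {-T..T}" for T
    by (intro integrable_continuous_interval continuous_intros continuous_on_subset[OF h(1)] subset_UNIV)+
  have "\<forall>\<^sub>F T in at_top. dist (integral {-T..T} (\<lambda>t. (h t)\<^sup>2) / T) 0 < (e / 4) * (e / 4)"
    using e by (intro tendstoD[OF lim]) simp
  then show "\<forall>\<^sub>F T in at_top. dist (integral {-T..T} h / T) 0 < e"
    using eventually_gt_at_top[of 0]
  proof eventually_elim
    fix T :: real
    assume T: "T > 0" and sm: "dist (integral {-T..T} (\<lambda>t. (h t)\<^sup>2) / T) 0 < (e / 4) * (e / 4)"
    have pt: "h t \<le> e / 4 + (h t)\<^sup>2 * (4 / e)" for t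
    proof (cases "h t \<le> e / 4")
      case False
      then have "h t * 1 \<le> h t * (h t * (4 / e))" using e h(2)[of t] by (intro mult_left_mono) (simp_all add: field_simps)
      moreover have "0 < e / 4" using e by simp
      ultimately show ?thesis by (simp add: power2_eq_square)
    next
      case True
      moreover have "0 \<le> (h t)\<^sup>2 * (4 / e)" using e by simp
      ultimately show ?thesis by linarith
    qed
    have "integral {-T..T} h \<le> integral {-T..T} (\<lambda>t. e / 4 + (h t)\<^sup>2 * (4 / e))"
      by (intro integral_le int integrable_add integrable_const_ivl integrable_on_mult_left) (rule pt)
    also have "\<dots> = integral {-T..T} (\<lambda>t. e / 4) + integral {-T..T} (\<lambda>t. (h t)\<^sup>2 * (4 / e))"
      by (intro integral_add int integrable_const_ivl integrable_on_mult_left)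
    also have "\<dots> = T * (e / 2) + integral {-T..T} (\<lambda>t. (h t)\<^sup>2) * (4 / e)"
      using T by simp
    finally have "integral {-T..T} h / T \<le> e / 2 + (integral {-T..T} (\<lambda>t. (h t)\<^sup>2) / T) * (4 / e)"
      using T by (simp add: field_simps)
    moreover have "integral {-T..T} (\<lambda>t. (h t)\<^sup>2) / T < (e / 4) * (e / 4)"
      using sm unfolding dist_real_def by linarith
    then have "(integral {-T..T} (\<lambda>t. (h t)\<^sup>2) / T) * (4 / e) < (e / 4) * (e / 4) * (4 / e)"
      using e by (intro mult_strict_right_mono) auto
    ultimately have "integral {-T..T} h / T < e" using e by simp
    moreover have "0 \<le> integral {-T..T} h / T"
      using T h(2) int by (intro divide_nonneg_pos integral_nonneg) auto
    ultimately show "dist (integral {-T..T} h / T) 0 < e" by (simp add: dist_real_def)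
  qed
qed

context bounded_symmetric
begin

lemma cinner_U: "cinner \<phi> (U t \<phi>) = (CLINT x|mu \<phi>. exp (\<i> * of_real (t * x)))"
  unfolding U_def by (rule cinner_fc[OF bounded_borel_exp])

lemma Wiener_U:
  assumes "\<And>x. E {x} \<phi> = 0"
  shows "((\<lambda>T. integral {-T..T} (\<lambda>t. cmod (cinner \<phi> (U t \<phi>))) / T) \<longlongrightarrow> 0) at_top"
proof (rule ergodic_average_integral)
  show cont: "continuous_on UNIV (\<lambda>t. cmod (cinner \<phi> (U t \<phi>)))"
    by (intro continuous_intros cinner.continuous_on continuous_U)
  have "measure (mu \<phi>) {x} = 0" for x
    using cinner_E[of "{x}" \<phi>] assms[of x] by simp
  from Wiener[OF mu_props(1) sets_mu this]
  have "((\<lambda>T. (LINT t:{-T..T}|lborel. (cmod (cinner \<phi> (U t \<phi>)))\<^sup>2) / T) \<longlongrightarrow> 0) at_top"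
    unfolding cinner_U[symmetric] .
  moreover have "(LINT t:{-T..T}|lborel. (cmod (cinner \<phi> (U t \<phi>)))\<^sup>2) = integral {-T..T} (\<lambda>t. (cmod (cinner \<phi> (U t \<phi>)))\<^sup>2)" for T
    by (intro set_borel_integral_eq_integral borel_integrable_atLeastAtMost' continuous_intros
        continuous_on_subset[OF cont] subset_UNIV)
  ultimately show "((\<lambda>T. integral {-T..T} (\<lambda>t. (cmod (cinner \<phi> (U t \<phi>)))\<^sup>2) / T) \<longlongrightarrow> 0) at_top"
    by simp
qed simp

text \<open>The integral of \<open>\<bar>\<langle>y, \<phi>(r)\<rangle>\<bar>\<^sup>2\<close> is \<open>\<langle>y, w\<rangle>\<close> with \<open>w = \<integral> \<langle>\<phi>(r), y\<rangle> \<phi>(r) dr\<close>, and the norm of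
  \<open>w\<close> is controlled by the autocorrelation \<open>\<langle>\<phi>(r), \<phi>(s)\<rangle>\<close>, to which Wiener's theorem applies.\<close>

lemma matrix_element_square_bound:
  assumes \<sigma>: "\<bar>\<sigma>\<bar> = 1" and T: "T > 0"
  shows "integral {0..T} (\<lambda>r. (cmod (cinner y (U (\<sigma> * r) \<phi>)))\<^sup>2) / T
    \<le> (norm y)\<^sup>2 * norm \<phi> * sqrt (integral {-T..T} (\<lambda>t. cmod (cinner \<phi> (U t \<phi>))) / T)"
proof -
  let ?p = "\<lambda>r. U (\<sigma> * r) \<phi>"
  let ?m = "\<lambda>t. cmod (cinner \<phi> (U t \<phi>))"
  let ?I = "integral {-T..T} ?m"
  define h where "h r = cnj (cinner y (?p r))" for r
  have contp: "continuous_on S ?p" for S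
    using continuous_on_compose2[OF continuous_U[of UNIV \<phi>], of S "\<lambda>r. \<sigma> * r"] by (simp add: continuous_intros)
  have conth: "continuous_on S h" for S
    unfolding h_def by (intro continuous_intros cinner.continuous_on contp)
  have contm: "continuous_on S ?m" for S
    by (intro continuous_intros cinner.continuous_on continuous_U)
  have h_le: "cmod (h r) \<le> norm y * norm \<phi>" for r
    unfolding h_def using Cauchy_Schwarz_cinner[of y "?p r"] by simp
  have scaleC_bb: "bounded_bilinear (\<lambda>c \<psi>. c *\<^sub>C (\<psi> :: ell2))"
  proof (rule bounded_bilinear.intro)
    show "\<exists>K. \<forall>a b. norm (a *\<^sub>C (b :: ell2)) \<le> norm a * norm b * K" by (intro exI[of _ 1]) simp
  qed (auto simp: scaleC_distribs intro!: ell2_eqI simp: scaleR_conv_of_real)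
  have conthp: "continuous_on S (\<lambda>r. h r *\<^sub>C ?p r)" for S
    by (rule bounded_bilinear.continuous_on[OF scaleC_bb conth contp])
  define w where "w = integral {0..T} (\<lambda>r. h r *\<^sub>C ?p r)"
  have inner_w: "cinner v w = integral {0..T} (\<lambda>r. h r * cinner v (?p r))" for v
  proof -
    have "integral {0..T} ((\<lambda>\<psi>. cinner v \<psi>) \<circ> (\<lambda>r. h r *\<^sub>C ?p r)) = cinner v w"
      unfolding w_def by (rule integral_linear[OF integrable_continuous_interval[OF conthp] cinner.bounded_linear_right])
    then show ?thesis by (simp add: comp_def)
  qed
  have corr: "cmod (cinner (?p r) w) \<le> norm y * norm \<phi> * ?I" if r: "r \<in> {0..T}" for r
  proof -
    have m_even: "?m (- t) = ?m t" for t
    proof -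
      have "cinner \<phi> (U (- t) \<phi>) = cnj (cinner \<phi> (U t \<phi>))"
        unfolding U_adjoint[symmetric] by (rule cinner_commute)
      then show ?thesis by simp
    qed
    have m_\<sigma>: "?m (\<sigma> * t) = ?m t" for t
      using \<sigma> m_even[of t] by (cases "\<sigma> = 1") (auto simp: abs_if split: if_splits)
    have shift: "cmod (cinner (?p r) (?p s)) = ?m (s - r)" for s
    proof -
      have "cinner (?p r) (?p s) = cinner \<phi> (U (\<sigma> * (s - r)) \<phi>)"
        unfolding U_adjoint U_add[symmetric] by (simp add: algebra_simps)
      then show ?thesis using m_\<sigma> by simp
    qed
    have "cmod (cinner (?p r) w) \<le> integral {0..T} (\<lambda>s. norm y * norm \<phi> * ?m (s - r))"
      unfolding inner_w
    proof (rule integral_norm_bound_integral)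
      show "(\<lambda>s. h s * cinner (?p r) (?p s)) integrable_on {0..T}"
        by (intro integrable_continuous_interval continuous_intros conth cinner.continuous_on contp)
      show "(\<lambda>s. norm y * norm \<phi> * ?m (s - r)) integrable_on {0..T}"
        by (intro integrable_continuous_interval continuous_intros continuous_on_compose2[OF contm[of UNIV]]) auto
      show "norm (h s * cinner (?p r) (?p s)) \<le> norm y * norm \<phi> * ?m (s - r)" for s
        unfolding norm_mult shift by (intro mult_right_mono h_le) simp
    qed
    also have "\<dots> = norm y * norm \<phi> * integral {0..T} (\<lambda>s. ?m (s - r))" by simp
    also have "integral {0..T} (\<lambda>s. ?m (s - r)) = integral {0 - r..T - r} ?m"
      using integral_shift_Icc_real[of 0 T ?m "- r"] by (simp add: comp_def)
    also have "\<dots> \<le> ?I"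
      using r by (intro integral_subset_le integrable_continuous_interval contm) auto
    finally show ?thesis by (simp add: mult_left_mono)
  qed
  have I0: "?I \<ge> 0" by (intro integral_nonneg integrable_continuous_interval contm) simp
  have "(norm w)\<^sup>2 = cmod (cinner w w)" unfolding cinner_self norm_of_real by simp
  also have "\<dots> \<le> integral {0..T} (\<lambda>r. (norm y * norm \<phi>) * (norm y * norm \<phi> * ?I))"
    unfolding inner_w
  proof (rule integral_norm_bound_integral)
    show "(\<lambda>r. h r * cinner w (?p r)) integrable_on {0..T}"
      by (intro integrable_continuous_interval continuous_intros conth cinner.continuous_on contp)
    fix r assume r: "r \<in> {0..T}"
    have "cmod (cinner w (?p r)) = cmod (cinner (?p r) w)" by (subst cinner_commute) simp
    then show "norm (h r * cinner w (?p r)) \<le> (norm y * norm \<phi>) * (norm y * norm \<phi> * ?I)"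
      unfolding norm_mult using corr[OF r] by (intro mult_mono h_le) auto
  qed (rule integrable_const_ivl)
  also have "\<dots> = (norm y * norm \<phi>)\<^sup>2 * (T * ?I)" using T by (simp add: power2_eq_square mult_ac)
  finally have "norm w \<le> sqrt ((norm y * norm \<phi>)\<^sup>2 * (T * ?I))" by (rule real_le_rsqrt)
  also have "\<dots> = norm y * norm \<phi> * sqrt (T * ?I)" by (simp add: real_sqrt_mult)
  finally have w_le: "norm w \<le> norm y * norm \<phi> * sqrt (T * ?I)" .
  have "complex_of_real (integral {0..T} (\<lambda>r. (cmod (cinner y (?p r)))\<^sup>2)) = cinner y w"
  proof -
    have "integral {0..T} (of_real \<circ> (\<lambda>r. (cmod (cinner y (?p r)))\<^sup>2))
        = complex_of_real (integral {0..T} (\<lambda>r. (cmod (cinner y (?p r)))\<^sup>2))"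
      by (intro integral_linear bounded_linear_of_real integrable_continuous_interval continuous_intros
          cinner.continuous_on contp)
    then show ?thesis
      unfolding inner_w comp_def complex_norm_square by (simp add: h_def mult.commute)
  qed
  then have "integral {0..T} (\<lambda>r. (cmod (cinner y (?p r)))\<^sup>2) \<le> cmod (cinner y w)"
    by (metis abs_ge_self norm_of_real)
  also have "\<dots> \<le> norm y * norm w" by (rule Cauchy_Schwarz_cinner)
  also have "\<dots> \<le> norm y * (norm y * norm \<phi> * sqrt (T * ?I))" by (intro mult_left_mono w_le) simp
  finally have "integral {0..T} (\<lambda>r. (cmod (cinner y (?p r)))\<^sup>2) / T \<le> (norm y)\<^sup>2 * norm \<phi> * (sqrt (T * ?I) / T)"
    using T by (simp add: divide_right_mono power2_eq_square mult_ac)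
  also have "sqrt (T * ?I) / T = sqrt (?I / T)"
    using T by (simp add: real_sqrt_mult real_sqrt_divide field_simps)
  finally show ?thesis .
qed

lemma matrix_element_average:
  assumes atomless: "\<And>x. E {x} \<phi> = 0" and \<sigma>: "\<bar>\<sigma>\<bar> = 1"
  shows "((\<lambda>T. integral {0..T} (\<lambda>r. cmod (cinner y (U (\<sigma> * r) \<phi>))) / T) \<longlongrightarrow> 0) at_top"
proof -
  define h where "h t = (if t \<ge> 0 then cmod (cinner y (U (\<sigma> * t) \<phi>)) else cmod (cinner y (U (- \<sigma> * t) \<phi>)))" for t
  have contp: "continuous_on S (\<lambda>r. U (s * r) \<phi>)" for S s
    using continuous_on_compose2[OF continuous_U[of UNIV \<phi>], of S "\<lambda>r. s * r"] by (simp add: continuous_intros)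
  have contq: "continuous_on S (\<lambda>r. cmod (cinner y (U (s * r) \<phi>)))" for S s
    by (intro continuous_intros cinner.continuous_on contp)
  have h_abs: "h t = cmod (cinner y (U (\<sigma> * \<bar>t\<bar>) \<phi>))" for t
    by (simp add: h_def abs_if)
  have conth: "continuous_on UNIV h"
    unfolding h_abs[abs_def] using continuous_on_compose2[OF contq[of UNIV \<sigma>], of UNIV abs]
    by (simp add: continuous_intros)
  have double: "integral {-T..T} g = 2 * integral {0..T} g"
    if g: "continuous_on UNIV g" "\<And>t. g (- t) = g t" and T: "T \<ge> 0" for g :: "real \<Rightarrow> real" and T
  proof -
    have "integral {-T..T} g = integral {-T..0} g + integral {0..T} g"
      using T by (intro Henstock_Kurzweil_Integration.integral_combine[symmetric] integrable_continuous_interval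
          continuous_on_subset[OF g(1)]) auto
    also have "integral {-T..0} g = integral {0..T} (\<lambda>t. g (- t))"
      using Henstock_Kurzweil_Integration.integral_reflect_real[of T 0 "\<lambda>t. g (- t)"] by simp
    finally show ?thesis by (simp add: g(2))
  qed
  have "((\<lambda>T. integral {-T..T} (\<lambda>t. (h t)\<^sup>2) / T) \<longlongrightarrow> 0) at_top"
  proof (rule Lim_null_comparison)
    show "\<forall>\<^sub>F T in at_top. norm (integral {-T..T} (\<lambda>t. (h t)\<^sup>2) / T)
        \<le> 2 * ((norm y)\<^sup>2 * norm \<phi> * sqrt (integral {-T..T} (\<lambda>t. cmod (cinner \<phi> (U t \<phi>))) / T))"
      using eventually_gt_at_top[of 0]
    proof eventually_elim
      fix T :: real assume T: "T > 0"
      have "integral {-T..T} (\<lambda>t. (h t)\<^sup>2) = 2 * integral {0..T} (\<lambda>t. (h t)\<^sup>2)"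
        using T by (intro double continuous_intros conth) (simp_all add: h_abs)
      also have "integral {0..T} (\<lambda>t. (h t)\<^sup>2) = integral {0..T} (\<lambda>t. (cmod (cinner y (U (\<sigma> * t) \<phi>)))\<^sup>2)"
        by (rule Henstock_Kurzweil_Integration.integral_cong) (simp add: h_def)
      finally have eq: "integral {-T..T} (\<lambda>t. (h t)\<^sup>2) = 2 * integral {0..T} (\<lambda>t. (cmod (cinner y (U (\<sigma> * t) \<phi>)))\<^sup>2)" .
      have "0 \<le> integral {-T..T} (\<lambda>t. (h t)\<^sup>2)"
        by (intro integral_nonneg integrable_continuous_interval continuous_intros continuous_on_subset[OF conth]) auto
      then have "norm (integral {-T..T} (\<lambda>t. (h t)\<^sup>2) / T) = integral {-T..T} (\<lambda>t. (h t)\<^sup>2) / T"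
        using T by simp
      also have "\<dots> = 2 * (integral {0..T} (\<lambda>t. (cmod (cinner y (U (\<sigma> * t) \<phi>)))\<^sup>2) / T)" by (simp add: eq)
      also have "\<dots> \<le> 2 * ((norm y)\<^sup>2 * norm \<phi> * sqrt (integral {-T..T} (\<lambda>t. cmod (cinner \<phi> (U t \<phi>))) / T))"
        by (intro mult_left_mono matrix_element_square_bound \<sigma> T) simp
      finally show "norm (integral {-T..T} (\<lambda>t. (h t)\<^sup>2) / T)
        \<le> 2 * ((norm y)\<^sup>2 * norm \<phi> * sqrt (integral {-T..T} (\<lambda>t. cmod (cinner \<phi> (U t \<phi>))) / T))" .
    qed
    have "((\<lambda>T. 2 * ((norm y)\<^sup>2 * norm \<phi> * sqrt (integral {-T..T} (\<lambda>t. cmod (cinner \<phi> (U t \<phi>))) / T)))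
        \<longlongrightarrow> 2 * ((norm y)\<^sup>2 * norm \<phi> * sqrt 0)) at_top"
      by (intro tendsto_intros Wiener_U atomless)
    then show "((\<lambda>T. 2 * ((norm y)\<^sup>2 * norm \<phi> * sqrt (integral {-T..T} (\<lambda>t. cmod (cinner \<phi> (U t \<phi>))) / T)))
        \<longlongrightarrow> 0) at_top" by simp
  qed
  then have lim: "((\<lambda>T. integral {-T..T} h / T) \<longlongrightarrow> 0) at_top"
    by (rule ergodic_average_integral[OF conth, rotated]) (simp add: h_def)
  then have lim2: "((\<lambda>T. (1/2) * (integral {-T..T} h / T)) \<longlongrightarrow> 0) at_top"
    using tendsto_mult_left[OF lim, of "1/2"] by simp
  have "\<forall>\<^sub>F T in at_top. (1/2) * (integral {-T..T} h / T) = integral {0..T} (\<lambda>r. cmod (cinner y (U (\<sigma> * r) \<phi>))) / T"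
    using eventually_gt_at_top[of 0]
  proof eventually_elim
    fix T :: real assume T: "T > 0"
    have "integral {-T..T} h = 2 * integral {0..T} h"
      using T by (intro double conth) (simp_all add: h_abs)
    also have "integral {0..T} h = integral {0..T} (\<lambda>r. cmod (cinner y (U (\<sigma> * r) \<phi>)))"
      by (rule Henstock_Kurzweil_Integration.integral_cong) (simp add: h_def)
    finally show "(1/2) * (integral {-T..T} h / T) = integral {0..T} (\<lambda>r. cmod (cinner y (U (\<sigma> * r) \<phi>))) / T" by simp
  qed
  with lim2 show ?thesis by (rule Lim_transform_eventually)
qed

text \<open>A nonzero \<open>E {x} \<phi>\<close> would be an eigenvector that is not orthogonal to \<open>\<phi>\<close>.\<close>

lemma continuous_subspace_atomless:
  assumes "\<phi> \<in> continuous_subspace H"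
  shows "E {x} \<phi> = 0"
proof (rule ccontr)
  assume ne: "E {x} \<phi> \<noteq> 0"
  note bb = bounded_borel_indicator[of "{x}", simplified]
  have "H (E {x} \<phi>) = fc (\<lambda>y. of_real (clamp_K K y) * of_real (indicator {x} y)) \<phi>"
    unfolding E_def using fc_mult[OF bounded_borel_clamp_power[of 1, simplified] bb] by (simp add: fc_clamp)
  also have "(\<lambda>y. complex_of_real (clamp_K K y) * complex_of_real (indicator {x} y))
      = (\<lambda>y. complex_of_real (clamp_K K x) * complex_of_real (indicator {x} y))"
    by (auto simp: indicator_def)
  also have "fc \<dots> \<phi> = complex_of_real (clamp_K K x) *\<^sub>C E {x} \<phi>"
    unfolding E_def by (rule fc_cmult[OF bb])
  finally have "E {x} \<phi> \<in> eigenvectors H" using ne unfolding eigenvectors_def by blast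
  then have "E {x} \<phi> \<in> closure (span (eigenvectors H))"
    using span_base closure_subset by blast
  then have "cinner (E {x} \<phi>) \<phi> = 0" using assms by (auto simp: continuous_subspace_def)
  then have "cinner \<phi> (E {x} \<phi>) = 0"
    using symmetric_opD[OF pvmD(2)[OF pvm_E], of "{x}" \<phi> \<phi>] by simp
  then have "norm (E {x} \<phi>) = 0" using pvm_cinner[OF pvm_E, of "{x}" \<phi>] by simp
  with ne show False by simp
qed

end

section \<open>Operators that are small on weakly null families\<close>

text \<open>Small if \<open>\<phi>\<close> is close to \<open>0\<close> in the weak topology.\<close>

definition weak_size :: "ell2 list \<Rightarrow> ell2 \<Rightarrow> real" where
  "weak_size ys \<phi> = (\<Sum>y\<leftarrow>ys. cmod (cinner y \<phi>))"

lemma weak_size_simps [simp]: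
  "weak_size [] \<phi> = 0" "weak_size (y # ys) \<phi> = cmod (cinner y \<phi>) + weak_size ys \<phi>"
  "weak_size (ys @ zs) \<phi> = weak_size ys \<phi> + weak_size zs \<phi>"
  by (simp_all add: weak_size_def)

lemma weak_size_nonneg: "0 \<le> weak_size ys \<phi>"
  by (induction ys) auto

lemma weak_size_member: "y \<in> set ys \<Longrightarrow> cmod (cinner y \<phi>) \<le> weak_size ys \<phi>"
  by (induction ys) (auto intro: add_increasing add_increasing2 weak_size_nonneg)

lemma weak_size_scaleR: "0 \<le> r \<Longrightarrow> weak_size (map (\<lambda>y. r *\<^sub>R y) ys) \<phi> = r * weak_size ys \<phi>"
  by (induction ys) (auto simp: norm_mult algebra_simps)

lemma weak_size_map:
  "(\<And>y. cinner (B y) \<phi> = cinner y \<psi>) \<Longrightarrow> weak_size (map B ys) \<phi> = weak_size ys \<psi>"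
  by (induction ys) auto

text \<open>This is compactness in the form in which time averages use it: up to \<open>\<epsilon>\<close> the size of
  \<open>L \<phi>\<close> is controlled by finitely many matrix elements of \<open>\<phi>\<close>.\<close>

definition compact_bound :: "(ell2 \<Rightarrow> ell2) \<Rightarrow> bool" where
  "compact_bound L \<longleftrightarrow> (\<forall>\<epsilon>>0. \<exists>ys. \<forall>\<phi>. norm (L \<phi>) \<le> \<epsilon> * norm \<phi> + weak_size ys \<phi>)"

lemma compact_boundD:
  assumes "compact_bound L" "\<epsilon> > 0"
  obtains ys where "\<And>\<phi>. norm (L \<phi>) \<le> \<epsilon> * norm \<phi> + weak_size ys \<phi>"
  using assms unfolding compact_bound_def by blast

lemma compact_bound_zero: "compact_bound (\<lambda>\<phi>. 0)"
  unfolding compact_bound_def by (auto intro!: exI[of _ "[]"])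

lemma compact_bound_add:
  assumes "compact_bound L" "compact_bound M"
  shows "compact_bound (\<lambda>\<phi>. L \<phi> + M \<phi>)"
  unfolding compact_bound_def
proof (intro allI impI)
  fix \<epsilon> :: real assume e: "\<epsilon> > 0"
  obtain ys where ys: "\<And>\<phi>. norm (L \<phi>) \<le> \<epsilon> / 2 * norm \<phi> + weak_size ys \<phi>"
    using compact_boundD[OF assms(1), of "\<epsilon> / 2"] e by auto
  obtain zs where zs: "\<And>\<phi>. norm (M \<phi>) \<le> \<epsilon> / 2 * norm \<phi> + weak_size zs \<phi>"
    using compact_boundD[OF assms(2), of "\<epsilon> / 2"] e by auto
  have "norm (L \<phi> + M \<phi>) \<le> \<epsilon> * norm \<phi> + weak_size (ys @ zs) \<phi>" for \<phi>
    using norm_triangle_ineq[of "L \<phi>" "M \<phi>"] ys[of \<phi>] zs[of \<phi>] by simp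
  then show "\<exists>ys. \<forall>\<phi>. norm (L \<phi> + M \<phi>) \<le> \<epsilon> * norm \<phi> + weak_size ys \<phi>" by blast
qed

lemma compact_bound_left:
  assumes L: "compact_bound L" and B: "bounded_op B"
  shows "compact_bound (\<lambda>\<phi>. B (L \<phi>))"
  unfolding compact_bound_def
proof (intro allI impI)
  fix \<epsilon> :: real assume e: "\<epsilon> > 0"
  obtain K where K: "K > 0" "\<And>\<psi>. norm (B \<psi>) \<le> norm \<psi> * K" using bounded_op_bound[OF B] by blast
  obtain ys where ys: "\<And>\<phi>. norm (L \<phi>) \<le> \<epsilon> / K * norm \<phi> + weak_size ys \<phi>"
    using compact_boundD[OF L, of "\<epsilon> / K"] e K by auto
  have "norm (B (L \<phi>)) \<le> \<epsilon> * norm \<phi> + weak_size (map (\<lambda>y. K *\<^sub>R y) ys) \<phi>" for \<phi>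
  proof -
    have "norm (B (L \<phi>)) \<le> norm (L \<phi>) * K" by (rule K)
    also have "\<dots> \<le> (\<epsilon> / K * norm \<phi> + weak_size ys \<phi>) * K"
      using K by (intro mult_right_mono ys) simp
    also have "\<dots> = \<epsilon> * norm \<phi> + K * weak_size ys \<phi>" using K by (simp add: field_simps)
    finally show ?thesis using K by (simp add: weak_size_scaleR)
  qed
  then show "\<exists>ys. \<forall>\<phi>. norm (B (L \<phi>)) \<le> \<epsilon> * norm \<phi> + weak_size ys \<phi>" by blast
qed

text \<open>The adjoint of \<open>B\<close> moves the test vectors.\<close>

lemma compact_bound_right:
  assumes L: "compact_bound L" and B: "bounded_op B"
  shows "compact_bound (\<lambda>\<phi>. L (B \<phi>))"
  unfolding compact_bound_def
proof (intro allI impI)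
  fix \<epsilon> :: real assume e: "\<epsilon> > 0"
  obtain K where K: "K > 0" "\<And>\<psi>. norm (B \<psi>) \<le> norm \<psi> * K" using bounded_op_bound[OF B] by blast
  obtain B' where "bounded_op B'" and B': "\<And>\<phi> \<psi>. cinner (B \<phi>) \<psi> = cinner \<phi> (B' \<psi>)"
    using bounded_op_adjoint[OF B] by blast
  have adj: "cinner (B' y) \<phi> = cinner y (B \<phi>)" for y \<phi>
    unfolding cinner_commute[of "B' y" \<phi>] B'[symmetric] by (rule cinner_commute[symmetric])
  obtain ys where ys: "\<And>\<phi>. norm (L \<phi>) \<le> \<epsilon> / K * norm \<phi> + weak_size ys \<phi>"
    using compact_boundD[OF L, of "\<epsilon> / K"] e K by auto
  have "norm (L (B \<phi>)) \<le> \<epsilon> * norm \<phi> + weak_size (map B' ys) \<phi>" for \<phi>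
  proof -
    have "norm (L (B \<phi>)) \<le> \<epsilon> / K * norm (B \<phi>) + weak_size ys (B \<phi>)" by (rule ys)
    also have "\<epsilon> / K * norm (B \<phi>) \<le> \<epsilon> / K * (norm \<phi> * K)"
      using e K by (intro mult_left_mono) auto
    also have "weak_size ys (B \<phi>) = weak_size (map B' ys) \<phi>"
      by (rule weak_size_map[symmetric]) (rule adj)
    finally show ?thesis using K by simp
  qed
  then show "\<exists>ys. \<forall>\<phi>. norm (L (B \<phi>)) \<le> \<epsilon> * norm \<phi> + weak_size ys \<phi>" by blast
qed

lemma compact_bound_minus: "compact_bound L \<Longrightarrow> compact_bound (\<lambda>\<phi>. - L \<phi>)"
  by (simp add: compact_bound_def)

lemma compact_bound_diff:
  "compact_bound L \<Longrightarrow> compact_bound M \<Longrightarrow> compact_bound (\<lambda>\<phi>. L \<phi> - M \<phi>)"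
  using compact_bound_add[OF _ compact_bound_minus, of L M] by simp

lemma compact_bound_scaleC: "compact_bound L \<Longrightarrow> compact_bound (\<lambda>\<phi>. c *\<^sub>C L \<phi>)"
  by (rule compact_bound_left[OF _ bounded_op_scaleC[OF bounded_op_id]])

text \<open>The analogous notion for quadratic forms, in a shape that is homogeneous of degree two.\<close>

definition compact_form :: "(ell2 \<Rightarrow> real) \<Rightarrow> bool" where
  "compact_form k \<longleftrightarrow> (\<forall>\<epsilon>>0. \<exists>ys. \<forall>\<phi>. \<bar>k \<phi>\<bar> \<le> \<epsilon> * (norm \<phi>)\<^sup>2 + norm \<phi> * weak_size ys \<phi>)"

lemma compact_formD:
  assumes "compact_form k" "\<epsilon> > 0"
  obtains ys where "\<And>\<phi>. \<bar>k \<phi>\<bar> \<le> \<epsilon> * (norm \<phi>)\<^sup>2 + norm \<phi> * weak_size ys \<phi>"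
  using assms unfolding compact_form_def by blast

lemma compact_form_add:
  assumes "compact_form k" "compact_form l"
  shows "compact_form (\<lambda>\<phi>. k \<phi> + l \<phi>)"
  unfolding compact_form_def
proof (intro allI impI)
  fix \<epsilon> :: real assume e: "\<epsilon> > 0"
  obtain ys where ys: "\<And>\<phi>. \<bar>k \<phi>\<bar> \<le> \<epsilon> / 2 * (norm \<phi>)\<^sup>2 + norm \<phi> * weak_size ys \<phi>"
    using compact_formD[OF assms(1), of "\<epsilon> / 2"] e by auto
  obtain zs where zs: "\<And>\<phi>. \<bar>l \<phi>\<bar> \<le> \<epsilon> / 2 * (norm \<phi>)\<^sup>2 + norm \<phi> * weak_size zs \<phi>"
    using compact_formD[OF assms(2), of "\<epsilon> / 2"] e by auto
  have "\<bar>k \<phi> + l \<phi>\<bar> \<le> \<epsilon> * (norm \<phi>)\<^sup>2 + norm \<phi> * weak_size (ys @ zs) \<phi>" for \<phi>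
    using ys[of \<phi>] zs[of \<phi>] abs_triangle_ineq[of "k \<phi>" "l \<phi>"] by (simp add: algebra_simps)
  then show "\<exists>ys. \<forall>\<phi>. \<bar>k \<phi> + l \<phi>\<bar> \<le> \<epsilon> * (norm \<phi>)\<^sup>2 + norm \<phi> * weak_size ys \<phi>" by blast
qed

lemma compact_bound_imp_form:
  assumes "compact_bound L"
  shows "compact_form (\<lambda>\<phi>. cmod (cinner \<phi> (L \<phi>)))"
  unfolding compact_form_def
proof (intro allI impI)
  fix \<epsilon> :: real assume "\<epsilon> > 0"
  then obtain ys where ys: "\<And>\<phi>. norm (L \<phi>) \<le> \<epsilon> * norm \<phi> + weak_size ys \<phi>"
    using compact_boundD[OF assms, of \<epsilon>] by auto
  have "\<bar>cmod (cinner \<phi> (L \<phi>))\<bar> \<le> \<epsilon> * (norm \<phi>)\<^sup>2 + norm \<phi> * weak_size ys \<phi>" for \<phi>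
  proof -
    have "cmod (cinner \<phi> (L \<phi>)) \<le> norm \<phi> * norm (L \<phi>)" by (rule Cauchy_Schwarz_cinner)
    also have "\<dots> \<le> norm \<phi> * (\<epsilon> * norm \<phi> + weak_size ys \<phi>)" by (intro mult_left_mono ys) simp
    finally show ?thesis by (simp add: algebra_simps power2_eq_square)
  qed
  then show "\<exists>ys. \<forall>\<phi>. \<bar>cmod (cinner \<phi> (L \<phi>))\<bar> \<le> \<epsilon> * (norm \<phi>)\<^sup>2 + norm \<phi> * weak_size ys \<phi>" by blast
qed

lemma compact_op_net:
  assumes C: "compact_op C" and e: "e > 0"
  obtains ys where "\<And>\<phi>. norm \<phi> \<le> 1 \<Longrightarrow> \<exists>y\<in>set ys. norm (C \<phi> - y) < e"
proof -
  have "compact (closure (C ` cball 0 1))"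
    using C unfolding compact_op_def by simp
  then obtain k where k: "finite k" "closure (C ` cball 0 1) \<subseteq> (\<Union>x\<in>k. ball x e)"
    using e unfolding compact_eq_totally_bounded by meson
  obtain ys where ys: "set ys = k" using finite_list[OF k(1)] by blast
  have "\<exists>y\<in>set ys. norm (C \<phi> - y) < e" if "norm \<phi> \<le> 1" for \<phi>
  proof -
    have "C \<phi> \<in> closure (C ` cball 0 1)" using that closure_subset by (force simp: dist_norm)
    then obtain y where "y \<in> k" "C \<phi> \<in> ball y e" using k(2) by blast
    then show ?thesis using ys by (auto simp: dist_norm norm_minus_commute)
  qed
  then show ?thesis by (rule that)
qed

text \<open>Replace \<open>C \<phi>\<close> for unit vectors \<open>\<phi>\<close> by the nearest point of a finite net of the compact image of the ball.\<close>

lemma compact_op_form: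
  assumes C: "compact_op C" and B: "bounded_op B"
  shows "compact_form (\<lambda>\<phi>. cmod (cinner \<phi> (B (C \<phi>))))"
  unfolding compact_form_def
proof (intro allI impI)
  fix \<epsilon> :: real assume e: "\<epsilon> > 0"
  have bC: "bounded_op C" using C by (simp add: compact_op_def)
  obtain K where K: "K > 0" "\<And>\<psi>. norm (B \<psi>) \<le> norm \<psi> * K" using bounded_op_bound[OF B] by blast
  obtain ys where ys: "\<And>\<phi>. norm \<phi> \<le> 1 \<Longrightarrow> \<exists>y\<in>set ys. norm (C \<phi> - y) < \<epsilon> / K"
    using compact_op_net[OF C, of "\<epsilon> / K"] e K by auto
  have unit: "cmod (cinner \<phi> (B (C \<phi>))) \<le> \<epsilon> + weak_size (map B ys) \<phi>" if n1: "norm \<phi> = 1" for \<phi>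
  proof -
    obtain y where y: "y \<in> set ys" "norm (C \<phi> - y) < \<epsilon> / K" using ys[of \<phi>] n1 by auto
    have "cinner \<phi> (B (C \<phi>)) = cinner \<phi> (B (C \<phi> - y)) + cinner \<phi> (B y)"
      by (simp add: bounded_op_simps[OF B] cinner_diff_right)
    then have "cmod (cinner \<phi> (B (C \<phi>))) \<le> cmod (cinner \<phi> (B (C \<phi> - y))) + cmod (cinner \<phi> (B y))"
      using norm_triangle_ineq by metis
    also have "cmod (cinner \<phi> (B (C \<phi> - y))) \<le> norm (B (C \<phi> - y))"
      using Cauchy_Schwarz_cinner[of \<phi> "B (C \<phi> - y)"] n1 by simp
    also have "\<dots> \<le> norm (C \<phi> - y) * K" by (rule K)
    also have "\<dots> \<le> \<epsilon> / K * K" using y K by (intro mult_right_mono) auto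
    also have "cmod (cinner \<phi> (B y)) = cmod (cinner (B y) \<phi>)" by (subst cinner_commute) simp
    also have "\<dots> \<le> weak_size (map B ys) \<phi>" using y by (intro weak_size_member) auto
    finally show ?thesis using K by simp
  qed
  have "\<bar>cmod (cinner \<phi> (B (C \<phi>)))\<bar> \<le> \<epsilon> * (norm \<phi>)\<^sup>2 + norm \<phi> * weak_size (map B ys) \<phi>" for \<phi>
  proof (cases "\<phi> = 0")
    case True then show ?thesis by (simp add: weak_size_nonneg)
  next
    case False
    define r where "r = norm \<phi>"
    have r: "r > 0" using False by (simp add: r_def)
    define u where "u = (1 / r) *\<^sub>R \<phi>"
    have \<phi>: "\<phi> = r *\<^sub>R u" using r by (simp add: u_def)
    have "norm u = 1" using r by (simp add: u_def r_def)
    from mult_left_mono[OF unit[OF this], of "r * r"] r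
    have "r * r * cmod (cinner u (B (C u))) \<le> r * r * (\<epsilon> + weak_size (map B ys) u)" by simp
    moreover have "weak_size (map B ys) \<phi> = r * weak_size (map B ys) u"
      unfolding \<phi> using r by (induction ys) (auto simp: norm_mult algebra_simps)
    moreover have "cmod (cinner \<phi> (B (C \<phi>))) = r * r * cmod (cinner u (B (C u)))"
      unfolding \<phi> using r by (simp add: bounded_op_simps[OF B] bounded_op_simps[OF bC] norm_mult)
    ultimately have "cmod (cinner \<phi> (B (C \<phi>))) \<le> \<epsilon> * (norm \<phi>)\<^sup>2 + norm \<phi> * weak_size (map B ys) \<phi>"
      by (simp add: r_def[symmetric] power2_eq_square algebra_simps)
    then show ?thesis by simp
  qed
  then show "\<exists>ys. \<forall>\<phi>. \<bar>cmod (cinner \<phi> (B (C \<phi>)))\<bar> \<le> \<epsilon> * (norm \<phi>)\<^sup>2 + norm \<phi> * weak_size ys \<phi>" by blast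
qed

text \<open>For symmetric \<open>V\<close> one has \<open>\<parallel>V \<phi>\<parallel>\<^sup>2 = \<langle>\<phi>, V (V \<phi>)\<rangle>\<close>, which is a compact form.\<close>

lemma compact_symmetric_bound:
  assumes V: "compact_op V" "symmetric_op V"
  shows "compact_bound V"
  unfolding compact_bound_def
proof (intro allI impI)
  fix \<epsilon> :: real assume e: "\<epsilon> > 0"
  have bV: "bounded_op V" using V(1) by (simp add: compact_op_def)
  obtain ys where ys: "\<And>\<phi>. \<bar>cmod (cinner \<phi> (V (V \<phi>)))\<bar> \<le> \<epsilon>\<^sup>2 * (norm \<phi>)\<^sup>2 + norm \<phi> * weak_size ys \<phi>"
    using compact_formD[OF compact_op_form[OF V(1) bV], of "\<epsilon>\<^sup>2"] e by auto
  let ?ys = "map (\<lambda>y. (1 / \<epsilon>) *\<^sub>R y) ys"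
  have "norm (V \<phi>) \<le> \<epsilon> * norm \<phi> + weak_size ?ys \<phi>" for \<phi>
  proof (rule power2_le_imp_le)
    have w: "weak_size ?ys \<phi> = weak_size ys \<phi> / \<epsilon>"
      using e by (simp add: weak_size_scaleR)
    have "complex_of_real ((norm (V \<phi>))\<^sup>2) = cinner \<phi> (V (V \<phi>))"
      unfolding cinner_self[symmetric] by (rule symmetric_opD[OF V(2)])
    from arg_cong[OF this, of cmod] have "(norm (V \<phi>))\<^sup>2 = cmod (cinner \<phi> (V (V \<phi>)))"
      unfolding norm_of_real by simp
    also have "\<dots> \<le> \<epsilon>\<^sup>2 * (norm \<phi>)\<^sup>2 + norm \<phi> * weak_size ys \<phi>" using ys[of \<phi>] by simp
    also have "\<dots> \<le> (\<epsilon> * norm \<phi> + weak_size ys \<phi> / \<epsilon>)\<^sup>2"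
    proof -
      have "(\<epsilon> * norm \<phi> + weak_size ys \<phi> / \<epsilon>)\<^sup>2
          = \<epsilon>\<^sup>2 * (norm \<phi>)\<^sup>2 + 2 * (norm \<phi> * weak_size ys \<phi>) + (weak_size ys \<phi> / \<epsilon>)\<^sup>2"
        using e by (simp add: power2_sum power_mult_distrib)
      moreover have "0 \<le> norm \<phi> * weak_size ys \<phi>" by (simp add: weak_size_nonneg)
      ultimately show ?thesis using zero_le_power2[of "weak_size ys \<phi> / \<epsilon>"] by linarith
    qed
    finally show "(norm (V \<phi>))\<^sup>2 \<le> (\<epsilon> * norm \<phi> + weak_size ?ys \<phi>)\<^sup>2" by (simp only: w)
    show "0 \<le> \<epsilon> * norm \<phi> + weak_size ?ys \<phi>" using e by (simp add: weak_size_nonneg)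
  qed
  then show "\<exists>ys. \<forall>\<phi>. norm (V \<phi>) \<le> \<epsilon> * norm \<phi> + weak_size ys \<phi>" by blast
qed

lemma AM_GM_weighted: "a * b \<le> \<epsilon> * a\<^sup>2 / 2 + b\<^sup>2 / (2 * \<epsilon>)" if "\<epsilon> > 0" for a b \<epsilon> :: real
proof -
  have "0 \<le> (\<epsilon> * a - b)\<^sup>2 / (2 * \<epsilon>)" using that by simp
  also have "\<dots> = \<epsilon> * a\<^sup>2 / 2 + b\<^sup>2 / (2 * \<epsilon>) - a * b"
    using that by (simp add: power2_eq_square field_simps)
  finally show ?thesis by simp
qed

lemma summable_inverse_squares: "summable (\<lambda>k. (1 / real k)\<^sup>2)"
  using inverse_power_summable[of 2] by (simp add: power_one_over field_simps)

text \<open>The term \<open>k = 0\<close> vanishes because division by \<open>0\<close> gives \<open>0\<close>.\<close>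

lemma summable_coord_over_n: "summable (\<lambda>k. cmod (coord \<phi> k) / real k)"
proof (rule summable_comparison_test')
    show "summable (\<lambda>k. 1 * (cmod (coord \<phi> k))\<^sup>2 / 2 + (1 / real k)\<^sup>2 / (2 * 1))"
      by (intro summable_add summable_divide summable_mult coord_summable summable_inverse_squares)
    show "norm (cmod (coord \<phi> k) / real k) \<le> 1 * (cmod (coord \<phi> k))\<^sup>2 / 2 + (1 / real k)\<^sup>2 / (2 * 1)" for k
      using AM_GM_weighted[of 1 "cmod (coord \<phi> k)" "1 / real k"] by simp
  qed

lemma suminf_coord_over_n_tail:
  assumes e: "\<epsilon> > 0"
  shows "\<exists>N. \<forall>\<phi>. (\<Sum>k. cmod (coord \<phi> k) / real k) \<le> \<epsilon> * norm \<phi> + (\<Sum>k\<le>N. cmod (coord \<phi> k))"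
proof -
  note s2 = summable_inverse_squares and sm = summable_coord_over_n and am = AM_GM_weighted
  have "(\<lambda>N. \<Sum>k. (1 / real (k + N))\<^sup>2) \<longlonglongrightarrow> 0" by (rule suminf_exist_split2[OF s2])
  from LIMSEQ_Suc[OF this] have "\<forall>\<^sub>F N in sequentially. (\<Sum>k. (1 / real (k + Suc N))\<^sup>2) < \<epsilon>\<^sup>2"
    using e by (intro order_tendstoD(2)) auto
  then obtain N where N: "(\<Sum>k. (1 / real (k + Suc N))\<^sup>2) < \<epsilon>\<^sup>2"
    unfolding eventually_sequentially by blast
  have "(\<Sum>k. cmod (coord \<phi> k) / real k) \<le> \<epsilon> * norm \<phi> + (\<Sum>k\<le>N. cmod (coord \<phi> k))" for \<phi>
  proof (cases "\<phi> = 0")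
    case False
    define r where "r = norm \<phi>"
    have r: "r > 0" using False by (simp add: r_def)
    have sh: "summable (\<lambda>k. f (k + Suc N))" if "summable f" for f :: "nat \<Rightarrow> real"
      using that by (subst summable_iff_shift)
    have "(\<Sum>k. cmod (coord \<phi> k) / real k)
        = (\<Sum>k. cmod (coord \<phi> (k + Suc N)) / real (k + Suc N)) + (\<Sum>k<Suc N. cmod (coord \<phi> k) / real k)"
      by (rule suminf_split_initial_segment[OF sm])
    also have "(\<Sum>k<Suc N. cmod (coord \<phi> k) / real k) \<le> (\<Sum>k<Suc N. cmod (coord \<phi> k))"
    proof (rule sum_mono)
      fix k show "cmod (coord \<phi> k) / real k \<le> cmod (coord \<phi> k)"
        by (cases "k = 0") (auto simp: divide_le_eq intro: mult_right_le_one_le[where y = 1, simplified] simp: mult_le_cancel_left1)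
    qed
    also have "(\<Sum>k<Suc N. cmod (coord \<phi> k)) = (\<Sum>k\<le>N. cmod (coord \<phi> k))" by (simp add: lessThan_Suc_atMost)
    also have "(\<Sum>k. cmod (coord \<phi> (k + Suc N)) / real (k + Suc N))
        \<le> (\<Sum>k. (\<epsilon> / r) * (cmod (coord \<phi> (k + Suc N)))\<^sup>2 / 2 + (1 / real (k + Suc N))\<^sup>2 / (2 * (\<epsilon> / r)))"
    proof (rule suminf_le)
      show "cmod (coord \<phi> (k + Suc N)) / real (k + Suc N)
        \<le> (\<epsilon> / r) * (cmod (coord \<phi> (k + Suc N)))\<^sup>2 / 2 + (1 / real (k + Suc N))\<^sup>2 / (2 * (\<epsilon> / r))" for k
        using am[of "\<epsilon> / r" "cmod (coord \<phi> (k + Suc N))" "1 / real (k + Suc N)"] e r by simp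
      show "summable (\<lambda>k. cmod (coord \<phi> (k + Suc N)) / real (k + Suc N))" by (rule sh[OF sm])
      show "summable (\<lambda>k. (\<epsilon> / r) * (cmod (coord \<phi> (k + Suc N)))\<^sup>2 / 2 + (1 / real (k + Suc N))\<^sup>2 / (2 * (\<epsilon> / r)))"
        by (intro summable_add summable_divide summable_mult sh[OF coord_summable] sh[OF s2])
    qed
    also have "\<dots> = (\<epsilon> / r) * (\<Sum>k. (cmod (coord \<phi> (k + Suc N)))\<^sup>2) / 2
        + (\<Sum>k. (1 / real (k + Suc N))\<^sup>2) / (2 * (\<epsilon> / r))"
      by (subst suminf_add[symmetric])
        (intro summable_divide summable_mult sh[OF coord_summable] sh[OF s2]
        | subst suminf_divide suminf_mult, intro summable_mult sh[OF coord_summable] sh[OF s2] | simp)+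
    also have "(\<Sum>k. (cmod (coord \<phi> (k + Suc N)))\<^sup>2) \<le> r\<^sup>2"
      unfolding r_def norm_diff_trunc_sq[symmetric]
    proof (rule power_mono)
      have "(norm (\<phi> - trunc N \<phi>))\<^sup>2 \<le> (norm \<phi>)\<^sup>2"
        unfolding norm_diff_trunc_sq norm_ell2_sq[of \<phi>] suminf_split_initial_segment[OF coord_summable, of \<phi> "Suc N"]
        by (simp add: sum_nonneg)
      then show "norm (\<phi> - trunc N \<phi>) \<le> norm \<phi>" by (rule power2_le_imp_le) simp
    qed simp
    also have "(\<Sum>k. (1 / real (k + Suc N))\<^sup>2) \<le> \<epsilon>\<^sup>2" using N by simp
    also have "(\<epsilon> / r) * r\<^sup>2 / 2 + \<epsilon>\<^sup>2 / (2 * (\<epsilon> / r)) = \<epsilon> * r"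
      using e r by (simp add: power2_eq_square field_simps)
    finally show ?thesis using e r by (simp add: r_def divide_right_mono mult_left_mono)
  qed simp
  then show ?thesis by blast
qed

lemma weak_size_basis: "weak_size (map basis [0..<n]) \<phi> = (\<Sum>k<n. cmod (coord \<phi> k))"
  by (induction n) auto

text \<open>A criterion of Hilbert--Schmidt type: the tails of the series are small by the square summability of
  \<open>1 / k\<close>, and the other terms are matrix elements.\<close>

lemma compact_bound_coord_sum:
  assumes "\<And>\<phi>. norm (L \<phi>) \<le> C * (\<Sum>k. cmod (coord \<phi> k) / real k)" "0 \<le> C"
  shows "compact_bound L"
  unfolding compact_bound_def
proof (intro allI impI)
  fix \<epsilon> :: real assume e: "\<epsilon> > 0"
  then have "\<epsilon> / (C + 1) > 0" using assms(2) by simp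
  from suminf_coord_over_n_tail[OF this] obtain N where
    N: "\<And>\<phi>. (\<Sum>k. cmod (coord \<phi> k) / real k) \<le> \<epsilon> / (C + 1) * norm \<phi> + (\<Sum>k\<le>N. cmod (coord \<phi> k))" by blast
  let ?ys = "map (\<lambda>y. C *\<^sub>R y) (map basis [0..<Suc N])"
  have "norm (L \<phi>) \<le> \<epsilon> * norm \<phi> + weak_size ?ys \<phi>" for \<phi>
  proof -
    have w: "weak_size ?ys \<phi> = C * (\<Sum>k\<le>N. cmod (coord \<phi> k))"
      by (simp only: weak_size_scaleR[OF assms(2)] weak_size_basis lessThan_Suc_atMost)
    have "norm (L \<phi>) \<le> C * (\<epsilon> / (C + 1) * norm \<phi> + (\<Sum>k\<le>N. cmod (coord \<phi> k)))"
      using assms(1) mult_left_mono[OF N assms(2)] by (rule order_trans)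
    also have "\<dots> = C / (C + 1) * (\<epsilon> * norm \<phi>) + weak_size ?ys \<phi>"
      unfolding w by (simp add: algebra_simps)
    also have "C / (C + 1) * (\<epsilon> * norm \<phi>) \<le> 1 * (\<epsilon> * norm \<phi>)"
      using assms(2) e by (intro mult_right_mono) auto
    finally show ?thesis by simp
  qed
  then show "\<exists>ys. \<forall>\<phi>. norm (L \<phi>) \<le> \<epsilon> * norm \<phi> + weak_size ys \<phi>" by blast
qed

context bounded_symmetric
begin

lemma continuous_weak_size_U: "continuous_on S (\<lambda>r. weak_size ys (U (\<sigma> * r) \<phi>))"
proof -
  have contp: "continuous_on S (\<lambda>r. U (\<sigma> * r) \<phi>)"
    using continuous_on_compose2[OF continuous_U[of UNIV \<phi>], of S "\<lambda>r. \<sigma> * r"] by (simp add: continuous_intros)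
  show ?thesis
    by (induction ys) (auto intro!: continuous_intros cinner.continuous_on contp)
qed

lemma weak_size_average:
  assumes "\<And>x. E {x} \<phi> = 0" "\<bar>\<sigma>\<bar> = 1"
  shows "((\<lambda>T. integral {0..T} (\<lambda>r. weak_size ys (U (\<sigma> * r) \<phi>)) / T) \<longlongrightarrow> 0) at_top"
proof (induction ys)
  case (Cons y ys)
  have int: "(\<lambda>r. cmod (cinner y (U (\<sigma> * r) \<phi>))) integrable_on {0..T}" for T
    using continuous_weak_size_U[of "{0..T}" "[y]"] by (intro integrable_continuous_interval) simp
  have "integral {0..T} (\<lambda>r. weak_size (y # ys) (U (\<sigma> * r) \<phi>)) / T
      = integral {0..T} (\<lambda>r. cmod (cinner y (U (\<sigma> * r) \<phi>))) / T + integral {0..T} (\<lambda>r. weak_size ys (U (\<sigma> * r) \<phi>)) / T" for T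
    unfolding weak_size_simps
    by (subst integral_add) (auto intro!: int integrable_continuous_interval continuous_weak_size_U simp: add_divide_distrib)
  then show ?case
    using tendsto_add[OF matrix_element_average[OF assms, of y] Cons.IH] by simp
qed simp

end

section \<open>Fourier series of continuously differentiable functions\<close>

definition chr :: "int \<Rightarrow> real \<Rightarrow> complex" where
  "chr n \<theta> = exp (\<i> * of_int n * of_real \<theta>)"

lemma chr_0 [simp]: "chr 0 \<theta> = 1" "chr n 0 = 1"
  by (simp_all add: chr_def)

lemma chr_mult: "chr m \<theta> * chr n \<theta> = chr (m + n) \<theta>"
  by (simp add: chr_def exp_add[symmetric] algebra_simps)

lemma chr_add_arg: "chr n (\<theta> + \<eta>) = chr n \<theta> * chr n \<eta>"
  by (simp add: chr_def exp_add[symmetric] algebra_simps)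

lemma cnj_chr: "cnj (chr n \<theta>) = chr (- n) \<theta>"
  by (simp add: chr_def exp_cnj)

lemma norm_chr [simp]: "cmod (chr n \<theta>) = 1"
proof -
  have "chr n \<theta> = exp (\<i> * of_real (of_int n * \<theta>))" by (simp add: chr_def mult.assoc)
  then show ?thesis by (simp only: norm_exp_i_times)
qed

lemma chr_2pi [simp]: "chr n (2 * pi) = 1"
proof -
  have "chr n (2 * pi) = exp ((2 * of_int n * pi) * \<i>)" by (simp add: chr_def mult_ac)
  also have "\<dots> = 1" by (rule exp_integer_2pi) simp
  finally show ?thesis .
qed

lemma continuous_chr [continuous_intros]: "continuous_on S (chr n)"
  unfolding chr_def by (intro continuous_intros)

lemma chr_has_derivative: "(chr n has_vector_derivative \<i> * of_int n * chr n \<theta>) (at \<theta> within S)"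
proof -
  have "((\<lambda>z. exp (\<i> * of_int n * z)) has_field_derivative \<i> * of_int n * exp (\<i> * of_int n * of_real \<theta>))
      (at (of_real \<theta>))"
    by (auto intro!: derivative_eq_intros)
  from has_vector_derivative_real_field[OF this] show ?thesis
    by (simp add: chr_def[abs_def] has_vector_derivative_at_within)
qed

definition fcoef :: "(real \<Rightarrow> complex) \<Rightarrow> int \<Rightarrow> complex" where
  "fcoef u n = integral {0..2*pi} (\<lambda>\<theta>. chr (- n) \<theta> * u \<theta>) / (2 * of_real pi)"

lemma fourier_coeff_eq:
  assumes "continuous_on UNIV u"
  shows "fourier_coeff u n = fcoef u n"
proof -
  have "continuous_on {0..2*pi} (\<lambda>\<theta>. exp (- \<i> * of_int n * of_real \<theta>) * u \<theta>)"
    by (intro continuous_intros continuous_on_subset[OF assms]) auto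
  then show ?thesis
    unfolding fourier_coeff_def fcoef_def chr_def
    by (subst set_borel_integral_eq_integral(2)) (auto intro: borel_integrable_atLeastAtMost')
qed

lemma integrable_period:
  assumes "continuous_on UNIV (u :: real \<Rightarrow> complex)"
  shows "u integrable_on {0..2*pi}"
  by (intro integrable_continuous_interval continuous_on_subset[OF assms]) auto

lemma fcoef_add:
  assumes "continuous_on UNIV u" "continuous_on UNIV v"
  shows "fcoef (\<lambda>\<theta>. u \<theta> + v \<theta>) n = fcoef u n + fcoef v n"
  unfolding fcoef_def distrib_left
  by (subst integral_add) (auto intro!: integrable_period continuous_intros assms simp: add_divide_distrib)

lemma fcoef_cmult: "fcoef (\<lambda>\<theta>. c * u \<theta>) n = c * fcoef u n"
  by (simp add: fcoef_def mult.left_commute[of _ c])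

lemma fcoef_diff:
  assumes "continuous_on UNIV u" "continuous_on UNIV v"
  shows "fcoef (\<lambda>\<theta>. u \<theta> - v \<theta>) n = fcoef u n - fcoef v n"
  unfolding fcoef_def right_diff_distrib
  by (subst integral_diff) (auto intro!: integrable_period continuous_intros assms simp: diff_divide_distrib)

lemma fcoef_sum:
  assumes "\<And>j. j \<in> A \<Longrightarrow> continuous_on UNIV (u j)"
  shows "fcoef (\<lambda>\<theta>. \<Sum>j\<in>A. u j \<theta>) n = (\<Sum>j\<in>A. fcoef (u j) n)"
  using assms
proof (induction A rule: infinite_finite_induct)
  case (insert j A)
  then have "continuous_on UNIV (\<lambda>\<theta>. \<Sum>j\<in>A. u j \<theta>)" by (intro continuous_on_sum) auto
  with insert show ?case by (simp add: fcoef_add)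
qed (simp_all add: fcoef_def)

lemma fcoef_chr_mult: "fcoef (\<lambda>\<theta>. chr m \<theta> * u \<theta>) n = fcoef u (n - m)"
  unfolding fcoef_def mult.assoc[symmetric] chr_mult by simp

lemma fcoef_1: "fcoef (\<lambda>_. 1) n = (if n = 0 then 1 else 0)"
proof (cases "n = 0")
  case True then show ?thesis by (simp add: fcoef_def scaleR_conv_of_real)
next
  case False
  let ?F = "\<lambda>\<theta>. chr (- n) \<theta> / (\<i> * of_int (- n))"
  have "(chr (- n) has_integral (?F (2*pi) - ?F 0)) {0..2*pi}"
  proof (rule fundamental_theorem_of_calculus)
    fix \<theta>
    have "(?F has_vector_derivative (\<i> * of_int (- n) * chr (- n) \<theta>) / (\<i> * of_int (- n))) (at \<theta> within {0..2*pi})"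
      by (intro has_vector_derivative_divide chr_has_derivative)
    then show "(?F has_vector_derivative chr (- n) \<theta>) (at \<theta> within {0..2*pi})" using False by simp
  qed simp
  then have "integral {0..2*pi} (chr (- n)) = 0" by (simp add: integral_unique)
  with False show ?thesis by (simp add: fcoef_def)
qed

lemma fcoef_chr: "fcoef (chr m) n = (if n = m then 1 else 0)"
  using fcoef_chr_mult[of m "\<lambda>_. 1" n] by (simp add: fcoef_1)

lemma fcoef_bound:
  assumes "continuous_on UNIV u" "\<And>\<theta>. \<theta> \<in> {0..2*pi} \<Longrightarrow> cmod (u \<theta>) \<le> B"
  shows "cmod (fcoef u n) \<le> B"
proof -
  have "norm (integral {0..2*pi} (\<lambda>\<theta>. chr (- n) \<theta> * u \<theta>)) \<le> B * (2 * pi - 0)"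
    by (rule integral_bound)
      (use assms in \<open>auto simp: norm_mult intro!: continuous_intros continuous_on_subset[OF assms(1)]\<close>)
  then show ?thesis by (simp add: fcoef_def norm_divide norm_mult divide_le_eq)
qed

lemma bounded_on_period:
  assumes "continuous_on UNIV (u :: real \<Rightarrow> complex)"
  obtains B where "B \<ge> 0" "\<And>\<theta>. \<theta> \<in> {0..2*pi} \<Longrightarrow> cmod (u \<theta>) \<le> B"
proof -
  have "bounded (u ` {0..2*pi})"
    by (intro compact_imp_bounded compact_continuous_image continuous_on_subset[OF assms]) auto
  then obtain B where "\<forall>x\<in>u ` {0..2*pi}. norm x \<le> B" unfolding bounded_iff by blast
  then have B: "cmod (u \<theta>) \<le> B" if "\<theta> \<in> {0..2*pi}" for \<theta> using that by blast
  have "cmod (u 0) \<le> B" by (rule B) simp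
  then have "B \<ge> 0" using norm_ge_zero[of "u 0"] by linarith
  then show ?thesis using B that by blast
qed

text \<open>Expand \<open>\<integral> \<bar>u - \<Sum>\<^sub>n c\<^sub>n e\<^sub>n\<bar>\<^sup>2 \<ge> 0\<close> with \<open>c\<^sub>n\<close> the Fourier coefficients.\<close>

lemma Bessel:
  assumes u: "continuous_on UNIV u" and A: "finite A"
    and B: "\<And>\<theta>. \<theta> \<in> {0..2*pi} \<Longrightarrow> cmod (u \<theta>) \<le> B"
  shows "(\<Sum>n\<in>A. (cmod (fcoef u n))\<^sup>2) \<le> B\<^sup>2"
proof -
  define s where "s \<theta> = (\<Sum>n\<in>A. fcoef u n * chr n \<theta>)" for \<theta>
  define I where "I g = integral {0..2*pi} g / (2 * of_real pi)" for g :: "real \<Rightarrow> complex"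
  define q where "q = (\<Sum>n\<in>A. (cmod (fcoef u n))\<^sup>2)"
  have cs: "continuous_on UNIV s" unfolding s_def by (intro continuous_intros)
  have cu: "continuous_on UNIV (\<lambda>\<theta>. cnj (u \<theta>))" by (intro continuous_intros u)
  have I_sum: "I (\<lambda>\<theta>. \<Sum>n\<in>A. c n * (chr (- n) \<theta> * v \<theta>)) = (\<Sum>n\<in>A. c n * fcoef v n)"
    if "continuous_on UNIV v" for v c
  proof -
    have "(\<lambda>\<theta>. c n * (chr (- n) \<theta> * v \<theta>)) integrable_on {0..2*pi}" for n
      by (intro integrable_period continuous_intros that)
    then show ?thesis
      using A by (simp add: I_def fcoef_def integral_sum sum_divide_distrib)
  qed
  have cnj_s: "cnj (s \<theta>) * v \<theta> = (\<Sum>n\<in>A. cnj (fcoef u n) * (chr (- n) \<theta> * v \<theta>))" for v \<theta>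
    by (simp add: s_def cnj_chr sum_distrib_right mult.assoc)
  have sq: "(\<Sum>n\<in>A. cnj (fcoef u n) * fcoef u n) = complex_of_real q"
    unfolding q_def of_real_sum complex_norm_square by (simp add: mult.commute)
  have coef_s: "fcoef s n = fcoef u n" if "n \<in> A" for n
  proof -
    have "fcoef s n = (\<Sum>m\<in>A. fcoef (\<lambda>\<theta>. fcoef u m * chr m \<theta>) n)"
      unfolding s_def by (rule fcoef_sum) (intro continuous_intros)
    also have "\<dots> = (\<Sum>m\<in>A. if m = n then fcoef u n else 0)"
      by (rule sum.cong) (auto simp: fcoef_cmult fcoef_chr)
    finally show ?thesis using A that by simp
  qed
  have 1: "I (\<lambda>\<theta>. cnj (s \<theta>) * u \<theta>) = complex_of_real q"
    unfolding cnj_s I_sum[OF u] sq ..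
  have 2: "I (\<lambda>\<theta>. cnj (s \<theta>) * s \<theta>) = complex_of_real q"
    unfolding cnj_s I_sum[OF cs] sq[symmetric] by (rule sum.cong) (simp_all add: coef_s)
  have I_cnj: "I (\<lambda>\<theta>. cnj (g \<theta>)) = cnj (I g)" for g
    by (simp add: I_def integral_cnj)
  have 3: "I (\<lambda>\<theta>. cnj (u \<theta>) * s \<theta>) = complex_of_real q"
    using I_cnj[of "\<lambda>\<theta>. cnj (s \<theta>) * u \<theta>"] 1 by (simp add: mult.commute)
  have "I (\<lambda>\<theta>. of_real ((cmod (u \<theta> - s \<theta>))\<^sup>2))
      = I (\<lambda>\<theta>. (cnj (u \<theta>) * u \<theta> - cnj (u \<theta>) * s \<theta>) - (cnj (s \<theta>) * u \<theta> - cnj (s \<theta>) * s \<theta>))"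
    unfolding complex_norm_square by (simp add: algebra_simps)
  also have "\<dots> = (I (\<lambda>\<theta>. cnj (u \<theta>) * u \<theta>) - I (\<lambda>\<theta>. cnj (u \<theta>) * s \<theta>))
      - (I (\<lambda>\<theta>. cnj (s \<theta>) * u \<theta>) - I (\<lambda>\<theta>. cnj (s \<theta>) * s \<theta>))"
    unfolding I_def
    by (subst integral_diff, (intro integrable_period continuous_intros u cs)+)+
      (simp add: diff_divide_distrib)
  finally have eq: "I (\<lambda>\<theta>. of_real ((cmod (u \<theta> - s \<theta>))\<^sup>2)) = I (\<lambda>\<theta>. cnj (u \<theta>) * u \<theta>) - of_real q"
    unfolding 1 2 3 by simp
  have real: "I (\<lambda>\<theta>. complex_of_real (g \<theta>)) = complex_of_real (integral {0..2*pi} g / (2 * pi))"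
    if "continuous_on UNIV g" for g
  proof -
    have "integral {0..2*pi} (complex_of_real \<circ> g) = complex_of_real (integral {0..2*pi} g)"
      by (intro integral_linear bounded_linear_of_real integrable_continuous_interval continuous_on_subset[OF that]) auto
    then show ?thesis by (simp add: I_def comp_def)
  qed
  have r1: "I (\<lambda>\<theta>. of_real ((cmod (u \<theta> - s \<theta>))\<^sup>2))
      = complex_of_real (integral {0..2*pi} (\<lambda>\<theta>. (cmod (u \<theta> - s \<theta>))\<^sup>2) / (2 * pi))"
    by (rule real) (intro continuous_intros u cs)
  have r2: "I (\<lambda>\<theta>. of_real ((cmod (u \<theta>))\<^sup>2))
      = complex_of_real (integral {0..2*pi} (\<lambda>\<theta>. (cmod (u \<theta>))\<^sup>2) / (2 * pi))"
    by (rule real) (intro continuous_intros u)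
  have "(\<lambda>\<theta>. cnj (u \<theta>) * u \<theta>) = (\<lambda>\<theta>. of_real ((cmod (u \<theta>))\<^sup>2))"
    by (simp only: complex_norm_square mult.commute)
  then have "complex_of_real (integral {0..2*pi} (\<lambda>\<theta>. (cmod (u \<theta> - s \<theta>))\<^sup>2) / (2 * pi))
      = complex_of_real (integral {0..2*pi} (\<lambda>\<theta>. (cmod (u \<theta>))\<^sup>2) / (2 * pi) - q)"
    using eq unfolding r1 of_real_diff r2[symmetric] by simp
  then have "integral {0..2*pi} (\<lambda>\<theta>. (cmod (u \<theta> - s \<theta>))\<^sup>2) / (2 * pi)
      = integral {0..2*pi} (\<lambda>\<theta>. (cmod (u \<theta>))\<^sup>2) / (2 * pi) - q"
    by (simp only: of_real_eq_iff)
  moreover have "0 \<le> integral {0..2*pi} (\<lambda>\<theta>. (cmod (u \<theta> - s \<theta>))\<^sup>2) / (2 * pi)"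
    by (intro divide_nonneg_pos integral_nonneg integrable_continuous_interval continuous_intros
        continuous_on_subset[OF u] continuous_on_subset[OF cs]) auto
  moreover have "integral {0..2*pi} (\<lambda>\<theta>. (cmod (u \<theta>))\<^sup>2) \<le> B\<^sup>2 * (2 * pi)"
  proof -
    have "integral {0..2*pi} (\<lambda>\<theta>. (cmod (u \<theta>))\<^sup>2) \<le> integral {0..2*pi} (\<lambda>\<theta>. B\<^sup>2)"
      using B by (intro integral_le integrable_continuous_interval continuous_intros continuous_on_subset[OF u] power_mono) auto
    then show ?thesis by (simp add: mult.commute)
  qed
  then have "integral {0..2*pi} (\<lambda>\<theta>. (cmod (u \<theta>))\<^sup>2) / (2 * pi) \<le> B\<^sup>2" by (simp add: divide_le_eq)
  ultimately show ?thesis unfolding q_def by linarith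
qed

definition C1_per :: "(real \<Rightarrow> complex) \<Rightarrow> (real \<Rightarrow> complex) \<Rightarrow> bool" where
  "C1_per u u' \<longleftrightarrow> (\<forall>\<theta>. (u has_vector_derivative u' \<theta>) (at \<theta>)) \<and> continuous_on UNIV u' \<and>
     (\<forall>\<theta>. u (\<theta> + 2 * pi) = u \<theta>)"

lemma C1_perD:
  assumes "C1_per u u'"
  shows "(u has_vector_derivative u' \<theta>) (at \<theta>)" "continuous_on UNIV u'" "u (\<theta> + 2 * pi) = u \<theta>"
    "continuous_on UNIV u"
  using assms has_vector_derivative_continuous[of u "u' _" _ UNIV]
  by (auto simp: C1_per_def intro!: continuous_at_imp_continuous_on)

lemma C1_per_deriv_periodic:
  assumes "C1_per u u'"
  shows "u' (\<theta> + 2 * pi) = u' \<theta>"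
proof (rule vector_derivative_unique_at)
  have "((u \<circ> (\<lambda>\<theta>. \<theta> + 2 * pi)) has_vector_derivative (1 *\<^sub>R u' (\<theta> + 2 * pi))) (at \<theta>)"
    by (rule vector_diff_chain_at) (auto intro!: derivative_eq_intros C1_perD(1)[OF assms])
  then show "(u has_vector_derivative u' (\<theta> + 2 * pi)) (at \<theta>)"
    by (simp add: comp_def C1_perD(3)[OF assms])
  show "(u has_vector_derivative u' \<theta>) (at \<theta>)" by (rule C1_perD[OF assms])
qed

lemma fcoef_deriv:
  assumes u: "C1_per u u'"
  shows "fcoef u' n = \<i> * of_int n * fcoef u n"
proof -
  note D = C1_perD[OF u]
  let ?F = "\<lambda>\<theta>. chr (- n) \<theta> * u \<theta>"
  have "((\<lambda>\<theta>. chr (- n) \<theta> * u' \<theta> + \<i> * of_int (- n) * chr (- n) \<theta> * u \<theta>) has_integral (?F (2*pi) - ?F 0)) {0..2*pi}"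
    by (rule fundamental_theorem_of_calculus, simp,
        rule has_vector_derivative_mult[OF chr_has_derivative has_vector_derivative_at_within[OF D(1)]])
  then have "integral {0..2*pi} (\<lambda>\<theta>. chr (- n) \<theta> * u' \<theta> + \<i> * of_int (- n) * chr (- n) \<theta> * u \<theta>) = 0"
    using D(3)[of 0] by (simp add: integral_unique)
  then have "integral {0..2*pi} (\<lambda>\<theta>. chr (- n) \<theta> * u' \<theta>) + integral {0..2*pi} (\<lambda>\<theta>. (\<i> * of_int (- n)) * (chr (- n) \<theta> * u \<theta>)) = 0"
    by (subst integral_add[symmetric])
      (auto intro!: integrable_period continuous_intros D simp: mult.assoc)
  then have "integral {0..2*pi} (\<lambda>\<theta>. chr (- n) \<theta> * u' \<theta>) = \<i> * of_int n * integral {0..2*pi} (\<lambda>\<theta>. chr (- n) \<theta> * u \<theta>)"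
    by (simp add: add_eq_0_iff)
  then show ?thesis by (simp add: fcoef_def)
qed

lemma summable_on_int_inverse_square: "(\<lambda>n::int. 1 / (real_of_int n)\<^sup>2) summable_on UNIV"
proof -
  have s: "(\<lambda>n::nat. 1 / (real n)\<^sup>2) summable_on UNIV"
    using inverse_power_summable[of 2] by (simp add: summable_on_UNIV_nonneg_real_iff field_simps)
  have "((\<lambda>n::int. 1 / (real_of_int n)\<^sup>2) \<circ> int) summable_on UNIV" using s by (simp add: comp_def)
  then have 1: "(\<lambda>n::int. 1 / (real_of_int n)\<^sup>2) summable_on range int"
    by (subst summable_on_reindex) auto
  have "((\<lambda>n::int. 1 / (real_of_int n)\<^sup>2) \<circ> (\<lambda>n. - int n)) summable_on UNIV" using s by (simp add: comp_def)
  then have 2: "(\<lambda>n::int. 1 / (real_of_int n)\<^sup>2) summable_on range (\<lambda>n. - int n)"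
    by (subst summable_on_reindex) (auto simp: inj_def)
  have "n \<in> range int \<union> range (\<lambda>n. - int n)" for n :: int
    by (cases n rule: int_cases2) auto
  then have "range int \<union> range (\<lambda>n. - int n) = UNIV" by blast
  with summable_on_union[OF 1 2] show ?thesis by simp
qed

text \<open>Bessel's inequality for \<open>u'\<close> shows that \<open>n c\<^sub>n\<close> is square summable, and so is \<open>1 / n\<close>.\<close>

lemma fcoef_summable:
  assumes u: "C1_per u u'"
  shows "(\<lambda>n. cmod (fcoef u n)) summable_on UNIV"
proof (rule nonneg_bdd_above_summable_on)
  note D = C1_perD[OF u]
  obtain B where B: "B \<ge> 0" "\<And>\<theta>. \<theta> \<in> {0..2*pi} \<Longrightarrow> cmod (u' \<theta>) \<le> B"
    by (rule bounded_on_period[OF D(2)]) auto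
  let ?q = "\<lambda>n::int. 1 / (real_of_int n)\<^sup>2"
  have pt: "cmod (fcoef u n) \<le> (if n = 0 then cmod (fcoef u 0) else 0) + ((cmod (fcoef u' n))\<^sup>2 + ?q n)" for n
  proof (cases "n = 0")
    case False
    have "cmod (fcoef u' n) = \<bar>real_of_int n\<bar> * cmod (fcoef u n)"
      unfolding fcoef_deriv[OF u] by (simp add: norm_mult)
    then have "cmod (fcoef u n) = cmod (fcoef u' n) * (1 / \<bar>real_of_int n\<bar>)" using False by simp
    also have "2 * \<dots> \<le> (cmod (fcoef u' n))\<^sup>2 + (1 / \<bar>real_of_int n\<bar>)\<^sup>2"
      using sum_squares_bound[of "cmod (fcoef u' n)" "1 / \<bar>real_of_int n\<bar>"] by simp
    finally have "2 * cmod (fcoef u n) \<le> (cmod (fcoef u' n))\<^sup>2 + ?q n" by (simp add: power_divide)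
    then show ?thesis unfolding if_not_P[OF False] using norm_ge_zero[of "fcoef u n"] by linarith
  qed simp
  show "bdd_above (sum (\<lambda>n. cmod (fcoef u n)) ` {F. F \<subseteq> UNIV \<and> finite F})"
  proof (rule bdd_aboveI, safe)
    fix A :: "int set" assume A: "finite A"
    have "(\<Sum>n\<in>A. cmod (fcoef u n)) \<le> (\<Sum>n\<in>A. (if n = 0 then cmod (fcoef u 0) else 0) + ((cmod (fcoef u' n))\<^sup>2 + ?q n))"
      by (intro sum_mono pt)
    also have "\<dots> = (\<Sum>n\<in>A. if n = 0 then cmod (fcoef u 0) else 0) + ((\<Sum>n\<in>A. (cmod (fcoef u' n))\<^sup>2) + (\<Sum>n\<in>A. ?q n))"
      by (simp only: sum.distrib)
    also have "\<dots> \<le> cmod (fcoef u 0) + (B\<^sup>2 + infsum ?q UNIV)"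
    proof (intro add_mono)
      show "(\<Sum>n\<in>A. if n = 0 then cmod (fcoef u 0) else 0) \<le> cmod (fcoef u 0)" using A by simp
      show "(\<Sum>n\<in>A. (cmod (fcoef u' n))\<^sup>2) \<le> B\<^sup>2" by (rule Bessel[OF D(2) A B(2)])
      show "sum ?q A \<le> infsum ?q UNIV"
        by (rule finite_sum_le_infsum[OF summable_on_int_inverse_square A]) auto
    qed
    finally show "(\<Sum>n\<in>A. cmod (fcoef u n)) \<le> cmod (fcoef u 0) + (B\<^sup>2 + infsum ?q UNIV)" .
  qed
qed simp

lemma fcoef_tendsto_0:
  assumes u: "continuous_on UNIV u"
  shows "(\<lambda>n. fcoef u (int n)) \<longlonglongrightarrow> 0" "(\<lambda>n. fcoef u (- int n)) \<longlonglongrightarrow> 0"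
proof -
  obtain B where B: "B \<ge> 0" "\<And>\<theta>. \<theta> \<in> {0..2*pi} \<Longrightarrow> cmod (u \<theta>) \<le> B"
    by (rule bounded_on_period[OF u]) auto
  have lim: "(\<lambda>n. fcoef u (g n)) \<longlonglongrightarrow> 0" if g: "inj g" for g :: "nat \<Rightarrow> int"
  proof -
    have "summable (\<lambda>n. (cmod (fcoef u (g n)))\<^sup>2)"
    proof (rule summableI_nonneg_bounded)
      fix N
      have "(\<Sum>n<N. (cmod (fcoef u (g n)))\<^sup>2) = (\<Sum>m\<in>g ` {..<N}. (cmod (fcoef u m))\<^sup>2)"
        using g by (subst sum.reindex) (auto intro: inj_on_subset)
      also have "\<dots> \<le> B\<^sup>2" by (rule Bessel[OF u _ B(2)]) auto
      finally show "(\<Sum>n<N. (cmod (fcoef u (g n)))\<^sup>2) \<le> B\<^sup>2" .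
    qed simp
    from tendsto_real_sqrt[OF summable_LIMSEQ_zero[OF this]] show ?thesis
      by (intro tendsto_norm_zero_cancel[of "\<lambda>n. fcoef u (g n)"]) simp
  qed
  show "(\<lambda>n. fcoef u (int n)) \<longlonglongrightarrow> 0" "(\<lambda>n. fcoef u (- int n)) \<longlonglongrightarrow> 0"
    by (intro lim; simp add: inj_def)+
qed

lemma filterlim_symmetric_intervals:
  "filterlim (\<lambda>N::nat. {- int N..int N}) (finite_subsets_at_top UNIV) sequentially"
  unfolding filterlim_finite_subsets_at_top
proof (intro allI impI, elim conjE)
  fix X :: "int set" assume X: "finite X"
  obtain N where N: "\<And>x. x \<in> X \<Longrightarrow> \<bar>x\<bar> \<le> int N"
  proof -
    have "\<bar>x\<bar> \<le> int (nat (Max (insert 0 (abs ` X))))" if "x \<in> X" for x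
      using X that by (auto intro!: Max_ge)
    then show thesis by (rule that)
  qed
  have "finite {- int n..int n} \<and> X \<subseteq> {- int n..int n} \<and> {- int n..int n} \<subseteq> UNIV" if "n \<ge> N" for n
    using N that by (auto simp: abs_le_iff) force+
  then show "\<forall>\<^sub>F n in sequentially. finite {- int n..int n} \<and> X \<subseteq> {- int n..int n} \<and> {- int n..int n} \<subseteq> UNIV"
    unfolding eventually_sequentially by blast
qed

text \<open>Near \<open>\<theta>\<^sub>0\<close> the quotient \<open>h = (u - u \<theta>\<^sub>0) / (e\<^bsup>i (\<theta> - \<theta>\<^sub>0)\<^esup> - 1)\<close> extends continuously, and
  \<open>u - u \<theta>\<^sub>0 = h e\<^bsup>i (\<theta> - \<theta>\<^sub>0)\<^esup> - h\<close> makes the symmetric partial sums telescope to Fourier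
  coefficients of \<open>h\<close>, which vanish at infinity.\<close>

lemma Fourier_partial_sums:
  assumes u: "C1_per u u'"
  shows "(\<lambda>N. \<Sum>n\<in>{- int N..int N}. fcoef u n * chr n x) \<longlonglongrightarrow> u x"
proof -
  note D = C1_perD[OF u]
  define h where "h \<theta> = (if chr 1 (\<theta> - x) = 1 then u' \<theta> / \<i> else (u \<theta> - u x) / (chr 1 (\<theta> - x) - 1))" for \<theta>
  have isol: "\<theta> = x + 2 * pi * of_int k" if one: "chr 1 (\<theta> - x) = 1" "k = \<lfloor>(\<theta> - x) / (2 * pi)\<rfloor>" for \<theta> k
  proof -
    obtain m :: int where "complex_of_real (\<theta> - x) * \<i> = of_int (2 * m) * pi * \<i>"
      using one(1) unfolding chr_def exp_eq_1
      by (auto simp: complex_eq_iff)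
    then have "\<theta> - x = 2 * pi * m" by (simp add: complex_eq_iff)
    then show ?thesis using one(2) by simp
  qed
  have per_int: "u (x + 2 * pi * of_int k) = u x" for k
  proof -
    have nat: "u (y + 2 * pi * real m) = u y" for y and m :: nat
    proof (induction m)
      case (Suc m)
      have "u (y + 2 * pi * real (Suc m)) = u ((y + 2 * pi * real m) + 2 * pi)" by (simp add: algebra_simps)
      then show ?case using Suc D(3) by simp
    qed simp
    show ?thesis
    proof (cases k rule: int_cases2)
      case (nonneg m) then show ?thesis using nat[of x m] by simp
    next
      case (nonpos m) then show ?thesis using nat[of "x - 2 * pi * real m" m] by simp
    qed
  qed
  have cont_h: "isCont h \<theta>" for \<theta>
  proof (cases "chr 1 (\<theta> - x) = 1")
    case False
    have cc: "continuous_on UNIV (\<lambda>\<theta>. chr 1 (\<theta> - x))"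
      using continuous_on_compose2[OF continuous_chr[of UNIV 1], of UNIV "\<lambda>\<theta>. \<theta> - x"] by (simp add: continuous_intros)
    then have ic: "isCont (\<lambda>\<theta>. chr 1 (\<theta> - x)) \<theta>" by (simp add: continuous_on_eq_continuous_at)
    have "\<forall>\<^sub>F t in nhds \<theta>. chr 1 (t - x) \<noteq> 1"
      using ic False unfolding isCont_def
      by (auto simp: eventually_nhds_conv_at intro: tendsto_imp_eventually_ne)
    then have ev: "\<forall>\<^sub>F t in nhds \<theta>. h t = (u t - u x) / (chr 1 (t - x) - 1)"
      by eventually_elim (simp add: h_def)
    have iu: "isCont u \<theta>" using D(4) by (simp add: continuous_on_eq_continuous_at)
    have "isCont (\<lambda>t. (u t - u x) / (chr 1 (t - x) - 1)) \<theta>"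
      using False by (intro continuous_intros iu ic) simp
    then show ?thesis using isCont_cong[OF ev] by simp
  next
    case True
    have ux: "u \<theta> = u x" using isol[OF True refl] per_int by metis
    have shift: "chr 1 (\<theta> + s - x) = chr 1 s" for s
      using True chr_add_arg[of 1 "\<theta> - x" s] by (simp add: algebra_simps)
    have quot: "((\<lambda>s. (v (\<theta> + s) - v \<theta>) /\<^sub>R s) \<longlongrightarrow> v') (at 0)" if "(v has_vector_derivative v') (at \<theta>)"
      for v :: "real \<Rightarrow> complex" and v' \<theta>
      using that unfolding has_vector_derivative_def has_derivative_at
    proof (elim conjE)
      assume lim: "(\<lambda>s. norm (v (\<theta> + s) - v \<theta> - s *\<^sub>R v') / norm s) \<midarrow>0\<rightarrow> 0"
      have "(\<lambda>s. (v (\<theta> + s) - v \<theta>) /\<^sub>R s - v') \<midarrow>0\<rightarrow> 0"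
      proof (rule Lim_null_comparison[OF _ lim])
        have "norm ((v (\<theta> + s) - v \<theta>) /\<^sub>R s - v') = norm (v (\<theta> + s) - v \<theta> - s *\<^sub>R v') / norm s" if "s \<noteq> 0" for s
        proof -
          have "(v (\<theta> + s) - v \<theta>) /\<^sub>R s - v' = (v (\<theta> + s) - v \<theta> - s *\<^sub>R v') /\<^sub>R s"
            using that by (simp add: scaleR_diff_right)
          then show ?thesis by (simp add: divide_inverse mult.commute)
        qed
        then show "\<forall>\<^sub>F s in at 0. norm ((v (\<theta> + s) - v \<theta>) /\<^sub>R s - v') \<le> norm (v (\<theta> + s) - v \<theta> - s *\<^sub>R v') / norm s"
          by (auto simp: eventually_at_filter)
      qed
      then show ?thesis by (rule LIM_zero_cancel)
    qed
    have "(\<lambda>s. ((u (\<theta> + s) - u \<theta>) /\<^sub>R s) / ((chr 1 (0 + s) - chr 1 0) /\<^sub>R s)) \<midarrow>0\<rightarrow> u' \<theta> / (\<i> * of_int 1 * chr 1 0)"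
      by (intro tendsto_divide quot D(1) chr_has_derivative) simp
    then have lim: "(\<lambda>s. ((u (\<theta> + s) - u \<theta>) /\<^sub>R s) / ((chr 1 s - 1) /\<^sub>R s)) \<midarrow>0\<rightarrow> h \<theta>"
      using True by (simp add: h_def)
    have near: "\<forall>\<^sub>F s in at 0. chr 1 s \<noteq> 1"
    proof -
      have "chr 1 s \<noteq> 1" if s: "s \<noteq> 0" "\<bar>s\<bar> < pi" for s
      proof
        assume "chr 1 s = 1"
        then have "s = 2 * pi * of_int \<lfloor>s / (2 * pi)\<rfloor>" using isol[of "x + s"] by simp
        then obtain m :: int where m: "s = 2 * pi * of_int m" by blast
        then have "m \<noteq> 0" using s by auto
        then have "1 \<le> \<bar>real_of_int m\<bar>" by linarith
        then have "2 * pi * 1 \<le> 2 * pi * \<bar>real_of_int m\<bar>" by (intro mult_left_mono) auto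
        then show False using s m pi_gt_zero by (simp add: abs_mult)
      qed
      then show ?thesis
        unfolding eventually_at by (intro exI[of _ pi]) (auto simp: dist_real_def)
    qed
    have "(\<lambda>s. h (\<theta> + s)) \<midarrow>0\<rightarrow> h \<theta>"
    proof (rule Lim_transform_eventually[OF lim])
      show "\<forall>\<^sub>F s in at 0. ((u (\<theta> + s) - u \<theta>) /\<^sub>R s) / ((chr 1 s - 1) /\<^sub>R s) = h (\<theta> + s)"
        using near
      proof (rule eventually_elim2[OF _ eventually_neq_at_within[of 0 0]])
        fix s :: real assume s: "chr 1 s \<noteq> 1" "s \<noteq> 0"
        show "((u (\<theta> + s) - u \<theta>) /\<^sub>R s) / ((chr 1 s - 1) /\<^sub>R s) = h (\<theta> + s)"
          using s unfolding h_def shift ux by (simp add: scaleR_conv_of_real)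
      qed
    qed
    then show ?thesis unfolding isCont_iff .
  qed
  then have ch: "continuous_on UNIV h" by (simp add: continuous_on_eq_continuous_at)
  have eq: "u \<theta> - u x = chr (- 1) x * (chr 1 \<theta> * h \<theta>) - h \<theta>" for \<theta>
  proof -
    have c: "chr (- 1) x * chr 1 \<theta> = chr 1 (\<theta> - x)"
      using chr_add_arg[of 1 \<theta> "- x"] by (simp add: chr_def mult.commute)
    have "u \<theta> - u x = (chr 1 (\<theta> - x) - 1) * h \<theta>"
    proof (cases "chr 1 (\<theta> - x) = 1")
      case True
      then have "u \<theta> = u x" using isol[OF True refl] per_int by metis
      with True show ?thesis by simp
    next
      case False then show ?thesis by (simp add: h_def)
    qed
    then show ?thesis unfolding mult.assoc[symmetric] c by (simp add: algebra_simps)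
  qed
  have coef: "fcoef u n * chr n x = (if n = 0 then u x else 0) + (fcoef h (n - 1) * chr (n - 1) x - fcoef h n * chr n x)" for n
  proof -
    have "fcoef u n - u x * (if n = 0 then 1 else 0) = fcoef (\<lambda>\<theta>. u \<theta> - u x * 1) n"
      by (subst fcoef_diff) (auto intro!: continuous_intros D simp: fcoef_cmult fcoef_1 fcoef_cmult[of "u x" "\<lambda>_. 1", simplified])
    also have "\<dots> = fcoef (\<lambda>\<theta>. chr (- 1) x * (chr 1 \<theta> * h \<theta>) - h \<theta>) n" by (simp add: eq)
    also have "\<dots> = chr (- 1) x * fcoef h (n - 1) - fcoef h n"
      by (subst fcoef_diff) (auto intro!: continuous_intros ch simp: fcoef_cmult fcoef_chr_mult)
    finally have "fcoef u n = u x * (if n = 0 then 1 else 0) + (chr (- 1) x * fcoef h (n - 1) - fcoef h n)"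
      by (simp add: diff_eq_eq add.commute)
    then have "fcoef u n * chr n x = (u x * (if n = 0 then 1 else 0) + (chr (- 1) x * fcoef h (n - 1) - fcoef h n)) * chr n x"
      by simp
    also have "\<dots> = u x * ((if n = 0 then 1 else 0) * chr n x) + (fcoef h (n - 1) * (chr (- 1) x * chr n x) - fcoef h n * chr n x)"
      by (simp add: algebra_simps)
    finally show ?thesis by (auto simp: chr_mult)
  qed
  have tel: "(\<Sum>n\<in>{- int N..int N}. fcoef u n * chr n x)
      = u x + (fcoef h (- int (Suc N)) * chr (- int (Suc N)) x - fcoef h (int N) * chr (int N) x)" for N
  proof (induction N)
    case 0 show ?case using coef[of 0] by simp
  next
    case (Suc N)
    have set: "{- int (Suc N)..int (Suc N)} = insert (- int (Suc N)) (insert (int (Suc N)) {- int N..int N})" by auto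
    have "(\<Sum>n\<in>{- int (Suc N)..int (Suc N)}. fcoef u n * chr n x)
        = fcoef u (- int (Suc N)) * chr (- int (Suc N)) x + (fcoef u (int (Suc N)) * chr (int (Suc N)) x
          + (\<Sum>n\<in>{- int N..int N}. fcoef u n * chr n x))"
      unfolding set by (subst sum.insert; simp)+
    also have "\<dots> = u x + (fcoef h (- int (Suc (Suc N))) * chr (- int (Suc (Suc N))) x - fcoef h (int (Suc N)) * chr (int (Suc N)) x)"
      unfolding Suc.IH coef[of "- int (Suc N)"] coef[of "int (Suc N)"] by (simp add: algebra_simps)
    finally show ?case .
  qed
  have z: "(\<lambda>n. fcoef h (g n) * chr (g n) x) \<longlonglongrightarrow> 0" if "(\<lambda>n. fcoef h (g n)) \<longlonglongrightarrow> 0" for g :: "nat \<Rightarrow> int"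
    by (rule tendsto_norm_zero_cancel) (use tendsto_norm_zero[OF that] in \<open>simp add: norm_mult\<close>)
  have "(\<lambda>N. u x + (fcoef h (- int (Suc N)) * chr (- int (Suc N)) x - fcoef h (int N) * chr (int N) x)) \<longlonglongrightarrow> u x + (0 - 0)"
    by (intro tendsto_add tendsto_diff tendsto_const z fcoef_tendsto_0(1)[OF ch] LIMSEQ_Suc[OF fcoef_tendsto_0(2)[OF ch]])
  then show ?thesis unfolding tel by simp
qed

lemma Fourier_tail:
  assumes u: "C1_per u u'"
  shows "cmod (u x - (\<Sum>n\<in>{- int N..int N}. fcoef u n * chr n x))
    \<le> infsum (\<lambda>n. cmod (fcoef u n)) UNIV - (\<Sum>n\<in>{- int N..int N}. cmod (fcoef u n))"
    (is "_ \<le> ?S - ?s N")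
proof (rule LIMSEQ_le_const2)
  let ?p = "\<lambda>N. \<Sum>n\<in>{- int N..int N}. fcoef u n * chr n x"
  show "(\<lambda>M. cmod (?p M - ?p N)) \<longlonglongrightarrow> cmod (u x - ?p N)"
    by (intro tendsto_intros Fourier_partial_sums[OF u])
  have "cmod (?p M - ?p N) \<le> ?S - ?s N" if "M \<ge> N" for M
  proof -
    have sub: "{- int N..int N} \<subseteq> {- int M..int M}" using that by auto
    have "?p M - ?p N = (\<Sum>n\<in>{- int M..int M} - {- int N..int N}. fcoef u n * chr n x)"
      by (simp add: sum_diff[OF _ sub])
    also have "cmod \<dots> \<le> (\<Sum>n\<in>{- int M..int M} - {- int N..int N}. cmod (fcoef u n))"
      by (rule order_trans[OF norm_sum]) (simp add: norm_mult)
    also have "\<dots> = ?s M - ?s N" by (simp add: sum_diff[OF _ sub])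
    also have "?s M \<le> ?S" by (rule finite_sum_le_infsum[OF fcoef_summable[OF u]]) auto
    finally show ?thesis by simp
  qed
  then show "\<exists>n. \<forall>M\<ge>n. cmod (?p M - ?p N) \<le> ?S - ?s N" by blast
qed

lemma Fourier_tail_tendsto:
  assumes u: "C1_per u u'"
  shows "(\<lambda>N. infsum (\<lambda>n. cmod (fcoef u n)) UNIV - (\<Sum>n\<in>{- int N..int N}. cmod (fcoef u n))) \<longlonglongrightarrow> 0"
proof -
  have "((\<lambda>n. cmod (fcoef u n)) has_sum infsum (\<lambda>n. cmod (fcoef u n)) UNIV) UNIV"
    by (rule has_sum_infsum[OF fcoef_summable[OF u]])
  from filterlim_compose[OF this[unfolded has_sum_def] filterlim_symmetric_intervals]
  have "(\<lambda>N. \<Sum>n\<in>{- int N..int N}. cmod (fcoef u n)) \<longlonglongrightarrow> infsum (\<lambda>n. cmod (fcoef u n)) UNIV" .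
  from tendsto_diff[OF tendsto_const[of "infsum (\<lambda>n. cmod (fcoef u n)) UNIV"] this] show ?thesis by simp
qed

lemma Fourier_has_sum:
  assumes u: "C1_per u u'"
  shows "((\<lambda>n. fcoef u n * chr n x) has_sum u x) UNIV"
proof -
  have "(\<lambda>n. norm (fcoef u n * chr n x)) summable_on UNIV"
    using fcoef_summable[OF u] by (simp add: norm_mult)
  then have hs: "((\<lambda>n. fcoef u n * chr n x) has_sum infsum (\<lambda>n. fcoef u n * chr n x) UNIV) UNIV"
    by (rule has_sum_infsum[OF abs_summable_summable])
  from filterlim_compose[OF this[unfolded has_sum_def] filterlim_symmetric_intervals]
  have "infsum (\<lambda>n. fcoef u n * chr n x) UNIV = u x"
    using Fourier_partial_sums[OF u] by (rule LIMSEQ_unique)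
  with hs show ?thesis by simp
qed

text \<open>Multiply the uniformly convergent Fourier series of \<open>u\<close> by \<open>v\<close> and integrate term by term.\<close>

lemma fcoef_product_has_sum:
  assumes u: "C1_per u u'" and v: "continuous_on UNIV v"
  shows "((\<lambda>j. fcoef u j * fcoef v (n - j)) has_sum fcoef (\<lambda>\<theta>. u \<theta> * v \<theta>) n) UNIV"
proof -
  note D = C1_perD[OF u]
  obtain B where B: "B \<ge> 0" "\<And>\<theta>. \<theta> \<in> {0..2*pi} \<Longrightarrow> cmod (v \<theta>) \<le> B"
    by (rule bounded_on_period[OF v]) auto
  have "(\<lambda>j. cmod (fcoef u j) * B) summable_on UNIV"
    by (intro summable_on_cmult_left fcoef_summable[OF u])
  then have "(\<lambda>j. norm (fcoef u j * fcoef v (n - j))) summable_on UNIV"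
    by (rule summable_on_comparison_test) (auto simp: norm_mult intro!: mult_left_mono fcoef_bound v B)
  then have hs: "((\<lambda>j. fcoef u j * fcoef v (n - j)) has_sum infsum (\<lambda>j. fcoef u j * fcoef v (n - j)) UNIV) UNIV"
    by (rule has_sum_infsum[OF abs_summable_summable])
  have "(\<lambda>N. (\<Sum>j\<in>{- int N..int N}. fcoef u j * fcoef v (n - j)) - fcoef (\<lambda>\<theta>. u \<theta> * v \<theta>) n) \<longlonglongrightarrow> 0"
  proof (rule Lim_null_comparison)
    let ?r = "\<lambda>N. infsum (\<lambda>n. cmod (fcoef u n)) UNIV - (\<Sum>n\<in>{- int N..int N}. cmod (fcoef u n))"
    have "(\<lambda>N. ?r N * B) \<longlonglongrightarrow> 0 * B" by (intro tendsto_intros Fourier_tail_tendsto[OF u])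
    then show "(\<lambda>N. ?r N * B) \<longlonglongrightarrow> 0" by simp
    show "\<forall>\<^sub>F N in sequentially. norm ((\<Sum>j\<in>{- int N..int N}. fcoef u j * fcoef v (n - j)) - fcoef (\<lambda>\<theta>. u \<theta> * v \<theta>) n) \<le> ?r N * B"
    proof (rule always_eventually, rule allI)
      fix N
      let ?p = "\<lambda>\<theta>. \<Sum>j\<in>{- int N..int N}. fcoef u j * chr j \<theta>"
      have "(\<Sum>j\<in>{- int N..int N}. fcoef u j * fcoef v (n - j)) = fcoef (\<lambda>\<theta>. \<Sum>j\<in>{- int N..int N}. fcoef u j * (chr j \<theta> * v \<theta>)) n"
        by (subst fcoef_sum) (auto intro!: continuous_intros v simp: fcoef_cmult fcoef_chr_mult)
      also have "\<dots> = fcoef (\<lambda>\<theta>. ?p \<theta> * v \<theta>) n" by (simp add: sum_distrib_right mult.assoc)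
      finally have "norm ((\<Sum>j\<in>{- int N..int N}. fcoef u j * fcoef v (n - j)) - fcoef (\<lambda>\<theta>. u \<theta> * v \<theta>) n)
          = norm (fcoef (\<lambda>\<theta>. ?p \<theta> * v \<theta> - u \<theta> * v \<theta>) n)"
        by (subst fcoef_diff) (auto intro!: continuous_intros v D)
      also have "\<dots> \<le> ?r N * B"
      proof (rule fcoef_bound)
        show "continuous_on UNIV (\<lambda>\<theta>. ?p \<theta> * v \<theta> - u \<theta> * v \<theta>)" by (intro continuous_intros v D)
        fix \<theta> assume \<theta>: "\<theta> \<in> {0..2*pi}"
        have "cmod (?p \<theta> * v \<theta> - u \<theta> * v \<theta>) = cmod (u \<theta> - ?p \<theta>) * cmod (v \<theta>)"
          by (simp add: norm_mult[symmetric] left_diff_distrib norm_minus_commute)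
        also have "\<dots> \<le> ?r N * B"
          by (rule mult_mono[OF Fourier_tail[OF u] B(2)[OF \<theta>] order_trans[OF norm_ge_zero Fourier_tail[OF u, of \<theta>]] norm_ge_zero])
        finally show "cmod (?p \<theta> * v \<theta> - u \<theta> * v \<theta>) \<le> ?r N * B" .
      qed
      finally show "norm ((\<Sum>j\<in>{- int N..int N}. fcoef u j * fcoef v (n - j)) - fcoef (\<lambda>\<theta>. u \<theta> * v \<theta>) n) \<le> ?r N * B" .
    qed
  qed
  then have "(\<lambda>N. \<Sum>j\<in>{- int N..int N}. fcoef u j * fcoef v (n - j)) \<longlonglongrightarrow> fcoef (\<lambda>\<theta>. u \<theta> * v \<theta>) n"
    by (rule LIM_zero_cancel)
  moreover from filterlim_compose[OF hs[unfolded has_sum_def] filterlim_symmetric_intervals]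
  have "(\<lambda>N. \<Sum>j\<in>{- int N..int N}. fcoef u j * fcoef v (n - j)) \<longlonglongrightarrow> infsum (\<lambda>j. fcoef u j * fcoef v (n - j)) UNIV" .
  ultimately show ?thesis using hs LIMSEQ_unique by metis
qed

section \<open>The position operator\<close>

lemma coord_X_op:
  assumes "\<psi> \<in> dom_X"
  shows "coord (X_op \<psi>) n = of_nat n * coord \<psi> n"
proof -
  have "coord (X_op \<psi>) = (\<lambda>n. of_nat n * coord \<psi> n)"
    unfolding X_op_def using assms
    by (intro coord_Abs_ell2) (simp_all add: dom_X_def norm_mult power_mult_distrib)
  then show ?thesis by simp
qed

lemma dom_XI:
  assumes "\<And>n. coord \<eta> n = of_nat n * coord \<psi> n"
  shows "\<psi> \<in> dom_X" "X_op \<psi> = \<eta>"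
proof -
  show *: "\<psi> \<in> dom_X"
    using coord_summable[of \<eta>] by (simp add: dom_X_def assms norm_mult power_mult_distrib)
  show "X_op \<psi> = \<eta>" by (rule ell2_eqI) (simp add: coord_X_op[OF *] assms)
qed

lemma X_zero: "0 \<in> dom_X" "X_op 0 = 0"
  using dom_XI[of 0 0] by simp_all

lemma X_add:
  assumes "\<phi> \<in> dom_X" "\<psi> \<in> dom_X"
  shows "\<phi> + \<psi> \<in> dom_X" "X_op (\<phi> + \<psi>) = X_op \<phi> + X_op \<psi>"
  using dom_XI[of "X_op \<phi> + X_op \<psi>" "\<phi> + \<psi>"] by (simp_all add: coord_X_op assms algebra_simps)

lemma X_scaleC:
  assumes "\<phi> \<in> dom_X"
  shows "c *\<^sub>C \<phi> \<in> dom_X" "X_op (c *\<^sub>C \<phi>) = c *\<^sub>C X_op \<phi>"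
  using dom_XI[of "c *\<^sub>C X_op \<phi>" "c *\<^sub>C \<phi>"] by (simp_all add: coord_X_op assms algebra_simps)

lemma X_sum:
  assumes "\<And>i. i \<in> I \<Longrightarrow> f i \<in> dom_X"
  shows "(\<Sum>i\<in>I. f i) \<in> dom_X \<and> X_op (\<Sum>i\<in>I. f i) = (\<Sum>i\<in>I. X_op (f i))"
  using assms by (induction I rule: infinite_finite_induct) (auto simp: X_zero X_add)

lemma X_basis: "basis n \<in> dom_X" "X_op (basis n) = of_nat n *\<^sub>C basis n"
  using dom_XI[of "of_nat n *\<^sub>C basis n" "basis n"] by (simp_all add: coord_basis)

lemma X_trunc:
  shows "trunc N \<psi> \<in> dom_X" and "\<psi> \<in> dom_X \<Longrightarrow> X_op (trunc N \<psi>) = trunc N (X_op \<psi>)"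
proof -
  show *: "trunc N \<psi> \<in> dom_X"
    unfolding trunc_def using X_sum[of "{..N}" "\<lambda>n. coord \<psi> n *\<^sub>C basis n"] X_scaleC(1)[OF X_basis(1)] by blast
  show "X_op (trunc N \<psi>) = trunc N (X_op \<psi>)" if "\<psi> \<in> dom_X"
    by (rule ell2_eqI) (simp add: coord_X_op * that)
qed

lemma X_closed:
  assumes "\<And>n::nat. f n \<in> dom_X" "f \<longlonglongrightarrow> \<psi>" "(\<lambda>n. X_op (f n)) \<longlonglongrightarrow> \<eta>"
  shows "\<psi> \<in> dom_X" "X_op \<psi> = \<eta>"
proof -
  have "coord \<eta> n = of_nat n * coord \<psi> n" for n
  proof (rule LIMSEQ_unique)
    show "(\<lambda>m. coord (X_op (f m)) n) \<longlonglongrightarrow> coord \<eta> n"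
      by (rule bounded_linear.tendsto[OF bounded_linear_coord assms(3)])
    show "(\<lambda>m. coord (X_op (f m)) n) \<longlonglongrightarrow> of_nat n * coord \<psi> n"
      unfolding coord_X_op[OF assms(1)]
      by (intro tendsto_mult tendsto_const bounded_linear.tendsto[OF bounded_linear_coord assms(2)])
  qed
  then show "\<psi> \<in> dom_X" "X_op \<psi> = \<eta>" by (rule dom_XI)+
qed

lemma X_symmetric:
  assumes "\<phi> \<in> dom_X" "\<psi> \<in> dom_X"
  shows "cinner (X_op \<phi>) \<psi> = cinner \<phi> (X_op \<psi>)"
  unfolding cinner_def by (simp add: coord_X_op assms mult_ac)

lemma dense_dom_X: "closure dom_X = UNIV"
proof -
  have "\<psi> \<in> closure dom_X" for \<psi>
    unfolding closure_sequential using X_trunc(1) trunc_tendsto by (intro exI[of _ "\<lambda>N. trunc N \<psi>"]) auto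
  then show ?thesis by blast
qed

section \<open>Toeplitz operators with summable symbols\<close>

lemma sum_shift_le:
  fixes \<phi> :: "nat \<Rightarrow> complex"
  assumes "summable (\<lambda>n. (cmod (\<phi> n))\<^sup>2)"
  shows "(\<Sum>n<N. (cmod (if n = 0 \<or> int n \<le> j then 0 else \<phi> (nat (int n - j))))\<^sup>2) \<le> (\<Sum>n. (cmod (\<phi> n))\<^sup>2)"
proof -
  let ?A = "{n. n < N \<and> n \<noteq> 0 \<and> j < int n}" and ?h = "\<lambda>n. nat (int n - j)"
  have "(\<Sum>n<N. (cmod (if n = 0 \<or> int n \<le> j then 0 else \<phi> (?h n)))\<^sup>2) = (\<Sum>n\<in>?A. (cmod (\<phi> (?h n)))\<^sup>2)"
    by (rule sum.mono_neutral_cong_right) auto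
  also have "\<dots> = (\<Sum>m\<in>?h ` ?A. (cmod (\<phi> m))\<^sup>2)"
    by (subst sum.reindex) (auto simp: inj_on_def)
  also have "\<dots> \<le> (\<Sum>n. (cmod (\<phi> n))\<^sup>2)"
    by (rule sum_le_suminf[OF assms]) auto
  finally show ?thesis .
qed

lift_definition shift :: "int \<Rightarrow> ell2 \<Rightarrow> ell2"
  is "\<lambda>j \<phi> n. if n = 0 \<or> int n \<le> j then 0 else \<phi> (nat (int n - j))"
proof
  fix j :: int and \<phi> :: "nat \<Rightarrow> complex"
  assume *: "\<phi> 0 = 0 \<and> summable (\<lambda>n. (cmod (\<phi> n))\<^sup>2)"
  show "(if 0 = (0::nat) \<or> int 0 \<le> j then 0 else \<phi> (nat (int 0 - j))) = 0" by simp
  show "summable (\<lambda>n. (cmod (if n = 0 \<or> int n \<le> j then 0 else \<phi> (nat (int n - j))))\<^sup>2)"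
    by (rule summableI_nonneg_bounded[OF _ sum_shift_le]) (use * in auto)
qed

lemma norm_shift_le: "norm (shift j \<phi>) \<le> norm \<phi>"
proof (rule norm_ell2_le)
  fix J show "(\<Sum>n<J. (cmod (coord (shift j \<phi>) n))\<^sup>2) \<le> (norm \<phi>)\<^sup>2"
    unfolding norm_ell2_sq shift.rep_eq by (rule sum_shift_le[OF coord_summable])
qed simp

text \<open>A Toeplitz operator with absolutely summable coefficients is a norm convergent series of shifts
  and therefore bounded.\<close>

definition toep :: "(int \<Rightarrow> complex) \<Rightarrow> ell2 \<Rightarrow> ell2" where
  "toep a \<phi> = infsum (\<lambda>j. a j *\<^sub>C shift j \<phi>) UNIV"

abbreviation l1 :: "(int \<Rightarrow> complex) \<Rightarrow> bool" where
  "l1 a \<equiv> (\<lambda>j. cmod (a j)) summable_on UNIV"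

lemma toep_abs_summable:
  assumes "l1 a"
  shows "(\<lambda>j. norm (a j *\<^sub>C shift j \<phi>)) summable_on UNIV"
proof (rule summable_on_comparison_test)
  show "(\<lambda>j. cmod (a j) * norm \<phi>) summable_on UNIV" by (intro summable_on_cmult_left assms)
qed (auto simp: norm_shift_le mult_left_mono)

lemma toep_has_sum:
  assumes "l1 a"
  shows "((\<lambda>j. a j *\<^sub>C shift j \<phi>) has_sum toep a \<phi>) UNIV"
  unfolding toep_def by (rule has_sum_infsum[OF abs_summable_summable[OF toep_abs_summable[OF assms]]])

lemma norm_toep_le:
  assumes "l1 a"
  shows "norm (toep a \<phi>) \<le> norm \<phi> * infsum (\<lambda>j. cmod (a j)) UNIV"
proof -
  have "norm (toep a \<phi>) \<le> infsum (\<lambda>j. norm (a j *\<^sub>C shift j \<phi>)) UNIV"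
    unfolding toep_def by (rule norm_infsum_bound[OF toep_abs_summable[OF assms]])
  also have "\<dots> \<le> infsum (\<lambda>j. cmod (a j) * norm \<phi>) UNIV"
    by (intro infsum_mono toep_abs_summable assms summable_on_cmult_left) (simp add: norm_shift_le mult_left_mono)
  also have "\<dots> = norm \<phi> * infsum (\<lambda>j. cmod (a j)) UNIV"
    by (subst infsum_cmult_left) (use assms in \<open>auto simp: mult.commute\<close>)
  finally show ?thesis .
qed

lemma toep_coord_has_sum:
  assumes a: "l1 a" and n: "n > 0"
  shows "((\<lambda>k. a (int n - int k) * coord \<phi> k) has_sum coord (toep a \<phi>) n) UNIV"
proof -
  let ?g = "\<lambda>j. if int n \<le> j then 0 else a j * coord \<phi> (nat (int n - j))"
  have "((\<lambda>j. coord (a j *\<^sub>C shift j \<phi>) n) has_sum coord (toep a \<phi>) n) UNIV"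
    by (rule has_sum_bounded_linear[OF bounded_linear_coord toep_has_sum[OF a]])
  then have "(?g has_sum coord (toep a \<phi>) n) UNIV"
    using n by (simp add: comp_def shift.rep_eq if_distrib cong: if_cong)
  then have "(?g has_sum coord (toep a \<phi>) n) {..<int n}"
    by (subst has_sum_cong_neutral[where T = UNIV and g = ?g]) auto
  also have "{..<int n} = (\<lambda>k. int n - int k) ` {1..}"
  proof (intro equalityI subsetI)
    fix j assume "j \<in> {..<int n}"
    then have "j = int n - int (nat (int n - j))" "nat (int n - j) \<in> {1..}" by auto
    then show "j \<in> (\<lambda>k. int n - int k) ` {1..}" by blast
  qed auto
  finally have "((?g \<circ> (\<lambda>k. int n - int k)) has_sum coord (toep a \<phi>) n) {1..}"
    by (subst (asm) has_sum_reindex) (auto simp: inj_on_def)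
  then show ?thesis
    by (subst (asm) has_sum_cong_neutral[where T = UNIV and g = "\<lambda>k. a (int n - int k) * coord \<phi> k"])
      (auto simp: not_le)
qed

lemma toep_coord_sums:
  assumes "l1 a" "n > 0"
  shows "(\<lambda>k. a (int n - int k) * coord \<phi> k) sums coord (toep a \<phi>) n"
  by (rule has_sum_imp_sums[OF toep_coord_has_sum[OF assms]])

lemma toep_eqI:
  assumes "\<And>n. n > 0 \<Longrightarrow> (\<lambda>k. a (int n - int k) * coord \<phi> k) sums coord \<psi> n" "l1 a"
  shows "toep a \<phi> = \<psi>"
proof (rule ell2_eqI)
  fix n show "coord (toep a \<phi>) n = coord \<psi> n"
    using sums_unique2[OF toep_coord_sums[OF assms(2)] assms(1)] by (cases "n = 0") auto
qed

lemma bounded_op_toep: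
  assumes "l1 a"
  shows "bounded_op (toep a)"
proof (rule bounded_opI[OF _ _ norm_toep_le[OF assms]])
  show "toep a (\<phi> + \<psi>) = toep a \<phi> + toep a \<psi>" for \<phi> \<psi>
    by (rule toep_eqI[OF _ assms]) (auto simp: distrib_left intro!: sums_add toep_coord_sums assms)
  show "toep a (c *\<^sub>C \<psi>) = c *\<^sub>C toep a \<psi>" for c \<psi>
    using sums_mult[OF toep_coord_sums[OF assms], of _ c \<psi>]
    by (intro toep_eqI[OF _ assms]) (auto simp: mult.left_commute)
qed

lemma toep_add:
  assumes "l1 a" "l1 b" "l1 (\<lambda>j. a j + b j)"
  shows "toep (\<lambda>j. a j + b j) \<phi> = toep a \<phi> + toep b \<phi>"
  by (rule toep_eqI[OF _ assms(3)]) (auto simp: distrib_right intro!: sums_add toep_coord_sums assms)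

lemma toep_cmult:
  assumes "l1 a" "l1 (\<lambda>j. c * a j)"
  shows "toep (\<lambda>j. c * a j) \<phi> = c *\<^sub>C toep a \<phi>"
  using sums_mult[OF toep_coord_sums[OF assms(1)], of _ c \<phi>]
  by (intro toep_eqI[OF _ assms(2)]) (auto simp: mult.assoc)

lemma coord_toep_basis:
  assumes "l1 a" "n > 0" "k > 0"
  shows "coord (toep a (basis k)) n = a (int n - int k)"
proof (rule sums_unique2[OF toep_coord_sums[OF assms(1,2)]])
  have "(\<lambda>m. a (int n - int m) * coord (basis k) m) = (\<lambda>m. if m = k then a (int n - int m) else 0)"
    using assms(3) by (auto simp: coord_basis)
  then show "(\<lambda>m. a (int n - int m) * coord (basis k) m) sums a (int n - int k)"
    using sums_single[of k "\<lambda>m. a (int n - int m)"] by simp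
qed

lemma toeplitz_eq_toep:
  assumes "continuous_on UNIV u" "l1 (fcoef u)"
  shows "toeplitz u = toep (fcoef u)"
proof
  fix \<phi>
  have "(\<lambda>n. if n = 0 then 0 else (\<Sum>k. fourier_coeff u (int n - int k) * coord \<phi> k)) = coord (toep (fcoef u) \<phi>)"
    using sums_unique[OF toep_coord_sums[OF assms(2)]] by (auto simp: fourier_coeff_eq[OF assms(1)])
  then show "toeplitz u \<phi> = toep (fcoef u) \<phi>" unfolding toeplitz_def by (simp add: coord_inverse)
qed

text \<open>It is enough to test with the basis vectors, by continuity.\<close>

lemma matrix_adjointI:
  assumes A: "bounded_op A" and B: "bounded_op B"
    and m: "\<And>n k. n > 0 \<Longrightarrow> k > 0 \<Longrightarrow> cnj (coord (A (basis n)) k) = coord (B (basis k)) n"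
  shows "cinner (A \<phi>) \<psi> = cinner \<phi> (B \<psi>)"
proof -
  have e: "cinner (A (basis n)) (basis k) = cinner (basis n) (B (basis k))" for n k
  proof (cases "n = 0 \<or> k = 0")
    case True then show ?thesis by (auto simp: bounded_op_simps[OF A] bounded_op_simps[OF B])
  next
    case False
    have "cinner (A (basis n)) (basis k) = cnj (coord (A (basis n)) k)"
      by (subst cinner_commute) simp
    then show ?thesis using False m by simp
  qed
  have tr: "cinner (A (trunc N \<phi>)) (trunc N \<psi>) = cinner (trunc N \<phi>) (B (trunc N \<psi>))" for N
    unfolding trunc_def
    by (simp add: bounded_op_simps[OF A] bounded_op_simps[OF B] cinner.sum_left cinner.sum_right e del: cinner_basis)
  have "(\<lambda>N. cinner (A (trunc N \<phi>)) (trunc N \<psi>)) \<longlonglongrightarrow> cinner (A \<phi>) \<psi>"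
    by (intro cinner.tendsto bounded_op_tendsto[OF A] trunc_tendsto)
  moreover have "(\<lambda>N. cinner (trunc N \<phi>) (B (trunc N \<psi>))) \<longlonglongrightarrow> cinner \<phi> (B \<psi>)"
    by (intro cinner.tendsto bounded_op_tendsto[OF B] trunc_tendsto)
  ultimately show ?thesis unfolding tr by (rule LIMSEQ_unique)
qed

lemma fcoef_real:
  "fcoef (\<lambda>\<theta>. of_real (g \<theta>)) (- n) = cnj (fcoef (\<lambda>\<theta>. of_real (g \<theta>)) n)"
proof -
  have "(\<lambda>\<theta>. chr n \<theta> * of_real (g \<theta>)) = (\<lambda>\<theta>. cnj (chr (- n) \<theta> * of_real (g \<theta>)))"
    by (simp add: cnj_chr)
  then show ?thesis by (simp add: fcoef_def integral_cnj)
qed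

lemma toep_symmetric:
  assumes "l1 (fcoef (\<lambda>\<theta>. of_real (g \<theta>)))"
  shows "symmetric_op (toep (fcoef (\<lambda>\<theta>. of_real (g \<theta>))))"
  unfolding symmetric_op_def
proof (intro allI matrix_adjointI bounded_op_toep assms)
  fix n k :: nat assume "n > 0" "k > 0"
  then show "cnj (coord (toep (fcoef (\<lambda>\<theta>. of_real (g \<theta>))) (basis n)) k)
      = coord (toep (fcoef (\<lambda>\<theta>. of_real (g \<theta>))) (basis k)) n"
    using fcoef_real[of g "int k - int n"] by (simp add: coord_toep_basis assms)
qed

text \<open>On a truncation of \<open>\<phi>\<close> the form is the mean of \<open>\<bar>s\<bar>\<^sup>2 g\<close>, where \<open>s\<close> is the trigonometric polynomial with
  the coordinates of \<open>\<phi>\<close> as coefficients.\<close>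

lemma toep_positive:
  assumes g: "continuous_on UNIV g" "\<And>\<theta>. 0 \<le> g \<theta>" and l: "l1 (fcoef (\<lambda>\<theta>. of_real (g \<theta>)))"
  shows "0 \<le> Re (cinner \<phi> (toep (fcoef (\<lambda>\<theta>. of_real (g \<theta>))) \<phi>))"
proof (rule LIMSEQ_le_const)
  let ?g = "\<lambda>\<theta>. complex_of_real (g \<theta>)" and ?T = "toep (fcoef (\<lambda>\<theta>. complex_of_real (g \<theta>)))"
  note T = bounded_op_toep[OF l]
  have cg: "continuous_on UNIV ?g" by (intro continuous_intros g)
  show "(\<lambda>N. Re (cinner (trunc N \<phi>) (?T (trunc N \<phi>)))) \<longlonglongrightarrow> Re (cinner \<phi> (?T \<phi>))"
    by (intro tendsto_Re cinner.tendsto bounded_op_tendsto[OF T] trunc_tendsto)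
  have "0 \<le> Re (cinner (trunc N \<phi>) (?T (trunc N \<phi>)))" for N
  proof -
    define s where "s \<theta> = (\<Sum>k\<le>N. coord \<phi> k * chr (int k) \<theta>)" for \<theta>
    have "cinner (trunc N \<phi>) (?T (trunc N \<phi>)) = (\<Sum>k\<le>N. \<Sum>n\<le>N. cnj (coord \<phi> n) * (coord \<phi> k * coord (?T (basis k)) n))"
      unfolding trunc_def
      by (simp add: bounded_op_simps[OF T] cinner.sum_left cinner.sum_right sum_distrib_left mult_ac)
    also have "\<dots> = (\<Sum>n\<le>N. \<Sum>k\<le>N. cnj (coord \<phi> n) * (coord \<phi> k * coord (?T (basis k)) n))"
      by (rule sum.swap)
    also have "\<dots> = (\<Sum>n\<le>N. \<Sum>k\<le>N. fcoef (\<lambda>\<theta>. cnj (coord \<phi> n) * (coord \<phi> k * (chr (int k - int n) \<theta> * ?g \<theta>))) 0)"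
    proof (intro sum.cong refl)
      fix n k
      show "cnj (coord \<phi> n) * (coord \<phi> k * coord (?T (basis k)) n)
          = fcoef (\<lambda>\<theta>. cnj (coord \<phi> n) * (coord \<phi> k * (chr (int k - int n) \<theta> * ?g \<theta>))) 0"
      proof (cases "n = 0 \<or> k = 0")
        case True
        then have "coord \<phi> n = 0 \<or> coord \<phi> k = 0" by auto
        then show ?thesis by (elim disjE) (simp_all add: fcoef_def)
      next
        case False
        then show ?thesis by (simp add: fcoef_cmult fcoef_chr_mult coord_toep_basis[OF l])
      qed
    qed
    also have "\<dots> = fcoef (\<lambda>\<theta>. \<Sum>n\<le>N. \<Sum>k\<le>N. cnj (coord \<phi> n) * (coord \<phi> k * (chr (int k - int n) \<theta> * ?g \<theta>))) 0"
      by (subst fcoef_sum, intro continuous_intros cg, subst fcoef_sum, intro continuous_intros cg, rule refl)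
    also have "(\<lambda>\<theta>. \<Sum>n\<le>N. \<Sum>k\<le>N. cnj (coord \<phi> n) * (coord \<phi> k * (chr (int k - int n) \<theta> * ?g \<theta>)))
        = (\<lambda>\<theta>. of_real ((cmod (s \<theta>))\<^sup>2 * g \<theta>))"
    proof
      fix \<theta>
      have "complex_of_real ((cmod (s \<theta>))\<^sup>2 * g \<theta>) = cnj (s \<theta>) * s \<theta> * ?g \<theta>"
        unfolding of_real_mult complex_norm_square by (simp add: mult.commute)
      also have "\<dots> = (\<Sum>n\<le>N. \<Sum>k\<le>N. cnj (coord \<phi> n * chr (int n) \<theta>) * (coord \<phi> k * chr (int k) \<theta>) * ?g \<theta>)"
      proof -
        have "cnj (s \<theta>) * s \<theta> = (\<Sum>n\<le>N. \<Sum>k\<le>N. cnj (coord \<phi> n * chr (int n) \<theta>) * (coord \<phi> k * chr (int k) \<theta>))"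
          unfolding s_def cnj_sum by (rule sum_product)
        then show ?thesis by (simp only: sum_distrib_right)
      qed
      also have "\<dots> = (\<Sum>n\<le>N. \<Sum>k\<le>N. cnj (coord \<phi> n) * (coord \<phi> k * (chr (int k - int n) \<theta> * ?g \<theta>)))"
      proof (intro sum.cong refl)
        fix n k
        have "chr (int k - int n) \<theta> = chr (- int n) \<theta> * chr (int k) \<theta>" by (simp add: chr_mult)
        then show "cnj (coord \<phi> n * chr (int n) \<theta>) * (coord \<phi> k * chr (int k) \<theta>) * ?g \<theta>
            = cnj (coord \<phi> n) * (coord \<phi> k * (chr (int k - int n) \<theta> * ?g \<theta>))"
          by (simp add: cnj_chr)
      qed
      finally show "(\<Sum>n\<le>N. \<Sum>k\<le>N. cnj (coord \<phi> n) * (coord \<phi> k * (chr (int k - int n) \<theta> * ?g \<theta>)))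
          = complex_of_real ((cmod (s \<theta>))\<^sup>2 * g \<theta>)" ..
    qed
    also have "fcoef \<dots> 0 = complex_of_real (integral {0..2*pi} (\<lambda>\<theta>. (cmod (s \<theta>))\<^sup>2 * g \<theta>) / (2 * pi))"
    proof -
      have cs: "continuous_on UNIV s" unfolding s_def by (intro continuous_intros)
      have "integral {0..2*pi} (of_real \<circ> (\<lambda>\<theta>. (cmod (s \<theta>))\<^sup>2 * g \<theta>))
          = complex_of_real (integral {0..2*pi} (\<lambda>\<theta>. (cmod (s \<theta>))\<^sup>2 * g \<theta>))"
        by (intro integral_linear bounded_linear_of_real integrable_continuous_interval continuous_intros
            continuous_on_subset[OF cs] continuous_on_subset[OF g(1)]) auto
      then show ?thesis by (simp add: fcoef_def comp_def)
    qed
    finally have "Re (cinner (trunc N \<phi>) (?T (trunc N \<phi>))) = integral {0..2*pi} (\<lambda>\<theta>. (cmod (s \<theta>))\<^sup>2 * g \<theta>) / (2 * pi)"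
      by (simp only: Re_complex_of_real)
    moreover have "0 \<le> integral {0..2*pi} (\<lambda>\<theta>. (cmod (s \<theta>))\<^sup>2 * g \<theta>)"
    proof (rule integral_nonneg)
      have cs: "continuous_on UNIV s" unfolding s_def by (intro continuous_intros)
      show "(\<lambda>\<theta>. (cmod (s \<theta>))\<^sup>2 * g \<theta>) integrable_on {0..2*pi}"
        by (intro integrable_continuous_interval continuous_intros
            continuous_on_subset[OF cs] continuous_on_subset[OF g(1)]) auto
    qed (simp add: g)
    ultimately show ?thesis by simp
  qed
  then show "\<exists>N. \<forall>n\<ge>N. 0 \<le> Re (cinner (trunc n \<phi>) (?T (trunc n \<phi>)))" by blast
qed

text \<open>The weight \<open>n = (n - k) + k\<close> is split between the coefficients and the vector.\<close>

lemma X_toep: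
  assumes a: "l1 a" and b: "l1 (\<lambda>j. of_int j * a j)" and \<phi>: "\<phi> \<in> dom_X"
  shows "toep a \<phi> \<in> dom_X" "X_op (toep a \<phi>) = toep a (X_op \<phi>) + toep (\<lambda>j. of_int j * a j) \<phi>"
proof -
  have *: "coord (toep a (X_op \<phi>) + toep (\<lambda>j. of_int j * a j) \<phi>) n = of_nat n * coord (toep a \<phi>) n" for n
  proof (cases "n = 0")
    case False
    then have n: "n > 0" by simp
    have "(\<lambda>k. a (int n - int k) * coord (X_op \<phi>) k + of_int (int n - int k) * a (int n - int k) * coord \<phi> k)
        sums (coord (toep a (X_op \<phi>)) n + coord (toep (\<lambda>j. of_int j * a j) \<phi>) n)"
      by (intro sums_add toep_coord_sums[OF a n] toep_coord_sums[OF b n])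
    moreover have "(\<lambda>k. a (int n - int k) * coord (X_op \<phi>) k + of_int (int n - int k) * a (int n - int k) * coord \<phi> k)
        = (\<lambda>k. of_nat n * (a (int n - int k) * coord \<phi> k))"
      by (simp add: coord_X_op[OF \<phi>] algebra_simps)
    ultimately show ?thesis
      using sums_unique2[OF sums_mult[OF toep_coord_sums[OF a n], of "of_nat n" \<phi>]] by simp
  qed simp
  show "toep a \<phi> \<in> dom_X" "X_op (toep a \<phi>) = toep a (X_op \<phi>) + toep (\<lambda>j. of_int j * a j) \<phi>"
    by (rule dom_XI[OF *])+
qed

lemma X_toep_symbol:
  assumes u: "C1_per u u'" and u': "C1_per u' u''" and \<phi>: "\<phi> \<in> dom_X"
  shows "toep (fcoef u) \<phi> \<in> dom_X"
    "X_op (toep (fcoef u) \<phi>) = toep (fcoef u) (X_op \<phi>) - \<i> *\<^sub>C toep (fcoef u') \<phi>"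
proof -
  have eq: "of_int j * fcoef u j = (- \<i>) * fcoef u' j" for j
    by (simp add: fcoef_deriv[OF u] flip: mult.assoc)
  have l: "l1 (\<lambda>j. (- \<i>) * fcoef u' j)"
    using fcoef_summable[OF u'] by (simp add: norm_mult)
  then have "l1 (\<lambda>j. of_int j * fcoef u j)" by (simp only: eq)
  note * = X_toep[OF fcoef_summable[OF u] this \<phi>]
  show "toep (fcoef u) \<phi> \<in> dom_X" by (rule *)
  show "X_op (toep (fcoef u) \<phi>) = toep (fcoef u) (X_op \<phi>) - \<i> *\<^sub>C toep (fcoef u') \<phi>"
    unfolding *(2) eq toep_cmult[OF fcoef_summable[OF u'] l] by simp
qed

section \<open>Semicommutators of Toeplitz operators\<close>

text \<open>The \<open>(n, k)\<close> entry of \<open>T\<^bsub>uv\<^esub> - T\<^sub>u T\<^sub>v\<close> is the part of the convolution of the Fourier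
  coefficients that runs over nonpositive intermediate sites.\<close>

lemma semicommutator_entry:
  assumes u: "C1_per u u'" and v: "C1_per v v'" and uv: "l1 (fcoef (\<lambda>\<theta>. u \<theta> * v \<theta>))"
    and n: "n > 0" and k: "k > 0"
    and B: "\<And>i. cmod (fcoef u (int n + int i)) * cmod (fcoef v (- int i - int k)) \<le> B * (1 / real (Suc i))\<^sup>2"
  shows "cmod (coord (toep (fcoef (\<lambda>\<theta>. u \<theta> * v \<theta>)) (basis k) - toep (fcoef u) (toep (fcoef v) (basis k))) n)
    \<le> B * (\<Sum>i. (1 / real (Suc i))\<^sup>2)"
proof -
  note lu = fcoef_summable[OF u] and lv = fcoef_summable[OF v]
  let ?f = "\<lambda>m::int. fcoef u (int n - m) * fcoef v (m - int k)"
  define S where "S = fcoef (\<lambda>\<theta>. u \<theta> * v \<theta>) (int n - int k)"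
  define R where "R = coord (toep (fcoef u) (toep (fcoef v) (basis k))) n"
  have "((\<lambda>j. fcoef u j * fcoef v (int n - int k - j)) has_sum S) (range (\<lambda>m. int n - m))"
  proof -
    have "range (\<lambda>m. int n - m) = UNIV" by (auto simp: image_iff intro: exI[of _ "int n - _"])
    then show ?thesis unfolding S_def using fcoef_product_has_sum[OF u C1_perD(4)[OF v]] by simp
  qed
  then have "((\<lambda>j. fcoef u j * fcoef v (int n - int k - j)) \<circ> (\<lambda>m. int n - m) has_sum S) UNIV"
    by (subst (asm) has_sum_reindex) (auto simp: inj_on_def)
  then have full: "(?f has_sum S) UNIV" by (simp add: comp_def algebra_simps)
  have "((\<lambda>m. fcoef u (int n - int m) * coord (toep (fcoef v) (basis k)) m) has_sum R) UNIV"
    unfolding R_def by (rule toep_coord_has_sum[OF lu n])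
  then have "((?f \<circ> int) has_sum R) {1..}"
    by (subst has_sum_cong_neutral[where T = UNIV and g = "\<lambda>m. fcoef u (int n - int m) * coord (toep (fcoef v) (basis k)) m"])
      (auto simp: coord_toep_basis[OF lv _ k] not_le Suc_le_eq)
  then have "(?f has_sum R) (int ` {1..})" by (subst has_sum_reindex) auto
  from has_sum_Diff[OF full this] have "(?f has_sum (S - R)) (UNIV - int ` {1..})" by simp
  also have "UNIV - int ` {1..} = range (\<lambda>i. - int i)"
  proof (intro equalityI subsetI)
    fix m assume m: "m \<in> UNIV - int ` {1..}"
    have "m \<le> 0"
    proof (rule ccontr)
      assume "\<not> m \<le> 0"
      then have "m = int (nat m)" "nat m \<in> {1..}" by auto
      with m show False by blast
    qed
    then have "m = - int (nat (- m))" by simp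
    then show "m \<in> range (\<lambda>i. - int i)" by blast
  qed auto
  finally have "((?f \<circ> (\<lambda>i. - int i)) has_sum (S - R)) UNIV"
    by (subst (asm) has_sum_reindex) (auto simp: inj_def)
  then have sums: "(\<lambda>i. fcoef u (int n + int i) * fcoef v (- int i - int k)) sums (S - R)"
    using has_sum_imp_sums by (fastforce simp: comp_def)
  have summ: "summable (\<lambda>i. B * (1 / real (Suc i))\<^sup>2)"
    by (intro summable_mult) (use summable_inverse_squares summable_Suc_iff[of "\<lambda>k. (1 / real k)\<^sup>2"] in simp)
  have "cmod (S - R) \<le> (\<Sum>i. B * (1 / real (Suc i))\<^sup>2)"
    unfolding sums_unique[OF sums]
    by (rule norm_suminf_le[OF _ summ]) (use B in \<open>simp add: norm_mult\<close>)
  also have "\<dots> = B * (\<Sum>i. (1 / real (Suc i))\<^sup>2)"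
    by (rule suminf_mult) (use summable_inverse_squares summable_Suc_iff[of "\<lambda>k. (1 / real k)\<^sup>2"] in simp)
  finally show ?thesis by (simp add: S_def R_def coord_toep_basis[OF uv n k])
qed

lemma coord_bound_from_columns:
  assumes B: "bounded_op B" and c: "\<And>k. k > 0 \<Longrightarrow> cmod (coord (B (basis k)) n) \<le> c / real k"
  shows "cmod (coord (B \<phi>) n) \<le> c * (\<Sum>k. cmod (coord \<phi> k) / real k)"
proof (rule LIMSEQ_le_const2)
  show "(\<lambda>N. cmod (coord (B (trunc N \<phi>)) n)) \<longlonglongrightarrow> cmod (coord (B \<phi>) n)"
    by (intro tendsto_norm bounded_linear.tendsto[OF bounded_linear_coord] bounded_op_tendsto[OF B] trunc_tendsto)
  have c0: "c \<ge> 0" using order_trans[OF norm_ge_zero c[of 1]] by simp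
  have "cmod (coord (B (trunc N \<phi>)) n) \<le> c * (\<Sum>k. cmod (coord \<phi> k) / real k)" for N
  proof -
    have "cmod (coord (B (trunc N \<phi>)) n) = cmod (\<Sum>k\<le>N. coord \<phi> k * coord (B (basis k)) n)"
      unfolding trunc_def by (simp add: bounded_op_simps[OF B])
    also have "\<dots> \<le> (\<Sum>k\<le>N. c * (cmod (coord \<phi> k) / real k))"
    proof (rule order_trans[OF norm_sum], rule sum_mono)
      fix k
      show "cmod (coord \<phi> k * coord (B (basis k)) n) \<le> c * (cmod (coord \<phi> k) / real k)"
      proof (cases "k = 0")
        case False
        then have "cmod (coord \<phi> k) * cmod (coord (B (basis k)) n) \<le> cmod (coord \<phi> k) * (c / real k)"
          by (intro mult_left_mono c) auto
        then show ?thesis by (simp add: norm_mult mult.commute)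
      qed simp
    qed
    also have "\<dots> = c * (\<Sum>k\<le>N. cmod (coord \<phi> k) / real k)" by (simp add: sum_distrib_left)
    also have "\<dots> \<le> c * (\<Sum>k. cmod (coord \<phi> k) / real k)"
      by (intro mult_left_mono c0 sum_le_suminf summable_coord_over_n) auto
    finally show ?thesis .
  qed
  then show "\<exists>N. \<forall>M\<ge>N. cmod (coord (B (trunc M \<phi>)) n) \<le> c * (\<Sum>k. cmod (coord \<phi> k) / real k)" by blast
qed

lemma norm_from_coord_decay:
  assumes "\<And>n. n > 0 \<Longrightarrow> cmod (coord \<psi> n) \<le> r / real n" "r \<ge> 0"
  shows "norm \<psi> \<le> sqrt (\<Sum>n. (1 / real n)\<^sup>2) * r"
proof (rule norm_ell2_le)
  fix J
  have "(\<Sum>n<J. (cmod (coord \<psi> n))\<^sup>2) \<le> (\<Sum>n<J. r\<^sup>2 * (1 / real n)\<^sup>2)"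
  proof (rule sum_mono)
    fix n
    show "(cmod (coord \<psi> n))\<^sup>2 \<le> r\<^sup>2 * (1 / real n)\<^sup>2"
    proof (cases "n = 0")
      case False
      then have "(cmod (coord \<psi> n))\<^sup>2 \<le> (r / real n)\<^sup>2" by (intro power_mono assms) auto
      then show ?thesis by (simp add: power_divide)
    qed simp
  qed
  also have "\<dots> = r\<^sup>2 * (\<Sum>n<J. (1 / real n)\<^sup>2)" by (simp add: sum_distrib_left)
  also have "\<dots> \<le> r\<^sup>2 * (\<Sum>n. (1 / real n)\<^sup>2)"
    by (intro mult_left_mono sum_le_suminf summable_inverse_squares) auto
  also have "\<dots> = (sqrt (\<Sum>n. (1 / real n)\<^sup>2) * r)\<^sup>2"
    by (simp add: power_mult_distrib suminf_nonneg[OF summable_inverse_squares])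
  finally show "(\<Sum>n<J. (cmod (coord \<psi> n))\<^sup>2) \<le> (sqrt (\<Sum>n. (1 / real n)\<^sup>2) * r)\<^sup>2" .
qed (use assms(2) suminf_nonneg[OF summable_inverse_squares] in auto)

definition decay :: "nat \<Rightarrow> (real \<Rightarrow> complex) \<Rightarrow> bool" where
  "decay p u \<longleftrightarrow> (\<exists>C\<ge>0. \<forall>j. cmod (fcoef u j) * \<bar>real_of_int j\<bar> ^ p \<le> C)"

lemma decay_0:
  assumes "continuous_on UNIV u"
  shows "decay 0 u"
proof -
  obtain B where "B \<ge> 0" "\<And>\<theta>. \<theta> \<in> {0..2*pi} \<Longrightarrow> cmod (u \<theta>) \<le> B"
    by (rule bounded_on_period[OF assms]) auto
  then show ?thesis unfolding decay_def using fcoef_bound[OF assms] by auto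
qed

lemma decay_Suc:
  assumes "C1_per u u'" "decay p u'"
  shows "decay (Suc p) u"
  using assms(2) unfolding decay_def fcoef_deriv[OF assms(1)]
  by (simp add: norm_mult mult_ac)

lemma decayD:
  assumes "decay p u"
  obtains C where "C \<ge> 0" "\<And>j. j \<noteq> 0 \<Longrightarrow> cmod (fcoef u j) \<le> C / \<bar>real_of_int j\<bar> ^ p"
  using assms unfolding decay_def by (auto simp: field_simps)

definition C2_per :: "(real \<Rightarrow> complex) \<Rightarrow> bool" where
  "C2_per u \<longleftrightarrow> (\<exists>u' u''. C1_per u u' \<and> C1_per u' u'')"

lemma C2_per_decay: "C2_per u \<Longrightarrow> decay 2 u"
  unfolding C2_per_def numeral_2_eq_2 using decay_Suc decay_0 C1_perD(2) by blast

lemma C2_per_l1: "C2_per u \<Longrightarrow> l1 (fcoef u)"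
  unfolding C2_per_def using fcoef_summable by blast

lemma C1_per_add:
  assumes "C1_per u u'" "C1_per v v'"
  shows "C1_per (\<lambda>\<theta>. u \<theta> + v \<theta>) (\<lambda>\<theta>. u' \<theta> + v' \<theta>)"
  using assms unfolding C1_per_def by (auto intro!: has_vector_derivative_add continuous_intros)

lemma C1_per_mult:
  assumes "C1_per u u'" "C1_per v v'"
  shows "C1_per (\<lambda>\<theta>. u \<theta> * v \<theta>) (\<lambda>\<theta>. u \<theta> * v' \<theta> + u' \<theta> * v \<theta>)"
  using assms C1_perD(4)[OF assms(1)] C1_perD(4)[OF assms(2)] unfolding C1_per_def
  by (auto intro!: has_vector_derivative_mult continuous_intros)

lemma C2_per_const: "C2_per (\<lambda>_. c)"
proof -
  have "C1_per (\<lambda>_. c) (\<lambda>_. 0)" "C1_per (\<lambda>_. 0) (\<lambda>_. 0)" by (auto simp: C1_per_def)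
  then show ?thesis unfolding C2_per_def by blast
qed

lemma C2_per_add: "C2_per u \<Longrightarrow> C2_per v \<Longrightarrow> C2_per (\<lambda>\<theta>. u \<theta> + v \<theta>)"
  unfolding C2_per_def using C1_per_add by blast

lemma C2_per_mult: "C2_per u \<Longrightarrow> C2_per v \<Longrightarrow> C2_per (\<lambda>\<theta>. u \<theta> * v \<theta>)"
  unfolding C2_per_def using C1_per_add C1_per_mult by blast

lemma C2_per_cont: "C2_per u \<Longrightarrow> continuous_on UNIV u"
  unfolding C2_per_def using C1_perD(4) by blast

text \<open>The elementary estimate \<open>(n + i)\<^sup>2 \<ge> n (1 + i)\<close> separates the variables.\<close>

lemma compact_semicommutator:
  assumes u: "C2_per u" and v: "C2_per v"
  shows "compact_bound (\<lambda>\<phi>. toep (fcoef (\<lambda>\<theta>. u \<theta> * v \<theta>)) \<phi> - toep (fcoef u) (toep (fcoef v) \<phi>))"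
    (is "compact_bound ?D")
proof -
  obtain Cu where Cu: "Cu \<ge> 0" "\<And>j. j \<noteq> 0 \<Longrightarrow> cmod (fcoef u j) \<le> Cu / \<bar>real_of_int j\<bar> ^ 2"
    using decayD[OF C2_per_decay[OF u]] by blast
  obtain Cv where Cv: "Cv \<ge> 0" "\<And>j. j \<noteq> 0 \<Longrightarrow> cmod (fcoef v j) \<le> Cv / \<bar>real_of_int j\<bar> ^ 2"
    using decayD[OF C2_per_decay[OF v]] by blast
  obtain u' v' where u': "C1_per u u'" and v': "C1_per v v'" using u v unfolding C2_per_def by blast
  let ?S = "\<Sum>i. (1 / real (Suc i))\<^sup>2"
  have S0: "?S \<ge> 0"
    by (rule suminf_nonneg) (use summable_inverse_squares summable_Suc_iff[of "\<lambda>k. (1 / real k)\<^sup>2"] in auto)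
  note luv = C2_per_l1[OF C2_per_mult[OF u v]]
  have D: "bounded_op ?D"
    by (intro bounded_op_diff bounded_op_toep luv
        bounded_op_compose[OF bounded_op_toep[OF C2_per_l1[OF u]] bounded_op_toep[OF C2_per_l1[OF v]]])
  have entry: "cmod (coord (?D (basis k)) n) \<le> (Cu * Cv * ?S / real n) / real k" if n: "n > 0" and k: "k > 0" for n k
  proof -
    have "cmod (coord (?D (basis k)) n) \<le> (Cu * Cv / (real n * real k)) * ?S"
    proof (rule semicommutator_entry[OF u' v' luv n k])
      fix i
      have 1: "cmod (fcoef u (int n + int i)) \<le> Cu / (real n * real (Suc i))"
      proof -
        have "cmod (fcoef u (int n + int i)) \<le> Cu / (real n + real i) ^ 2" using Cu(2)[of "int n + int i"] n by simp
        also have "\<dots> \<le> Cu / (real n * real (Suc i))"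
          unfolding power2_eq_square using n Cu(1) by (intro divide_left_mono mult_mono mult_pos_pos) auto
        finally show ?thesis .
      qed
      have 2: "cmod (fcoef v (- int i - int k)) \<le> Cv / (real k * real (Suc i))"
      proof -
        have "\<bar>real_of_int (- int i - int k)\<bar> = real k + real i" by simp
        then have "cmod (fcoef v (- int i - int k)) \<le> Cv / (real k + real i) ^ 2" using Cv(2)[of "- int i - int k"] k by simp
        also have "\<dots> \<le> Cv / (real k * real (Suc i))"
          unfolding power2_eq_square using k Cv(1) by (intro divide_left_mono mult_mono mult_pos_pos) auto
        finally show ?thesis .
      qed
      have "cmod (fcoef u (int n + int i)) * cmod (fcoef v (- int i - int k))
          \<le> (Cu / (real n * real (Suc i))) * (Cv / (real k * real (Suc i)))"
        using Cu Cv by (intro mult_mono 1 2) auto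
      also have "\<dots> = Cu * Cv / (real n * real k) * (1 / real (Suc i))\<^sup>2"
        by (simp add: power2_eq_square)
      finally show "cmod (fcoef u (int n + int i)) * cmod (fcoef v (- int i - int k))
          \<le> Cu * Cv / (real n * real k) * (1 / real (Suc i))\<^sup>2" .
    qed
    then show ?thesis by simp
  qed
  show ?thesis
  proof (rule compact_bound_coord_sum)
    fix \<phi>
    let ?s = "\<Sum>k. cmod (coord \<phi> k) / real k"
    have s0: "?s \<ge> 0" by (rule suminf_nonneg[OF summable_coord_over_n]) simp
    have "norm (?D \<phi>) \<le> sqrt (\<Sum>n. (1 / real n)\<^sup>2) * (Cu * Cv * ?S * ?s)"
    proof (rule norm_from_coord_decay)
      show "cmod (coord (?D \<phi>) n) \<le> Cu * Cv * ?S * ?s / real n" if "n > 0" for n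
        using coord_bound_from_columns[OF D entry[OF that], of \<phi>] by simp
      show "0 \<le> Cu * Cv * ?S * ?s" using Cu Cv S0 s0 by simp
    qed
    then show "norm (?D \<phi>) \<le> (sqrt (\<Sum>n. (1 / real n)\<^sup>2) * (Cu * Cv * ?S)) * ?s" by (simp add: mult.assoc)
  next
    show "0 \<le> sqrt (\<Sum>n. (1 / real n)\<^sup>2) * (Cu * Cv * ?S)"
      using Cu Cv S0 suminf_nonneg[OF summable_inverse_squares] by simp
  qed
qed

section \<open>Commutators as operators\<close>

lemma bounded_sesquilinear_op:
  assumes "bounded_sesquilinear q"
  obtains C where "bounded_op C" "\<And>\<phi> \<psi>. q \<phi> \<psi> = cinner \<phi> (C \<psi>)"
proof -
  interpret bounded_bilinear q using assms by (simp add: bounded_sesquilinear_def)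
  obtain K where K: "\<forall>a b. norm (q a b) \<le> norm a * norm b * K" using bounded by (rule exE)
  show ?thesis
  proof (rule riesz_form[of q K])
    show "q \<phi> (c *\<^sub>C a) = c * q \<phi> a" "q (c *\<^sub>C a) \<phi> = cnj c * q a \<phi>" for c \<phi> a
      using assms by (simp_all add: bounded_sesquilinear_def)
    show "cmod (q \<phi> \<psi>) \<le> norm \<phi> * norm \<psi> * K" for \<phi> \<psi> using K by blast
    fix C assume "bounded_op C" "\<And>\<phi> \<psi>. q \<phi> \<psi> = cinner \<phi> (C \<psi>)"
    then show thesis by (rule that)
  qed (simp_all add: add_left add_right)
qed

lemma C1_op:
  assumes "C1 A B"
  obtains C where "bounded_op C"
    "\<And>\<phi> \<phi>' \<psi> \<psi>'. (\<phi>, \<phi>') \<in> A \<Longrightarrow> (\<psi>, \<psi>') \<in> A \<Longrightarrow> cinner \<phi>' (B \<psi>) - cinner \<phi> (B \<psi>') = cinner \<phi> (C \<psi>)"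
proof -
  obtain q where q: "bounded_sesquilinear q"
    "\<forall>(\<phi>, \<phi>')\<in>A. \<forall>(\<psi>, \<psi>')\<in>A. cinner \<phi>' (B \<psi>) - cinner \<phi> (B \<psi>') = q \<phi> \<psi>"
    using assms unfolding C1_def by blast
  obtain C where C: "bounded_op C" "\<And>\<phi> \<psi>. q \<phi> \<psi> = cinner \<phi> (C \<psi>)"
    using bounded_sesquilinear_op[OF q(1)] by blast
  show ?thesis
  proof (rule that[OF C(1)])
    fix \<phi> \<phi>' \<psi> \<psi>' assume "(\<phi>, \<phi>') \<in> A" "(\<psi>, \<psi>') \<in> A"
    then show "cinner \<phi>' (B \<psi>) - cinner \<phi> (B \<psi>') = cinner \<phi> (C \<psi>)"
      using q(2) C(2) by fastforce
  qed
qed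

lemma cinner_zero_dense:
  assumes D: "closure D = UNIV" and C: "bounded_op C"
    and 0: "\<And>\<phi> \<psi>. \<phi> \<in> D \<Longrightarrow> \<psi> \<in> D \<Longrightarrow> cinner \<phi> (C \<psi>) = 0"
  shows "C \<psi> = 0"
proof (rule cinner_eqI)
  fix \<phi>
  obtain f where f: "\<And>n. f n \<in> D" "f \<longlonglongrightarrow> \<phi>" using D closure_sequential[of \<phi> D] by auto
  obtain g where g: "\<And>n. g n \<in> D" "g \<longlonglongrightarrow> \<psi>" using D closure_sequential[of \<psi> D] by auto
  have "(\<lambda>n. cinner (f n) (C (g n))) \<longlonglongrightarrow> cinner \<phi> (C \<psi>)"
    by (intro cinner.tendsto f bounded_op_tendsto[OF C] g)
  then have "(\<lambda>n. 0) \<longlonglongrightarrow> cinner \<phi> (C \<psi>)" using 0[OF f(1) g(1)] by simp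
  then show "cinner \<phi> (C \<psi>) = cinner \<phi> 0" by (simp add: LIMSEQ_const_iff)
qed

text \<open>The commutator is unique because it is tested on a dense domain, so \<open>ad A B\<close> denotes it.\<close>

lemma ad_op:
  assumes "C1 A B" and dense: "closure (Domain A) = UNIV"
  shows "bounded_op (ad A B)"
    "(\<phi>, \<phi>') \<in> A \<Longrightarrow> (\<psi>, \<psi>') \<in> A \<Longrightarrow> cinner \<phi>' (B \<psi>) - cinner \<phi> (B \<psi>') = cinner \<phi> (ad A B \<psi>)"
proof -
  let ?P = "\<lambda>C. bounded_op C \<and> (\<forall>(\<phi>, \<phi>')\<in>A. \<forall>(\<psi>, \<psi>')\<in>A. cinner \<phi>' (B \<psi>) - cinner \<phi> (B \<psi>') = cinner \<phi> (C \<psi>))"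
  obtain C where C: "bounded_op C"
    "\<And>\<phi> \<phi>' \<psi> \<psi>'. (\<phi>, \<phi>') \<in> A \<Longrightarrow> (\<psi>, \<psi>') \<in> A \<Longrightarrow> cinner \<phi>' (B \<psi>) - cinner \<phi> (B \<psi>') = cinner \<phi> (C \<psi>)"
    using C1_op[OF assms(1)] by blast
  have "?P (ad A B)"
    unfolding ad_def
  proof (rule theI[of ?P])
    show "?P C" using C by auto
    fix D assume D: "?P D"
    have "D \<psi> - C \<psi> = 0" for \<psi>
    proof (rule cinner_zero_dense[OF dense, of "\<lambda>\<psi>. D \<psi> - C \<psi>"])
      show "bounded_op (\<lambda>\<psi>. D \<psi> - C \<psi>)" using D C by (intro bounded_op_diff) auto
      fix \<phi> \<psi> assume "\<phi> \<in> Domain A" "\<psi> \<in> Domain A"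
      then obtain \<phi>' \<psi>' where *: "(\<phi>, \<phi>') \<in> A" "(\<psi>, \<psi>') \<in> A" by auto
      then have "cinner \<phi>' (B \<psi>) - cinner \<phi> (B \<psi>') = cinner \<phi> (D \<psi>)" using D by fastforce
      then show "cinner \<phi> (D \<psi> - C \<psi>) = 0" using C(2)[OF *] by (simp add: cinner_diff_right)
    qed
    then show "D = C" by (auto simp: fun_eq_iff)
  qed
  then show "bounded_op (ad A B)"
    "(\<phi>, \<phi>') \<in> A \<Longrightarrow> (\<psi>, \<psi>') \<in> A \<Longrightarrow> cinner \<phi>' (B \<psi>) - cinner \<phi> (B \<psi>') = cinner \<phi> (ad A B \<psi>)"
    by auto
qed

text \<open>Tested with the basis vectors, the commutator identity says that \<open>V (X \<psi>) + W \<psi>\<close> has the coordinates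
  \<open>n (V \<psi>)\<^sub>n\<close>; hence \<open>V \<psi>\<close> is in the domain of \<open>X\<close>.\<close>

lemma C1_X_commutator:
  assumes V: "bounded_op V" and C1: "C1 X_graph V"
  obtains W where "bounded_op W"
    "\<And>\<psi>. \<psi> \<in> dom_X \<Longrightarrow> V \<psi> \<in> dom_X" "\<And>\<psi>. \<psi> \<in> dom_X \<Longrightarrow> X_op (V \<psi>) = V (X_op \<psi>) + W \<psi>"
proof -
  obtain W where W: "bounded_op W"
    "\<And>\<phi> \<phi>' \<psi> \<psi>'. (\<phi>, \<phi>') \<in> X_graph \<Longrightarrow> (\<psi>, \<psi>') \<in> X_graph \<Longrightarrow> cinner \<phi>' (V \<psi>) - cinner \<phi> (V \<psi>') = cinner \<phi> (W \<psi>)"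
    using C1_op[OF C1] by blast
  have *: "coord (V (X_op \<psi>) + W \<psi>) n = of_nat n * coord (V \<psi>) n" if "\<psi> \<in> dom_X" for \<psi> n
  proof -
    have "(basis n, of_nat n *\<^sub>C basis n) \<in> X_graph" using X_basis[of n] unfolding X_graph_def by force
    moreover have "(\<psi>, X_op \<psi>) \<in> X_graph" using that by (auto simp: X_graph_def)
    ultimately have "cinner (of_nat n *\<^sub>C basis n) (V \<psi>) - cinner (basis n) (V (X_op \<psi>)) = cinner (basis n) (W \<psi>)"
      by (rule W(2))
    then show ?thesis by (simp add: algebra_simps)
  qed
  show ?thesis
    by (rule that[OF W(1)]) (use dom_XI[OF *] in blast)+
qed

text \<open>On the domain of \<open>X\<^sup>2\<close> the form \<open>2 Re \<langle>X \<psi>, i [X, V] \<psi>\<rangle>\<close> is that of \<open>i [X\<^sup>2, V]\<close>; finite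
  truncations carry the bound over to the domain of \<open>X\<close>.\<close>

lemma C1_X2_bound:
  assumes V: "bounded_op V" "symmetric_op V" and C1: "C1 (X_graph O X_graph) V"
    and W: "bounded_op W" "\<And>\<psi>. \<psi> \<in> dom_X \<Longrightarrow> V \<psi> \<in> dom_X"
      "\<And>\<psi>. \<psi> \<in> dom_X \<Longrightarrow> X_op (V \<psi>) = V (X_op \<psi>) + W \<psi>"
  obtains K where "\<And>\<psi>. \<psi> \<in> dom_X \<Longrightarrow> \<bar>2 * Re (cinner (X_op \<psi>) (\<i> *\<^sub>C W \<psi>))\<bar> \<le> K * (norm \<psi>)\<^sup>2"
proof -
  obtain C where C: "bounded_op C"
    "\<And>\<phi> \<phi>' \<psi> \<psi>'. (\<phi>, \<phi>') \<in> X_graph O X_graph \<Longrightarrow> (\<psi>, \<psi>') \<in> X_graph O X_graph \<Longrightarrow>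
      cinner \<phi>' (V \<psi>) - cinner \<phi> (V \<psi>') = cinner \<phi> (C \<psi>)"
    using C1_op[OF C1] by blast
  obtain K where K: "K > 0" "\<And>\<psi>. norm (C \<psi>) \<le> norm \<psi> * K" using bounded_op_bound[OF C(1)] by blast
  have bound: "\<bar>2 * Re (cinner (X_op \<psi>) (\<i> *\<^sub>C W \<psi>))\<bar> \<le> K * (norm \<psi>)\<^sup>2"
    if \<psi>: "\<psi> \<in> dom_X" "X_op \<psi> \<in> dom_X" for \<psi>
  proof -
    have g: "(\<psi>, X_op (X_op \<psi>)) \<in> X_graph O X_graph" using \<psi> by (auto simp: X_graph_def)
    define z where "z = cinner (X_op (X_op \<psi>)) (V \<psi>)"
    have z: "z = cinner (X_op \<psi>) (X_op (V \<psi>))"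
      unfolding z_def using \<psi> W(2) by (intro X_symmetric) auto
    have "cinner \<psi> (V (X_op (X_op \<psi>))) = cinner (V \<psi>) (X_op (X_op \<psi>))"
      by (rule symmetric_opD[OF V(2), symmetric])
    also have "\<dots> = cnj z" unfolding z_def by (rule cinner_commute)
    finally have "z - cnj z = cinner \<psi> (C \<psi>)" using C(2)[OF g g] by (simp add: z_def)
    from arg_cong[OF this, of cmod] have im: "2 * \<bar>Im z\<bar> = cmod (cinner \<psi> (C \<psi>))"
      by (simp add: complex_diff_cnj norm_mult)
    have "cinner (X_op \<psi>) (V (X_op \<psi>)) = cnj (cinner (X_op \<psi>) (V (X_op \<psi>)))"
      using cinner_commute[of "X_op \<psi>" "V (X_op \<psi>)"] symmetric_opD[OF V(2), of "X_op \<psi>" "X_op \<psi>"] by simp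
    from arg_cong[OF this, of Im] have "Im (cinner (X_op \<psi>) (V (X_op \<psi>))) = 0" by simp
    then have "Im (cinner (X_op \<psi>) (W \<psi>)) = Im z"
      unfolding z W(3)[OF \<psi>(1)] cinner_add_right by simp
    then have "\<bar>2 * Re (cinner (X_op \<psi>) (\<i> *\<^sub>C W \<psi>))\<bar> = cmod (cinner \<psi> (C \<psi>))"
      using im by simp
    also have "\<dots> \<le> norm \<psi> * norm (C \<psi>)" by (rule Cauchy_Schwarz_cinner)
    also have "\<dots> \<le> norm \<psi> * (norm \<psi> * K)" by (intro mult_left_mono K) simp
    finally show ?thesis by (simp add: power2_eq_square mult_ac)
  qed
  show ?thesis
  proof (rule that)
    fix \<psi> assume \<psi>: "\<psi> \<in> dom_X"
    show "\<bar>2 * Re (cinner (X_op \<psi>) (\<i> *\<^sub>C W \<psi>))\<bar> \<le> K * (norm \<psi>)\<^sup>2"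
    proof (rule LIMSEQ_le)
      show "(\<lambda>N. \<bar>2 * Re (cinner (X_op (trunc N \<psi>)) (\<i> *\<^sub>C W (trunc N \<psi>)))\<bar>)
          \<longlonglongrightarrow> \<bar>2 * Re (cinner (X_op \<psi>) (\<i> *\<^sub>C W \<psi>))\<bar>"
        unfolding X_trunc(2)[OF \<psi>]
        by (intro tendsto_intros cinner.tendsto trunc_tendsto bounded_op_tendsto[OF bounded_op_scaleC[OF W(1)]])
      show "(\<lambda>N. K * (norm (trunc N \<psi>))\<^sup>2) \<longlonglongrightarrow> K * (norm \<psi>)\<^sup>2"
        by (intro tendsto_intros trunc_tendsto)
      show "\<exists>N. \<forall>n\<ge>N. \<bar>2 * Re (cinner (X_op (trunc n \<psi>)) (\<i> *\<^sub>C W (trunc n \<psi>)))\<bar> \<le> K * (norm (trunc n \<psi>))\<^sup>2"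
      proof (intro exI allI impI)
        fix n show "\<bar>2 * Re (cinner (X_op (trunc n \<psi>)) (\<i> *\<^sub>C W (trunc n \<psi>)))\<bar> \<le> K * (norm (trunc n \<psi>))\<^sup>2"
          by (rule bound[OF X_trunc(1)]) (simp only: X_trunc(2)[OF \<psi>] X_trunc(1))
      qed
    qed
  qed
qed

section \<open>The commutator of two Toeplitz operators, multiplied by the position operator\<close>

text \<open>\<open>L\<close> is the difference of the semicommutators for \<open>(u, v)\<close> and \<open>(v, u)\<close>. Because of \<open>(n + i)\<^sup>3 \<ge> n\<^sup>2 (1 + i)\<close>
  and \<open>(k + i)\<^sup>2 \<ge> k (1 + i)\<close>, and similarly with the roles of \<open>u\<close> and \<open>v\<close> exchanged, its entries are of
  order \<open>n\<^bsup>-2\<^esup> k\<^bsup>-1\<^esup>\<close>. This leaves one power of \<open>n\<close> for \<open>X\<close>.\<close>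

lemma position_commutator:
  assumes u: "C1_per u u'" "decay 3 u" and v: "C1_per v v'" "decay 2 v" and uv: "l1 (fcoef (\<lambda>\<theta>. u \<theta> * v \<theta>))"
  defines "L \<equiv> \<lambda>\<phi>. toep (fcoef v) (toep (fcoef u) \<phi>) - toep (fcoef u) (toep (fcoef v) \<phi>)"
  shows "L \<phi> \<in> dom_X" "compact_bound (\<lambda>\<phi>. X_op (L \<phi>))"
proof -
  obtain Cu where Cu: "Cu \<ge> 0" "\<And>j. j \<noteq> 0 \<Longrightarrow> cmod (fcoef u j) \<le> Cu / \<bar>real_of_int j\<bar> ^ 3"
    using decayD[OF u(2)] by blast
  obtain Cv where Cv: "Cv \<ge> 0" "\<And>j. j \<noteq> 0 \<Longrightarrow> cmod (fcoef v j) \<le> Cv / \<bar>real_of_int j\<bar> ^ 2"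
    using decayD[OF v(2)] by blast
  note lu = fcoef_summable[OF u(1)] and lv = fcoef_summable[OF v(1)]
  have vu: "(\<lambda>\<theta>. v \<theta> * u \<theta>) = (\<lambda>\<theta>. u \<theta> * v \<theta>)" by (simp add: mult.commute)
  let ?S = "\<Sum>i. (1 / real (Suc i))\<^sup>2"
  have S0: "?S \<ge> 0"
    by (rule suminf_nonneg) (use summable_inverse_squares summable_Suc_iff[of "\<lambda>k. (1 / real k)\<^sup>2"] in auto)
  have L: "bounded_op L"
    unfolding L_def
    by (intro bounded_op_diff bounded_op_compose[OF bounded_op_toep[OF lu] bounded_op_toep[OF lv]]
        bounded_op_compose[OF bounded_op_toep[OF lv] bounded_op_toep[OF lu]])
  let ?C = "2 * (Cu * Cv * ?S)"
  have C0: "?C \<ge> 0" using Cu Cv S0 by simp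
  have entry: "cmod (coord (L (basis k)) n) \<le> (?C / (real n)\<^sup>2) / real k" if n: "n > 0" and k: "k > 0" for n k
  proof -
    let ?D1 = "coord (toep (fcoef (\<lambda>\<theta>. u \<theta> * v \<theta>)) (basis k) - toep (fcoef u) (toep (fcoef v) (basis k))) n"
    let ?D2 = "coord (toep (fcoef (\<lambda>\<theta>. v \<theta> * u \<theta>)) (basis k) - toep (fcoef v) (toep (fcoef u) (basis k))) n"
    have up: "cmod (fcoef u (int n + int i)) \<le> Cu / ((real n)\<^sup>2 * real (Suc i))" for i
    proof -
      have "cmod (fcoef u (int n + int i)) \<le> Cu / (real n + real i) ^ 3" using Cu(2)[of "int n + int i"] n by simp
      also have "\<dots> \<le> Cu / ((real n)\<^sup>2 * real (Suc i))"
        unfolding power2_eq_square power3_eq_cube using n Cu(1)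
        by (intro divide_left_mono mult_mono mult_pos_pos) auto
      finally show ?thesis .
    qed
    have vm: "cmod (fcoef v (- int i - int k)) \<le> Cv / (real k * real (Suc i))" for i
    proof -
      have "\<bar>real_of_int (- int i - int k)\<bar> = real k + real i" by simp
      then have "cmod (fcoef v (- int i - int k)) \<le> Cv / (real k + real i) ^ 2" using Cv(2)[of "- int i - int k"] k by simp
      also have "\<dots> \<le> Cv / (real k * real (Suc i))"
        unfolding power2_eq_square using k Cv(1) by (intro divide_left_mono mult_mono mult_pos_pos) auto
      finally show ?thesis .
    qed
    have vp: "cmod (fcoef v (int n + int i)) \<le> Cv / (real n)\<^sup>2" for i
    proof -
      have "cmod (fcoef v (int n + int i)) \<le> Cv / (real n + real i) ^ 2" using Cv(2)[of "int n + int i"] n by simp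
      also have "\<dots> \<le> Cv / (real n)\<^sup>2"
        using n Cv(1) by (intro divide_left_mono power_mono mult_pos_pos) auto
      finally show ?thesis .
    qed
    have um: "cmod (fcoef u (- int i - int k)) \<le> Cu / (real k * (real (Suc i) * real (Suc i)))" for i
    proof -
      have "\<bar>real_of_int (- int i - int k)\<bar> = real k + real i" by simp
      then have "cmod (fcoef u (- int i - int k)) \<le> Cu / (real k + real i) ^ 3" using Cu(2)[of "- int i - int k"] k by simp
      also have "\<dots> \<le> Cu / (real k * (real (Suc i) * real (Suc i)))"
        unfolding power3_eq_cube mult.assoc using k Cu(1)
        by (intro divide_left_mono mult_mono mult_pos_pos) auto
      finally show ?thesis .
    qed
    have "cmod ?D1 \<le> (Cu * Cv / ((real n)\<^sup>2 * real k)) * ?S"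
    proof (rule semicommutator_entry[OF u(1) v(1) uv n k])
      fix i
      have "cmod (fcoef u (int n + int i)) * cmod (fcoef v (- int i - int k))
          \<le> (Cu / ((real n)\<^sup>2 * real (Suc i))) * (Cv / (real k * real (Suc i)))"
        using Cu Cv by (intro mult_mono up vm) auto
      also have "\<dots> = Cu * Cv / ((real n)\<^sup>2 * real k) * (1 / real (Suc i))\<^sup>2"
        by (simp add: power2_eq_square mult_ac)
      finally show "cmod (fcoef u (int n + int i)) * cmod (fcoef v (- int i - int k))
          \<le> Cu * Cv / ((real n)\<^sup>2 * real k) * (1 / real (Suc i))\<^sup>2" .
    qed
    moreover have "cmod ?D2 \<le> (Cu * Cv / ((real n)\<^sup>2 * real k)) * ?S"
    proof (rule semicommutator_entry[OF v(1) u(1) _ n k])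
      show "l1 (fcoef (\<lambda>\<theta>. v \<theta> * u \<theta>))" unfolding vu by (rule uv)
      fix i
      have "cmod (fcoef v (int n + int i)) * cmod (fcoef u (- int i - int k))
          \<le> (Cv / (real n)\<^sup>2) * (Cu / (real k * (real (Suc i) * real (Suc i))))"
        using Cu Cv by (intro mult_mono vp um) auto
      also have "\<dots> = Cu * Cv / ((real n)\<^sup>2 * real k) * (1 / real (Suc i))\<^sup>2"
        by (simp add: power2_eq_square mult_ac)
      finally show "cmod (fcoef v (int n + int i)) * cmod (fcoef u (- int i - int k))
          \<le> Cu * Cv / ((real n)\<^sup>2 * real k) * (1 / real (Suc i))\<^sup>2" .
    qed
    moreover have "coord (L (basis k)) n = ?D1 - ?D2"
      unfolding L_def vu by simp
    ultimately have "cmod (coord (L (basis k)) n) \<le> (Cu * Cv / ((real n)\<^sup>2 * real k)) * ?S + (Cu * Cv / ((real n)\<^sup>2 * real k)) * ?S"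
      using norm_triangle_ineq4[of ?D1 ?D2] by (simp only:)
    also have "\<dots> = (?C / (real n)\<^sup>2) / real k" by (simp add: mult_ac)
    finally show ?thesis .
  qed
  have decay: "real n * cmod (coord (L \<phi>) n) \<le> ?C * (\<Sum>k. cmod (coord \<phi> k) / real k) / real n" if n: "n > 0" for n \<phi>
  proof -
    have "cmod (coord (L \<phi>) n) \<le> ?C / (real n)\<^sup>2 * (\<Sum>k. cmod (coord \<phi> k) / real k)"
      by (rule coord_bound_from_columns[OF L entry[OF n]])
    from mult_left_mono[OF this, of "real n"] n show ?thesis by (simp add: power2_eq_square)
  qed
  have s0: "(\<Sum>k. cmod (coord \<phi> k) / real k) \<ge> 0" for \<phi>
    by (rule suminf_nonneg[OF summable_coord_over_n]) simp
  show dom: "L \<phi> \<in> dom_X" for \<phi>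
    unfolding dom_X_def mem_Collect_eq
  proof (rule summable_comparison_test')
    let ?r = "?C * (\<Sum>k. cmod (coord \<phi> k) / real k)"
    show "summable (\<lambda>n. ?r\<^sup>2 * (1 / real n)\<^sup>2)" by (intro summable_mult summable_inverse_squares)
    fix n :: nat
    show "norm ((real n)\<^sup>2 * (cmod (coord (L \<phi>) n))\<^sup>2) \<le> ?r\<^sup>2 * (1 / real n)\<^sup>2"
    proof (cases "n = 0")
      case False
      then have "(real n * cmod (coord (L \<phi>) n))\<^sup>2 \<le> (?r / real n)\<^sup>2" by (intro power_mono decay) auto
      then show ?thesis by (simp add: power_mult_distrib power_divide)
    qed simp
  qed
  show "compact_bound (\<lambda>\<phi>. X_op (L \<phi>))"
  proof (rule compact_bound_coord_sum)
    fix \<phi>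
    let ?s = "\<Sum>k. cmod (coord \<phi> k) / real k"
    have "norm (X_op (L \<phi>)) \<le> sqrt (\<Sum>n. (1 / real n)\<^sup>2) * (?C * ?s)"
    proof (rule norm_from_coord_decay)
      show "cmod (coord (X_op (L \<phi>)) n) \<le> ?C * ?s / real n" if "n > 0" for n
        using decay[OF that, of \<phi>] by (simp add: coord_X_op[OF dom] norm_mult)
      show "0 \<le> ?C * ?s" using C0 s0 by (rule mult_nonneg_nonneg)
    qed
    then show "norm (X_op (L \<phi>)) \<le> (sqrt (\<Sum>n. (1 / real n)\<^sup>2) * ?C) * ?s" by (simp add: mult.assoc)
  next
    show "0 \<le> sqrt (\<Sum>n. (1 / real n)\<^sup>2) * ?C"
      by (rule mult_nonneg_nonneg[OF _ C0]) (simp add: suminf_nonneg[OF summable_inverse_squares])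
  qed
qed

section \<open>Localization in energy\<close>

lemma toep_const: "toep (fcoef (\<lambda>_. c)) \<phi> = c *\<^sub>C \<phi>"
proof (rule toep_eqI)
  have f: "fcoef (\<lambda>_. c) j = (if j = 0 then c else 0)" for j
    using fcoef_cmult[of c "\<lambda>_. 1" j] by (simp add: fcoef_1)
  fix n :: nat
  have "(\<lambda>k. fcoef (\<lambda>_. c) (int n - int k) * coord \<phi> k) = (\<lambda>k. if k = n then c * coord \<phi> k else 0)"
    by (auto simp: f)
  then show "(\<lambda>k. fcoef (\<lambda>_. c) (int n - int k) * coord \<phi> k) sums coord (c *\<^sub>C \<phi>) n"
    using sums_single[of n "\<lambda>k. c * coord \<phi> k"] by simp
qed (rule C2_per_l1[OF C2_per_const])

lemma toep_fcoef_add: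
  assumes "C2_per u" "C2_per v"
  shows "toep (fcoef (\<lambda>\<theta>. u \<theta> + v \<theta>)) \<phi> = toep (fcoef u) \<phi> + toep (fcoef v) \<phi>"
proof -
  have eq: "fcoef (\<lambda>\<theta>. u \<theta> + v \<theta>) = (\<lambda>j. fcoef u j + fcoef v j)"
    by (rule ext) (intro fcoef_add C2_per_cont assms)
  show ?thesis
    using toep_add[OF C2_per_l1[OF assms(1)] C2_per_l1[OF assms(2)]] C2_per_l1[OF C2_per_add[OF assms]]
    unfolding eq by simp
qed

lemma toep_fcoef_cmult:
  assumes "C2_per u"
  shows "toep (fcoef (\<lambda>\<theta>. c * u \<theta>)) \<phi> = c *\<^sub>C toep (fcoef u) \<phi>"
proof -
  have eq: "fcoef (\<lambda>\<theta>. c * u \<theta>) = (\<lambda>j. c * fcoef u j)"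
    by (rule ext) (rule fcoef_cmult)
  show ?thesis
    using toep_cmult[OF C2_per_l1[OF assms], of c] C2_per_l1[OF C2_per_mult[OF C2_per_const[of c] assms]]
    unfolding eq by simp
qed

lemma C2_per_bound:
  assumes "C2_per u"
  obtains C where "C \<ge> 0" "\<And>\<theta>. cmod (u \<theta>) \<le> C"
proof -
  obtain u' where u': "C1_per u u'" using assms unfolding C2_per_def by blast
  have l: "(\<lambda>n. norm (fcoef u n * chr n \<theta>)) summable_on UNIV" for \<theta>
    using fcoef_summable[OF u'] by (simp add: norm_mult)
  have "cmod (u \<theta>) \<le> infsum (\<lambda>n. cmod (fcoef u n)) UNIV" for \<theta>
    using norm_infsum_bound[OF l[of \<theta>]] infsumI[OF Fourier_has_sum[OF u', of \<theta>]] by (simp add: norm_mult)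
  moreover have "0 \<le> infsum (\<lambda>n. cmod (fcoef u n)) UNIV" by (rule infsum_nonneg) simp
  ultimately show ?thesis using that by blast
qed

text \<open>The constant \<open>K\<close> bounds both \<open>H\<close> and \<open>f\<close>, so that one interval \<open>[-K, K]\<close> serves for the approximation
  of functions of \<open>H\<close> and of functions of the symbol.\<close>

locale toeplitz_perturbation = bounded_symmetric H K for H K +
  fixes f :: "real \<Rightarrow> real" and V :: "ell2 \<Rightarrow> ell2"
  assumes C2_f: "C2_per (\<lambda>\<theta>. of_real (f \<theta>))"
    and compact_V: "compact_op V" and symmetric_V: "symmetric_op V"
    and H_eq: "H = (\<lambda>\<psi>. toep (fcoef (\<lambda>\<theta>. of_real (f \<theta>))) \<psi> + V \<psi>)"
    and f_bound: "\<And>\<theta>. \<bar>f \<theta>\<bar> \<le> K"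
begin

abbreviation T :: "(real \<Rightarrow> complex) \<Rightarrow> ell2 \<Rightarrow> ell2" where "T u \<equiv> toep (fcoef u)"

lemma bounded_borel_clamped:
  assumes "continuous_on UNIV P"
  shows "bounded_borel (\<lambda>x. of_real (P (clamp_K K x)))"
proof -
  have "bounded (P ` {-K..K})"
    by (intro compact_imp_bounded compact_continuous_image continuous_on_subset[OF assms]) auto
  then obtain B where B: "\<forall>y\<in>P ` {-K..K}. norm y \<le> B" unfolding bounded_iff by blast
  show ?thesis
  proof (rule bounded_borelI[of _ B])
    show "(\<lambda>x. complex_of_real (P (clamp_K K x))) \<in> borel_measurable borel"
      using borel_measurable_continuous_onI[OF assms] by measurable
    show "cmod (of_real (P (clamp_K K x))) \<le> B" for x
      using B clamp_K_bounds[of K x] K_pos by simp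
  qed
qed

lemma polynomial_C2:
  assumes "real_polynomial_function P"
  shows "C2_per (\<lambda>\<theta>. of_real (P (f \<theta>)))"
  using assms
proof induction
  case (linear h)
  have "h x = h 1 * x" for x :: real
    using linear_cmul[OF bounded_linear.linear[OF linear], of x 1] by (simp add: mult.commute)
  then have "(\<lambda>\<theta>. complex_of_real (h (f \<theta>))) = (\<lambda>\<theta>. complex_of_real (h 1) * complex_of_real (f \<theta>))"
    by (metis of_real_mult)
  then show ?case using C2_per_mult[OF C2_per_const C2_f] by simp
qed (auto intro: C2_per_const C2_per_add C2_per_mult)

lemma continuous_real_polynomial: "real_polynomial_function P \<Longrightarrow> continuous_on UNIV P" for P :: "real \<Rightarrow> real"
  by (intro continuous_at_imp_continuous_on ballI continuous_real_polymonial_function)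

text \<open>Induction on the polynomial: \<open>P \<mapsto> P(H)\<close> is multiplicative, and \<open>P \<mapsto> T\<^bsub>P \<circ> f\<^esub>\<close> is so up to a semicommutator.\<close>

lemma polynomial_compact:
  assumes "real_polynomial_function P"
  shows "compact_bound (\<lambda>\<phi>. fc (\<lambda>x. of_real (P (clamp_K K x))) \<phi> - T (\<lambda>\<theta>. of_real (P (f \<theta>))) \<phi>)"
  using assms
proof induction
  case (linear h)
  have h: "h x = h 1 * x" for x :: real
    using linear_cmul[OF bounded_linear.linear[OF linear], of x 1] by (simp add: mult.commute)
  have 1: "fc (\<lambda>x. complex_of_real (h (clamp_K K x))) \<phi> = complex_of_real (h 1) *\<^sub>C H \<phi>" for \<phi>
    using fc_cmult[OF bounded_borel_clamp_power[of 1], of "complex_of_real (h 1)" \<phi>] fc_power[of 1]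
    by (subst h) simp
  have 2: "T (\<lambda>\<theta>. complex_of_real (h (f \<theta>))) \<phi> = complex_of_real (h 1) *\<^sub>C T (\<lambda>\<theta>. complex_of_real (f \<theta>)) \<phi>" for \<phi>
    using toep_fcoef_cmult[OF C2_f, of "complex_of_real (h 1)" \<phi>] by (subst h) simp
  have eq: "(\<lambda>\<phi>. fc (\<lambda>x. of_real (h (clamp_K K x))) \<phi> - T (\<lambda>\<theta>. of_real (h (f \<theta>))) \<phi>)
      = (\<lambda>\<phi>. of_real (h 1) *\<^sub>C V \<phi>)"
    unfolding 1 2 fun_cong[OF H_eq] by (simp add: scaleC_distribs del: scaleC_of_real)
  show ?case unfolding eq by (rule compact_bound_scaleC[OF compact_symmetric_bound[OF compact_V symmetric_V]])
next
  case (const c)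
  have "(\<lambda>\<phi>. fc (\<lambda>x. of_real c) \<phi> - T (\<lambda>\<theta>. of_real c) \<phi>) = (\<lambda>\<phi>. 0)"
    unfolding fc_const toep_const by simp
  then show ?case using compact_bound_zero by simp
next
  case (add p q)
  note bp = bounded_borel_clamped[OF continuous_real_polynomial[OF add.hyps(1)]]
    and bq = bounded_borel_clamped[OF continuous_real_polynomial[OF add.hyps(2)]]
  have "(\<lambda>\<phi>. fc (\<lambda>x. of_real (p (clamp_K K x) + q (clamp_K K x))) \<phi> - T (\<lambda>\<theta>. of_real (p (f \<theta>) + q (f \<theta>))) \<phi>)
      = (\<lambda>\<phi>. (fc (\<lambda>x. of_real (p (clamp_K K x))) \<phi> - T (\<lambda>\<theta>. of_real (p (f \<theta>))) \<phi>)
          + (fc (\<lambda>x. of_real (q (clamp_K K x))) \<phi> - T (\<lambda>\<theta>. of_real (q (f \<theta>))) \<phi>))"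
    using fc_add[OF bp bq] toep_fcoef_add[OF polynomial_C2[OF add.hyps(1)] polynomial_C2[OF add.hyps(2)]] by (simp add: algebra_simps)
  then show ?case using compact_bound_add[OF add.IH] by simp
next
  case (mult p q)
  let ?F = "\<lambda>p. fc (\<lambda>x. complex_of_real (p (clamp_K K x)))" and ?T = "\<lambda>p. T (\<lambda>\<theta>. complex_of_real (p (f \<theta>)))"
  note bp = bounded_borel_clamped[OF continuous_real_polynomial[OF mult.hyps(1)]]
    and bq = bounded_borel_clamped[OF continuous_real_polynomial[OF mult.hyps(2)]]
  note cp = polynomial_C2[OF mult.hyps(1)] and cq = polynomial_C2[OF mult.hyps(2)]
  note bT = bounded_op_toep[OF C2_per_l1[OF cp]]
  have "?F (\<lambda>x. p x * q x) \<phi> = ?F p (?F q \<phi>)" for \<phi>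
    using fc_mult[OF bp bq, of \<phi>] by simp
  then have "(\<lambda>\<phi>. ?F (\<lambda>x. p x * q x) \<phi> - ?T (\<lambda>x. p x * q x) \<phi>)
      = (\<lambda>\<phi>. ((?F p (?F q \<phi>) - ?T p (?F q \<phi>)) + ?T p (?F q \<phi> - ?T q \<phi>)) - (?T (\<lambda>x. p x * q x) \<phi> - ?T p (?T q \<phi>)))"
    by (simp add: bounded_op_simps[OF bT])
  moreover have "compact_bound (\<lambda>\<phi>. ((?F p (?F q \<phi>) - ?T p (?F q \<phi>)) + ?T p (?F q \<phi> - ?T q \<phi>)) - (?T (\<lambda>x. p x * q x) \<phi> - ?T p (?T q \<phi>)))"
    using compact_semicommutator[OF cp cq]
    by (intro compact_bound_diff[OF compact_bound_add[OF compact_bound_right[OF mult.IH(1) bounded_op_fc[OF bq]]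
          compact_bound_left[OF mult.IH(2) bT]]]) simp
  ultimately show ?case by simp
qed

text \<open>Replace \<open>\<Phi>(H)\<close> by a polynomial \<open>P(H)\<close> and then, up to compact operators, the sandwich
  \<open>P(H) T\<^sub>k P(H)\<close> by the Toeplitz operator with symbol \<open>k (P \<circ> f)\<^sup>2\<close>. This symbol is almost
  nonnegative: where \<open>\<Phi> \<circ> f\<close> does not vanish \<open>k\<close> is nonnegative, and elsewhere \<open>P \<circ> f\<close> is small.\<close>

lemma energy_localization:
  assumes \<Phi>: "continuous_on UNIV \<Phi>" "bounded_borel (\<lambda>x. of_real (\<Phi> x))"
    and k: "C2_per (\<lambda>\<theta>. of_real (k \<theta>))" and pos: "\<And>\<theta>. \<Phi> (f \<theta>) \<noteq> 0 \<Longrightarrow> 0 \<le> k \<theta>"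
    and e: "\<epsilon> > 0"
  obtains ys where "\<And>\<phi>. - \<epsilon> * (norm \<phi>)\<^sup>2 - norm \<phi> * weak_size ys \<phi>
    \<le> Re (cinner (fc (\<lambda>x. of_real (\<Phi> x)) \<phi>) (T (\<lambda>\<theta>. of_real (k \<theta>)) (fc (\<lambda>x. of_real (\<Phi> x)) \<phi>)))"
proof -
  let ?k = "\<lambda>\<theta>. complex_of_real (k \<theta>)"
  define F where "F = fc (\<lambda>x. of_real (\<Phi> x))"
  note lk = C2_per_l1[OF k]
  note bTk = bounded_op_toep[OF lk]
  obtain \<kappa> where \<kappa>: "\<kappa> \<ge> 0" "\<And>\<theta>. \<bar>k \<theta>\<bar> \<le> \<kappa>" using C2_per_bound[OF k] by auto
  obtain N where N: "N > 0" "\<And>\<psi>. norm (T ?k \<psi>) \<le> norm \<psi> * N" using bounded_op_bound[OF bTk] by blast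
  obtain m where m: "\<And>x. \<bar>\<Phi> x\<bar> \<le> m" using \<Phi>(2) unfolding bounded_borel_def by auto
  have m0: "m \<ge> 0" using order_trans[OF abs_ge_zero m[of 0]] .
  define d where "d = \<kappa> + N * (2 * m + 1) + 1"
  \<comment> \<open>The accuracy of the approximating polynomial: the symbol stays above \<open>- \<kappa> \<eta>\<close>, and the
    exchange of \<open>\<Phi>(H)\<close> for \<open>P(H)\<close> costs \<open>\<eta> N (2 m + 1)\<close>.\<close>
  define \<eta> where "\<eta> = min 1 (\<epsilon> / 2 / d)"
  have den: "d > 0" unfolding d_def using \<kappa> N m0 by (intro add_nonneg_pos add_nonneg_nonneg mult_nonneg_nonneg) auto
  have \<eta>: "\<eta> > 0" "\<eta> \<le> 1" "\<eta> * (\<kappa> + N * (2 * m + 1)) \<le> \<epsilon> / 2"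
  proof -
    show "\<eta> > 0" "\<eta> \<le> 1" using e den by (auto simp: \<eta>_def)
    have "\<eta> * (\<kappa> + N * (2 * m + 1)) \<le> \<eta> * d" using \<open>\<eta> > 0\<close> by (intro mult_left_mono) (auto simp: d_def)
    also have "\<dots> \<le> (\<epsilon> / 2 / d) * d"
      using den by (intro mult_right_mono) (auto simp: \<eta>_def)
    finally show "\<eta> * (\<kappa> + N * (2 * m + 1)) \<le> \<epsilon> / 2" using den by simp
  qed
  obtain P where P: "real_polynomial_function P" "\<And>x. x \<in> {-K..K} \<Longrightarrow> \<bar>\<Phi> x - P x\<bar> < \<eta>"
    using Stone_Weierstrass_real_polynomial_function[OF compact_Icc continuous_on_subset[OF \<Phi>(1)] \<eta>(1), of "-K" K] by blast
  let ?p = "\<lambda>\<theta>. complex_of_real (P (f \<theta>))"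
  note cp = polynomial_C2[OF P(1)]
  define B where "B = fc (\<lambda>x. of_real (P (clamp_K K x)))"
  note bP = bounded_borel_clamped[OF continuous_real_polynomial[OF P(1)]]
  have bB: "bounded_op B" unfolding B_def by (rule bounded_op_fc[OF bP])
  have symB: "symmetric_op B" unfolding B_def by (rule fc_real_symmetric[OF bP])
  have bF: "bounded_op F" unfolding F_def by (rule bounded_op_fc[OF \<Phi>(2)])
  have BF: "norm (F \<phi> - B \<phi>) \<le> \<eta> * norm \<phi>" for \<phi>
    unfolding F_def B_def fc_diff[OF \<Phi>(2) bP, symmetric]
  proof (rule norm_fc_le[OF bounded_borel_diff[OF \<Phi>(2) bP]])
    fix x assume x: "\<bar>x\<bar> \<le> K"
    then have "\<bar>\<Phi> x - P x\<bar> < \<eta>" by (intro P(2)) (auto simp: abs_le_iff)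
    then show "cmod (of_real (\<Phi> x) - of_real (P (clamp_K K x))) \<le> \<eta>"
      by (simp add: clamp_K_id[OF x] flip: of_real_diff)
  qed (use \<eta> in simp)
  have nF: "norm (F \<phi>) \<le> m * norm \<phi>" for \<phi>
    unfolding F_def by (rule norm_fc_le[OF \<Phi>(2)]) (use m m0 in auto)
  have nB: "norm (B \<phi>) \<le> (m + 1) * norm \<phi>" for \<phi>
  proof -
    have "norm (B \<phi>) \<le> norm (F \<phi>) + norm (F \<phi> - B \<phi>)"
      using norm_triangle_ineq4[of "F \<phi>" "F \<phi> - B \<phi>"] by simp
    also have "\<dots> \<le> m * norm \<phi> + 1 * norm \<phi>"
      using nF BF[of \<phi>] mult_right_mono[OF \<eta>(2), of "norm \<phi>"] by (intro add_mono) auto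
    finally show ?thesis by (simp add: algebra_simps)
  qed
  have diffB: "compact_bound (\<lambda>\<phi>. B \<phi> - T ?p \<phi>)"
    unfolding B_def by (rule polynomial_compact[OF P(1)])
  define R where "R \<phi> = T (\<lambda>\<theta>. ?p \<theta> * (?k \<theta> * ?p \<theta>)) \<phi> - B (T ?k (B \<phi>))" for \<phi>
  note bTp = bounded_op_toep[OF C2_per_l1[OF cp]]
  have "compact_bound R"
  proof -
    have eq: "R = (\<lambda>\<phi>. ((T (\<lambda>\<theta>. ?p \<theta> * (?k \<theta> * ?p \<theta>)) \<phi> - T ?p (T (\<lambda>\<theta>. ?k \<theta> * ?p \<theta>) \<phi>))
        + T ?p (T (\<lambda>\<theta>. ?k \<theta> * ?p \<theta>) \<phi> - T ?k (T ?p \<phi>)))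
        - ((B (T ?k (T ?p \<phi>)) - T ?p (T ?k (T ?p \<phi>))) + B (T ?k (B \<phi> - T ?p \<phi>))))"
      by (rule ext) (simp add: R_def bounded_op_simps[OF bTp] bounded_op_simps[OF bTk] bounded_op_simps[OF bB])
    have 1: "compact_bound (\<lambda>\<phi>. T (\<lambda>\<theta>. ?p \<theta> * (?k \<theta> * ?p \<theta>)) \<phi> - T ?p (T (\<lambda>\<theta>. ?k \<theta> * ?p \<theta>) \<phi>))"
      by (rule compact_semicommutator[OF cp C2_per_mult[OF k cp]])
    have 2: "compact_bound (\<lambda>\<phi>. T ?p (T (\<lambda>\<theta>. ?k \<theta> * ?p \<theta>) \<phi> - T ?k (T ?p \<phi>)))"
      by (rule compact_bound_left[OF compact_semicommutator[OF k cp] bTp])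
    have 3: "compact_bound (\<lambda>\<phi>. B (T ?k (T ?p \<phi>)) - T ?p (T ?k (T ?p \<phi>)))"
      by (rule compact_bound_right[OF diffB bounded_op_compose[OF bTk bTp]])
    have 4: "compact_bound (\<lambda>\<phi>. B (T ?k (B \<phi> - T ?p \<phi>)))"
      by (rule compact_bound_left[OF diffB bounded_op_compose[OF bB bTk]])
    show ?thesis unfolding eq by (rule compact_bound_diff[OF compact_bound_add[OF 1 2] compact_bound_add[OF 3 4]])
  qed
  from compact_formD[OF compact_bound_imp_form[OF this], of "\<epsilon> / 2"] e
  obtain ys where ys: "\<And>\<phi>. cmod (cinner \<phi> (R \<phi>)) \<le> \<epsilon> / 2 * (norm \<phi>)\<^sup>2 + norm \<phi> * weak_size ys \<phi>"
    by auto
  have symbol: "- (\<kappa> * \<eta>) * (norm \<phi>)\<^sup>2 \<le> Re (cinner \<phi> (T (\<lambda>\<theta>. ?p \<theta> * (?k \<theta> * ?p \<theta>)) \<phi>))" for \<phi>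
  proof -
    let ?g = "\<lambda>\<theta>. P (f \<theta>) * (k \<theta> * P (f \<theta>)) + \<kappa> * \<eta>"
    have c2: "C2_per (\<lambda>\<theta>. ?p \<theta> * (?k \<theta> * ?p \<theta>))" by (intro C2_per_mult cp k)
    have gc: "(\<lambda>\<theta>. complex_of_real (?g \<theta>)) = (\<lambda>\<theta>. ?p \<theta> * (?k \<theta> * ?p \<theta>) + complex_of_real (\<kappa> * \<eta>))" by simp
    have c2g: "C2_per (\<lambda>\<theta>. of_real (?g \<theta>))" unfolding gc by (intro C2_per_add c2 C2_per_const)
    have "0 \<le> Re (cinner \<phi> (T (\<lambda>\<theta>. of_real (?g \<theta>)) \<phi>))"
    proof (rule toep_positive[OF _ _ C2_per_l1[OF c2g]])
      show "continuous_on UNIV ?g"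
        using continuous_on_Re[OF C2_per_cont[OF c2g]] by simp
      show "0 \<le> ?g \<theta>" for \<theta>
      proof (cases "\<Phi> (f \<theta>) = 0")
        case False
        have "0 \<le> k \<theta> * (P (f \<theta>) * P (f \<theta>))" by (rule mult_nonneg_nonneg[OF pos[OF False] zero_le_square])
        moreover have "0 \<le> \<kappa> * \<eta>" using \<kappa> \<eta> by simp
        ultimately show ?thesis by (metis add_nonneg_nonneg mult.left_commute)
      next
        case True
        have "f \<theta> \<in> {-K..K}" using f_bound[of \<theta>] by (auto simp: abs_le_iff)
        from P(2)[OF this] True have small: "\<bar>P (f \<theta>)\<bar> \<le> \<eta>" by simp
        have "\<bar>P (f \<theta>)\<bar> * (\<bar>k \<theta>\<bar> * \<bar>P (f \<theta>)\<bar>) \<le> 1 * (\<kappa> * \<eta>)"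
          using small \<eta> \<kappa> by (intro mult_mono) auto
        then have "\<bar>P (f \<theta>) * (k \<theta> * P (f \<theta>))\<bar> \<le> \<kappa> * \<eta>" by (simp add: abs_mult)
        then show ?thesis by linarith
      qed
    qed
    then show ?thesis
      unfolding gc toep_fcoef_add[OF c2 C2_per_const] toep_const cinner_add_right cinner_scaleC_right cinner_self
      by (simp flip: of_real_mult of_real_power)
  qed
  have "- \<epsilon> * (norm \<phi>)\<^sup>2 - norm \<phi> * weak_size ys \<phi> \<le> Re (cinner (F \<phi>) (T ?k (F \<phi>)))" for \<phi>
  proof -
    define n where "n = norm \<phi>"
    have n0: "n \<ge> 0" by (simp add: n_def)
    have "Re (cinner (B \<phi>) (T ?k (B \<phi>))) = Re (cinner \<phi> (T (\<lambda>\<theta>. ?p \<theta> * (?k \<theta> * ?p \<theta>)) \<phi>)) - Re (cinner \<phi> (R \<phi>))"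
      unfolding R_def using symmetric_opD[OF symB, of \<phi> "T ?k (B \<phi>)"] by (simp add: cinner_diff_right)
    moreover have "\<bar>Re (cinner \<phi> (R \<phi>))\<bar> \<le> \<epsilon> / 2 * n\<^sup>2 + n * weak_size ys \<phi>"
      using order_trans[OF abs_Re_le_cmod ys[of \<phi>]] by (simp add: n_def)
    ultimately have low: "- (\<kappa> * \<eta>) * n\<^sup>2 - (\<epsilon> / 2 * n\<^sup>2 + n * weak_size ys \<phi>) \<le> Re (cinner (B \<phi>) (T ?k (B \<phi>)))"
      using symbol[of \<phi>] unfolding n_def by (smt (verit))
    have "cinner (F \<phi>) (T ?k (F \<phi>)) - cinner (B \<phi>) (T ?k (B \<phi>)) = cinner (F \<phi> - B \<phi>) (T ?k (F \<phi>)) + cinner (B \<phi>) (T ?k (F \<phi> - B \<phi>))"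
      by (simp add: bounded_op_simps[OF bTk] cinner_diff_left cinner_diff_right)
    then have "cmod (cinner (F \<phi>) (T ?k (F \<phi>)) - cinner (B \<phi>) (T ?k (B \<phi>)))
        \<le> norm (F \<phi> - B \<phi>) * norm (T ?k (F \<phi>)) + norm (B \<phi>) * norm (T ?k (F \<phi> - B \<phi>))"
      by (metis Cauchy_Schwarz_cinner add_mono norm_triangle_le)
    also have "\<dots> \<le> (\<eta> * n) * ((m * n) * N) + ((m + 1) * n) * ((\<eta> * n) * N)"
    proof (intro add_mono mult_mono)
      show "norm (T ?k (F \<phi>)) \<le> (m * n) * N"
        using order_trans[OF N(2)[of "F \<phi>"] mult_right_mono[OF nF[of \<phi>] less_imp_le[OF N(1)]]] by (simp add: n_def)
      show "norm (T ?k (F \<phi> - B \<phi>)) \<le> (\<eta> * n) * N"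
        using order_trans[OF N(2)[of "F \<phi> - B \<phi>"] mult_right_mono[OF BF[of \<phi>] less_imp_le[OF N(1)]]] by (simp add: n_def)
    qed (use BF[of \<phi>] nB[of \<phi>] \<eta> n0 m0 in \<open>auto simp: n_def\<close>)
    also have "\<dots> = \<eta> * (N * (2 * m + 1)) * n\<^sup>2" by (simp add: power2_eq_square algebra_simps)
    finally have "\<bar>Re (cinner (F \<phi>) (T ?k (F \<phi>))) - Re (cinner (B \<phi>) (T ?k (B \<phi>)))\<bar> \<le> \<eta> * (N * (2 * m + 1)) * n\<^sup>2"
      using abs_Re_le_cmod[of "cinner (F \<phi>) (T ?k (F \<phi>)) - cinner (B \<phi>) (T ?k (B \<phi>))"] by simp
    moreover have "(\<eta> * (\<kappa> + N * (2 * m + 1))) * n\<^sup>2 \<le> (\<epsilon> / 2) * n\<^sup>2" using \<eta>(3) by (intro mult_right_mono) auto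
    then have "\<eta> * (N * (2 * m + 1)) * n\<^sup>2 + (\<kappa> * \<eta>) * n\<^sup>2 \<le> (\<epsilon> / 2) * n\<^sup>2" by (simp add: algebra_simps)
    moreover from low have "- ((\<kappa> * \<eta>) * n\<^sup>2) - (\<epsilon> / 2 * n\<^sup>2 + n * weak_size ys \<phi>) \<le> Re (cinner (B \<phi>) (T ?k (B \<phi>)))"
      by simp
    ultimately have "- ((\<epsilon> / 2) * n\<^sup>2) - (\<epsilon> / 2 * n\<^sup>2 + n * weak_size ys \<phi>) \<le> Re (cinner (F \<phi>) (T ?k (F \<phi>)))"
      unfolding abs_le_iff by (smt (verit))
    moreover have "\<epsilon> * n\<^sup>2 = \<epsilon> / 2 * n\<^sup>2 + \<epsilon> / 2 * n\<^sup>2" by simp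
    ultimately show ?thesis unfolding n_def by (smt (verit) mult_minus_left)
  qed
  then show ?thesis unfolding F_def by (rule that)
qed

end

section \<open>Propagation in the domain of the position operator\<close>

text \<open>\<open>Z\<close> is the commutator \<open>[X, H]\<close>.\<close>

locale position_regular = bounded_symmetric H K for H K +
  fixes Z :: "ell2 \<Rightarrow> ell2"
  assumes bounded_Z: "bounded_op Z"
    and H_dom: "\<And>\<psi>. \<psi> \<in> dom_X \<Longrightarrow> H \<psi> \<in> dom_X"
    and X_H: "\<And>\<psi>. \<psi> \<in> dom_X \<Longrightarrow> X_op (H \<psi>) = H (X_op \<psi>) + Z \<psi>"
begin

lemma funpow_dom: "\<psi> \<in> dom_X \<Longrightarrow> (H ^^ n) \<psi> \<in> dom_X"
  by (induction n) (auto intro: H_dom)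

text \<open>As \<open>[X, H] = Z\<close> is bounded, so is \<open>H\<close> for the graph norm of \<open>X\<close>, with constant \<open>K + \<parallel>Z\<parallel>\<close>; this
  makes the exponential series converge in the domain of \<open>X\<close>.\<close>

lemma graph_norm_growth:
  obtains C where "C > 0"
    "\<And>\<psi> n. \<psi> \<in> dom_X \<Longrightarrow> norm (X_op ((H ^^ n) \<psi>)) \<le> C ^ n * (norm \<psi> + norm (X_op \<psi>))"
proof -
  obtain L where L: "L > 0" "\<And>\<psi>. norm (Z \<psi>) \<le> norm \<psi> * L" using bounded_op_bound[OF bounded_Z] by blast
  let ?C = "K + L"
  have growth: "norm ((H ^^ n) \<psi>) + norm (X_op ((H ^^ n) \<psi>)) \<le> ?C ^ n * (norm \<psi> + norm (X_op \<psi>))"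
    if \<psi>: "\<psi> \<in> dom_X" for \<psi> n
  proof (induction n)
    case (Suc n)
    let ?\<eta> = "(H ^^ n) \<psi>"
    have "norm (H ?\<eta>) + norm (X_op (H ?\<eta>)) \<le> norm ?\<eta> * K + (norm (X_op ?\<eta>) * K + norm ?\<eta> * L)"
      unfolding X_H[OF funpow_dom[OF \<psi>]]
      by (intro add_mono norm_H order_trans[OF norm_triangle_ineq] L)
    also have "\<dots> \<le> ?C * (norm ?\<eta> + norm (X_op ?\<eta>))"
      using L(1) by (simp add: algebra_simps)
    also have "\<dots> \<le> ?C * (?C ^ n * (norm \<psi> + norm (X_op \<psi>)))"
      using Suc L(1) K_pos by (intro mult_left_mono) auto
    finally show ?case by (simp add: mult.assoc)
  qed simp
  have "?C > 0" using L(1) K_pos by simp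
  moreover have "norm (X_op ((H ^^ n) \<psi>)) \<le> ?C ^ n * (norm \<psi> + norm (X_op \<psi>))" if "\<psi> \<in> dom_X" for \<psi> n
    using growth[OF that, of n] norm_ge_zero[of "(H ^^ n) \<psi>"] by linarith
  ultimately show ?thesis by (rule that)
qed

text \<open>The exponential series converges in the graph norm of \<open>X\<close>, and \<open>X\<close> is closed. The expansion keeps its
  terms of order zero and one.\<close>

lemma U_dom: "\<psi> \<in> dom_X \<Longrightarrow> U t \<psi> \<in> dom_X"
  and X_U_expansion: "\<exists>C>0. \<forall>\<psi>\<in>dom_X. \<forall>t. \<bar>t\<bar> * C \<le> 1 \<longrightarrow>
    norm (X_op (U t \<psi>) - X_op \<psi> - t *\<^sub>R (\<i> *\<^sub>C X_op (H \<psi>))) \<le> (\<bar>t\<bar> * C)\<^sup>2 * (norm \<psi> + norm (X_op \<psi>))"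
proof -
  obtain C where C: "C > 0"
    "\<And>\<psi> n. \<psi> \<in> dom_X \<Longrightarrow> norm (X_op ((H ^^ n) \<psi>)) \<le> C ^ n * (norm \<psi> + norm (X_op \<psi>))"
    using graph_norm_growth by blast
  define c where "c t k = (\<i> * of_real t) ^ k / fact k" for t k
  define b where "b t \<psi> k = c t k *\<^sub>C X_op ((H ^^ k) \<psi>)" for t \<psi> k
  have nc: "cmod (c t k) = \<bar>t\<bar> ^ k / fact k" for t k
    by (simp add: c_def norm_divide norm_power norm_mult)
  have nb: "norm (b t \<psi> k) \<le> (norm \<psi> + norm (X_op \<psi>)) * ((\<bar>t\<bar> * C) ^ k / fact k)" if "\<psi> \<in> dom_X" for t \<psi> k
  proof -
    have "norm (b t \<psi> k) = \<bar>t\<bar> ^ k / fact k * norm (X_op ((H ^^ k) \<psi>))" by (simp add: b_def nc)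
    also have "\<dots> \<le> \<bar>t\<bar> ^ k / fact k * (C ^ k * (norm \<psi> + norm (X_op \<psi>)))"
      by (intro mult_left_mono C(2)[OF that]) simp
    finally show ?thesis by (simp add: power_mult_distrib mult_ac)
  qed
  have exp_sums: "(\<lambda>k. y ^ k / fact k) sums exp y" for y :: real
    using exp_converges[of y] by (simp add: divide_inverse mult.commute)
  have summ_b: "summable (b t \<psi>)" if "\<psi> \<in> dom_X" for t \<psi>
    by (rule summable_comparison_test'[where N = 0, OF summable_mult[OF sums_summable[OF exp_sums]]])
      (use nb[OF that] in auto)
  have main: "U t \<psi> \<in> dom_X \<and> X_op (U t \<psi>) = (\<Sum>k. b t \<psi> k)" if \<psi>: "\<psi> \<in> dom_X" for t \<psi>
  proof -
    let ?S = "\<lambda>N. \<Sum>k\<le>N. c t k *\<^sub>C (H ^^ k) \<psi>"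
    have S: "?S N \<in> dom_X" "X_op (?S N) = (\<Sum>k\<le>N. b t \<psi> k)" for N
      using X_sum[of "{..N}" "\<lambda>k. c t k *\<^sub>C (H ^^ k) \<psi>"] X_scaleC[OF funpow_dom[OF \<psi>]]
      by (auto simp: b_def)
    have "?S \<longlonglongrightarrow> U t \<psi>"
    proof -
      have "(\<lambda>N. (\<bar>t\<bar> * K) ^ N / fact N) \<longlonglongrightarrow> 0"
        by (rule summable_LIMSEQ_zero[OF sums_summable[OF exp_sums]])
      then have "(\<lambda>N. (\<bar>t\<bar> * K) ^ Suc N / fact (Suc N) * norm \<psi>) \<longlonglongrightarrow> 0 * norm \<psi>"
        by (intro tendsto_mult tendsto_const) (rule LIMSEQ_Suc)
      then have lim: "(\<lambda>N. (\<bar>t\<bar> * K) ^ Suc N / fact (Suc N) * norm \<psi>) \<longlonglongrightarrow> 0" by (simp only: mult_zero_left)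
      have "(\<lambda>N. U t \<psi> - ?S N) \<longlonglongrightarrow> 0"
        by (rule Lim_null_comparison[OF always_eventually lim]) (use U_Taylor[of t \<psi>] in \<open>simp add: c_def\<close>)
      from tendsto_diff[OF tendsto_const[of "U t \<psi>"] this] show ?thesis by simp
    qed
    moreover have "(\<lambda>N. X_op (?S N)) \<longlonglongrightarrow> (\<Sum>k. b t \<psi> k)"
      unfolding S(2) by (rule summable_LIMSEQ'[OF summ_b[OF \<psi>]])
    ultimately show ?thesis using X_closed[of ?S, OF S(1)] by blast
  qed
  show "U t \<psi> \<in> dom_X" if "\<psi> \<in> dom_X" using main[OF that] by blast
  show "\<exists>C>0. \<forall>\<psi>\<in>dom_X. \<forall>t. \<bar>t\<bar> * C \<le> 1 \<longrightarrow>
    norm (X_op (U t \<psi>) - X_op \<psi> - t *\<^sub>R (\<i> *\<^sub>C X_op (H \<psi>))) \<le> (\<bar>t\<bar> * C)\<^sup>2 * (norm \<psi> + norm (X_op \<psi>))"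
  proof (intro exI[of _ C] conjI ballI allI impI C(1))
    fix \<psi> t assume \<psi>: "\<psi> \<in> dom_X" and t: "\<bar>t\<bar> * C \<le> 1"
    let ?y = "\<bar>t\<bar> * C" and ?G = "norm \<psi> + norm (X_op \<psi>)"
    have y0: "?y \<ge> 0" using C(1) by simp
    have s2: "summable (\<lambda>k. ?G * (?y ^ (k + 2) / fact (k + 2)))"
      by (intro summable_mult) (rule sums_summable[OF exp_sums, THEN summable_ignore_initial_segment])
    have "X_op (U t \<psi>) = (\<Sum>k. b t \<psi> (k + 2)) + (\<Sum>k<2. b t \<psi> k)"
      using main[OF \<psi>] suminf_split_initial_segment[OF summ_b[OF \<psi>], of t 2] by simp
    moreover have "(\<Sum>k<2. b t \<psi> k) = X_op \<psi> + t *\<^sub>R (\<i> *\<^sub>C X_op (H \<psi>))"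
      by (rule ell2_eqI) (simp add: b_def c_def eval_nat_numeral)
    ultimately have "norm (X_op (U t \<psi>) - X_op \<psi> - t *\<^sub>R (\<i> *\<^sub>C X_op (H \<psi>))) = norm (\<Sum>k. b t \<psi> (k + 2))"
      by simp
    also have "\<dots> \<le> (\<Sum>k. ?G * (?y ^ (k + 2) / fact (k + 2)))"
      by (rule norm_suminf_le[OF nb[OF \<psi>] s2])
    also have "\<dots> = ?G * (\<Sum>k. ?y ^ (k + 2) / fact (k + 2))"
      by (rule suminf_mult) (rule sums_summable[OF exp_sums, THEN summable_ignore_initial_segment])
    also have "(\<Sum>k. ?y ^ (k + 2) / fact (k + 2)) = exp ?y - (1 + ?y)"
      using suminf_split_initial_segment[OF sums_summable[OF exp_sums[of ?y]], of 2] sums_unique[OF exp_sums[of ?y]]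
      by (simp add: eval_nat_numeral)
    also have "?G * (exp ?y - (1 + ?y)) \<le> ?G * ?y\<^sup>2"
      using exp_bound[OF y0 t] by (intro mult_left_mono) auto
    finally show "norm (X_op (U t \<psi>) - X_op \<psi> - t *\<^sub>R (\<i> *\<^sub>C X_op (H \<psi>))) \<le> ?y\<^sup>2 * ?G"
      by (simp add: mult.commute)
  qed
qed

lemma X_U_has_derivative:
  assumes \<psi>: "\<psi> \<in> dom_X"
  shows "((\<lambda>t. X_op (U t \<psi>)) has_vector_derivative \<i> *\<^sub>C X_op (H (U t \<psi>))) (at t)"
  unfolding has_vector_derivative_def has_derivative_at
proof (intro conjI)
  show "bounded_linear (\<lambda>h. h *\<^sub>R (\<i> *\<^sub>C X_op (H (U t \<psi>))))" by (rule bounded_linear_scaleR_left)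
  obtain C where C: "C > 0" "\<And>\<psi> t. \<psi> \<in> dom_X \<Longrightarrow> \<bar>t\<bar> * C \<le> 1 \<Longrightarrow>
    norm (X_op (U t \<psi>) - X_op \<psi> - t *\<^sub>R (\<i> *\<^sub>C X_op (H \<psi>))) \<le> (\<bar>t\<bar> * C)\<^sup>2 * (norm \<psi> + norm (X_op \<psi>))"
    using X_U_expansion by blast
  let ?\<eta> = "U t \<psi>" and ?G = "norm (U t \<psi>) + norm (X_op (U t \<psi>))"
  have bound: "norm (X_op (U (t + h) \<psi>) - X_op ?\<eta> - h *\<^sub>R (\<i> *\<^sub>C X_op (H ?\<eta>))) / norm h \<le> \<bar>h\<bar> * (C\<^sup>2 * ?G)"
    if h: "\<bar>h\<bar> * C \<le> 1" "h \<noteq> 0" for h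
  proof -
    have "U (t + h) \<psi> = U h ?\<eta>" unfolding U_add[symmetric] by (simp add: add.commute)
    then have "norm (X_op (U (t + h) \<psi>) - X_op ?\<eta> - h *\<^sub>R (\<i> *\<^sub>C X_op (H ?\<eta>))) \<le> (\<bar>h\<bar> * C)\<^sup>2 * ?G"
      using C(2)[OF U_dom[OF \<psi>] h(1)] by simp
    also have "\<dots> = \<bar>h\<bar> * (\<bar>h\<bar> * (C\<^sup>2 * ?G))" by (simp add: power2_eq_square algebra_simps)
    finally show ?thesis using h(2) by (simp add: divide_le_eq mult.commute)
  qed
  have "((\<lambda>h. \<bar>h\<bar> * (C\<^sup>2 * ?G)) \<longlongrightarrow> \<bar>0\<bar> * (C\<^sup>2 * ?G)) (at 0)" by (intro tendsto_intros)
  then have lim: "((\<lambda>h. \<bar>h\<bar> * (C\<^sup>2 * ?G)) \<longlongrightarrow> 0) (at 0)" by simp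
  show "(\<lambda>h. norm (X_op (U (t + h) \<psi>) - X_op ?\<eta> - h *\<^sub>R (\<i> *\<^sub>C X_op (H ?\<eta>))) / norm h) \<midarrow>0\<rightarrow> 0"
  proof (rule Lim_null_comparison[OF _ lim])
    show "\<forall>\<^sub>F h in at 0. norm (norm (X_op (U (t + h) \<psi>) - X_op ?\<eta> - h *\<^sub>R (\<i> *\<^sub>C X_op (H ?\<eta>))) / norm h)
        \<le> \<bar>h\<bar> * (C\<^sup>2 * ?G)"
      unfolding eventually_at
    proof (intro exI[of _ "1 / C"] conjI ballI impI)
      fix h :: real assume "h \<noteq> 0 \<and> dist h 0 < 1 / C"
      then have "\<bar>h\<bar> * C \<le> 1" "h \<noteq> 0" using C(1) by (auto simp: dist_real_def field_simps)
      then show "norm (norm (X_op (U (t + h) \<psi>) - X_op ?\<eta> - h *\<^sub>R (\<i> *\<^sub>C X_op (H ?\<eta>))) / norm h)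
        \<le> \<bar>h\<bar> * (C\<^sup>2 * ?G)" using bound by simp
    qed (use C(1) in simp)
  qed
qed

lemma inner_i_H: "inner v (\<i> *\<^sub>C H v) = 0"
proof -
  have "cinner v (H v) = cnj (cinner v (H v))"
    using cinner_commute[of v "H v"] symmetric_opD[OF symmetric_H, of v v] by simp
  from arg_cong[OF this, of Im] show ?thesis by (simp add: inner_ell2_def)
qed

text \<open>Of \<open>X (H \<psi>) = H (X \<psi>) + Z \<psi>\<close> only \<open>Z \<psi>\<close> contributes, as the expectation of \<open>i H\<close> is imaginary.\<close>

lemma position_square_derivative:
  assumes \<psi>: "\<psi> \<in> dom_X"
  shows "((\<lambda>t. (norm (X_op (U t \<psi>)))\<^sup>2) has_real_derivative 2 * inner (X_op (U t \<psi>)) (\<i> *\<^sub>C Z (U t \<psi>))) (at t)"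
proof -
  let ?v = "X_op (U t \<psi>)" and ?v' = "\<i> *\<^sub>C X_op (H (U t \<psi>))"
  have "((\<lambda>t. inner (X_op (U t \<psi>)) (X_op (U t \<psi>))) has_vector_derivative (inner ?v ?v' + inner ?v' ?v)) (at t)"
    by (rule bounded_bilinear.has_vector_derivative[OF bounded_bilinear_inner X_U_has_derivative[OF \<psi>] X_U_has_derivative[OF \<psi>]])
  moreover have "inner ?v ?v' = inner ?v (\<i> *\<^sub>C Z (U t \<psi>))"
    unfolding X_H[OF U_dom[OF \<psi>]] scaleC_distribs inner_add_right inner_i_H by simp
  ultimately show ?thesis
    by (simp add: has_real_derivative_iff_has_vector_derivative power2_norm_eq_inner inner_commute)
qed

text \<open>The derivative of \<open>sqrt (1 + \<parallel>X \<psi>(t)\<parallel>\<^sup>2)\<close> is at most \<open>\<parallel>Z\<parallel> \<parallel>\<psi>\<parallel>\<close>.\<close>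

lemma X_U_linear_bound:
  assumes \<psi>: "\<psi> \<in> dom_X"
  obtains A B where "A \<ge> 0" "B \<ge> 0" "\<And>t. norm (X_op (U t \<psi>)) \<le> A + B * \<bar>t\<bar>"
proof -
  obtain L where L: "L > 0" "\<And>\<psi>. norm (Z \<psi>) \<le> norm \<psi> * L" using bounded_op_bound[OF bounded_Z] by blast
  let ?M = "\<lambda>t. (norm (X_op (U t \<psi>)))\<^sup>2" and ?M' = "\<lambda>t. 2 * inner (X_op (U t \<psi>)) (\<i> *\<^sub>C Z (U t \<psi>))"
  let ?s = "\<lambda>t. sqrt (1 + ?M t)"
  have pos: "1 + ?M t > 0" for t by (simp add: add_pos_nonneg)
  have d: "(?s has_real_derivative ?M' t / (2 * ?s t)) (at t)" for t
  proof -
    have "((\<lambda>t. 1 + ?M t) has_real_derivative 0 + ?M' t) (at t)"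
      by (rule DERIV_add[OF DERIV_const position_square_derivative[OF \<psi>]])
    from DERIV_chain2[OF DERIV_real_sqrt[OF pos[of t]] this] show ?thesis by (simp add: field_simps)
  qed
  have bd: "\<bar>?M' t / (2 * ?s t)\<bar> \<le> norm \<psi> * L" for t
  proof -
    have "\<bar>inner (X_op (U t \<psi>)) (\<i> *\<^sub>C Z (U t \<psi>))\<bar> \<le> norm (X_op (U t \<psi>)) * norm (\<i> *\<^sub>C Z (U t \<psi>))"
      by (rule Cauchy_Schwarz_ineq2)
    also have "\<dots> \<le> ?s t * (norm \<psi> * L)"
    proof (rule mult_mono)
      show "norm (X_op (U t \<psi>)) \<le> ?s t" by (rule real_le_rsqrt) simp
      show "norm (\<i> *\<^sub>C Z (U t \<psi>)) \<le> norm \<psi> * L" using L(2)[of "U t \<psi>"] by simp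
    qed auto
    finally show ?thesis using pos[of t] by (simp add: abs_mult divide_le_eq mult.commute)
  qed
  have "norm (?s t - ?s 0) \<le> norm \<psi> * L * norm (t - 0)" for t
    by (rule field_differentiable_bound[of UNIV ?s "\<lambda>t. ?M' t / (2 * ?s t)"]) (use d bd in auto)
  then have "?s t \<le> ?s 0 + norm \<psi> * L * \<bar>t\<bar>" for t by (simp add: abs_le_iff) (smt (verit))
  moreover have "norm (X_op (U t \<psi>)) \<le> ?s t" for t by (rule real_le_rsqrt) simp
  ultimately have "norm (X_op (U t \<psi>)) \<le> ?s 0 + norm \<psi> * L * \<bar>t\<bar>" for t using order_trans by blast
  then show ?thesis using L(1) pos[of 0] by (intro that[of "?s 0" "norm \<psi> * L"]) auto
qed

end

section \<open>A second order differential inequality\<close>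

text \<open>Integrate twice. Let \<open>J(T)\<close> be the integral of \<open>\<kappa>\<close> over \<open>[0, T]\<close>. Then \<open>\<alpha>(t) \<ge> \<alpha>(0) + \<gamma> t - J(T)\<close> for
  \<open>t \<le> T\<close>, so that \<open>m(T)\<close> is bounded below by a parabola up to an error \<open>2 T J(T)\<close>, which is \<open>o(T\<^sup>2)\<close>.\<close>

lemma second_order_growth_aux:
  fixes m m' \<alpha> \<alpha>' \<kappa> :: "real \<Rightarrow> real"
  assumes m: "\<And>t. (m has_real_derivative m' t) (at t)"
    and \<alpha>: "\<And>t. (\<alpha> has_real_derivative \<alpha>' t) (at t)"
    and m': "\<And>t. \<bar>m' t - 2 * \<alpha> t\<bar> \<le> D"
    and \<alpha>': "\<And>t. \<gamma> - \<kappa> t \<le> \<alpha>' t"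
    and \<kappa>: "continuous_on UNIV \<kappa>" "\<And>t. 0 \<le> \<kappa> t"
    and avg: "((\<lambda>T. integral {0..T} \<kappa> / T) \<longlongrightarrow> 0) at_top" and e: "\<epsilon> > 0"
  shows "\<forall>\<^sub>F T in at_top. \<gamma> - \<epsilon> \<le> m T / T\<^sup>2"
proof -
  let ?J = "\<lambda>T. integral {0..T} \<kappa>"
  have int: "\<kappa> integrable_on {a..b}" for a b
    by (intro integrable_continuous_interval continuous_on_subset[OF \<kappa>(1)]) auto
  have \<alpha>_low: "\<alpha> 0 + \<gamma> * t - ?J T \<le> \<alpha> t" if t: "0 \<le> t" "t \<le> T" for t T
  proof -
    have 1: "(\<alpha>' has_integral \<alpha> t - \<alpha> 0) {0..t}"
      by (rule fundamental_theorem_of_calculus[OF t(1)])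
        (use \<alpha> in \<open>auto simp: has_real_derivative_iff_has_vector_derivative[symmetric] intro: has_field_derivative_at_within\<close>)
    have 2: "((\<lambda>s. \<gamma> - \<kappa> s) has_integral (t - 0) *\<^sub>R \<gamma> - ?J t) {0..t}"
      using t(1) has_integral_const_real[of \<gamma> 0 t] by (intro has_integral_diff integrable_integral int) simp
    have "(t - 0) *\<^sub>R \<gamma> - ?J t \<le> \<alpha> t - \<alpha> 0"
      by (rule has_integral_le[OF 2 1]) (rule \<alpha>')
    moreover have "?J t \<le> ?J T"
      using t \<kappa>(2) by (intro integral_subset_le int) auto
    ultimately show ?thesis by (simp add: mult.commute)
  qed
  have m_low: "m 0 + (2 * \<alpha> 0 - 2 * ?J T - D) * T + \<gamma> * T\<^sup>2 \<le> m T" if T: "T \<ge> 0" for T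
  proof -
    let ?h = "\<lambda>t. m t - ((2 * \<alpha> 0 - 2 * ?J T - D) * t + \<gamma> * t\<^sup>2)"
    have "?h 0 \<le> ?h T"
    proof (rule DERIV_nonneg_imp_nondecreasing[OF T])
      fix t assume t: "0 \<le> t" "t \<le> T"
      have "(?h has_real_derivative m' t - ((2 * \<alpha> 0 - 2 * ?J T - D) + \<gamma> * (2 * t))) (at t)"
        by (auto intro!: derivative_eq_intros m)
      moreover have "0 \<le> m' t - ((2 * \<alpha> 0 - 2 * ?J T - D) + \<gamma> * (2 * t))"
        using m'[of t] \<alpha>_low[OF t] by (simp add: abs_le_iff)
      ultimately show "\<exists>y. (?h has_real_derivative y) (at t) \<and> 0 \<le> y" by blast
    qed
    then show ?thesis by simp
  qed
  have lim: "((\<lambda>T. m 0 * (1 / T * (1 / T)) + ((2 * \<alpha> 0 - D) * (1 / T) - 2 * (?J T / T)) + \<gamma>) \<longlongrightarrow> m 0 * (0 * 0) + ((2 * \<alpha> 0 - D) * 0 - 2 * 0) + \<gamma>) at_top"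
  proof (intro tendsto_intros avg)
    show "((\<lambda>T::real. 1 / T) \<longlongrightarrow> 0) at_top"
      by (rule tendsto_divide_0[OF tendsto_const]) (rule filterlim_at_top_imp_at_infinity[OF filterlim_ident])
    then show "((\<lambda>T::real. 1 / T) \<longlongrightarrow> 0) at_top" .
    then show "((\<lambda>T::real. 1 / T) \<longlongrightarrow> 0) at_top" .
  qed
  have "\<forall>\<^sub>F T in at_top. \<gamma> - \<epsilon> < m 0 * (1 / T * (1 / T)) + ((2 * \<alpha> 0 - D) * (1 / T) - 2 * (?J T / T)) + \<gamma>"
    by (rule order_tendstoD(1)[OF lim]) (use e in simp)
  then show ?thesis using eventually_gt_at_top[of 0]
  proof eventually_elim
    fix T :: real assume T: "T > 0"
      and low: "\<gamma> - \<epsilon> < m 0 * (1 / T * (1 / T)) + ((2 * \<alpha> 0 - D) * (1 / T) - 2 * (?J T / T)) + \<gamma>"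
    have "m 0 * (1 / T * (1 / T)) + ((2 * \<alpha> 0 - D) * (1 / T) - 2 * (?J T / T)) + \<gamma>
        = (m 0 + (2 * \<alpha> 0 - 2 * ?J T - D) * T + \<gamma> * T\<^sup>2) / T\<^sup>2"
      using T by (simp add: power2_eq_square field_simps)
    also have "\<dots> \<le> m T / T\<^sup>2" using m_low[of T] T by (intro divide_right_mono) auto
    finally show "\<gamma> - \<epsilon> \<le> m T / T\<^sup>2" using low by linarith
  qed
qed

text \<open>The sign \<open>\<tau>\<close> selects the direction of time, the sign \<open>s\<close> lower or upper bounds.\<close>

lemma second_order_growth:
  fixes M M' a a' \<kappa> :: "real \<Rightarrow> real"
  assumes M: "\<And>t. (M has_real_derivative M' t) (at t)"
    and a: "\<And>t. (a has_real_derivative a' t) (at t)"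
    and M': "\<And>t. \<bar>M' t - 2 * a t\<bar> \<le> D"
    and s: "\<bar>s\<bar> = 1" and \<tau>: "\<bar>\<tau>\<bar> = 1"
    and a': "\<And>t. \<gamma> - \<kappa> t \<le> s * a' (\<tau> * t)"
    and \<kappa>: "continuous_on UNIV \<kappa>" "\<And>t. 0 \<le> \<kappa> t"
    and avg: "((\<lambda>T. integral {0..T} \<kappa> / T) \<longlongrightarrow> 0) at_top" and e: "\<epsilon> > 0"
  shows "\<forall>\<^sub>F T in at_top. \<gamma> - \<epsilon> \<le> s * M (\<tau> * T) / T\<^sup>2"
proof (rule second_order_growth_aux[of "\<lambda>T. s * M (\<tau> * T)" "\<lambda>t. s * (\<tau> * M' (\<tau> * t))"
      "\<lambda>t. s * (\<tau> * a (\<tau> * t))" "\<lambda>t. s * a' (\<tau> * t)" D \<gamma> \<kappa>, OF _ _ _ a' \<kappa> avg e])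
  have \<tau>2: "\<tau> * \<tau> = 1" using \<tau> by (metis abs_mult_self_eq mult_1)
  have chain: "((\<lambda>t. g (\<tau> * t)) has_real_derivative \<tau> * g' (\<tau> * t)) (at t)"
    if "\<And>t. (g has_real_derivative g' t) (at t)" for g g' t
  proof -
    have "((\<lambda>t. \<tau> * t) has_real_derivative \<tau>) (at t)" by (auto intro!: derivative_eq_intros)
    from DERIV_chain2[OF that this] show ?thesis by (simp add: mult.commute)
  qed
  show "((\<lambda>T. s * M (\<tau> * T)) has_real_derivative s * (\<tau> * M' (\<tau> * t))) (at t)" for t
    by (intro DERIV_cmult chain M)
  show "((\<lambda>t. s * (\<tau> * a (\<tau> * t))) has_real_derivative s * a' (\<tau> * t)) (at t)" for t
    using DERIV_cmult[OF DERIV_cmult[OF chain[OF a], of \<tau>], of s t] by (simp add: mult.assoc[symmetric] \<tau>2)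
  show "\<bar>s * (\<tau> * M' (\<tau> * t)) - 2 * (s * (\<tau> * a (\<tau> * t)))\<bar> \<le> D" for t
  proof -
    have "s * (\<tau> * M' (\<tau> * t)) - 2 * (s * (\<tau> * a (\<tau> * t))) = s * (\<tau> * (M' (\<tau> * t) - 2 * a (\<tau> * t)))"
      by (simp add: algebra_simps)
    then show ?thesis using M'[of "\<tau> * t"] s \<tau> by (simp add: abs_mult)
  qed
qed

section \<open>Ballistic growth\<close>

lemma inner_scaleC_i: "inner (\<i> *\<^sub>C \<phi>) \<psi> = - inner \<phi> (\<i> *\<^sub>C \<psi>)"
  by (simp add: inner_ell2_def)

lemma inner_symmetric_op: "symmetric_op B \<Longrightarrow> inner (B \<phi>) \<psi> = inner \<phi> (B \<psi>)"
  by (simp add: inner_ell2_def symmetric_opD)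

lemma inner_X_op: "\<phi> \<in> dom_X \<Longrightarrow> \<psi> \<in> dom_X \<Longrightarrow> inner (X_op \<phi>) \<psi> = inner \<phi> (X_op \<psi>)"
  by (simp add: inner_ell2_def X_symmetric)

lemma abs_inner_i_le: "\<bar>inner (\<i> *\<^sub>C \<phi>) \<psi>\<bar> \<le> cmod (cinner \<psi> \<phi>)"
proof -
  have "\<bar>inner \<psi> (\<i> *\<^sub>C \<phi>)\<bar> \<le> cmod (cinner \<psi> (\<i> *\<^sub>C \<phi>))"
    unfolding inner_ell2_def by (rule abs_Re_le_cmod)
  then show ?thesis by (simp add: inner_commute norm_mult)
qed

text \<open>The velocity \<open>f1\<close> is \<open>f'\<close>; \<open>W\<close> is the commutator \<open>[X, V]\<close> and \<open>C\<close> is \<open>[A, V]\<close>,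
  where \<open>A = (T\<^bsub>f1\<^esub> X + X T\<^bsub>f1\<^esub>) / 2\<close> on the domain of \<open>X\<close>. The bound by \<open>D\<close> is what
  \<open>V \<in> C\<^sup>1(X\<^sup>2)\<close> means in terms of \<open>W\<close>.\<close>

locale ballistic = toeplitz_perturbation H K f V for H K f V +
  fixes f1 :: "real \<Rightarrow> real" and F2 F3 :: "real \<Rightarrow> complex" and W C :: "ell2 \<Rightarrow> ell2" and D :: real
  assumes f_deriv: "C1_per (\<lambda>\<theta>. of_real (f \<theta>)) (\<lambda>\<theta>. of_real (f1 \<theta>))"
    and f1_deriv: "C1_per (\<lambda>\<theta>. of_real (f1 \<theta>)) F2" and F2_deriv: "C1_per F2 F3"
    and bounded_W: "bounded_op W"
    and V_dom: "\<And>\<psi>. \<psi> \<in> dom_X \<Longrightarrow> V \<psi> \<in> dom_X"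
    and X_V: "\<And>\<psi>. \<psi> \<in> dom_X \<Longrightarrow> X_op (V \<psi>) = V (X_op \<psi>) + W \<psi>"
    and X2_V: "\<And>\<psi>. \<psi> \<in> dom_X \<Longrightarrow> \<bar>2 * Re (cinner (X_op \<psi>) (\<i> *\<^sub>C W \<psi>))\<bar> \<le> D * (norm \<psi>)\<^sup>2"
    and compact_C: "compact_op C"
    and A_V: "\<And>\<psi>. \<psi> \<in> dom_X \<Longrightarrow>
      cinner ((1/2) *\<^sub>R (toep (fcoef (\<lambda>\<theta>. of_real (f1 \<theta>))) (X_op \<psi>) + X_op (toep (fcoef (\<lambda>\<theta>. of_real (f1 \<theta>))) \<psi>))) (V \<psi>)
      - cinner \<psi> (V ((1/2) *\<^sub>R (toep (fcoef (\<lambda>\<theta>. of_real (f1 \<theta>))) (X_op \<psi>) + X_op (toep (fcoef (\<lambda>\<theta>. of_real (f1 \<theta>))) \<psi>))))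
      = cinner \<psi> (C \<psi>)"
begin

abbreviation F :: "real \<Rightarrow> complex" where "F \<equiv> \<lambda>\<theta>. of_real (f \<theta>)"
abbreviation F1 :: "real \<Rightarrow> complex" where "F1 \<equiv> \<lambda>\<theta>. of_real (f1 \<theta>)"

lemma C2_F1: "C2_per F1"
  using f1_deriv F2_deriv unfolding C2_per_def by blast

lemma bounded_TF: "bounded_op (T F)" and bounded_TF1: "bounded_op (T F1)"
  by (intro bounded_op_toep C2_per_l1 C2_f C2_F1)+

lemma symmetric_TF: "symmetric_op (T F)" and symmetric_TF1: "symmetric_op (T F1)"
  by (intro toep_symmetric C2_per_l1 C2_f C2_F1)+

lemma X_TF: "\<psi> \<in> dom_X \<Longrightarrow> T F \<psi> \<in> dom_X"
    "\<psi> \<in> dom_X \<Longrightarrow> X_op (T F \<psi>) = T F (X_op \<psi>) - \<i> *\<^sub>C T F1 \<psi>"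
  and X_TF1: "\<psi> \<in> dom_X \<Longrightarrow> T F1 \<psi> \<in> dom_X"
  using X_toep_symbol[OF f_deriv f1_deriv] X_toep_symbol(1)[OF f1_deriv F2_deriv] by blast+

sublocale position_regular H K "\<lambda>\<psi>. W \<psi> - \<i> *\<^sub>C T F1 \<psi>"
proof
  show "bounded_op (\<lambda>\<psi>. W \<psi> - \<i> *\<^sub>C T F1 \<psi>)"
    by (intro bounded_op_diff bounded_W bounded_op_scaleC bounded_TF1)
  fix \<psi> assume \<psi>: "\<psi> \<in> dom_X"
  show "H \<psi> \<in> dom_X" unfolding H_eq by (intro X_add X_TF V_dom \<psi>)
  show "X_op (H \<psi>) = H (X_op \<psi>) + (W \<psi> - \<i> *\<^sub>C T F1 \<psi>)"
    unfolding H_eq X_add(2)[OF X_TF(1)[OF \<psi>] V_dom[OF \<psi>]] X_TF(2)[OF \<psi>] X_V[OF \<psi>] by simp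
qed

definition L :: "ell2 \<Rightarrow> ell2" where "L \<phi> = T F1 (T F \<phi>) - T F (T F1 \<phi>)"

lemma X_L: "L \<phi> \<in> dom_X" "compact_bound (\<lambda>\<phi>. X_op (L \<phi>))"
proof -
  have d: "decay 3 F"
    using decay_Suc[OF f_deriv C2_per_decay[OF C2_F1]] by (simp add: numeral_3_eq_3 numeral_2_eq_2)
  note * = position_commutator[OF f_deriv d f1_deriv C2_per_decay[OF C2_F1] C2_per_l1[OF C2_per_mult[OF C2_f C2_F1]]]
  show "L \<phi> \<in> dom_X" "compact_bound (\<lambda>\<phi>. X_op (L \<phi>))"
    using *(1)[of \<phi>] *(2) unfolding L_def by auto
qed

text \<open>The rate \<open>A_rate \<psi>\<close> at which the expectation of \<open>A\<close> grows along the flow, that is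
  \<open>i\<langle>\<psi>, [A, H] \<psi>\<rangle>\<close>; up to a compact error it is the expectation of the squared velocity.\<close>

definition A_rate :: "ell2 \<Rightarrow> real" where
  "A_rate \<psi> = inner (X_op \<psi>) (T F1 (\<i> *\<^sub>C H \<psi>)) + inner (\<i> *\<^sub>C X_op (H \<psi>)) (T F1 \<psi>)"

text \<open>Since \<open>X\<close> and \<open>T\<^bsub>f1\<^esub>\<close> are symmetric, the contribution of \<open>V\<close> is the form of \<open>i [A, V]\<close>.\<close>

lemma A_rate_potential:
  assumes \<psi>: "\<psi> \<in> dom_X"
  shows "\<bar>inner (X_op \<psi>) (T F1 (\<i> *\<^sub>C V \<psi>)) + inner (\<i> *\<^sub>C X_op (V \<psi>)) (T F1 \<psi>)\<bar> \<le> cmod (cinner \<psi> (C \<psi>))"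
proof -
  let ?B = "T F1 (X_op \<psi>) + X_op (T F1 \<psi>)"
  have "inner (X_op \<psi>) (T F1 (\<i> *\<^sub>C V \<psi>)) + inner (\<i> *\<^sub>C X_op (V \<psi>)) (T F1 \<psi>)
      = inner (T F1 (X_op \<psi>)) (\<i> *\<^sub>C V \<psi>) - inner (X_op (V \<psi>)) (\<i> *\<^sub>C T F1 \<psi>)"
    unfolding inner_symmetric_op[OF symmetric_TF1] inner_scaleC_i by simp
  also have "inner (X_op (V \<psi>)) (\<i> *\<^sub>C T F1 \<psi>) = inner (V \<psi>) (\<i> *\<^sub>C X_op (T F1 \<psi>))"
    using inner_X_op[OF V_dom[OF \<psi>], of "\<i> *\<^sub>C T F1 \<psi>"] X_scaleC[OF X_TF1[OF \<psi>], of \<i>] by simp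
  also have "\<dots> = - inner (X_op (T F1 \<psi>)) (\<i> *\<^sub>C V \<psi>)"
    by (metis inner_commute inner_scaleC_i)
  finally have 1: "inner (X_op \<psi>) (T F1 (\<i> *\<^sub>C V \<psi>)) + inner (\<i> *\<^sub>C X_op (V \<psi>)) (T F1 \<psi>) = Re (\<i> * cinner ?B (V \<psi>))"
    by (simp add: inner_ell2_def cinner_add_left)
  have "cinner ?B (V \<psi>) - cnj (cinner ?B (V \<psi>)) = 2 * cinner \<psi> (C \<psi>)"
  proof -
    have "cinner \<psi> (V ((1/2) *\<^sub>R ?B)) = cnj (cinner ((1/2) *\<^sub>R ?B) (V \<psi>))"
      by (metis cinner_commute symmetric_V symmetric_opD)
    moreover have "cinner ((1/2) *\<^sub>R ?B) (V \<psi>) = (1/2) * cinner ?B (V \<psi>)"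
      using cinner_scaleR(1)[of "1/2" ?B "V \<psi>"] by simp
    ultimately have "(1/2) * cinner ?B (V \<psi>) - cnj ((1/2) * cinner ?B (V \<psi>)) = cinner \<psi> (C \<psi>)"
      using A_V[OF \<psi>] by metis
    moreover have "a - b = 2 * c" if "(1/2) * a - cnj (1/2) * b = c" for a b c :: complex
      using that by (auto simp: complex_eq_iff)
    ultimately show ?thesis by (metis complex_cnj_mult)
  qed
  then have "cinner \<psi> (C \<psi>) = \<i> * of_real (Im (cinner ?B (V \<psi>)))"
    by (simp add: complex_eq_iff)
  then have "cmod (cinner \<psi> (C \<psi>)) = \<bar>Im (cinner ?B (V \<psi>))\<bar>" by (simp add: norm_mult)
  then show ?thesis unfolding 1 by simp
qed

text \<open>The commutator \<open>[X, T\<^sub>f]\<close> produces the square, and what remains is the commutator \<open>L\<close>.\<close>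

lemma A_rate_free:
  assumes \<psi>: "\<psi> \<in> dom_X"
  shows "inner (X_op \<psi>) (T F1 (\<i> *\<^sub>C T F \<psi>)) + inner (\<i> *\<^sub>C X_op (T F \<psi>)) (T F1 \<psi>)
    = (norm (T F1 \<psi>))\<^sup>2 + inner (\<i> *\<^sub>C X_op (L \<psi>)) \<psi>"
proof -
  have "inner (\<i> *\<^sub>C X_op (T F \<psi>)) (T F1 \<psi>) = inner (T F1 \<psi>) (T F1 \<psi>) + inner (\<i> *\<^sub>C T F (X_op \<psi>)) (T F1 \<psi>)"
    unfolding X_TF(2)[OF \<psi>] by (simp add: inner_ell2_def cinner_diff_left algebra_simps)
  also have "inner (\<i> *\<^sub>C T F (X_op \<psi>)) (T F1 \<psi>) = - inner (X_op \<psi>) (\<i> *\<^sub>C T F (T F1 \<psi>))"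
    unfolding inner_scaleC_i inner_symmetric_op[OF symmetric_TF] by (simp add: bounded_op_simps[OF bounded_TF])
  finally have "inner (X_op \<psi>) (T F1 (\<i> *\<^sub>C T F \<psi>)) + inner (\<i> *\<^sub>C X_op (T F \<psi>)) (T F1 \<psi>)
      = (norm (T F1 \<psi>))\<^sup>2 + inner (X_op \<psi>) (\<i> *\<^sub>C L \<psi>)"
    by (simp add: bounded_op_simps[OF bounded_TF1] L_def inner_ell2_def cinner_diff_right power2_norm_eq_inner algebra_simps)
  also have "inner (X_op \<psi>) (\<i> *\<^sub>C L \<psi>) = inner \<psi> (\<i> *\<^sub>C X_op (L \<psi>))"
    using inner_X_op[OF \<psi> X_scaleC(1)[OF X_L(1)[of \<psi>], of \<i>]] X_scaleC(2)[OF X_L(1)[of \<psi>], of \<i>] by simp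
  finally show ?thesis by (simp add: inner_commute)
qed

lemma A_rate_compact:
  obtains k where "compact_form k"
    "\<And>\<psi>. \<psi> \<in> dom_X \<Longrightarrow> \<bar>A_rate \<psi> - Re (cinner \<psi> (T (\<lambda>\<theta>. F1 \<theta> * F1 \<theta>) \<psi>))\<bar> \<le> k \<psi>"
proof -
  let ?S = "\<lambda>\<psi>. T (\<lambda>\<theta>. F1 \<theta> * F1 \<theta>) \<psi> - T F1 (T F1 \<psi>)"
  let ?k = "\<lambda>\<psi>. cmod (cinner \<psi> (C \<psi>)) + (cmod (cinner \<psi> (X_op (L \<psi>))) + cmod (cinner \<psi> (?S \<psi>)))"
  have "compact_form ?k"
    using compact_op_form[OF compact_C bounded_op_id] compact_bound_imp_form[OF X_L(2)]
      compact_bound_imp_form[OF compact_semicommutator[OF C2_F1 C2_F1]]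
    by (intro compact_form_add) auto
  moreover have "\<bar>A_rate \<psi> - Re (cinner \<psi> (T (\<lambda>\<theta>. F1 \<theta> * F1 \<theta>) \<psi>))\<bar> \<le> ?k \<psi>" if \<psi>: "\<psi> \<in> dom_X" for \<psi>
  proof -
    have "A_rate \<psi> = (inner (X_op \<psi>) (T F1 (\<i> *\<^sub>C V \<psi>)) + inner (\<i> *\<^sub>C X_op (V \<psi>)) (T F1 \<psi>))
        + ((norm (T F1 \<psi>))\<^sup>2 + inner (\<i> *\<^sub>C X_op (L \<psi>)) \<psi>)"
      unfolding A_rate_def fun_cong[OF H_eq, of \<psi>] A_rate_free[OF \<psi>, symmetric] X_add(2)[OF X_TF(1)[OF \<psi>] V_dom[OF \<psi>]]
      by (simp add: scaleC_distribs bounded_op_simps[OF bounded_TF1] inner_add_left inner_add_right)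
    moreover have "(norm (T F1 \<psi>))\<^sup>2 = Re (cinner \<psi> (T (\<lambda>\<theta>. F1 \<theta> * F1 \<theta>) \<psi>)) - Re (cinner \<psi> (?S \<psi>))"
      using symmetric_opD[OF symmetric_TF1, of \<psi> "T F1 \<psi>"]
      by (simp add: cinner_diff_right power2_norm_eq_inner inner_ell2_def)
    moreover have "\<bar>Re (cinner \<psi> (?S \<psi>))\<bar> \<le> cmod (cinner \<psi> (?S \<psi>))" by (rule abs_Re_le_cmod)
    ultimately show ?thesis
      using A_rate_potential[OF \<psi>] abs_inner_i_le[of "X_op (L \<psi>)" \<psi>] by linarith
  qed
  ultimately show ?thesis by (rule that)
qed

lemma position_velocity_derivative:
  assumes \<psi>: "\<psi> \<in> dom_X"
  shows "((\<lambda>t. inner (X_op (U t \<psi>)) (T F1 (U t \<psi>))) has_real_derivative A_rate (U t \<psi>)) (at t)"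
proof -
  have "((\<lambda>t. T F1 (U t \<psi>)) has_vector_derivative T F1 (\<i> *\<^sub>C H (U t \<psi>))) (at t)"
    by (rule bounded_linear.has_vector_derivative[OF bounded_op_linear[OF bounded_TF1] U_has_derivative])
  from bounded_bilinear.has_vector_derivative[OF bounded_bilinear_inner X_U_has_derivative[OF \<psi>] this]
  show ?thesis
    unfolding A_rate_def has_real_derivative_iff_has_vector_derivative by simp
qed

lemma position_square_velocity:
  assumes \<psi>: "\<psi> \<in> dom_X"
  shows "\<bar>2 * inner (X_op (U t \<psi>)) (\<i> *\<^sub>C (W (U t \<psi>) - \<i> *\<^sub>C T F1 (U t \<psi>))) - 2 * inner (X_op (U t \<psi>)) (T F1 (U t \<psi>))\<bar>
    \<le> D * (norm \<psi>)\<^sup>2"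
proof -
  have "\<i> *\<^sub>C (W (U t \<psi>) - \<i> *\<^sub>C T F1 (U t \<psi>)) = \<i> *\<^sub>C W (U t \<psi>) + T F1 (U t \<psi>)"
    by (rule ell2_eqI) (simp add: algebra_simps)
  then show ?thesis
    using X2_V[OF U_dom[OF \<psi>], of t] by (simp add: cinner_add_right inner_ell2_def)
qed

text \<open>Functions of \<open>H\<close> commute with its spectral projections.\<close>

lemma atomless_fc:
  assumes "\<And>x. E {x} \<eta> = 0" "bounded_borel g"
  shows "E {x} (fc g \<eta>) = 0"
proof -
  have "E {x} (fc g \<eta>) = fc g (E {x} \<eta>)"
    unfolding E_def fc_mult[OF bounded_borel_indicator[of "{x}", simplified] assms(2), symmetric]
      fc_mult[OF assms(2) bounded_borel_indicator[of "{x}", simplified], symmetric]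
    by (simp add: mult.commute)
  then show ?thesis using assms(1) bounded_op_simps(4)[OF bounded_op_fc[OF assms(2)]] bounded_op_fc[OF assms(2)]
    by (simp add: bounded_op_simps)
qed

text \<open>With \<open>s = 1\<close> this bounds the growth from below, with \<open>s = -1\<close> from above; \<open>\<tau>\<close> is the
  direction of time. The compact errors disappear in the time average since \<open>\<eta>\<close>, hence also
  \<open>\<Phi>(H) \<eta>\<close>, has no atoms.\<close>

lemma position_growth:
  assumes \<eta>: "\<And>x. E {x} \<eta> = 0"
    and \<Phi>: "continuous_on UNIV \<Phi>" "bounded_borel (\<lambda>x. of_real (\<Phi> x))"
    and \<psi>: "fc (\<lambda>x. of_real (\<Phi> x)) \<eta> = \<psi>" "\<psi> \<in> dom_X"
    and s: "\<bar>s\<bar> = 1" and \<tau>: "\<bar>\<tau>\<bar> = 1" and e: "\<epsilon> > 0"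
    and c: "\<And>\<theta>. \<Phi> (f \<theta>) \<noteq> 0 \<Longrightarrow> 0 \<le> s * ((f1 \<theta>)\<^sup>2 - c)"
  shows "\<forall>\<^sub>F t in at_top. s * c * (norm \<psi>)\<^sup>2 - \<epsilon> \<le> s * (norm (X_op (U (\<tau> * t) \<psi>)))\<^sup>2 / t\<^sup>2"
proof -
  define \<delta> where "\<delta> = \<epsilon> / 2 / ((norm \<eta>)\<^sup>2 + (norm \<psi>)\<^sup>2 + 1)"
  have den: "(norm \<eta>)\<^sup>2 + (norm \<psi>)\<^sup>2 + 1 > 0" by (simp add: add_nonneg_pos)
  have \<delta>: "\<delta> > 0" using e den by (simp add: \<delta>_def)
  have \<delta>_le: "\<delta> * (norm \<eta>)\<^sup>2 + \<delta> * (norm \<psi>)\<^sup>2 \<le> \<epsilon> / 2"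
  proof -
    have "\<delta> * ((norm \<eta>)\<^sup>2 + (norm \<psi>)\<^sup>2) \<le> \<delta> * ((norm \<eta>)\<^sup>2 + (norm \<psi>)\<^sup>2 + 1)" using \<delta> by (intro mult_left_mono) auto
    also have "\<dots> = \<epsilon> / 2"
      using den unfolding \<delta>_def by (metis less_irrefl nonzero_mult_div_cancel_right times_divide_eq_left)
    finally show ?thesis by (simp add: distrib_left)
  qed
  let ?G = "\<lambda>\<theta>. F1 \<theta> * F1 \<theta>" and ?k = "\<lambda>\<theta>. s * ((f1 \<theta>)\<^sup>2 - c)"
  have k: "(\<lambda>\<theta>. complex_of_real (?k \<theta>)) = (\<lambda>\<theta>. complex_of_real s * (?G \<theta> + complex_of_real (- c)))"
    by (simp add: power2_eq_square algebra_simps)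
  have c2G: "C2_per ?G" by (intro C2_per_mult C2_F1)
  have c2k: "C2_per (\<lambda>\<theta>. of_real (?k \<theta>))"
    unfolding k by (intro C2_per_mult C2_per_add c2G C2_per_const)
  have Tk: "T (\<lambda>\<theta>. of_real (?k \<theta>)) \<phi> = s *\<^sub>R (T ?G \<phi> - c *\<^sub>R \<phi>)" for \<phi>
    unfolding k toep_fcoef_cmult[OF C2_per_add[OF c2G C2_per_const]] toep_fcoef_add[OF c2G C2_per_const] toep_const
    by simp
  obtain ys where ys: "\<And>\<phi>. - \<delta> * (norm \<phi>)\<^sup>2 - norm \<phi> * weak_size ys \<phi>
    \<le> Re (cinner (fc (\<lambda>x. of_real (\<Phi> x)) \<phi>) (T (\<lambda>\<theta>. of_real (?k \<theta>)) (fc (\<lambda>x. of_real (\<Phi> x)) \<phi>)))"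
    using energy_localization[OF \<Phi> c2k c \<delta>] by blast
  obtain k0 where k0: "compact_form k0"
    "\<And>\<psi>. \<psi> \<in> dom_X \<Longrightarrow> \<bar>A_rate \<psi> - Re (cinner \<psi> (T ?G \<psi>))\<bar> \<le> k0 \<psi>"
    using A_rate_compact by blast
  obtain zs where zs: "\<And>\<phi>. \<bar>k0 \<phi>\<bar> \<le> \<delta> * (norm \<phi>)\<^sup>2 + norm \<phi> * weak_size zs \<phi>"
    using compact_formD[OF k0(1) \<delta>] by blast
  let ?\<kappa> = "\<lambda>t. norm \<eta> * weak_size ys (U (\<tau> * t) \<eta>) + norm \<psi> * weak_size zs (U (\<tau> * t) \<psi>)"
  have atomless: "E {x} \<psi> = 0" for x using atomless_fc[OF \<eta> \<Phi>(2), of x] \<psi>(1) by simp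
  have avg: "((\<lambda>T. integral {0..T} ?\<kappa> / T) \<longlongrightarrow> 0) at_top"
  proof -
    have int: "(\<lambda>t. weak_size xs (U (\<tau> * t) \<phi>)) integrable_on {0..T}" for xs \<phi> T
      by (rule integrable_continuous_interval[OF continuous_weak_size_U])
    have "integral {0..T} ?\<kappa> / T = norm \<eta> * (integral {0..T} (\<lambda>t. weak_size ys (U (\<tau> * t) \<eta>)) / T)
        + norm \<psi> * (integral {0..T} (\<lambda>t. weak_size zs (U (\<tau> * t) \<psi>)) / T)" for T
      by (subst Henstock_Kurzweil_Integration.integral_add)
        (auto intro!: integrable_on_cmult_left[where 'a=real, simplified] int simp: integrable_on_mult_right int add_divide_distrib)
    moreover have "((\<lambda>T. norm \<eta> * (integral {0..T} (\<lambda>t. weak_size ys (U (\<tau> * t) \<eta>)) / T)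
        + norm \<psi> * (integral {0..T} (\<lambda>t. weak_size zs (U (\<tau> * t) \<psi>)) / T)) \<longlongrightarrow> norm \<eta> * 0 + norm \<psi> * 0) at_top"
      by (intro tendsto_intros weak_size_average \<eta> atomless \<tau>)
    ultimately show ?thesis by simp
  qed
  have low: "(s * c * (norm \<psi>)\<^sup>2 - \<epsilon> / 2) - ?\<kappa> t \<le> s * A_rate (U (\<tau> * t) \<psi>)" for t
  proof -
    let ?\<eta> = "U (\<tau> * t) \<eta>" and ?\<psi> = "U (\<tau> * t) \<psi>"
    have "fc (\<lambda>x. of_real (\<Phi> x)) ?\<eta> = ?\<psi>" using U_fc[OF \<Phi>(2)] \<psi>(1) by metis
    then have "- \<delta> * (norm \<eta>)\<^sup>2 - norm \<eta> * weak_size ys ?\<eta> \<le> Re (cinner ?\<psi> (T (\<lambda>\<theta>. of_real (?k \<theta>)) ?\<psi>))"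
      using ys[of ?\<eta>] by simp
    also have "\<dots> = s * Re (cinner ?\<psi> (T ?G ?\<psi>)) - s * c * (norm \<psi>)\<^sup>2"
      unfolding Tk by (simp add: cinner_diff_right cinner_self algebra_simps flip: of_real_power)
    finally have 1: "- \<delta> * (norm \<eta>)\<^sup>2 - norm \<eta> * weak_size ys ?\<eta> \<le> s * Re (cinner ?\<psi> (T ?G ?\<psi>)) - s * c * (norm \<psi>)\<^sup>2" .
    have "\<bar>s * (A_rate ?\<psi> - Re (cinner ?\<psi> (T ?G ?\<psi>)))\<bar> \<le> \<delta> * (norm \<psi>)\<^sup>2 + norm \<psi> * weak_size zs ?\<psi>"
      using k0(2)[OF U_dom[OF \<psi>(2)], of "\<tau> * t"] zs[of ?\<psi>] by (simp add: abs_mult s)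
    then have "- (\<delta> * (norm \<psi>)\<^sup>2 + norm \<psi> * weak_size zs ?\<psi>) \<le> s * A_rate ?\<psi> - s * Re (cinner ?\<psi> (T ?G ?\<psi>))"
      unfolding right_diff_distrib by linarith
    moreover from 1 have "s * c * (norm \<psi>)\<^sup>2 - (\<delta> * (norm \<eta>)\<^sup>2 + norm \<eta> * weak_size ys ?\<eta>) \<le> s * Re (cinner ?\<psi> (T ?G ?\<psi>))"
      by simp
    ultimately show ?thesis using \<delta>_le by linarith
  qed
  have "\<forall>\<^sub>F t in at_top. (s * c * (norm \<psi>)\<^sup>2 - \<epsilon> / 2) - \<epsilon> / 2 \<le> s * (norm (X_op (U (\<tau> * t) \<psi>)))\<^sup>2 / t\<^sup>2"
  proof (rule second_order_growth[OF position_square_derivative[OF \<psi>(2)] position_velocity_derivative[OF \<psi>(2)]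
        position_square_velocity[OF \<psi>(2)] s \<tau> low _ _ avg half_gt_zero[OF e]])
    show "continuous_on UNIV ?\<kappa>" by (intro continuous_intros continuous_weak_size_U)
    show "0 \<le> ?\<kappa> t" for t by (simp add: weak_size_nonneg)
  qed
  then show ?thesis by simp
qed

end

section \<open>Smooth functions of the Hamiltonian\<close>

lemma periodic_int_shift:
  fixes u :: "real \<Rightarrow> 'a"
  assumes "\<And>\<theta>. u (\<theta> + 2 * pi) = u \<theta>"
  shows "u (\<theta> + 2 * pi * of_int k) = u \<theta>"
proof (induction k rule: int_induct[of _ 0])
  case (step1 i)
  then show ?case using assms[of "\<theta> + 2 * pi * of_int i"] by (simp add: algebra_simps)
next
  case (step2 i)
  then show ?case using assms[of "\<theta> + 2 * pi * of_int (i - 1)"] by (simp add: algebra_simps)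
qed simp

text \<open>Meant for functions that vanish outside \<open>[-1, 1]\<close>, whose translates by multiples of \<open>2\<pi>\<close> have disjoint
  supports.\<close>

definition periodize :: "(real \<Rightarrow> complex) \<Rightarrow> real \<Rightarrow> complex" where
  "periodize \<phi> \<theta> = \<phi> (\<theta> - 2 * pi * of_int (round (\<theta> / (2 * pi))))"

lemma round_period: "\<bar>\<theta> - 2 * pi * of_int (round (\<theta> / (2 * pi)))\<bar> \<le> pi"
proof -
  have "\<bar>of_int (round (\<theta> / (2 * pi))) - \<theta> / (2 * pi)\<bar> \<le> 1 / 2" by (rule of_int_round_abs_le)
  then have "2 * pi * \<bar>of_int (round (\<theta> / (2 * pi))) - \<theta> / (2 * pi)\<bar> \<le> 2 * pi * (1 / 2)"
    by (intro mult_left_mono) auto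
  also have "2 * pi * \<bar>of_int (round (\<theta> / (2 * pi))) - \<theta> / (2 * pi)\<bar>
      = \<bar>2 * pi * (of_int (round (\<theta> / (2 * pi))) - \<theta> / (2 * pi))\<bar>"
    by (simp add: abs_mult)
  also have "2 * pi * (of_int (round (\<theta> / (2 * pi))) - \<theta> / (2 * pi)) = 2 * pi * of_int (round (\<theta> / (2 * pi))) - \<theta>"
    by (simp add: right_diff_distrib)
  finally show ?thesis by (simp add: abs_minus_commute)
qed

text \<open>The bound \<open>2\<pi> - 1 > \<pi>\<close> makes the set of such \<open>y\<close> an open neighbourhood of every point that rounds to \<open>m\<close>.\<close>

lemma periodize_eq:
  assumes \<phi>: "\<And>y. \<bar>y\<bar> > 1 \<Longrightarrow> \<phi> y = 0" and y: "\<bar>y - 2 * pi * of_int m\<bar> < 2 * pi - 1"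
  shows "periodize \<phi> y = \<phi> (y - 2 * pi * of_int m)"
proof -
  let ?k = "round (y / (2 * pi))"
  show ?thesis
  proof (cases "?k = m")
    case False
    then have "1 \<le> \<bar>real_of_int (?k - m)\<bar>" by linarith
    then have "2 * pi * 1 \<le> 2 * pi * \<bar>real_of_int (?k - m)\<bar>" by (intro mult_left_mono) auto
    also have "\<dots> = \<bar>(y - 2 * pi * of_int m) - (y - 2 * pi * of_int ?k)\<bar>"
      using abs_mult[of "2 * pi" "real_of_int (?k - m)"] by (simp add: algebra_simps)
    finally have "\<bar>y - 2 * pi * of_int ?k\<bar> > 1" "\<bar>y - 2 * pi * of_int m\<bar> > 1"
      using y round_period[of y] pi_gt3 by linarith+
    then show ?thesis using \<phi> by (simp add: periodize_def)
  qed (simp add: periodize_def)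
qed

lemma periodize_deriv:
  assumes \<phi>: "\<And>y. \<bar>y\<bar> > 1 \<Longrightarrow> \<phi> y = 0" and \<phi>': "\<And>y. \<bar>y\<bar> > 1 \<Longrightarrow> \<phi>' y = 0"
    and d: "\<And>y. (\<phi> has_vector_derivative \<phi>' y) (at y)"
  shows "(periodize \<phi> has_vector_derivative periodize \<phi>' \<theta>) (at \<theta>)"
proof -
  let ?m = "round (\<theta> / (2 * pi))"
  have "((\<phi> \<circ> (\<lambda>y. y - 2 * pi * of_int ?m)) has_vector_derivative (1 *\<^sub>R \<phi>' (\<theta> - 2 * pi * of_int ?m))) (at \<theta>)"
    by (rule vector_diff_chain_at) (auto intro!: derivative_eq_intros d)
  then have "((\<lambda>y. \<phi> (y - 2 * pi * of_int ?m)) has_vector_derivative periodize \<phi>' \<theta>) (at \<theta>)"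
    by (simp add: comp_def periodize_def)
  moreover have "open {y. \<bar>y - 2 * pi * of_int ?m\<bar> < 2 * pi - 1}"
    by (intro open_Collect_less continuous_intros)
  moreover have "\<theta> \<in> {y. \<bar>y - 2 * pi * of_int ?m\<bar> < 2 * pi - 1}"
    using round_period[of \<theta>] pi_gt3 by simp
  ultimately show ?thesis
    by (rule has_vector_derivative_transform_within_open) (simp add: periodize_eq[OF \<phi>])
qed

lemma periodize_periodic: "periodize \<phi> (\<theta> + 2 * pi) = periodize \<phi> \<theta>"
proof -
  have "(\<theta> + 2 * pi) / (2 * pi) = \<theta> / (2 * pi) + of_int 1" by (simp add: add_divide_distrib)
  then have "round ((\<theta> + 2 * pi) / (2 * pi)) = round (\<theta> / (2 * pi)) + 1"
    unfolding round_def by (metis add.commute add.left_commute floor_add_int)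
  then show ?thesis by (simp add: periodize_def algebra_simps)
qed

lemma periodize_C2:
  assumes z: "\<And>y. \<bar>y\<bar> > 1 \<Longrightarrow> \<phi> y = 0" "\<And>y. \<bar>y\<bar> > 1 \<Longrightarrow> \<phi>' y = 0" "\<And>y. \<bar>y\<bar> > 1 \<Longrightarrow> \<phi>'' y = 0"
      "\<And>y. \<bar>y\<bar> > 1 \<Longrightarrow> \<phi>''' y = 0"
    and d: "\<And>y. (\<phi> has_vector_derivative \<phi>' y) (at y)" "\<And>y. (\<phi>' has_vector_derivative \<phi>'' y) (at y)"
      "\<And>y. (\<phi>'' has_vector_derivative \<phi>''' y) (at y)"
  shows "C2_per (periodize \<phi>)"
proof -
  have c: "continuous_on UNIV (periodize \<phi>')" "continuous_on UNIV (periodize \<phi>'')"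
    using has_vector_derivative_continuous[OF periodize_deriv[OF z(2,3) d(2)]]
      has_vector_derivative_continuous[OF periodize_deriv[OF z(3,4) d(3)]]
    by (simp_all add: continuous_at_imp_continuous_on)
  have "C1_per (periodize \<phi>) (periodize \<phi>')" "C1_per (periodize \<phi>') (periodize \<phi>'')"
    unfolding C1_per_def using periodize_deriv[OF z(1,2) d(1)] periodize_deriv[OF z(2,3) d(2)] c periodize_periodic by auto
  then show ?thesis unfolding C2_per_def by blast
qed

context position_regular
begin

text \<open>Expand in a Fourier series: \<open>u(sH)\<close> is a superposition of the evolutions \<open>U(ns)\<close>, whose
  coefficients beat the linear growth of \<open>\<parallel>X U(ns) \<psi>\<parallel>\<close>.\<close>

lemma periodic_fc_dom:
  assumes u: "C2_per u" and g: "bounded_borel g" "\<And>x. \<bar>x\<bar> \<le> K \<Longrightarrow> g x = u (s * x)" and \<psi>: "\<psi> \<in> dom_X"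
  shows "fc g \<psi> \<in> dom_X"
proof -
  obtain u' u'' where u': "C1_per u u'" "C1_per u' u''" using u unfolding C2_per_def by blast
  note l = fcoef_summable[OF u'(1)] and l' = fcoef_summable[OF u'(2)]
  obtain A B where AB: "A \<ge> 0" "B \<ge> 0" "\<And>t. norm (X_op (U t \<psi>)) \<le> A + B * \<bar>t\<bar>"
    using X_U_linear_bound[OF \<psi>] by blast
  let ?e = "\<lambda>n x. fcoef u n * exp (\<i> * complex_of_real ((of_int n * s) * x))"
  let ?G = "\<lambda>N x. \<Sum>n\<in>{- int N..int N}. ?e n x"
  have e: "?e n x = fcoef u n * chr n (s * x)" for n x by (simp add: chr_def mult_ac)
  have bb: "bounded_borel (?e n)" for n by (intro bounded_borel_cmult bounded_borel_exp)
  have GU: "fc (?G N) \<psi> = (\<Sum>n\<in>{- int N..int N}. fcoef u n *\<^sub>C U (of_int n * s) \<psi>)" for N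
    unfolding fc_sum[OF bb] fc_cmult[OF bounded_borel_exp] U_def ..
  have "(\<lambda>N. fc (?G N) \<psi>) \<longlonglongrightarrow> fc (\<lambda>x. u (s * x)) \<psi>"
  proof (rule fc_strong_lim)
    show "bounded_borel (?G N)" for N by (rule bounded_borel_sum) (rule bb)
    show "cmod (?G N x) \<le> infsum (\<lambda>n. cmod (fcoef u n)) UNIV" for N x
    proof -
      have "cmod (?G N x) \<le> (\<Sum>n\<in>{- int N..int N}. cmod (fcoef u n))"
        by (rule order_trans[OF norm_sum]) (simp add: e norm_mult)
      also have "\<dots> \<le> infsum (\<lambda>n. cmod (fcoef u n)) UNIV"
        by (rule finite_sum_le_infsum[OF l]) auto
      finally show ?thesis .
    qed
    show "(\<lambda>N. ?G N x) \<longlonglongrightarrow> u (s * x)" for x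
      unfolding e using filterlim_compose[OF Fourier_has_sum[OF u'(1), of "s * x", unfolded has_sum_def] filterlim_symmetric_intervals] .
  qed
  moreover have "fc (\<lambda>x. u (s * x)) = fc g"
  proof (rule fc_cong[OF _ g(1)])
    obtain M where "\<And>\<theta>. cmod (u \<theta>) \<le> M" using C2_per_bound[OF u] by blast
    then show "bounded_borel (\<lambda>x. u (s * x))"
      by (intro bounded_borelI[of _ M] borel_measurable_continuous_onI continuous_on_compose2[OF C2_per_cont[OF u]] continuous_intros) auto
  qed (simp add: g(2))
  ultimately have lim: "(\<lambda>N. fc (?G N) \<psi>) \<longlonglongrightarrow> fc g \<psi>" by simp
  let ?x = "\<lambda>n. fcoef u n *\<^sub>C X_op (U (of_int n * s) \<psi>)"
  have X: "fc (?G N) \<psi> \<in> dom_X" "X_op (fc (?G N) \<psi>) = (\<Sum>n\<in>{- int N..int N}. ?x n)" for N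
    unfolding GU using X_sum[of "{- int N..int N}" "\<lambda>n. fcoef u n *\<^sub>C U (of_int n * s) \<psi>"] X_scaleC[OF U_dom[OF \<psi>]]
    by auto
  have "(\<lambda>n. norm (?x n)) summable_on UNIV"
  proof (rule summable_on_comparison_test)
    show "(\<lambda>n. A * cmod (fcoef u n) + B * \<bar>s\<bar> * cmod (fcoef u' n)) summable_on UNIV"
      by (intro summable_on_add summable_on_cmult_right l l')
    show "norm (?x n) \<le> A * cmod (fcoef u n) + B * \<bar>s\<bar> * cmod (fcoef u' n)" for n
    proof -
      have "norm (?x n) \<le> cmod (fcoef u n) * (A + B * \<bar>of_int n * s\<bar>)"
        using AB(3) by (simp add: mult_left_mono)
      also have "\<dots> = A * cmod (fcoef u n) + B * \<bar>s\<bar> * cmod (fcoef u' n)"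
        by (simp add: fcoef_deriv[OF u'(1)] norm_mult abs_mult algebra_simps)
      finally show ?thesis .
    qed
  qed auto
  from has_sum_infsum[OF abs_summable_summable[OF this]]
  have "((\<lambda>F. \<Sum>n\<in>F. ?x n) \<longlongrightarrow> infsum ?x UNIV) (finite_subsets_at_top UNIV)"
    by (simp add: has_sum_def)
  from filterlim_compose[OF this filterlim_symmetric_intervals]
  have "(\<lambda>N. X_op (fc (?G N) \<psi>)) \<longlonglongrightarrow> infsum ?x UNIV" unfolding X(2) .
  from X_closed(1)[OF X(1) lim this] show ?thesis .
qed

end

lemma C_infinity_compactD:
  assumes "C_infinity_compact \<Phi>"
  shows "((deriv ^^ j) \<Phi> has_real_derivative (deriv ^^ Suc j) \<Phi> x) (at x)"
    and "continuous_on UNIV \<Phi>" and "bounded_borel (\<lambda>x. of_real (\<Phi> x))"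
    and "\<exists>R. \<forall>R'\<ge>R. \<forall>j x. \<bar>x\<bar> > R' \<longrightarrow> (deriv ^^ j) \<Phi> x = 0"
proof -
  have "C_k (Suc j) \<Phi>" using assms by (simp add: C_infinity_compact_def)
  then have "(deriv ^^ j) \<Phi> differentiable (at x)" unfolding C_k_def by blast
  then show "((deriv ^^ j) \<Phi> has_real_derivative (deriv ^^ Suc j) \<Phi> x) (at x)"
    by (simp add: DERIV_deriv_iff_real_differentiable)
  have "C_k 0 \<Phi>" using assms unfolding C_infinity_compact_def by blast
  then show cont: "continuous_on UNIV \<Phi>" by (simp add: C_k_def)
  have "bounded (closure {x. \<Phi> x \<noteq> 0})"
    using assms compact_imp_bounded unfolding C_infinity_compact_def by blast
  then obtain R where R: "\<And>x. x \<in> closure {x. \<Phi> x \<noteq> 0} \<Longrightarrow> \<bar>x\<bar> \<le> R"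
    by (auto simp: bounded_real)
  then have R0: "\<Phi> x = 0" if "\<bar>x\<bar> > R" for x
    using that closure_subset[of "{x. \<Phi> x \<noteq> 0}"] by fastforce
  have zero: "(deriv ^^ j) \<Phi> x = 0" if "\<bar>x\<bar> > R" for j x
    using that
  proof (induction j arbitrary: x)
    case (Suc j)
    have op: "open {x. \<bar>x\<bar> > R}" by (intro open_Collect_less continuous_intros)
    have "((\<lambda>_. 0) has_real_derivative 0) (at x)" by simp
    then have "((deriv ^^ j) \<Phi> has_real_derivative 0) (at x)"
      by (rule has_field_derivative_transform_within_open[OF _ op]) (use Suc in auto)
    then show ?case by (simp add: DERIV_imp_deriv)
  qed (use R0 in simp)
  then show "\<exists>R. \<forall>R'\<ge>R. \<forall>j x. \<bar>x\<bar> > R' \<longrightarrow> (deriv ^^ j) \<Phi> x = 0"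
    by (intro exI[of _ R]) auto
  have "compact (\<Phi> ` {-R..R})" by (intro compact_continuous_image continuous_on_subset[OF cont] compact_Icc) auto
  then have "bounded (\<Phi> ` {-R..R})" by (rule compact_imp_bounded)
  then obtain M where M: "\<And>x. x \<in> {-R..R} \<Longrightarrow> \<bar>\<Phi> x\<bar> \<le> M" unfolding bounded_real by blast
  have "\<bar>\<Phi> x\<bar> \<le> max M 0" for x
    using M[of x] R0[of x] by (cases "\<bar>x\<bar> \<le> R") (auto simp: abs_le_iff)
  then show "bounded_borel (\<lambda>x. of_real (\<Phi> x))"
    by (intro bounded_borelI[of _ "max M 0"] borel_measurable_continuous_onI continuous_intros continuous_on_compose2[OF cont]) auto
qed

context position_regular
begin

text \<open>Scaled to \<open>[-1, 1]\<close>, which also covers the spectrum, \<open>\<Phi>\<close> agrees there with its periodization.\<close>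

lemma smooth_fc_dom:
  assumes \<Phi>: "C_infinity_compact \<Phi>" and \<psi>: "\<psi> \<in> dom_X"
  shows "fc (\<lambda>x. of_real (\<Phi> x)) \<psi> \<in> dom_X"
proof -
  note P = C_infinity_compactD[OF \<Phi>]
  obtain R0 where R0: "\<And>R' j x. R' \<ge> R0 \<Longrightarrow> \<bar>x\<bar> > R' \<Longrightarrow> (deriv ^^ j) \<Phi> x = 0" using P(4) by blast
  define R where "R = max R0 K"
  have R: "R \<ge> K" "R > 0" "\<And>j x. \<bar>x\<bar> > R \<Longrightarrow> (deriv ^^ j) \<Phi> x = 0"
    using K_pos R0[of R] unfolding R_def by auto
  define p where "p j y = complex_of_real (R ^ j * (deriv ^^ j) \<Phi> (R * y))" for j y
  have z: "p j y = 0" if "\<bar>y\<bar> > 1" for j y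
  proof -
    have "\<bar>R * y\<bar> > R" using that R(2) by (simp add: abs_mult)
    then show ?thesis using R(3) by (simp add: p_def)
  qed
  have d: "(p j has_vector_derivative p (Suc j) y) (at y)" for j y
  proof -
    have "((\<lambda>y. (deriv ^^ j) \<Phi> (R * y)) has_real_derivative (deriv ^^ Suc j) \<Phi> (R * y) * R) (at y)"
      by (rule DERIV_chain2[OF P(1)]) (auto intro!: derivative_eq_intros)
    from DERIV_cmult[OF this, of "R ^ j"]
    have "((\<lambda>y. R ^ j * (deriv ^^ j) \<Phi> (R * y)) has_real_derivative R ^ Suc j * (deriv ^^ Suc j) \<Phi> (R * y)) (at y)"
      by (simp add: mult_ac)
    then show ?thesis
      unfolding p_def has_real_derivative_iff_has_vector_derivative
      by (rule bounded_linear.has_vector_derivative[OF bounded_linear_of_real])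
  qed
  show ?thesis
  proof (rule periodic_fc_dom[OF periodize_C2[OF z z z z d d d] P(3) _ \<psi>])
    fix x assume "\<bar>x\<bar> \<le> K"
    then have "\<bar>(1 / R) * x\<bar> \<le> 1" using R by (simp add: abs_mult field_simps)
    then have "periodize (p 0) ((1 / R) * x) = p 0 ((1 / R) * x)"
      using periodize_eq[of "p 0" "(1 / R) * x" 0] z[of _ 0] pi_gt3 by simp
    then show "complex_of_real (\<Phi> x) = periodize (p 0) ((1 / R) * x)" using R(2) by (simp add: p_def)
  qed
qed

end

section \<open>From growth estimates to limits inferior and superior\<close>

lemma Liminf_growth:
  fixes m :: "real \<Rightarrow> real" and F :: "real filter"
  assumes c: "0 \<le> c" and N: "0 \<le> N" and m: "\<And>t. 0 \<le> m t"
    and low: "\<And>b \<epsilon>. b < c \<Longrightarrow> \<epsilon> > 0 \<Longrightarrow> \<forall>\<^sub>F t in F. b * N\<^sup>2 - \<epsilon> \<le> m t / t\<^sup>2"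
  shows "ereal (sqrt c * N) \<le> Liminf F (\<lambda>t. ereal (1 / \<bar>t\<bar> * sqrt (N\<^sup>2 + m t)))"
  unfolding le_Liminf_iff
proof (intro allI impI)
  have size: "1 / \<bar>t\<bar> * sqrt (N\<^sup>2 + m t) \<ge> sqrt (m t / t\<^sup>2)" for t
    using m[of t] by (simp add: real_sqrt_divide divide_right_mono)
  fix y assume "y < ereal (sqrt c * N)"
  then obtain r where r: "y < ereal r" "r < sqrt c * N"
    using ereal_dense2[of y "ereal (sqrt c * N)"] by auto
  have "\<forall>\<^sub>F t in F. max r 0 \<le> sqrt (m t / t\<^sup>2)"
  proof (cases "r < 0")
    case True
    then show ?thesis using m by (auto intro!: always_eventually)
  next
    case False
    then have r0: "0 \<le> r" by simp
    have "r\<^sup>2 < (sqrt c * N)\<^sup>2" using r(2) r0 by (intro power_strict_mono) auto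
    then have rc: "r\<^sup>2 < c * N\<^sup>2" using c by (simp add: power_mult_distrib)
    then have N2: "N\<^sup>2 > 0" using zero_le_power2[of r] by (cases "N = 0") auto
    \<comment> \<open>Strictly between \<open>r\<^sup>2 / N\<^sup>2\<close> and \<open>c\<close>, which leaves room for the error \<open>\<epsilon>\<close>.\<close>
    define b where "b = (r\<^sup>2 / N\<^sup>2 + c) / 2"
    have b: "b * N\<^sup>2 = (r\<^sup>2 + c * N\<^sup>2) / 2" using N2 by (simp add: b_def field_simps)
    have "r\<^sup>2 / N\<^sup>2 < c" using rc N2 by (simp add: divide_less_eq)
    then have "b < c" by (simp add: b_def)
    moreover have "b * N\<^sup>2 - r\<^sup>2 > 0" unfolding b using rc by (simp add: field_simps)
    moreover have "b * N\<^sup>2 - (b * N\<^sup>2 - r\<^sup>2) = r\<^sup>2" by simp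
    ultimately have "\<forall>\<^sub>F t in F. r\<^sup>2 \<le> m t / t\<^sup>2" using low[of b "b * N\<^sup>2 - r\<^sup>2"] by simp
    then show ?thesis
      by eventually_elim (use r0 in \<open>simp add: real_le_rsqrt m\<close>)
  qed
  moreover have "\<forall>\<^sub>F t in F. y < ereal (1 / \<bar>t\<bar> * sqrt (N\<^sup>2 + m t))" if "\<forall>\<^sub>F t in F. max r 0 \<le> sqrt (m t / t\<^sup>2)"
    using that
  proof eventually_elim
    case (elim t)
    then have "r \<le> 1 / \<bar>t\<bar> * sqrt (N\<^sup>2 + m t)" using size[of t] by linarith
    with r(1) show ?case using less_le_trans ereal_less_eq(3) by blast
  qed
  ultimately show "\<forall>\<^sub>F t in F. y < ereal (1 / \<bar>t\<bar> * sqrt (N\<^sup>2 + m t))" by blast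
qed

lemma Limsup_growth:
  fixes m :: "real \<Rightarrow> real" and F :: "real filter"
  assumes c: "0 \<le> c" and N: "0 \<le> N" and F: "F \<le> at_infinity"
    and up: "\<And>b \<epsilon>. c < b \<Longrightarrow> \<epsilon> > 0 \<Longrightarrow> \<forall>\<^sub>F t in F. m t / t\<^sup>2 \<le> b * N\<^sup>2 + \<epsilon>"
  shows "Limsup F (\<lambda>t. ereal (1 / \<bar>t\<bar> * sqrt (N\<^sup>2 + m t))) \<le> ereal (sqrt c * N)"
  unfolding Limsup_le_iff
proof (intro allI impI)
  fix y assume "ereal (sqrt c * N) < y"
  then obtain r where r: "ereal r < y" "sqrt c * N < r"
    using ereal_dense2[of "ereal (sqrt c * N)" y] by auto
  have rc: "c * N\<^sup>2 < r\<^sup>2"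
    using power_strict_mono[OF r(2), of 2] c N by (simp add: power_mult_distrib)
  have r0: "0 < r" using r(2) c N by (meson le_less_trans mult_nonneg_nonneg real_sqrt_ge_zero)
  \<comment> \<open>A quarter of the gap for each of the error of \<open>b\<close>, the admitted error and the term \<open>N\<^sup>2 / t\<^sup>2\<close>.\<close>
  define \<epsilon> where "\<epsilon> = (r\<^sup>2 - c * N\<^sup>2) / 4"
  define b where "b = c + \<epsilon> / (N\<^sup>2 + 1)"
  have N1: "N\<^sup>2 + 1 > 0" by (simp add: add_nonneg_pos)
  have e: "\<epsilon> > 0" using rc by (simp add: \<epsilon>_def)
  have "b > c" using e N1 by (simp add: b_def)
  have "b * N\<^sup>2 \<le> c * N\<^sup>2 + \<epsilon>"
  proof -
    have "\<epsilon> / (N\<^sup>2 + 1) * N\<^sup>2 \<le> \<epsilon> / (N\<^sup>2 + 1) * (N\<^sup>2 + 1)" using e N1 by (intro mult_left_mono) auto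
    also have "\<dots> = \<epsilon>" using N1 by simp
    finally show ?thesis by (simp add: b_def distrib_right)
  qed
  have "((\<lambda>t::real. N\<^sup>2 * (1 / t * (1 / t))) \<longlongrightarrow> N\<^sup>2 * (0 * 0)) F"
  proof -
    have "((\<lambda>t::real. 1 / t) \<longlongrightarrow> 0) at_infinity"
      by (rule tendsto_divide_0[OF tendsto_const]) (rule filterlim_ident)
    then have "((\<lambda>t::real. 1 / t) \<longlongrightarrow> 0) F" by (rule filterlim_mono[OF _ order_refl F])
    then show ?thesis by (intro tendsto_intros)
  qed
  then have "\<forall>\<^sub>F t in F. N\<^sup>2 * (1 / t * (1 / t)) < \<epsilon>" using e by (intro order_tendstoD(2)) auto
  moreover have "\<forall>\<^sub>F t in F. m t / t\<^sup>2 \<le> b * N\<^sup>2 + \<epsilon>" by (rule up[OF \<open>b > c\<close> e])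
  ultimately show "\<forall>\<^sub>F t in F. ereal (1 / \<bar>t\<bar> * sqrt (N\<^sup>2 + m t)) < y"
  proof eventually_elim
    case (elim t)
    have "(N\<^sup>2 + m t) / t\<^sup>2 = N\<^sup>2 * (1 / t * (1 / t)) + m t / t\<^sup>2"
      by (simp add: add_divide_distrib power2_eq_square)
    also have "\<dots> < r\<^sup>2"
    proof -
      have "4 * \<epsilon> = r\<^sup>2 - c * N\<^sup>2" by (simp add: \<epsilon>_def)
      then show ?thesis using elim \<open>b * N\<^sup>2 \<le> c * N\<^sup>2 + \<epsilon>\<close> e by linarith
    qed
    finally have "sqrt ((N\<^sup>2 + m t) / t\<^sup>2) < r" using r0 by (intro real_less_lsqrt) auto
    then have "1 / \<bar>t\<bar> * sqrt (N\<^sup>2 + m t) < r" by (simp add: real_sqrt_divide)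
    with r(1) show ?case using less_trans ereal_less(2) by (metis ereal_less_eq(3) le_less_trans less_imp_le order_less_le_trans)
  qed
qed

section \<open>Extremal velocities\<close>

lemma c_min_le:
  assumes "\<And>\<theta>. 0 \<le> g \<theta>" "\<theta> \<in> closure (f -` A)"
  shows "c_min A f g \<le> (g \<theta> :: real)"
  unfolding c_min_def by (rule cINF_lower[OF bdd_belowI2[of _ 0]]) (use assms in auto)

lemma C_max_ge:
  assumes "\<And>\<theta>. g \<theta> \<le> B" "\<theta> \<in> closure (f -` A)"
  shows "(g \<theta> :: real) \<le> C_max A f g"
  unfolding C_max_def by (rule cSUP_upper[OF _ bdd_aboveI2[of _ _ B]]) (use assms in auto)

lemma in_closure_preimage: "f \<theta> \<in> A \<Longrightarrow> \<theta> \<in> closure (f -` A)"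
  using closure_subset[of "f -` A"] by auto

lemma c_min_nonneg:
  assumes "\<And>\<theta>. 0 \<le> g \<theta>" "f \<theta> \<in> A"
  shows "0 \<le> c_min A f g"
  unfolding c_min_def by (rule cINF_greatest) (use assms in_closure_preimage[of f \<theta> A] in auto)

lemma bdd_above_c_min:
  assumes "\<And>\<theta>. 0 \<le> g \<theta>" "f \<theta> \<in> A"
  shows "bdd_above ((\<lambda>A'. c_min A' f g) ` {A'. open A' \<and> closure A \<subseteq> A'})"
  using assms closure_subset[of A] in_closure_preimage[of f \<theta>]
  by (intro bdd_aboveI2[of _ _ "g \<theta>"] c_min_le) auto

lemma c_sharp_nonneg:
  assumes "\<And>\<theta>. 0 \<le> g \<theta>" "f \<theta> \<in> A"
  shows "0 \<le> c_sharp A f g"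
proof -
  have "c_min UNIV f g \<le> c_sharp A f g"
    unfolding c_sharp_def by (rule cSUP_upper[OF _ bdd_above_c_min[of g f, OF assms]]) simp
  moreover have "0 \<le> c_min UNIV f g" by (rule c_min_nonneg[OF assms(1)]) simp
  ultimately show ?thesis by simp
qed

lemma less_c_sharpE:
  assumes "\<And>\<theta>. 0 \<le> g \<theta>" "f \<theta> \<in> A" "b < c_sharp A f g"
  obtains A' where "open A'" "closure A \<subseteq> A'" "b < c_min A' f g"
proof -
  have "{A'. open A' \<and> closure A \<subseteq> A'} \<noteq> {}" by (auto intro!: exI[of _ UNIV])
  from less_cSUP_iff[OF this bdd_above_c_min[of g f, OF assms(1,2)], of b] assms(3) that
  show ?thesis unfolding c_sharp_def by auto
qed

lemma C_max_nonneg: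
  assumes "\<And>\<theta>. 0 \<le> g \<theta>" "\<And>\<theta>. g \<theta> \<le> B" "f \<theta> \<in> A"
  shows "0 \<le> C_max A f g"
  using order_trans[OF assms(1) C_max_ge[of g, OF assms(2) in_closure_preimage[of f, OF assms(3)]]] .

lemma C_flat_nonneg:
  assumes "\<And>\<theta>. 0 \<le> g \<theta>" "\<And>\<theta>. g \<theta> \<le> B" "f \<theta> \<in> A"
  shows "0 \<le> C_flat A f g"
  unfolding C_flat_def
  by (rule cINF_greatest)
    (use assms closure_subset[of A] in \<open>auto intro!: exI[of _ UNIV] C_max_nonneg[of g B f \<theta>]\<close>)

lemma C_flat_lessE:
  assumes "\<And>\<theta>. 0 \<le> g \<theta>" "\<And>\<theta>. g \<theta> \<le> B" "f \<theta> \<in> A" "C_flat A f g < b"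
  obtains A' where "open A'" "closure A \<subseteq> A'" "C_max A' f g < b"
proof -
  have ne: "{A'. open A' \<and> closure A \<subseteq> A'} \<noteq> {}" by (auto intro!: exI[of _ UNIV])
  have "bdd_below ((\<lambda>A'. C_max A' f g) ` {A'. open A' \<and> closure A \<subseteq> A'})"
    by (intro bdd_belowI2[of _ 0]) (use assms(1-3) closure_subset[of A] in \<open>auto intro!: C_max_nonneg[of g B f \<theta>]\<close>)
  from cINF_less_iff[OF ne this, of b] assms(4) that
  show ?thesis unfolding C_flat_def by auto
qed

lemma c_sharp_le_c_min:
  assumes "\<And>\<theta>. 0 \<le> g \<theta>" "f \<theta> \<in> A"
  shows "c_sharp A f g \<le> c_min A f g"
  unfolding c_sharp_def
proof (rule cSUP_least)
  show "{A'. open A' \<and> closure A \<subseteq> A'} \<noteq> {}" by (auto intro!: exI[of _ UNIV])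
  fix A' assume "A' \<in> {A'. open A' \<and> closure A \<subseteq> A'}"
  then have "f -` A \<subseteq> f -` A'" using closure_subset[of A] by auto
  then show "c_min A' f g \<le> c_min A f g"
    unfolding c_min_def
    by (intro cINF_superset_mono bdd_belowI2[of _ 0] closure_mono)
      (use assms in_closure_preimage[of f \<theta> A] in auto)
qed

text \<open>The distance between \<open>A\<close> and the values of \<open>f\<close> at the zeros of \<open>g\<close> is positive, so that near
  \<open>A\<close> the function \<open>g\<close> stays away from \<open>0\<close> by compactness.\<close>

lemma c_sharp_pos:
  fixes f g :: "real \<Rightarrow> real"
  assumes g: "\<And>\<theta>. 0 \<le> g \<theta>" "continuous_on UNIV g" and f: "continuous_on UNIV f"
    and per: "\<And>\<theta>. f (\<theta> + 2 * pi) = f \<theta>" "\<And>\<theta>. g (\<theta> + 2 * pi) = g \<theta>"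
    and ne: "f \<theta>0 \<in> A" and A: "closure A \<subseteq> range f - f ` {\<theta>. g \<theta> = 0}"
  shows "c_sharp A f g > 0"
proof -
  have red: "\<exists>\<theta>'\<in>{0..2*pi}. f \<theta>' = f \<theta> \<and> g \<theta>' = g \<theta>" for \<theta>
  proof -
    let ?k = "\<lfloor>\<theta> / (2 * pi)\<rfloor>"
    have "\<theta> + 2 * pi * of_int (- ?k) \<in> {0..2*pi}"
      using floor_divide_lower[of "2 * pi" \<theta>] floor_divide_upper[of "2 * pi" \<theta>] by (simp add: algebra_simps)
    then show ?thesis using periodic_int_shift[of f, OF per(1)] periodic_int_shift[of g, OF per(2)] by blast
  qed
  have ck: "compact (f ` ({\<theta>. g \<theta> = 0} \<inter> {0..2*pi}))"
    by (intro compact_continuous_image continuous_on_subset[OF f] closed_Int_compact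
        closed_Collect_eq g(2) continuous_intros) auto
  have "closure A \<inter> f ` ({\<theta>. g \<theta> = 0} \<inter> {0..2*pi}) = {}" using A by auto
  from separate_closed_compact[OF closed_closure ck this] obtain d where
    d: "d > 0" "\<And>x y. x \<in> closure A \<Longrightarrow> y \<in> f ` ({\<theta>. g \<theta> = 0} \<inter> {0..2*pi}) \<Longrightarrow> d \<le> dist x y" by blast
  let ?A' = "{x. infdist x (closure A) < d / 2}" and ?S = "{\<theta>. infdist (f \<theta>) (closure A) \<le> d / 2}"
  have A'ne: "closure A \<noteq> {}" using ne closure_subset[of A] by auto
  have A': "open ?A'" by (intro open_Collect_less continuous_intros)
  have AA': "closure A \<subseteq> ?A'" using d(1) by auto
  have "closed ?S" by (intro closed_Collect_le continuous_intros f)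
  then have sub: "closure (f -` ?A') \<subseteq> ?S" by (intro closure_minimal) auto
  have pos: "g \<theta> > 0" if \<theta>: "\<theta> \<in> ?S" for \<theta>
  proof (rule ccontr)
    assume "\<not> g \<theta> > 0"
    then have "g \<theta> = 0" using g(1)[of \<theta>] by simp
    moreover obtain \<theta>' where "\<theta>' \<in> {0..2*pi}" "f \<theta>' = f \<theta>" "g \<theta>' = g \<theta>" using red by blast
    ultimately have "f \<theta>' \<in> f ` ({\<theta>. g \<theta> = 0} \<inter> {0..2*pi})" by (intro imageI) simp
    with \<open>f \<theta>' = f \<theta>\<close> have "f \<theta> \<in> f ` ({\<theta>. g \<theta> = 0} \<inter> {0..2*pi})" by simp
    from d(2)[OF _ this] have "d \<le> infdist (f \<theta>) (closure A)"
      unfolding infdist_notempty[OF A'ne] by (intro cINF_greatest A'ne) (simp add: dist_commute)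
    then show False using \<theta> d(1) by simp
  qed
  have ne': "?S \<inter> {0..2*pi} \<noteq> {}"
  proof -
    have "f \<theta>0 \<in> closure A" using ne closure_subset[of A] by auto
    then have "infdist (f \<theta>0) (closure A) = 0" by simp
    moreover obtain \<theta>' where "\<theta>' \<in> {0..2*pi}" "f \<theta>' = f \<theta>0" using red by blast
    ultimately have "\<theta>' \<in> ?S \<inter> {0..2*pi}" using d(1) by simp
    then show ?thesis by blast
  qed
  have "compact (?S \<inter> {0..2*pi})" by (intro closed_Int_compact \<open>closed ?S\<close> compact_Icc)
  from continuous_attains_inf[OF this ne' continuous_on_subset[OF g(2)]] obtain \<theta>1 where
    \<theta>1: "\<theta>1 \<in> ?S" "\<And>\<theta>. \<theta> \<in> ?S \<inter> {0..2*pi} \<Longrightarrow> g \<theta>1 \<le> g \<theta>" by auto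
  have "g \<theta>1 \<le> c_min ?A' f g"
    unfolding c_min_def
  proof (rule cINF_greatest)
    show "closure (f -` ?A') \<noteq> {}"
      using in_closure_preimage[of f \<theta>0 ?A'] ne AA' closure_subset[of A] by auto
    fix \<theta> assume "\<theta> \<in> closure (f -` ?A')"
    with sub have "\<theta> \<in> ?S" by blast
    moreover obtain \<theta>' where "\<theta>' \<in> {0..2*pi}" "f \<theta>' = f \<theta>" "g \<theta>' = g \<theta>" using red by blast
    ultimately show "g \<theta>1 \<le> g \<theta>" using \<theta>1(2)[of \<theta>'] by simp
  qed
  also have "\<dots> \<le> c_sharp A f g"
    unfolding c_sharp_def
    by (rule cSUP_upper[OF _ bdd_above_c_min[of g f, OF g(1) ne]]) (use A' AA' in simp)
  finally show ?thesis using pos[OF \<theta>1(1)] by simp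
qed

section \<open>The velocity theorem\<close>

context bounded_symmetric
begin

text \<open>A continuous function that is \<open>1\<close> on the closure of \<open>A\<close> and \<open>0\<close> outside \<open>A'\<close>.\<close>

lemma energy_cutoff:
  assumes A: "A \<in> sets borel" and A': "open A'" "closure A \<subseteq> A'"
  obtains \<Phi> :: "real \<Rightarrow> real" where "continuous_on UNIV \<Phi>" "bounded_borel (\<lambda>x. of_real (\<Phi> x))"
    "\<And>\<phi>. fc (\<lambda>x. of_real (\<Phi> x)) (E A \<phi>) = E A \<phi>" "\<And>x. \<Phi> x \<noteq> 0 \<Longrightarrow> x \<in> A'"
proof -
  have "closure A \<inter> - A' = {}" using A'(2) by auto
  from Urysohn[OF closed_closure _ this, of 1 "0::real"] A'(1) obtain \<Phi> :: "real \<Rightarrow> real" where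
    \<Phi>: "continuous_on UNIV \<Phi>" "\<And>x. \<Phi> x \<in> closed_segment 1 0" "\<And>x. x \<in> closure A \<Longrightarrow> \<Phi> x = 1"
      "\<And>x. x \<in> - A' \<Longrightarrow> \<Phi> x = 0" by (auto simp: closed_def)
  have bb: "bounded_borel (\<lambda>x. of_real (\<Phi> x))"
  proof (rule bounded_borelI[of _ 1])
    show "(\<lambda>x. complex_of_real (\<Phi> x)) \<in> borel_measurable borel"
      by (intro borel_measurable_continuous_onI continuous_intros \<Phi>(1))
    show "cmod (of_real (\<Phi> x)) \<le> 1" for x using \<Phi>(2)[of x] by (simp add: closed_segment_eq_real_ivl)
  qed
  have "fc (\<lambda>x. of_real (\<Phi> x)) (E A \<phi>) = E A \<phi>" for \<phi>
  proof -
    have eq: "complex_of_real (\<Phi> x) * complex_of_real (indicator A x) = complex_of_real (indicator A x)" for x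
      using \<Phi>(3) closure_subset[of A] by (auto simp: indicator_def)
    show ?thesis
      unfolding E_def fc_mult[OF bb bounded_borel_indicator[OF A], symmetric] eq ..
  qed
  then show ?thesis using that[OF \<Phi>(1) bb] \<Phi>(4) by blast
qed

end

context ballistic
begin

text \<open>The cutoff \<open>\<Phi>\<close> may depend on the bound \<open>b\<close>: the optimal constants for spectral projections are a
  supremum and an infimum over neighbourhoods, which need not be attained.\<close>

lemma velocity_bounds:
  fixes G :: "real filter"
  assumes \<eta>: "\<And>x. E {x} \<eta> = 0" and \<psi>: "\<psi> \<in> dom_X" and G: "G \<in> {at_top, at_bot}"
    and c: "0 \<le> c" "0 \<le> c'"
    and low: "\<And>b. b < c \<Longrightarrow> \<exists>\<Phi>. continuous_on UNIV \<Phi> \<and> bounded_borel (\<lambda>x. of_real (\<Phi> x)) \<and>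
      fc (\<lambda>x. of_real (\<Phi> x)) \<eta> = \<psi> \<and> (\<forall>\<theta>. \<Phi> (f \<theta>) \<noteq> 0 \<longrightarrow> b \<le> (f1 \<theta>)\<^sup>2)"
    and up: "\<And>b. c' < b \<Longrightarrow> \<exists>\<Phi>. continuous_on UNIV \<Phi> \<and> bounded_borel (\<lambda>x. of_real (\<Phi> x)) \<and>
      fc (\<lambda>x. of_real (\<Phi> x)) \<eta> = \<psi> \<and> (\<forall>\<theta>. \<Phi> (f \<theta>) \<noteq> 0 \<longrightarrow> (f1 \<theta>)\<^sup>2 \<le> b)"
  defines "r \<equiv> \<lambda>t. ereal (1 / \<bar>t\<bar> * norm_X (U t \<psi>))"
  shows "ereal (sqrt c * norm \<psi>) \<le> Liminf G r \<and> Liminf G r \<le> Limsup G r \<and> Limsup G r \<le> ereal (sqrt c' * norm \<psi>)"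
proof -
  let ?m = "\<lambda>t. (norm (X_op (U t \<psi>)))\<^sup>2"
  have r: "r = (\<lambda>t. ereal (1 / \<bar>t\<bar> * sqrt ((norm \<psi>)\<^sup>2 + ?m t)))"
    by (simp add: r_def norm_X_def)
  obtain \<tau> :: real where \<tau>: "\<bar>\<tau>\<bar> = 1" "G = filtermap (\<lambda>t. \<tau> * t) at_top"
  proof -
    have "at_top = filtermap (\<lambda>t::real. 1 * t) at_top" by (simp add: filtermap_ident)
    moreover have "at_bot = filtermap (\<lambda>t::real. (- 1) * t) at_top" by (simp add: at_bot_mirror)
    ultimately show ?thesis using G that[of 1] that[of "- 1"] by auto
  qed
  have \<tau>2: "(\<tau> * t)\<^sup>2 = t\<^sup>2" for t using \<tau>(1) by (metis abs_mult mult_1 power2_abs)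
  have ev: "\<forall>\<^sub>F t in G. s * b * (norm \<psi>)\<^sup>2 - \<epsilon> \<le> s * ?m t / t\<^sup>2"
    if "\<bar>s\<bar> = 1" "\<epsilon> > 0" "continuous_on UNIV \<Phi>" "bounded_borel (\<lambda>x. of_real (\<Phi> x))"
      "fc (\<lambda>x. of_real (\<Phi> x)) \<eta> = \<psi>" "\<And>\<theta>. \<Phi> (f \<theta>) \<noteq> 0 \<Longrightarrow> 0 \<le> s * ((f1 \<theta>)\<^sup>2 - b)" for s b \<epsilon> \<Phi>
    unfolding \<tau>(2) eventually_filtermap \<tau>2
    by (rule position_growth[OF \<eta> that(3,4,5) \<psi> that(1) \<tau>(1) that(2,6)])
  have "ereal (sqrt c * norm \<psi>) \<le> Liminf G r"
    unfolding r
  proof (rule Liminf_growth[OF c(1)])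
    fix b \<epsilon> :: real assume b: "b < c" and e: "\<epsilon> > 0"
    from low[OF b] obtain \<Phi> where "continuous_on UNIV \<Phi>" "bounded_borel (\<lambda>x. of_real (\<Phi> x))"
      "fc (\<lambda>x. of_real (\<Phi> x)) \<eta> = \<psi>" "\<forall>\<theta>. \<Phi> (f \<theta>) \<noteq> 0 \<longrightarrow> b \<le> (f1 \<theta>)\<^sup>2" by blast
    then show "\<forall>\<^sub>F t in G. b * (norm \<psi>)\<^sup>2 - \<epsilon> \<le> ?m t / t\<^sup>2"
      using ev[of 1 \<epsilon> \<Phi> b] e by simp
  qed simp_all
  moreover have "Limsup G r \<le> ereal (sqrt c' * norm \<psi>)"
    unfolding r
  proof (rule Limsup_growth[OF c(2)])
    show "G \<le> at_infinity" using G at_top_le_at_infinity at_bot_le_at_infinity by blast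
    fix b \<epsilon> :: real assume b: "c' < b" and e: "\<epsilon> > 0"
    from up[OF b] obtain \<Phi> where "continuous_on UNIV \<Phi>" "bounded_borel (\<lambda>x. of_real (\<Phi> x))"
      "fc (\<lambda>x. of_real (\<Phi> x)) \<eta> = \<psi>" "\<forall>\<theta>. \<Phi> (f \<theta>) \<noteq> 0 \<longrightarrow> (f1 \<theta>)\<^sup>2 \<le> b" by blast
    then have "\<forall>\<^sub>F t in G. - b * (norm \<psi>)\<^sup>2 - \<epsilon> \<le> - 1 * ?m t / t\<^sup>2"
      using ev[of "- 1" \<epsilon> \<Phi> b] e by simp
    then show "\<forall>\<^sub>F t in G. ?m t / t\<^sup>2 \<le> b * (norm \<psi>)\<^sup>2 + \<epsilon>"
      by eventually_elim simp
  qed simp_all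
  moreover have "Liminf G r \<le> Limsup G r"
    by (rule Liminf_le_Limsup) (use G trivial_limit_at_top_linorder[where 'a=real] trivial_limit_at_bot_linorder[where 'a=real] in \<open>metis insertE singletonD\<close>)
  ultimately show ?thesis by blast
qed

end

lemma A_graph_core:
  assumes "\<psi> \<in> dom_X"
  shows "(\<psi>, (1/2) *\<^sub>R (toeplitz (\<lambda>\<theta>. of_real (g \<theta>)) (X_op \<psi>) + X_op (toeplitz (\<lambda>\<theta>. of_real (g \<theta>)) \<psi>))) \<in> A_graph g"
  unfolding A_graph_def by (rule subsetD[OF closure_subset]) (use assms in blast)

text \<open>The core is already dense.\<close>

lemma A_graph_dense: "closure (Domain (A_graph g)) = UNIV"
proof -
  have "dom_X \<subseteq> Domain (A_graph g)" using A_graph_core by blast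
  then show ?thesis using closure_mono dense_dom_X by blast
qed

lemma C3_torusD:
  assumes f: "C_k_torus 3 f"
  obtains f2 f3 :: "real \<Rightarrow> real" where "C1_per (\<lambda>\<theta>. of_real (f \<theta>)) (\<lambda>\<theta>. of_real (deriv f \<theta>))"
    "C1_per (\<lambda>\<theta>. of_real (deriv f \<theta>)) (\<lambda>\<theta>. of_real (f2 \<theta>))"
    "C1_per (\<lambda>\<theta>. of_real (f2 \<theta>)) (\<lambda>\<theta>. of_real (f3 \<theta>))"
proof -
  let ?d = "\<lambda>j \<theta>. complex_of_real ((deriv ^^ j) f \<theta>)"
  have diff: "((deriv ^^ j) f has_real_derivative (deriv ^^ Suc j) f x) (at x)" if "j < 3" for j x
    using f that by (auto simp: C_k_torus_def C_k_def DERIV_deriv_iff_real_differentiable)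
  have cont: "continuous_on UNIV ((deriv ^^ j) f)" if "j \<le> 3" for j
  proof (cases "j = 3")
    case False
    with that have "j < 3" by simp
    then show ?thesis by (meson DERIV_isCont continuous_at_imp_continuous_on diff)
  qed (use f in \<open>simp add: C_k_torus_def C_k_def\<close>)
  have dv: "(?d j has_vector_derivative ?d (Suc j) x) (at x)" if "j < 3" for j x
    using bounded_linear.has_vector_derivative[OF bounded_linear_of_real
        diff[OF that, unfolded has_real_derivative_iff_has_vector_derivative]] .
  have c: "continuous_on UNIV (?d j)" if "j \<le> 3" for j by (intro continuous_intros cont that)
  have 0: "C1_per (?d 0) (?d 1)"
    unfolding C1_per_def using dv[of 0] c[of 1] f by (simp add: C_k_torus_def)
  have 1: "C1_per (?d 1) (?d 2)"
    unfolding C1_per_def using dv[of 1] c[of 2] C1_per_deriv_periodic[OF 0] by (simp add: numeral_2_eq_2)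
  have 2: "C1_per (?d 2) (?d 3)"
    unfolding C1_per_def using dv[of 2] c[of 3] C1_per_deriv_periodic[OF 1] by (simp add: numeral_3_eq_3 numeral_2_eq_2)
  show ?thesis by (rule that[of "(deriv ^^ 2) f" "(deriv ^^ 3) f"]) (use 0 1 2 in simp_all)
qed

theorem proposition4p3:
  fixes f :: "real \<Rightarrow> real" and V H :: "ell2 \<Rightarrow> ell2" and \<Lambda> :: "real set"
  assumes "C_k_torus 3 f" and "\<not> f constant_on UNIV"
    and "compact_op V" and "symmetric_op V"
    and "C1 (A_graph (deriv f)) V" and "C1 X_graph V" and "C1 (X_graph O X_graph) V"
    and "compact_op (ad (A_graph (deriv f)) V)"
    and "H = (\<lambda>\<psi>. toeplitz (\<lambda>\<theta>. complex_of_real (f \<theta>)) \<psi> + V \<psi>)"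
    and "\<Lambda> \<noteq> {}" and "\<Lambda> \<in> sets borel" and "\<Lambda> \<subseteq> range f"
  shows
    "(\<forall>F\<in>{at_top, at_bot :: real filter}.
        (\<forall>\<phi>. spectral_proj H \<Lambda> \<phi> \<in> continuous_subspace H \<inter> dom_X \<longrightarrow>
           (let \<psi> = spectral_proj H \<Lambda> \<phi>;
                r = (\<lambda>t. ereal (1 / \<bar>t\<bar> * norm_X (evolution H t \<psi>)))
            in ereal (sqrt (c_sharp \<Lambda> f (\<lambda>\<theta>. \<bar>deriv f \<theta>\<bar>\<^sup>2)) * norm \<psi>) \<le> Liminf F r
               \<and> Liminf F r \<le> Limsup F r
               \<and> Limsup F r \<le> ereal (sqrt (C_flat \<Lambda> f (\<lambda>\<theta>. \<bar>deriv f \<theta>\<bar>\<^sup>2)) * norm \<psi>))) \<and>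
        (\<forall>\<phi> \<Phi>. \<phi> \<in> continuous_subspace H \<inter> dom_X \<longrightarrow>
           C_infinity_compact \<Phi> \<longrightarrow> (\<forall>x. x \<notin> \<Lambda> \<longrightarrow> \<Phi> x = 0) \<longrightarrow>
           (let \<psi> = fun_calc (\<lambda>x. complex_of_real (\<Phi> x)) H \<phi>;
                r = (\<lambda>t. ereal (1 / \<bar>t\<bar> * norm_X (evolution H t \<psi>)))
            in ereal (sqrt (c_min \<Lambda> f (\<lambda>\<theta>. \<bar>deriv f \<theta>\<bar>\<^sup>2)) * norm \<psi>) \<le> Liminf F r
               \<and> Liminf F r \<le> Limsup F r
               \<and> Limsup F r \<le> ereal (sqrt (C_max \<Lambda> f (\<lambda>\<theta>. \<bar>deriv f \<theta>\<bar>\<^sup>2)) * norm \<psi>)))) \<and>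
     (closure \<Lambda> \<subseteq> range f - f ` critical_set f \<longrightarrow>
        c_min \<Lambda> f (\<lambda>\<theta>. \<bar>deriv f \<theta>\<bar>\<^sup>2) \<ge> c_sharp \<Lambda> f (\<lambda>\<theta>. \<bar>deriv f \<theta>\<bar>\<^sup>2) \<and>
        c_sharp \<Lambda> f (\<lambda>\<theta>. \<bar>deriv f \<theta>\<bar>\<^sup>2) > 0)"
proof -
  let ?F = "\<lambda>\<theta>. complex_of_real (f \<theta>)" and ?F1 = "\<lambda>\<theta>. complex_of_real (deriv f \<theta>)" and ?g = "\<lambda>\<theta>. \<bar>deriv f \<theta>\<bar>\<^sup>2"
  obtain f2 f3 where D: "C1_per ?F ?F1" "C1_per ?F1 (\<lambda>\<theta>. of_real (f2 \<theta>))"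
    "C1_per (\<lambda>\<theta>. of_real (f2 \<theta>)) (\<lambda>\<theta>. of_real (f3 \<theta>))"
    using C3_torusD[OF assms(1)] by blast
  have c2: "C2_per ?F" "C2_per ?F1" unfolding C2_per_def using D by blast+
  have T: "toeplitz ?F = toep (fcoef ?F)" "toeplitz ?F1 = toep (fcoef ?F1)"
    by (intro toeplitz_eq_toep C2_per_l1 C2_per_cont c2)+
  have V: "bounded_op V" using assms(3) by (simp add: compact_op_def)
  have bH: "bounded_op H"
    unfolding assms(9) T by (intro bounded_op_add bounded_op_toep C2_per_l1 c2 V)
  have sH: "symmetric_op H"
    using symmetric_opD[OF toep_symmetric[OF C2_per_l1[OF c2(1)]]] symmetric_opD[OF assms(4)]
    unfolding assms(9) T symmetric_op_def by (simp add: cinner_add_left cinner_add_right)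
  obtain N where N: "N > 0" "\<And>\<psi>. norm (H \<psi>) \<le> norm \<psi> * N" using bounded_op_bound[OF bH] by blast
  obtain B where B: "B \<ge> 0" "\<And>\<theta>. cmod (?F \<theta>) \<le> B" using C2_per_bound[OF c2(1)] by blast
  obtain B1 where B1: "B1 \<ge> 0" "\<And>\<theta>. cmod (?F1 \<theta>) \<le> B1" using C2_per_bound[OF c2(2)] by blast
  obtain W where W: "bounded_op W" "\<And>\<psi>. \<psi> \<in> dom_X \<Longrightarrow> V \<psi> \<in> dom_X"
    "\<And>\<psi>. \<psi> \<in> dom_X \<Longrightarrow> X_op (V \<psi>) = V (X_op \<psi>) + W \<psi>"
    using C1_X_commutator[OF V assms(6)] by blast
  obtain D2 where D2: "\<And>\<psi>. \<psi> \<in> dom_X \<Longrightarrow> \<bar>2 * Re (cinner (X_op \<psi>) (\<i> *\<^sub>C W \<psi>))\<bar> \<le> D2 * (norm \<psi>)\<^sup>2"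
    using C1_X2_bound[OF V assms(4,7) W] by blast
  interpret ballistic H "N + B" f V "deriv f" "\<lambda>\<theta>. complex_of_real (f2 \<theta>)" "\<lambda>\<theta>. complex_of_real (f3 \<theta>)"
    W "ad (A_graph (deriv f)) V" D2
  proof
    show "norm (H \<psi>) \<le> norm \<psi> * (N + B)" for \<psi>
      using N(2)[of \<psi>] mult_nonneg_nonneg[OF norm_ge_zero[of \<psi>] B(1)] by (simp add: distrib_left)
    show "\<bar>f \<theta>\<bar> \<le> N + B" for \<theta> using B(2)[of \<theta>] N(1) by simp
    show "cinner ((1/2) *\<^sub>R (toep (fcoef ?F1) (X_op \<psi>) + X_op (toep (fcoef ?F1) \<psi>))) (V \<psi>)
      - cinner \<psi> (V ((1/2) *\<^sub>R (toep (fcoef ?F1) (X_op \<psi>) + X_op (toep (fcoef ?F1) \<psi>))))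
      = cinner \<psi> (ad (A_graph (deriv f)) V \<psi>)" if "\<psi> \<in> dom_X" for \<psi>
      using A_graph_core[OF that, of "deriv f"] unfolding T by (rule ad_op(2)[OF assms(5) A_graph_dense, rotated]) 
        (use A_graph_core[OF that, of "deriv f"] in \<open>simp add: T\<close>)
    show "H = (\<lambda>\<psi>. toep (fcoef ?F) \<psi> + V \<psi>)" unfolding assms(9) T ..
    show "\<bar>2 * Re (cinner (X_op \<psi>) (\<i> *\<^sub>C W \<psi>))\<bar> \<le> D2 * (norm \<psi>)\<^sup>2" if "\<psi> \<in> dom_X" for \<psi>
      by (rule D2[OF that])
  qed (use N B in \<open>auto simp: bH sH c2 D assms(3,4,8) W\<close>)
  note spectral = spectral_proj_eq[OF assms(11)] fun_calc_eq evolution_eq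
  obtain \<theta>0 where \<theta>0: "f \<theta>0 \<in> \<Lambda>" using assms(10,12) by blast
  have g0: "0 \<le> ?g \<theta>" for \<theta> by simp
  have gB: "?g \<theta> \<le> B1\<^sup>2" for \<theta> using B1(2)[of \<theta>] by (intro power_mono) auto
  let ?r = "\<lambda>\<psi> t. ereal (1 / \<bar>t\<bar> * norm_X (U t \<psi>))"
  let ?bounds = "\<lambda>c c' F \<psi>. ereal (sqrt c * norm \<psi>) \<le> Liminf F (?r \<psi>) \<and> Liminf F (?r \<psi>) \<le> Limsup F (?r \<psi>) \<and>
    Limsup F (?r \<psi>) \<le> ereal (sqrt c' * norm \<psi>)"
  have sharp: "?bounds (c_sharp \<Lambda> f ?g) (C_flat \<Lambda> f ?g) F (E \<Lambda> \<phi>)"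
    if F: "F \<in> {at_top, at_bot}" and \<phi>: "E \<Lambda> \<phi> \<in> continuous_subspace H \<inter> dom_X" for F \<phi>
  proof (rule velocity_bounds[OF continuous_subspace_atomless[OF IntD1[OF \<phi>]] IntD2[OF \<phi>] F
        c_sharp_nonneg[of ?g f, OF g0 \<theta>0] C_flat_nonneg[of ?g _ f, OF g0 gB \<theta>0]])
    fix b assume "b < c_sharp \<Lambda> f ?g"
    then obtain A' where A': "open A'" "closure \<Lambda> \<subseteq> A'" "b < c_min A' f ?g"
      using less_c_sharpE[of ?g f, OF g0 \<theta>0] by blast
    obtain \<Phi> where \<Phi>: "continuous_on UNIV \<Phi>" "bounded_borel (\<lambda>x. of_real (\<Phi> x))"
      "\<And>\<phi>. fc (\<lambda>x. of_real (\<Phi> x)) (E \<Lambda> \<phi>) = E \<Lambda> \<phi>" "\<And>x. \<Phi> x \<noteq> 0 \<Longrightarrow> x \<in> A'"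
      using energy_cutoff[OF assms(11) A'(1,2)] by blast
    have "b \<le> (deriv f \<theta>)\<^sup>2" if "\<Phi> (f \<theta>) \<noteq> 0" for \<theta>
      using c_min_le[of ?g, OF g0 in_closure_preimage[of f, OF \<Phi>(4)[OF that]]] A'(3) by simp
    with \<Phi> show "\<exists>\<Phi>. continuous_on UNIV \<Phi> \<and> bounded_borel (\<lambda>x. of_real (\<Phi> x)) \<and>
      fc (\<lambda>x. of_real (\<Phi> x)) (E \<Lambda> \<phi>) = E \<Lambda> \<phi> \<and> (\<forall>\<theta>. \<Phi> (f \<theta>) \<noteq> 0 \<longrightarrow> b \<le> (deriv f \<theta>)\<^sup>2)" by blast
  next
    fix b assume "C_flat \<Lambda> f ?g < b"
    then obtain A' where A': "open A'" "closure \<Lambda> \<subseteq> A'" "C_max A' f ?g < b"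
      using C_flat_lessE[of ?g _ f, OF g0 gB \<theta>0] by blast
    obtain \<Phi> where \<Phi>: "continuous_on UNIV \<Phi>" "bounded_borel (\<lambda>x. of_real (\<Phi> x))"
      "\<And>\<phi>. fc (\<lambda>x. of_real (\<Phi> x)) (E \<Lambda> \<phi>) = E \<Lambda> \<phi>" "\<And>x. \<Phi> x \<noteq> 0 \<Longrightarrow> x \<in> A'"
      using energy_cutoff[OF assms(11) A'(1,2)] by blast
    have "(deriv f \<theta>)\<^sup>2 \<le> b" if "\<Phi> (f \<theta>) \<noteq> 0" for \<theta>
      using C_max_ge[of ?g, OF gB in_closure_preimage[of f, OF \<Phi>(4)[OF that]]] A'(3) by simp
    with \<Phi> show "\<exists>\<Phi>. continuous_on UNIV \<Phi> \<and> bounded_borel (\<lambda>x. of_real (\<Phi> x)) \<and>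
      fc (\<lambda>x. of_real (\<Phi> x)) (E \<Lambda> \<phi>) = E \<Lambda> \<phi> \<and> (\<forall>\<theta>. \<Phi> (f \<theta>) \<noteq> 0 \<longrightarrow> (deriv f \<theta>)\<^sup>2 \<le> b)" by blast
  qed
  have smooth: "?bounds (c_min \<Lambda> f ?g) (C_max \<Lambda> f ?g) F (fc (\<lambda>x. of_real (\<Phi> x)) \<phi>)"
    if F: "F \<in> {at_top, at_bot}" and \<phi>: "\<phi> \<in> continuous_subspace H \<inter> dom_X"
      and \<Phi>: "C_infinity_compact \<Phi>" "\<forall>x. x \<notin> \<Lambda> \<longrightarrow> \<Phi> x = 0" for F \<phi> \<Phi>
  proof (rule velocity_bounds[OF continuous_subspace_atomless[OF IntD1[OF \<phi>]] smooth_fc_dom[OF \<Phi>(1) IntD2[OF \<phi>]] F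
        c_min_nonneg[of ?g f, OF g0 \<theta>0] C_max_nonneg[of ?g _ f, OF g0 gB \<theta>0]])
    note \<Phi>c = C_infinity_compactD(2,3)[OF \<Phi>(1)]
    have in\<Lambda>: "\<theta> \<in> closure (f -` \<Lambda>)" if "\<Phi> (f \<theta>) \<noteq> 0" for \<theta>
      using \<Phi>(2) that by (intro in_closure_preimage) auto
    fix b
    have "b \<le> (deriv f \<theta>)\<^sup>2" if "b < c_min \<Lambda> f ?g" "\<Phi> (f \<theta>) \<noteq> 0" for \<theta>
      using c_min_le[of ?g, OF g0 in\<Lambda>[OF that(2)]] that(1) by simp
    with \<Phi>c show "\<exists>\<Phi>'. continuous_on UNIV \<Phi>' \<and> bounded_borel (\<lambda>x. of_real (\<Phi>' x)) \<and>
      fc (\<lambda>x. of_real (\<Phi>' x)) \<phi> = fc (\<lambda>x. of_real (\<Phi> x)) \<phi> \<and>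
      (\<forall>\<theta>. \<Phi>' (f \<theta>) \<noteq> 0 \<longrightarrow> b \<le> (deriv f \<theta>)\<^sup>2)" if "b < c_min \<Lambda> f ?g"
      using that by blast
    have "(deriv f \<theta>)\<^sup>2 \<le> b" if "C_max \<Lambda> f ?g < b" "\<Phi> (f \<theta>) \<noteq> 0" for \<theta>
      using C_max_ge[of ?g, OF gB in\<Lambda>[OF that(2)]] that(1) by simp
    with \<Phi>c show "\<exists>\<Phi>'. continuous_on UNIV \<Phi>' \<and> bounded_borel (\<lambda>x. of_real (\<Phi>' x)) \<and>
      fc (\<lambda>x. of_real (\<Phi>' x)) \<phi> = fc (\<lambda>x. of_real (\<Phi> x)) \<phi> \<and>
      (\<forall>\<theta>. \<Phi>' (f \<theta>) \<noteq> 0 \<longrightarrow> (deriv f \<theta>)\<^sup>2 \<le> b)" if "C_max \<Lambda> f ?g < b"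
      using that by blast
  qed
  have positive: "c_sharp \<Lambda> f ?g \<le> c_min \<Lambda> f ?g \<and> c_sharp \<Lambda> f ?g > 0" if A: "closure \<Lambda> \<subseteq> range f - f ` critical_set f"
  proof
    show "c_sharp \<Lambda> f ?g \<le> c_min \<Lambda> f ?g" by (rule c_sharp_le_c_min[of ?g f, OF g0 \<theta>0])
    show "c_sharp \<Lambda> f ?g > 0"
    proof (rule c_sharp_pos[of ?g f, OF g0 _ _ _ _ \<theta>0])
      have cf: "continuous_on UNIV f" "continuous_on UNIV (deriv f)"
        using continuous_on_Re[OF C2_per_cont[OF c2(1)]] continuous_on_Re[OF C2_per_cont[OF c2(2)]] by simp_all
      show "continuous_on UNIV ?g" by (intro continuous_intros cf)
      show "continuous_on UNIV f" by (rule cf)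
      show "f (\<theta> + 2 * pi) = f \<theta>" for \<theta> using C1_perD(3)[OF D(1), of \<theta>] by simp
      show "?g (\<theta> + 2 * pi) = ?g \<theta>" for \<theta> using C1_perD(3)[OF D(2), of \<theta>] by simp
      have "{\<theta>. ?g \<theta> = 0} \<subseteq> critical_set f" by (auto simp: critical_set_def)
      then show "closure \<Lambda> \<subseteq> range f - f ` {\<theta>. ?g \<theta> = 0}" using A by blast
    qed
  qed
  show ?thesis
    unfolding spectral Let_def
    by (intro conjI[OF ballI[OF conjI]] allI impI) (rule sharp smooth positive; assumption)+
qed

end
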